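(* Let $\Sigma$ be an LTSI system $\frac{\mathrm d}{\mathrm dt}z(t)=\mathcal A z(t)+\mathcal B u(t)$, $y(t)=\mathcal C z(t)$ (not necessarily well-posed) with continuous Fourier symbols $\hat A,\hat B,\hat C$, associated LTI systems $\hat\Sigma_\omega$, $\omega\in\mathbb R^s$, and impulse response $\mathcal G$. Suppose that $\Sigma$ is reciprocal and weakly impedance passive, that $\hat\Sigma_\omega$ is minimal for all $\omega\in\mathbb R^s$, and that $\hat S:\mathbb R^s\to\mathbb C^{n\times n}$ and $\hat Q:\mathbb R^s\to\mathbb C^{n\times n}$ are continuous, pointwise invertible maps such that, for all $\omega\in\mathbb R^s$, $\hat S_\omega=\hat S_\omega^*$ satisfies $$\hat A_\omega^*\hat S_\omega=\hat S_\omega\hat A_\omega,\qquad \hat C_\omega^*=\hat S_\omega\hat B_\omega,$$ $\hat Q_\omega>0$ satisfies $$\hat A_\omega^*\hat Q_\omega+\hat Q_\omega\hat A_\omega\le0,\qquad \hat C_\omega^*=\hat Q_\omega\hat B_\omega,$$ and $\hat Q_\omega=\hat S_\omega\hat Q_\omega^{-1}\hat S_\omega$. If, in addition, $$\sup_{\omega\in\mathbb R^s}\big\|\hat C_\omega\hat S_\omega^{-1}\hat Q_\omega\hat B_\omega\big\|<\infty,$$ then there exists a well-posed LTSI system $$\bar\Sigma:\quad\frac{\mathrm d}{\mathrm dt}\bar z(t)=\bar{\mathcal A}\bar z(t)+\bar{\mathcal B}u(t),\qquad y(t)=\bar{\mathcal C}\bar z(t),$$ with state space $\bar{\mathcal Z}=\mathcal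 Z$ and impulse response $\mathcal G$, that is both internally impedance passive and self-dual. Furthermore, we can partition $\bar{\mathcal Z}=\bar{\mathcal Z}_1\times\bar{\mathcal Z}_2$ and, accordingly, $$\bar{\mathcal A}=\begin{bmatrix}\bar{\mathcal A}_{11}&\bar{\mathcal A}_{12}\\-\bar{\mathcal A}_{12}^*&\bar{\mathcal A}_{22}\end{bmatrix},\qquad \bar{\mathcal C}^*=\bar{\mathcal B}=\begin{bmatrix}\bar{\mathcal B}_1\\0\end{bmatrix},$$ where the operators $\bar{\mathcal A}_{11}$, $\bar{\mathcal A}_{12}$ and $\bar{\mathcal A}_{22}$ are densely defined, $\bar{\mathcal A}_{11}\le0$ and $\bar{\mathcal A}_{22}\le0$.
   Context: **Fourier symbols.** Let $\hat f$ denote the unitary Fourier transform of $f\in L_2(\mathbb R^s,\mathbb C^n)$, extending $\hat f(\omega)=(2\pi)^{-s/2}\int_{\mathbb R^s}e^{-j\langle\omega,x\rangle}f(x)\,\mathrm dx$. A densely defined linear operator $\mathcal M:L_2(\mathbb R^s,\mathbb C^n)\supset\mathscr D(\mathcal M)\to L_2(\mathbb R^s,\mathbb C^m)$ is translation invariant if its domain is invariant under all translations $f\mapsto f(\cdot+x)$, $x\in\mathbb R^s$, and $\mathcal M$ commutes with them. Such an operator has a Fourier symbol $\hat M:\mathbb R^s\to\mathbb C^{m\times n}$, i.e. $\widehat{\mathcal M f}(\omega)=\hat M_\omega\hat f(\omega)$ for $f\in\mathscr D(\mathcal M)$, where $\hat M_\omega=\hat M(\omega)$. Conversely, for a (measurable)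 $\hat M$ bounded on compact sets (e.g. continuous), "the translation invariant operator with Fourier symbol $\hat M$" is the operator $f\mapsto\mathcal M f$, $\widehat{\mathcal Mf}(\omega)=\hat M_\omega\hat f(\omega)$, with domain $\{f\in L_2:\hat M\hat f\in L_2\}$. It is densely defined. **LTSI system.** An LTSI system has input, state and output spaces $\mathcal U=L_2(\mathbb R^s,\mathbb C^m)$, $\mathcal Z=L_2(\mathbb R^s,\mathbb C^n)$, $\mathcal Y=L_2(\mathbb R^s,\mathbb C^p)$ and translation invariant operators $\mathcal A:\mathcal Z\supset\mathscr D(\mathcal A)\to\mathcal Z$ (densely defined, possibly unbounded), $\mathcal B:\mathcal U\to\mathcal Z$ and $\mathcal C:\mathcal Z\to\mathcal Y$ (bounded), with Fourier symbols $\hat A,\hat B,\hat C$. For the given system $\Sigma$ these symbols are assumed continuous. The system is well-posed if $\mathcal A$ generates a $C_0$-semigroup $\exp(\mathcal At)$ on $\mathcal Z$. **Associated LTI systems.** For $\omega\in\mathbb R^s$, $\hat\Sigma_\omega$ is the complex finite-dimensional system $\dot{\hat z}_\omega=\hat A_\omega\hat z_\omega+\hat B_\omega\hat u_\omega$, $\hat y_\omega=\hat C_\omega\hat z_\omega$, with impulse response $\hat g_\omega(t)=\hat C_\omega e^{\hat A_\omega t}\hat B_\omega$, $t\ge0$. It is minimal if it is controllable and observable. $^*$ on matrices is the conjugate transpose. **Impulse response and reciprocity.** For each $t\ge 0$, $\mathcal G(t):\mathcal U\supset\mathscr D(\mathcal G(t))\to\mathcal Y$ is the translation invariant operator with Fourier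 symbol $\omega\mapsto\hat g_\omega(t)$. For a well-posed system the impulse response is $\mathcal C\exp(\mathcal At)\mathcal B$, consistently with this definition. $\Sigma$ is reciprocal if $\mathcal U=\mathcal Y$ and $\mathcal G(t)$ is self-adjoint for all $t\ge0$. **Passivity.** $\Sigma$ is weakly impedance passive if $\hat\Sigma_\omega$ is passive for all $\omega\in\mathbb R^s$, i.e. ($m=p$ and) for each $\omega$ there is $\hat Q_\omega\in\mathbb C^{n\times n}$, $\hat Q_\omega\ge0$, with $\hat A_\omega^*\hat Q_\omega+\hat Q_\omega\hat A_\omega\le0$ and $\hat C_\omega^*=\hat Q_\omega\hat B_\omega$. A well-posed LTSI system is impedance passive if $\mathcal U=\mathcal Y$ and there is a bounded self-adjoint $\mathcal Q\ge0$ on $\mathcal Z$ such that the storage functional $V(z)=\langle\mathcal Qz,z\rangle$ satisfies $$V(z(t))\le V(z(0))+\int_0^t\big(\langle u(\tau),y(\tau)\rangle+\langle y(\tau),u(\tau)\rangle\big)\,\mathrm d\tau$$ for all $z(0)\in\mathcal Z$, $t\ge0$, $u\in L_2([0,t],\mathcal U)$, where $z,y$ are the resulting (mild) state and output trajectories. It is internally impedance passive if this holds with $V(z)=\|z\|^2$. **Self-duality.** The dual of an LTSI system $(\mathcal A,\mathcal B,\mathcal C)$ is the LTSI system $\frac{\mathrm d}{\mathrm dt}z^{\mathrm d}(t)=\mathcal A^*z^{\mathrm d}(t)+\mathcal C^*u^{\mathrm d}(t)$, $y^{\mathrm d}(t)=\mathcal B^*z^{\mathrm d}(t)$. A well-posed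 system is self-dual if it is isomorphic to its dual, i.e. there is a bounded linear operator $\mathcal T$ on $\mathcal Z$ with bounded inverse such that $\mathcal T\mathscr D(\mathcal A)=\mathscr D(\mathcal A^* )$, $\mathcal A^*\mathcal T=\mathcal T\mathcal A$ on $\mathscr D(\mathcal A)$, $\mathcal C^*=\mathcal T\mathcal B$ and $\mathcal C=\mathcal B^*\mathcal T$. **Order and block notation.** For a (possibly unbounded) densely defined operator $\mathcal M$, $\mathcal M\le0$ means $\mathcal M$ is self-adjoint and $\langle\mathcal Mz,z\rangle\le0$ for all $z\in\mathscr D(\mathcal M)$. The partition $\bar{\mathcal Z}=\bar{\mathcal Z}_1\times\bar{\mathcal Z}_2$ is a partition of the state vector, $\bar{\mathcal Z}_i=L_2(\mathbb R^s,\mathbb C^{n_i})$, $n_1+n_2=n$ (one block may be empty). The block expressions for the translation invariant operators $\bar{\mathcal A},\bar{\mathcal B},\bar{\mathcal C}^*$ mean that their Fourier symbols are partitioned accordingly, the blocks $\bar{\mathcal A}_{ik}$, $\bar{\mathcal B}_1$ being the translation invariant operators whose Fourier symbols are the corresponding blocks. *)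

theory Defs
  imports "HOL-Analysis.Analysis"
begin

section \<open>The Hilbert space of square-integrable functions\<close>

definition sq_int :: "(real^'s \<Rightarrow> complex^'n) \<Rightarrow> bool" where
  "sq_int f \<longleftrightarrow> f \<in> borel_measurable borel \<and> integrable lborel (\<lambda>x. (norm (f x))\<^sup>2)"

definition l2_rel :: "(real^'s \<Rightarrow> complex^'n) \<Rightarrow> (real^'s \<Rightarrow> complex^'n) \<Rightarrow> bool" where
  "l2_rel f g \<longleftrightarrow> sq_int f \<and> sq_int g \<and> (AE x in lborel. f x = g x)"

lemma sq_int_zero: "sq_int (\<lambda>x. 0)"
  by (simp add: sq_int_def)

lemma sq_int_bound:
  assumes "f \<in> borel_measurable borel" "integrable lborel h"
    and "AE x in lborel. (norm (f x))\<^sup>2 \<le> h x"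
  shows "sq_int f"
  unfolding sq_int_def
proof
  show "integrable lborel (\<lambda>x. (norm (f x))\<^sup>2)"
    by (rule Bochner_Integration.integrable_bound[OF assms(2)])
       (use assms in \<open>auto elim!: eventually_mono\<close>)
qed fact

lemma norm_add_sq_le: "(norm (a + b))\<^sup>2 \<le> 2 * (norm a)\<^sup>2 + 2 * (norm (b::'a::real_inner))\<^sup>2"
proof -
  have "0 \<le> (norm (a - b))\<^sup>2" by simp
  then show ?thesis
    by (simp add: power2_norm_eq_inner inner_add_left inner_add_right inner_diff_left
        inner_diff_right inner_commute)
qed

lemma sq_int_add:
  assumes "sq_int f" "sq_int g" shows "sq_int (\<lambda>x. f x + g x)"
  by (rule sq_int_bound[where h = "\<lambda>x. 2 * (norm (f x))\<^sup>2 + 2 * (norm (g x))\<^sup>2"])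
     (use assms norm_add_sq_le in \<open>auto simp: sq_int_def\<close>)

lemma sq_int_scaleR: "sq_int f \<Longrightarrow> sq_int (\<lambda>x. c *\<^sub>R f x)"
  by (auto simp: sq_int_def power_mult_distrib)

lemma norm_vector_scalar_mult: "norm (c *s (v :: complex^'n)) = cmod c * norm v"
  by (simp add: norm_vec_def L2_set_def norm_mult power_mult_distrib
      sum_distrib_left[symmetric] real_sqrt_mult)

lemma bounded_linear_vector_scalar_mult: "bounded_linear (\<lambda>v :: complex^'n. c *s v)"
  by (rule bounded_linear_intro[where K = "cmod c"])
     (auto simp: norm_vector_scalar_mult vec_eq_iff algebra_simps)

lemma sq_int_scaleC:
  assumes "sq_int f" shows "sq_int (\<lambda>x. c *s f x)"
proof -
  have "(\<lambda>x. c *s f x) \<in> borel_measurable borel"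
    using assms bounded_linear.continuous_on[OF bounded_linear_vector_scalar_mult continuous_on_id]
    unfolding sq_int_def by (intro borel_measurable_continuous_on[where f = "\<lambda>v. c *s v"]) auto
  with assms show ?thesis
    by (auto simp: sq_int_def norm_vector_scalar_mult power_mult_distrib)
qed

lemma sq_int_uminus: "sq_int f \<Longrightarrow> sq_int (\<lambda>x. - f x)"
  by (auto simp: sq_int_def)

lemma sq_int_diff: "sq_int f \<Longrightarrow> sq_int g \<Longrightarrow> sq_int (\<lambda>x. f x - g x)"
  using sq_int_add[OF _ sq_int_uminus, of f g] by simp

lemma integrable_sq_inner:
  assumes "sq_int f" "sq_int g" shows "integrable lborel (\<lambda>x. f x \<bullet> g x)"
proof (rule Bochner_Integration.integrable_bound)
  show "integrable lborel (\<lambda>x. (norm (f x))\<^sup>2 + (norm (g x))\<^sup>2)"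
    using assms by (auto simp: sq_int_def)
  have "\<bar>a \<bullet> b\<bar> \<le> (norm a)\<^sup>2 + (norm b)\<^sup>2" for a b :: "complex^'b"
  proof -
    have "\<bar>a \<bullet> b\<bar> \<le> norm a * norm b" by (rule Cauchy_Schwarz_ineq2)
    also have "\<dots> \<le> (norm a)\<^sup>2 + (norm b)\<^sup>2"
      using sum_squares_bound[of "norm a" "norm b"] mult_nonneg_nonneg[of "norm a" "norm b"]
      by (simp only: mult.assoc) (smt (verit) norm_ge_zero)
    finally show ?thesis .
  qed
  then show "AE x in lborel. norm (f x \<bullet> g x) \<le> norm ((norm (f x))\<^sup>2 + (norm (g x))\<^sup>2)"
    by (auto simp: abs_of_nonneg)
qed (use assms in \<open>auto simp: sq_int_def\<close>)

lemma part_equivp_l2_rel: "part_equivp (l2_rel :: (real^'s \<Rightarrow> complex^'n) \<Rightarrow> _)"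
proof (rule part_equivpI)
  show "\<exists>f :: real^'s \<Rightarrow> complex^'n. l2_rel f f"
    by (intro exI[of _ "\<lambda>x. 0"]) (simp add: l2_rel_def sq_int_zero)
  show "symp (l2_rel :: (real^'s \<Rightarrow> complex^'n) \<Rightarrow> _)"
    by (auto simp: symp_def l2_rel_def elim: eventually_mono)
  show "transp (l2_rel :: (real^'s \<Rightarrow> complex^'n) \<Rightarrow> _)"
    unfolding transp_def l2_rel_def by (auto elim: eventually_elim2)
qed

quotient_type ('s, 'n) l2 = "real^'s \<Rightarrow> complex^'n" / partial: l2_rel
  by (rule part_equivp_l2_rel)

lemma sq_int_rep: "sq_int (rep_l2 f)"
  using Quotient_rep_reflp[OF Quotient_l2] by (auto simp: l2_rel_def)

lemma rep_abs_l2: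
  assumes "sq_int f" shows "AE x in lborel. rep_l2 (abs_l2 f) x = f x"
proof -
  have "l2_rel f f" using assms by (simp add: l2_rel_def)
  from Quotient_rep_abs[OF Quotient_l2, OF this] show ?thesis by (auto simp: l2_rel_def)
qed

lemma l2_eqI:
  assumes "AE x in lborel. rep_l2 f x = rep_l2 g x" shows "f = g"
  using assms sq_int_rep Quotient_rel_rep[OF Quotient_l2, of f g] by (auto simp: l2_rel_def)

instantiation l2 :: (finite, finite) real_vector
begin

lift_definition zero_l2 :: "('a, 'b) l2" is "\<lambda>x. 0"
  by (simp add: l2_rel_def sq_int_zero)

lift_definition plus_l2 :: "('a, 'b) l2 \<Rightarrow> ('a, 'b) l2 \<Rightarrow> ('a, 'b) l2"
  is "\<lambda>f g x. f x + g x"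
  unfolding l2_rel_def by (auto intro!: sq_int_add)

lift_definition minus_l2 :: "('a, 'b) l2 \<Rightarrow> ('a, 'b) l2 \<Rightarrow> ('a, 'b) l2"
  is "\<lambda>f g x. f x - g x"
  unfolding l2_rel_def by (auto intro!: sq_int_diff)

lift_definition uminus_l2 :: "('a, 'b) l2 \<Rightarrow> ('a, 'b) l2" is "\<lambda>f x. - f x"
  unfolding l2_rel_def by (auto intro!: sq_int_uminus)

lift_definition scaleR_l2 :: "real \<Rightarrow> ('a, 'b) l2 \<Rightarrow> ('a, 'b) l2" is "\<lambda>c f x. c *\<^sub>R f x"
  unfolding l2_rel_def by (auto intro!: sq_int_scaleR)

instance
  by standard
     (transfer; auto simp: l2_rel_def algebra_simps
       intro!: sq_int_zero sq_int_add sq_int_diff sq_int_uminus sq_int_scaleR)+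

end

instantiation l2 :: (finite, finite) real_inner
begin

lift_definition inner_l2 :: "('a, 'b) l2 \<Rightarrow> ('a, 'b) l2 \<Rightarrow> real"
  is "\<lambda>f g. LINT x|lborel. f x \<bullet> g x"
proof -
  fix f f' g g' :: "(real, 'a) vec \<Rightarrow> (complex, 'b) vec"
  assume *: "l2_rel f f'" "l2_rel g g'"
  then show "(LINT x|lborel. f x \<bullet> g x) = (LINT x|lborel. f' x \<bullet> g' x)"
    using integrable_sq_inner[of f g] integrable_sq_inner[of f' g']
    by (intro integral_cong_AE) (auto simp: l2_rel_def)
qed

definition norm_l2 :: "('a, 'b) l2 \<Rightarrow> real" where "norm_l2 f = sqrt (f \<bullet> f)"

definition sgn_l2 :: "('a, 'b) l2 \<Rightarrow> ('a, 'b) l2" where "sgn_l2 f = f /\<^sub>R norm f"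

definition dist_l2 :: "('a, 'b) l2 \<Rightarrow> ('a, 'b) l2 \<Rightarrow> real" where "dist_l2 f g = norm (f - g)"

definition uniformity_l2 :: "(('a, 'b) l2 \<times> ('a, 'b) l2) filter" where
  "uniformity_l2 = (INF e\<in>{0<..}. principal {(f, g). dist f g < e})"

definition open_l2 :: "('a, 'b) l2 set \<Rightarrow> bool" where
  "open_l2 U \<longleftrightarrow> (\<forall>f\<in>U. eventually (\<lambda>(f', g). f' = f \<longrightarrow> g \<in> U) uniformity)"

instance
proof
  fix f g h :: "('a, 'b) l2" and c :: real and U :: "('a, 'b) l2 set"
  show "dist f g = norm (f - g)" by (rule dist_l2_def)
  show "sgn f = f /\<^sub>R norm f" by (rule sgn_l2_def)
  show "norm f = sqrt (f \<bullet> f)" by (rule norm_l2_def)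
  show "uniformity = (INF e\<in>{0<..}. principal {(f, g :: ('a, 'b) l2). dist f g < e})"
    by (rule uniformity_l2_def)
  show "open U \<longleftrightarrow> (\<forall>f\<in>U. eventually (\<lambda>(f', g). f' = f \<longrightarrow> g \<in> U) uniformity)"
    by (rule open_l2_def)
  show "f \<bullet> g = g \<bullet> f" by transfer (simp add: inner_commute)
  show "(f + g) \<bullet> h = f \<bullet> h + g \<bullet> h"
    by transfer (auto simp: l2_rel_def inner_add_left integrable_sq_inner)
  show "(c *\<^sub>R f) \<bullet> g = c * (f \<bullet> g)" by transfer simp
  show "0 \<le> f \<bullet> f" by transfer simp
  show "f \<bullet> f = 0 \<longleftrightarrow> f = 0"
  proof transfer
    fix f :: "(real, 'a) vec \<Rightarrow> (complex, 'b) vec" assume f: "l2_rel f f"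
    then have "integrable lborel (\<lambda>x. f x \<bullet> f x)"
      by (auto simp: l2_rel_def integrable_sq_inner)
    then have "(LINT x|lborel. f x \<bullet> f x) = 0 \<longleftrightarrow> (AE x in lborel. f x \<bullet> f x = 0)"
      by (rule integral_nonneg_eq_0_iff_AE) simp
    with f show "(LINT x|lborel. f x \<bullet> f x) = 0 \<longleftrightarrow> l2_rel f (\<lambda>x. 0)"
      by (simp add: l2_rel_def sq_int_zero)
  qed
qed

end


lemma abs_l2_eq:
  assumes "sq_int f" "AE x in lborel. rep_l2 g x = f x" shows "abs_l2 f = g"
  using rep_abs_l2[OF assms(1)] assms(2) by (intro l2_eqI) (auto elim: eventually_elim2)

lemma abs_l2_add:
  assumes "sq_int f" "sq_int g" shows "abs_l2 (\<lambda>x. f x + g x) = abs_l2 f + abs_l2 g"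
proof (rule abs_l2_eq)
  have "abs_l2 f + abs_l2 g = abs_l2 (\<lambda>x. rep_l2 (abs_l2 f) x + rep_l2 (abs_l2 g) x)"
    by (simp add: plus_l2_def)
  then show "AE x in lborel. rep_l2 (abs_l2 f + abs_l2 g) x = f x + g x"
    using rep_abs_l2[OF assms(1)] rep_abs_l2[OF assms(2)]
      rep_abs_l2[OF sq_int_add[OF sq_int_rep sq_int_rep], of "abs_l2 f" "abs_l2 g"]
    by auto
qed (intro sq_int_add assms)

lemma abs_l2_diff:
  assumes "sq_int f" "sq_int g" shows "abs_l2 (\<lambda>x. f x - g x) = abs_l2 f - abs_l2 g"
  using abs_l2_add[OF sq_int_diff[OF assms] assms(2)] by (simp add: eq_diff_eq)

lemma abs_l2_scaleR:
  assumes "sq_int f" shows "abs_l2 (\<lambda>x. c *\<^sub>R f x) = c *\<^sub>R abs_l2 f"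
proof (rule abs_l2_eq)
  have "c *\<^sub>R abs_l2 f = abs_l2 (\<lambda>x. c *\<^sub>R rep_l2 (abs_l2 f) x)"
    by (simp add: scaleR_l2_def)
  then show "AE x in lborel. rep_l2 (c *\<^sub>R abs_l2 f) x = c *\<^sub>R f x"
    using rep_abs_l2[OF assms] rep_abs_l2[OF sq_int_scaleR[OF sq_int_rep], of c "abs_l2 f"]
    by auto
qed (intro sq_int_scaleR assms)

lemma abs_l2_zero: "abs_l2 (\<lambda>x. 0) = 0"
  by (simp add: zero_l2_def)

lemma abs_l2_rep: "abs_l2 (rep_l2 f) = f"
  by (rule abs_l2_eq[OF sq_int_rep]) simp

lemma norm_l2_sq: "(norm f)\<^sup>2 = (LINT x|lborel. (norm (rep_l2 f x))\<^sup>2)"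
  by (simp add: power2_norm_eq_inner inner_l2_def)

lemma norm_abs_l2_sq:
  assumes "sq_int f" shows "(norm (abs_l2 f))\<^sup>2 = (LINT x|lborel. (norm (f x))\<^sup>2)"
  unfolding norm_l2_sq using assms rep_abs_l2[OF assms] sq_int_rep[of "abs_l2 f"]
  by (intro integral_cong_AE) (auto simp: sq_int_def)

lemma ennreal_norm_abs_l2_sq:
  assumes "sq_int f"
  shows "ennreal ((norm (abs_l2 f))\<^sup>2) = (\<integral>\<^sup>+x. ennreal ((norm (f x))\<^sup>2) \<partial>lborel)"
  unfolding norm_abs_l2_sq[OF assms]
  using assms by (subst nn_integral_eq_integral) (auto simp: sq_int_def)

instance l2 :: (finite, finite) banach
proof
  fix X :: "nat \<Rightarrow> ('a, 'b) l2" assume "Cauchy X"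
  then have "\<forall>k. \<exists>N. \<forall>m\<ge>N. \<forall>n\<ge>N. dist (X m) (X n) < (1/2) ^ k"
    by (auto simp: Cauchy_def)
  then obtain N where N: "\<And>k m n. N k \<le> m \<Longrightarrow> N k \<le> n \<Longrightarrow> dist (X m) (X n) < (1/2) ^ k"
    by metis
  define r where "r k = (\<Sum>i\<le>k. N i)" for k
  have r: "N k \<le> r j" if "k \<le> j" for k j
    unfolding r_def using that by (intro member_le_sum) auto
  define y where "y k = rep_l2 (X (r k))" for k
  have y_sq: "sq_int (y k)" for k by (simp add: y_def sq_int_rep)
  then have y_meas[measurable]: "y k \<in> borel_measurable borel" for k by (auto simp: sq_int_def)
  have y_dist: "(\<integral>\<^sup>+x. ennreal ((norm (y j x - y k x))\<^sup>2) \<partial>lborel) \<le> ennreal ((1/4) ^ k)"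
    if "k \<le> j" for k j
  proof -
    have "(\<integral>\<^sup>+x. ennreal ((norm (y j x - y k x))\<^sup>2) \<partial>lborel)
        = ennreal ((norm (abs_l2 (y j) - abs_l2 (y k)))\<^sup>2)"
      by (subst ennreal_norm_abs_l2_sq[symmetric])
         (auto intro!: sq_int_diff y_sq simp: abs_l2_diff y_sq)
    also have "\<dots> = ennreal ((dist (X (r j)) (X (r k)))\<^sup>2)"
      by (simp add: y_def abs_l2_rep dist_norm)
    also have "\<dots> \<le> ennreal (((1/2) ^ k)\<^sup>2)"
      using N[of k "r j" "r k"] r[OF that] r[of k k]
      by (intro ennreal_leI power_mono) auto
    also have "((1/2::real) ^ k)\<^sup>2 = (1/4) ^ k"
      by (simp add: power2_eq_square flip: power_mult_distrib)
    finally show ?thesis .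
  qed
  define w where "w k x = 2 ^ k * (norm (y (Suc k) x - y k x))\<^sup>2" for k x
  have w_meas[measurable]: "w k \<in> borel_measurable borel" for k unfolding w_def by simp
  have "(\<integral>\<^sup>+x. (\<Sum>k. ennreal (w k x)) \<partial>lborel) = (\<Sum>k. \<integral>\<^sup>+x. ennreal (w k x) \<partial>lborel)"
    by (intro nn_integral_suminf) simp
  also have "\<dots> \<le> (\<Sum>k. ennreal ((1/2) ^ k))"
  proof (intro suminf_le)
    fix k
    have "(\<integral>\<^sup>+x. ennreal (w k x) \<partial>lborel)
        = ennreal (2 ^ k) * (\<integral>\<^sup>+x. ennreal ((norm (y (Suc k) x - y k x))\<^sup>2) \<partial>lborel)"
      unfolding w_def by (subst nn_integral_cmult[symmetric]) (auto simp: ennreal_mult)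
    also have "\<dots> \<le> ennreal (2 ^ k) * ennreal ((1/4) ^ k)"
      by (intro mult_left_mono y_dist) auto
    also have "\<dots> = ennreal ((1/2) ^ k)"
      by (simp flip: ennreal_mult power_mult_distrib)
    finally show "(\<integral>\<^sup>+x. ennreal (w k x) \<partial>lborel) \<le> ennreal ((1/2) ^ k)" .
  qed auto
  also have "\<dots> < \<infinity>"
    by (subst suminf_ennreal2) (auto intro!: summable_geometric)
  finally have "AE x in lborel. (\<Sum>k. ennreal (w k x)) \<noteq> \<infinity>"
    by (intro nn_integral_noteq_infinite) auto
  then have conv: "AE x in lborel. convergent (\<lambda>k. y k x)"
  proof eventually_elim
    case (elim x)
    have "summable (\<lambda>k. w k x)"
      using elim by (intro summable_suminf_not_top) (auto simp: w_def)
    then have "Bseq (\<lambda>k. w k x)"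
      by (intro convergent_imp_Bseq summable_LIMSEQ_zero[THEN convergentI])
    then obtain M where M: "M > 0" "\<And>k. w k x \<le> M"
      unfolding Bseq_def by (metis abs_le_D1 real_norm_def)
    have "summable (\<lambda>k. y (Suc k) x - y k x)"
    proof (rule summable_comparison_test')
      show "summable (\<lambda>k. sqrt M * (1 / sqrt 2) ^ k)"
        by (intro summable_mult summable_geometric) (simp add: real_less_rsqrt)
      fix k :: nat
      have "norm (y (Suc k) x - y k x) = sqrt (w k x / 2 ^ k)" by (simp add: w_def)
      also have "\<dots> \<le> sqrt (M / 2 ^ k)" using M(2) by (simp add: divide_right_mono)
      also have "\<dots> = sqrt M * (1 / sqrt 2) ^ k"
        by (simp add: real_sqrt_divide real_sqrt_power power_divide)
      finally show "norm (y (Suc k) x - y k x) \<le> sqrt M * (1 / sqrt 2) ^ k" .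
    qed
    then have "(\<lambda>n. (\<Sum>k<n. y (Suc k) x - y k x) + y 0 x)
        \<longlonglongrightarrow> (\<Sum>k. y (Suc k) x - y k x) + y 0 x"
      by (intro tendsto_add summable_LIMSEQ tendsto_const)
    moreover have "(\<Sum>k<n. y (Suc k) x - y k x) + y 0 x = y n x" for n
      using sum_lessThan_telescope[of "\<lambda>k. y k x" n] by simp
    ultimately show ?case by (auto simp: convergent_def)
  qed
  define f where "f x = lim (\<lambda>k. y k x)" for x
  have f_meas[measurable]: "f \<in> borel_measurable borel"
    unfolding f_def by (rule borel_measurable_lim_metric) simp
  have fatou: "(\<integral>\<^sup>+x. ennreal ((norm (f x - y k x))\<^sup>2) \<partial>lborel) \<le> ennreal ((1/4) ^ k)" for k
  proof -
    have "(\<integral>\<^sup>+x. ennreal ((norm (f x - y k x))\<^sup>2) \<partial>lborel)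
        = (\<integral>\<^sup>+x. liminf (\<lambda>j. ennreal ((norm (y j x - y k x))\<^sup>2)) \<partial>lborel)"
    proof (rule nn_integral_cong_AE, use conv in eventually_elim)
      case (elim x)
      then have "(\<lambda>j. y j x) \<longlonglongrightarrow> f x" by (simp add: f_def convergent_LIMSEQ_iff)
      then have "(\<lambda>j. ennreal ((norm (y j x - y k x))\<^sup>2))
          \<longlonglongrightarrow> ennreal ((norm (f x - y k x))\<^sup>2)"
        by (intro tendsto_ennrealI tendsto_intros)
      then show ?case by (rule lim_imp_Liminf[OF sequentially_bot, symmetric])
    qed
    also have "\<dots> \<le> liminf (\<lambda>j. \<integral>\<^sup>+x. ennreal ((norm (y j x - y k x))\<^sup>2) \<partial>lborel)"
      by (intro nn_integral_liminf) simp
    also have "\<dots> \<le> limsup (\<lambda>j. \<integral>\<^sup>+x. ennreal ((norm (y j x - y k x))\<^sup>2) \<partial>lborel)"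
      by (intro Liminf_le_Limsup) simp
    also have "\<dots> \<le> ennreal ((1/4) ^ k)"
      by (intro Limsup_bounded eventually_sequentiallyI[of k] y_dist)
    finally show ?thesis .
  qed
  have diff_sq: "sq_int (\<lambda>x. f x - y k x)" for k
    unfolding sq_int_def
  proof (intro conjI integrableI_nonneg)
    show "(\<integral>\<^sup>+x. ennreal ((norm (f x - y k x))\<^sup>2) \<partial>lborel) < \<infinity>"
      by (rule le_less_trans[OF fatou]) simp
  qed auto
  have f_sq: "sq_int f" using sq_int_add[OF diff_sq[of 0] y_sq[of 0]] by simp
  have limit: "dist (abs_l2 f) (X (r k)) \<le> (1/2) ^ k" for k
  proof -
    have "ennreal ((norm (abs_l2 f - abs_l2 (y k)))\<^sup>2) \<le> ennreal ((1/4) ^ k)"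
      using fatou[of k] ennreal_norm_abs_l2_sq[OF diff_sq, of k]
      by (simp add: abs_l2_diff f_sq y_sq)
    moreover have "(1/4 :: real) ^ k = ((1/2) ^ k)\<^sup>2"
      by (simp add: power2_eq_square flip: power_mult_distrib)
    moreover have "abs_l2 (y k) = X (r k)" by (simp add: y_def abs_l2_rep)
    ultimately have "(norm (abs_l2 f - X (r k)))\<^sup>2 \<le> ((1/2) ^ k)\<^sup>2"
      by (metis ennreal_le_iff zero_le_power2)
    then show ?thesis unfolding dist_norm by (rule power2_le_imp_le) simp
  qed
  have "X \<longlonglongrightarrow> abs_l2 f"
  proof (rule metric_LIMSEQ_I)
    fix e :: real assume "e > 0"
    then obtain k where k: "(1/2) ^ k < e / 2"
      using real_arch_pow_inv[of "e / 2" "1 / 2"] by auto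
    have "dist (X n) (abs_l2 f) < e" if "n \<ge> N k" for n
    proof -
      have "dist (X n) (abs_l2 f) \<le> dist (X n) (X (r k)) + dist (abs_l2 f) (X (r k))"
        by (metis dist_commute dist_triangle)
      also have "\<dots> < (1/2) ^ k + (1/2) ^ k"
        using N[OF that r[of k k]] limit[of k] by simp
      finally show ?thesis using k by simp
    qed
    then show "\<exists>n0. \<forall>n\<ge>n0. dist (X n) (abs_l2 f) < e" by blast
  qed
  then show "convergent X" by (rule convergentI)
qed


lemma l2_dominated_convergence:
  fixes f :: "real^'s \<Rightarrow> complex^'n"
  assumes f: "sq_int f" "\<And>i. sq_int (F i)"
    and h: "integrable lborel h" "\<And>i x. (norm (F i x - f x))\<^sup>2 \<le> h x"
    and lim: "\<And>x. (\<lambda>i. F i x) \<longlonglongrightarrow> f x"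
  shows "(\<lambda>i. abs_l2 (F i)) \<longlonglongrightarrow> abs_l2 f"
proof -
  have [measurable]: "f \<in> borel_measurable borel" "F i \<in> borel_measurable borel" for i
    using f by (auto simp: sq_int_def)
  have "(\<lambda>i. LINT x|lborel. (norm (F i x - f x))\<^sup>2) \<longlonglongrightarrow> (LINT x :: real^'s|lborel. 0)"
  proof (rule integral_dominated_convergence[where w = h])
    show "AE x in lborel. (\<lambda>i. (norm (F i x - f x))\<^sup>2) \<longlonglongrightarrow> 0"
    proof (intro AE_I2)
      fix x
      have "(\<lambda>i. (norm (F i x - f x))\<^sup>2) \<longlonglongrightarrow> (norm (f x - f x))\<^sup>2"
        by (intro tendsto_intros lim)
      then show "(\<lambda>i. (norm (F i x - f x))\<^sup>2) \<longlonglongrightarrow> 0" by simp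
    qed
  qed (use h in auto)
  moreover have "(LINT x|lborel. (norm (F i x - f x))\<^sup>2) = (norm (abs_l2 (F i) - abs_l2 f))\<^sup>2" for i
    by (subst norm_abs_l2_sq[symmetric]) (auto intro!: sq_int_diff f simp: abs_l2_diff f)
  ultimately have "(\<lambda>i. sqrt ((norm (abs_l2 (F i) - abs_l2 f))\<^sup>2)) \<longlonglongrightarrow> sqrt 0"
    by (intro tendsto_real_sqrt) simp
  then show ?thesis by (simp add: LIM_zero_iff tendsto_norm_zero_iff)
qed

definition l2_indicator :: "(real^'s) set \<Rightarrow> complex^'n \<Rightarrow> ('s, 'n) l2" where
  "l2_indicator A v = abs_l2 (\<lambda>x. indicator A x *\<^sub>R v)"

lemma sq_int_indicator:
  assumes "A \<in> sets borel" "emeasure lborel A < \<infinity>"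
  shows "sq_int (\<lambda>x. indicator A x *\<^sub>R v)"
proof (rule sq_int_bound)
  show "integrable lborel (\<lambda>x. (norm v)\<^sup>2 * indicator A x)"
    using assms by (intro integrable_mult_right) simp
qed (use assms(1) in \<open>auto simp: indicator_def\<close>)

lemma abs_l2_sum:
  assumes "finite I" "\<And>i. i \<in> I \<Longrightarrow> sq_int (f i)"
  shows "sq_int (\<lambda>x. \<Sum>i\<in>I. f i x) \<and> abs_l2 (\<lambda>x. \<Sum>i\<in>I. f i x) = (\<Sum>i\<in>I. abs_l2 (f i))"
  using assms
proof (induction I rule: finite_induct)
  case empty
  then show ?case by (simp add: sq_int_zero abs_l2_zero)
next
  case (insert i I)
  then have "sq_int (f i)" "sq_int (\<lambda>x. \<Sum>i\<in>I. f i x)"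
    "abs_l2 (\<lambda>x. \<Sum>i\<in>I. f i x) = (\<Sum>i\<in>I. abs_l2 (f i))" by auto
  with insert.hyps show ?case by (simp add: sq_int_add abs_l2_add)
qed

lemma l2_countable_dense:
  "\<exists>D :: ('s::finite, 'n::finite) l2 set. countable D \<and> closure D = UNIV"
proof -
  obtain BB0 :: "(real^'s) set set" where BB0: "countable BB0" "topological_basis BB0"
    using ex_countable_basis by blast
  define BB where "BB = {U \<in> BB0. emeasure lborel U < \<infinity>}"
  have BB_countable: "countable BB" using BB0 by (simp add: BB_def)
  have BB_open: "open U" if "U \<in> BB" for U
    using that BB0(2) topological_basis_open by (auto simp: BB_def)
  have union_fin: "emeasure lborel (\<Union>F) < \<infinity>" "\<Union>F \<in> sets borel"
    if "finite F" "F \<subseteq> BB" for F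
  proof -
    show "\<Union>F \<in> sets borel" using that BB_open by (auto intro!: borel_open)
    have "emeasure lborel (\<Union>U\<in>F. U) \<le> (\<Sum>U\<in>F. emeasure lborel U)"
      using that BB_open by (intro emeasure_subadditive_finite) auto
    also have "\<dots> < \<infinity>" using that by (auto simp: BB_def)
    finally show "emeasure lborel (\<Union>F) < \<infinity>" by simp
  qed
  define P where "P = (UNIV :: rat set) \<times> {F. finite F \<and> F \<subseteq> BB} \<times> (Basis :: (complex^'n) set)"
  define G where "G = (\<lambda>(q :: rat, F, b). of_rat q *\<^sub>R (l2_indicator (\<Union>F) b :: ('s, 'n) l2))"
  define D where "D = (\<lambda>l. sum_list (map G l)) ` lists P"
  have "countable P"
    unfolding P_def using BB_countable
    by (intro countable_SIGMA countable_Collect_finite_subset) (auto intro: countable_finite)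
  then have D_countable: "countable D" unfolding D_def by (intro countable_image countable_lists)
  have D_zero: "0 \<in> D" unfolding D_def by (intro image_eqI[of _ _ "[]"]) auto
  have D_add: "x + y \<in> D" if "x \<in> D" "y \<in> D" for x y
  proof -
    from that obtain l m where "l \<in> lists P" "x = sum_list (map G l)"
      "m \<in> lists P" "y = sum_list (map G m)" by (auto simp: D_def)
    then show ?thesis unfolding D_def by (intro image_eqI[of _ _ "l @ m"]) auto
  qed
  have D_scale: "of_rat q *\<^sub>R x \<in> D" if "x \<in> D" for q :: rat and x
  proof -
    from that obtain l where l: "l \<in> lists P" "x = sum_list (map G l)" by (auto simp: D_def)
    have "of_rat q *\<^sub>R sum_list (map G l) = sum_list (map G (map (\<lambda>(r, z). (q * r, z)) l))"
      by (induction l) (auto simp: G_def scaleR_add_right of_rat_mult)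
    moreover have "map (\<lambda>(r, z). (q * r, z)) l \<in> lists P"
      using l(1) by (auto simp: P_def lists_eq_set)
    ultimately show ?thesis unfolding D_def l(2) by blast
  qed
  let ?C = "closure D"
  have C_add: "x + y \<in> ?C" if xy: "x \<in> ?C" "y \<in> ?C" for x y
  proof -
    from xy obtain X Y where "\<And>n. X n \<in> D" "X \<longlonglongrightarrow> x"
      "\<And>n. Y n \<in> D" "Y \<longlonglongrightarrow> y"
      by (auto simp: closure_sequential)
    then show ?thesis unfolding closure_sequential
      by (intro exI[of _ "\<lambda>n. X n + Y n"]) (auto intro: D_add tendsto_add)
  qed
  have C_scale: "c *\<^sub>R x \<in> ?C" if x: "x \<in> ?C" for c x
  proof -
    from x obtain X where X: "\<And>n. X n \<in> D" "X \<longlonglongrightarrow> x"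
      by (auto simp: closure_sequential)
    have "c \<in> closure \<rat>" using Rats_closure_real by auto
    then obtain Q where Q: "\<And>n. Q n \<in> \<rat>" "Q \<longlonglongrightarrow> c"
      by (auto simp: closure_sequential)
    have "Q n *\<^sub>R X n \<in> D" for n using Q(1)[of n] X(1)[of n] D_scale by (auto elim!: Rats_cases)
    then show ?thesis unfolding closure_sequential
      using X(2) Q(2) by (intro exI[of _ "\<lambda>n. Q n *\<^sub>R X n"]) (auto intro: tendsto_scaleR)
  qed
  have C_sum: "(\<Sum>i\<in>I. g i) \<in> ?C" if "finite I" "\<And>i. i \<in> I \<Longrightarrow> g i \<in> ?C" for g and I :: "(complex^'n) set"
    using that by (induction I rule: finite_induct) (auto intro: C_add D_zero closure_subset[THEN subsetD])
  have C_lim: "x \<in> ?C" if "\<And>n. X n \<in> ?C" "X \<longlonglongrightarrow> x" for X x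
    using that closed_closure closed_sequentially by blast
  have step_basic: "l2_indicator (\<Union>F) b \<in> ?C" if "finite F" "F \<subseteq> BB" "b \<in> Basis" for F b
  proof -
    have "l2_indicator (\<Union>F) b = sum_list (map G [(1, F, b)])" by (simp add: G_def)
    moreover have "[(1, F, b)] \<in> lists P" using that by (simp add: P_def)
    ultimately have "l2_indicator (\<Union>F) b \<in> D" unfolding D_def by (rule image_eqI)
    then show ?thesis using closure_subset by blast
  qed
  have step_open: "l2_indicator U b \<in> ?C"
    if U: "open U" "emeasure lborel U < \<infinity>" "b \<in> Basis" for U b
  proof -
    obtain B' where B': "B' \<subseteq> BB0" "\<Union>B' = U"
      using BB0(2) U(1) unfolding topological_basis_def by blast
    have B'_BB: "B' \<subseteq> BB"
    proof
      fix V assume V: "V \<in> B'"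
      have "emeasure lborel V \<le> emeasure lborel U"
        using V B' U(1) by (intro emeasure_mono) auto
      then show "V \<in> BB" using V B' U(2) by (auto simp: BB_def intro: le_less_trans)
    qed
    show ?thesis
    proof (cases "B' = {}")
      case True
      then show ?thesis using step_basic[of "{}" b] B' U(3) by auto
    next
      case False
      have B'_countable: "countable B'" using B'_BB BB_countable countable_subset by blast
      define F where "F n = from_nat_into B' ` {..n}" for n :: nat
      have F: "finite (F n)" "F n \<subseteq> BB" for n
        using from_nat_into[OF False] B'_BB by (auto simp: F_def)
      have F_sub: "\<Union>(F n) \<subseteq> U" for n
        using from_nat_into[OF False] B' by (auto simp: F_def)
      have "(\<lambda>n. l2_indicator (\<Union>(F n)) b) \<longlonglongrightarrow> l2_indicator U b"
        unfolding l2_indicator_def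
      proof (rule l2_dominated_convergence)
        show "integrable lborel (\<lambda>x. (norm b)\<^sup>2 * indicator U x)"
          using U by (intro integrable_mult_right) auto
        show "(norm (indicator (\<Union>(F n)) x *\<^sub>R b - indicator U x *\<^sub>R b))\<^sup>2
            \<le> (norm b)\<^sup>2 * indicator U x" for n x
          using F_sub[of n] by (auto simp: indicator_def)
        show "(\<lambda>n. indicator (\<Union>(F n)) x *\<^sub>R b) \<longlonglongrightarrow> indicator U x *\<^sub>R b" for x
        proof (cases "x \<in> U")
          case True
          then obtain V where V: "x \<in> V" "V \<in> B'" using B' by blast
          then obtain k where "from_nat_into B' k = V"
            using from_nat_into_surj[OF B'_countable] by blast
          with V True have "indicator (\<Union>(F n)) x *\<^sub>R b = indicator U x *\<^sub>R b" if "n \<ge> k" for n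
            using that by (auto simp: F_def indicator_def)
          then show ?thesis by (intro tendsto_eventually eventually_sequentiallyI[of k])
        next
          case False
          then have "indicator (\<Union>(F n)) x *\<^sub>R b = indicator U x *\<^sub>R b" for n
            using F_sub[of n] by (auto simp: indicator_def)
          then show ?thesis by (simp only: tendsto_const)
        qed
      qed (use U F union_fin in \<open>auto intro!: sq_int_indicator\<close>)
      then show ?thesis by (rule C_lim[OF step_basic[OF F U(3)]])
    qed
  qed
  have step_borel: "l2_indicator A b \<in> ?C"
    if A: "A \<in> sets borel" "emeasure lborel A < \<infinity>" "b \<in> Basis" for A b
  proof -
    have "\<exists>z\<in>?C. dist z (l2_indicator A b) < e" if "e > 0" for e
    proof -
      have "e\<^sup>2 > 0" using that by simp
      then obtain U where U: "open U" "A \<subseteq> U" "emeasure lborel (U - A) < ennreal (e\<^sup>2)"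
        using outer_regular_lborel[OF A(1)] by metis
      have "emeasure lborel U \<le> emeasure lborel A + emeasure lborel (U - A)"
        using emeasure_subadditive[of A lborel "U - A"] A(1) U by (auto simp: Un_absorb1)
      also have "\<dots> < \<infinity>" using A(2) U(3) by (auto simp: less_top[symmetric])
      finally have U_fin: "emeasure lborel U < \<infinity>" .
      have UA: "U - A \<in> sets borel" using U A by auto
      have eq: "indicator U x *\<^sub>R b - indicator A x *\<^sub>R b = indicator (U - A) x *\<^sub>R b" for x
        using U(2) by (auto simp: indicator_def)
      have UA_fin: "emeasure lborel (U - A) < \<infinity>"
        using U(3) by (rule less_trans) simp
      have "ennreal ((norm (l2_indicator U b - l2_indicator A b))\<^sup>2)
          = ennreal ((norm (abs_l2 (\<lambda>x. indicator (U - A) x *\<^sub>R b)))\<^sup>2)"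
        unfolding l2_indicator_def eq[symmetric]
        by (subst abs_l2_diff) (use U A U_fin in \<open>auto intro!: sq_int_indicator\<close>)
      also have "\<dots> = (\<integral>\<^sup>+x. ennreal ((norm (indicator (U - A) x *\<^sub>R b))\<^sup>2) \<partial>lborel)"
        by (rule ennreal_norm_abs_l2_sq[OF sq_int_indicator[OF UA UA_fin]])
      also have "\<dots> = (\<integral>\<^sup>+x. indicator (U - A) x \<partial>lborel)"
        using A(3) by (intro nn_integral_cong) (auto simp: indicator_def)
      also have "\<dots> = emeasure lborel (U - A)" using UA by simp
      also have "\<dots> < ennreal (e\<^sup>2)" by (rule U(3))
      finally have "(norm (l2_indicator U b - l2_indicator A b))\<^sup>2 < e\<^sup>2"
        by (simp add: ennreal_less_iff)
      then have "dist (l2_indicator U b) (l2_indicator A b) < e"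
        unfolding dist_norm using that by (simp add: power_less_imp_less_base)
      then show ?thesis using step_open[OF U(1) U_fin A(3)] by blast
    qed
    then have "l2_indicator A b \<in> closure ?C"
      by (intro closure_approachable[THEN iffD2] allI impI)
    then show ?thesis by (simp only: closure_closure)
  qed
  have step_vec: "l2_indicator A v \<in> ?C"
    if A: "A \<in> sets borel" "emeasure lborel A < \<infinity>" for A and v :: "complex^'n"
  proof -
    have "l2_indicator A v = abs_l2 (\<lambda>x. \<Sum>b\<in>Basis. (v \<bullet> b) *\<^sub>R indicator A x *\<^sub>R b)"
    proof -
      have "indicator A x *\<^sub>R v = (\<Sum>b\<in>Basis. (v \<bullet> b) *\<^sub>R indicator A x *\<^sub>R b)" for x
        by (subst euclidean_representation[of v, symmetric])
           (simp add: scaleR_sum_right mult.commute)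
      then show ?thesis by (simp add: l2_indicator_def)
    qed
    also have "\<dots> = (\<Sum>b\<in>Basis. abs_l2 (\<lambda>x. (v \<bullet> b) *\<^sub>R indicator A x *\<^sub>R b))"
      by (rule abs_l2_sum[THEN conjunct2]) (intro finite_Basis sq_int_scaleR sq_int_indicator A)+
    also have "\<dots> = (\<Sum>b\<in>Basis. (v \<bullet> b) *\<^sub>R l2_indicator A b)"
      unfolding l2_indicator_def by (intro sum.cong refl abs_l2_scaleR sq_int_indicator A)
    also have "\<dots> \<in> ?C" by (intro C_sum C_scale step_borel A) auto
    finally show ?thesis .
  qed
  have step_simple: "abs_l2 g \<in> ?C" if g: "simple_function lborel g" "sq_int g"
    for g :: "real^'s \<Rightarrow> complex^'n"
  proof -
    have fin: "finite (range g - {0})" using g(1) by (simp add: simple_function_def)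
    have meas: "g -` {v} \<in> sets borel" for v
      using g(2) measurable_sets_borel[of g borel "{v}"] by (auto simp: sq_int_def)
    have emeas: "emeasure lborel (g -` {v}) < \<infinity>" if "v \<noteq> 0" for v
    proof -
      have "ennreal ((norm v)\<^sup>2) * emeasure lborel (g -` {v})
          = (\<integral>\<^sup>+x. ennreal ((norm v)\<^sup>2) * indicator (g -` {v}) x \<partial>lborel)"
        using meas by (simp add: nn_integral_cmult_indicator)
      also have "\<dots> \<le> (\<integral>\<^sup>+x. ennreal ((norm (g x))\<^sup>2) \<partial>lborel)"
        by (intro nn_integral_mono) (auto simp: indicator_def)
      also have "\<dots> < \<infinity>" by (simp flip: ennreal_norm_abs_l2_sq[OF g(2)])
      finally show ?thesis using that by (auto simp: ennreal_mult_less_top)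
    qed
    have "g x = (\<Sum>v\<in>range g - {0}. indicator (g -` {v}) x *\<^sub>R v)" for x
    proof (cases "g x = 0")
      case False
      then have "(\<Sum>v\<in>range g - {0}. indicator (g -` {v}) x *\<^sub>R v)
          = (\<Sum>v\<in>range g - {0}. if v = g x then v else 0)"
        by (intro sum.cong) (auto simp: indicator_def)
      then show ?thesis using fin False by (simp add: sum.delta)
    qed (auto intro!: sum.neutral[symmetric] simp: indicator_def)
    then have "g = (\<lambda>x. \<Sum>v\<in>range g - {0}. indicator (g -` {v}) x *\<^sub>R v)" by (rule ext)
    then have "abs_l2 g = abs_l2 (\<lambda>x. \<Sum>v\<in>range g - {0}. indicator (g -` {v}) x *\<^sub>R v)"
      by (rule arg_cong)
    also have "\<dots> = (\<Sum>v\<in>range g - {0}. l2_indicator (g -` {v}) v)"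
      unfolding l2_indicator_def
      by (rule abs_l2_sum[THEN conjunct2]) (use fin in \<open>auto intro!: sq_int_indicator meas emeas\<close>)
    also have "\<dots> \<in> ?C" by (intro C_sum step_vec fin meas emeas) blast
    finally show ?thesis .
  qed
  have "z \<in> ?C" for z
  proof -
    let ?f = "rep_l2 z"
    have f_meas: "?f \<in> borel_measurable lborel" and f_int: "integrable lborel (\<lambda>x. (norm (?f x))\<^sup>2)"
      using sq_int_rep[of z] by (auto simp: sq_int_def)
    obtain F where F: "\<And>i. simple_function lborel (F i)"
      "\<And>x. (\<lambda>i. F i x) \<longlonglongrightarrow> ?f x"
      "\<And>i x. dist (F i x) 0 \<le> 2 * dist (?f x) 0"
      using borel_measurable_implies_sequence_metric[OF f_meas, of 0] by auto
    have F_norm: "norm (F i x) \<le> 2 * norm (?f x)" for i x using F(3)[of i x] by simp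
    have F_sq: "sq_int (F i)" for i
    proof (rule sq_int_bound)
      show "F i \<in> borel_measurable borel"
        using borel_measurable_simple_function[OF F(1)[of i]] by simp
      show "integrable lborel (\<lambda>x. 4 * (norm (?f x))\<^sup>2)" using f_int by simp
      show "AE x in lborel. (norm (F i x))\<^sup>2 \<le> 4 * (norm (?f x))\<^sup>2"
        using power_mono[OF F_norm, of _ _ 2] by (auto simp: power_mult_distrib)
    qed
    have "(\<lambda>i. abs_l2 (F i)) \<longlonglongrightarrow> abs_l2 ?f"
    proof (rule l2_dominated_convergence[OF sq_int_rep F_sq])
      show "integrable lborel (\<lambda>x. 9 * (norm (?f x))\<^sup>2)" using f_int by simp
      show "(norm (F i x - ?f x))\<^sup>2 \<le> 9 * (norm (?f x))\<^sup>2" for i x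
      proof -
        have "norm (F i x - ?f x) \<le> 3 * norm (?f x)"
          using norm_triangle_ineq4[of "F i x" "?f x"] F_norm[of i x] by simp
        from power_mono[OF this, of 2] show ?thesis by (simp add: power_mult_distrib)
      qed
    qed (rule F(2))
    then have "abs_l2 ?f \<in> ?C" by (rule C_lim[rotated]) (intro step_simple F(1) F_sq)
    then show ?thesis by (simp add: abs_l2_rep)
  qed
  with D_countable show ?thesis by blast
qed

instance l2 :: (finite, finite) second_countable_topology
proof
  obtain D :: "('a, 'b) l2 set" where D: "countable D" "closure D = UNIV"
    using l2_countable_dense by blast
  define B where "B = (\<lambda>(d, n). ball d (1 / real (Suc n))) ` (D \<times> (UNIV :: nat set))"
  have "countable B" unfolding B_def using D(1) by (intro countable_image countable_SIGMA) auto
  moreover have "topological_basis B"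
  proof (rule topological_basisI)
    show "open U" if "U \<in> B" for U using that by (auto simp: B_def)
    fix U and x :: "('a, 'b) l2" assume "open U" "x \<in> U"
    then obtain e where e: "e > 0" "ball x e \<subseteq> U" by (auto simp: open_contains_ball)
    obtain n where n: "1 / real (Suc n) < e / 2"
      using nat_approx_posE[of "e / 2"] e by auto
    obtain d where d: "d \<in> D" "dist d x < 1 / real (Suc n)"
      using D(2) closure_approachable[of x D] zero_less_divide_1_iff[of "real (Suc n)"]
      by (metis UNIV_I of_nat_0_less_iff zero_less_Suc)
    have "ball d (1 / real (Suc n)) \<subseteq> U"
    proof
      fix y assume "y \<in> ball d (1 / real (Suc n))"
      then have "dist x y < e"
        using d n dist_triangle[of x y d] by (simp add: dist_commute)
      then show "y \<in> U" using e by auto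
    qed
    moreover have "x \<in> ball d (1 / real (Suc n))" using d by simp
    moreover have "ball d (1 / real (Suc n)) \<in> B"
      unfolding B_def using d(1) by (intro image_eqI[of _ _ "(d, n)"]) auto
    ultimately show "\<exists>V\<in>B. x \<in> V \<and> V \<subseteq> U" by blast
  qed
  ultimately show "\<exists>B :: ('a, 'b) l2 set set. countable B \<and> open = generate_topology B"
    using topological_basis_imp_subbasis by blast
qed


definition cvec_inner :: "complex^'n \<Rightarrow> complex^'n \<Rightarrow> complex" where
  "cvec_inner v w = (\<Sum>i\<in>UNIV. v $ i * cnj (w $ i))"

lift_definition cinner_l2 :: "('s::finite, 'n::finite) l2 \<Rightarrow> ('s, 'n) l2 \<Rightarrow> complex"
  is "\<lambda>f g. LINT x|lborel. cvec_inner (f x) (g x)"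
proof -
  have meas: "(\<lambda>x. cvec_inner (f x) (g x)) \<in> borel_measurable lborel"
    if "sq_int f" "sq_int g" for f g :: "real^'s \<Rightarrow> complex^'n"
  proof -
    have "(\<lambda>p. cvec_inner (fst p) (snd p)) \<in> borel_measurable (borel :: ((complex^'n) \<times> (complex^'n)) measure)"
      unfolding cvec_inner_def by (intro borel_measurable_continuous_onI continuous_intros)
    moreover have "(\<lambda>x. (f x, g x)) \<in> borel_measurable lborel"
      using that by (intro borel_measurable_Pair) (auto simp: sq_int_def)
    ultimately show ?thesis by (auto dest: measurable_compose[rotated])
  qed
  fix f f' g g' :: "real^'s \<Rightarrow> complex^'n"
  assume "l2_rel f f'" "l2_rel g g'"
  then show "(LINT x|lborel. cvec_inner (f x) (g x)) = (LINT x|lborel. cvec_inner (f' x) (g' x))"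
    by (intro integral_cong_AE meas) (auto simp: l2_rel_def)
qed

lift_definition scaleC_l2 :: "complex \<Rightarrow> ('s::finite, 'n::finite) l2 \<Rightarrow> ('s, 'n) l2"
  is "\<lambda>c f x. c *s f x"
  unfolding l2_rel_def by (auto intro!: sq_int_scaleC)

lift_definition translate_l2 :: "real^'s \<Rightarrow> ('s::finite, 'n::finite) l2 \<Rightarrow> ('s, 'n) l2"
  is "\<lambda>a f x. f (x + a)"
proof -
  fix a :: "real^'s" and f g :: "real^'s \<Rightarrow> complex^'n"
  assume *: "l2_rel f g"
  have distr: "distr lborel borel ((+) a) = lborel" by (rule lborel_distr_plus)
  have "sq_int (\<lambda>x. h (x + a))" if h: "sq_int h" for h :: "real^'s \<Rightarrow> complex^'n"
  proof -
    have [measurable]: "h \<in> borel_measurable borel" using h by (simp add: sq_int_def)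
    have "integrable (distr lborel borel ((+) a)) (\<lambda>x. (norm (h x))\<^sup>2)"
      unfolding distr using h by (simp add: sq_int_def)
    then have "integrable lborel (\<lambda>x. (norm (h (a + x)))\<^sup>2)"
      by (subst (asm) integrable_distr_eq) auto
    then show ?thesis by (simp add: sq_int_def add.commute)
  qed
  moreover have "AE x in lborel. f (x + a) = g (x + a)"
  proof -
    have [measurable]: "f \<in> borel_measurable borel" "g \<in> borel_measurable borel"
      using * by (auto simp: l2_rel_def sq_int_def)
    have "AE x in distr lborel borel ((+) a). f x = g x"
      unfolding distr using * by (simp add: l2_rel_def)
    then show ?thesis by (subst (asm) AE_distr_iff) (auto simp: add.commute)
  qed
  ultimately show "l2_rel (\<lambda>x. f (x + a)) (\<lambda>x. g (x + a))"
    using * by (simp add: l2_rel_def)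
qed

section \<open>Operators\<close>

text \<open>
  Possibly unbounded operators are represented by their graphs, so that equality of graphs
  includes equality of domains; the domain is \<^const>\<open>Domain\<close> of the graph. Everywhere defined
  bounded operators are functions.
\<close>

type_synonym ('s, 'n, 'm) l2_op = "(('s, 'n) l2 \<times> ('s, 'm) l2) set"

definition graph :: "('a \<Rightarrow> 'b) \<Rightarrow> ('a \<times> 'b) set" where
  "graph F = {(f, F f) | f. True}"

definition linear_op :: "('s::finite, 'n::finite, 'm::finite) l2_op \<Rightarrow> bool" where
  "linear_op M \<longleftrightarrow> single_valued M \<and> (0, 0) \<in> M
    \<and> (\<forall>(f, g)\<in>M. \<forall>(f', g')\<in>M. (f + f', g + g') \<in> M)
    \<and> (\<forall>c. \<forall>(f, g)\<in>M. (scaleC_l2 c f, scaleC_l2 c g) \<in> M)"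

definition bounded_op :: "(('s::finite, 'n::finite) l2 \<Rightarrow> ('s, 'm::finite) l2) \<Rightarrow> bool" where
  "bounded_op F \<longleftrightarrow> bounded_linear F \<and> (\<forall>c f. F (scaleC_l2 c f) = scaleC_l2 c (F f))"

definition translation_invariant :: "('s::finite, 'n::finite, 'm::finite) l2_op \<Rightarrow> bool" where
  "translation_invariant M \<longleftrightarrow> (\<forall>a. \<forall>(f, g)\<in>M. (translate_l2 a f, translate_l2 a g) \<in> M)"

text \<open>
  The following three notions are relative to closed subspaces \<open>X\<close> and \<open>Y\<close>, with \<open>M\<close> regarded as
  an operator from \<open>X\<close> to \<open>Y\<close>; the blocks of a partitioned operator act between such subspaces.
\<close>

definition densely_defined_on :: "('s::finite, 'n::finite) l2 set \<Rightarrow> ('s, 'n, 'm) l2_op \<Rightarrow> bool" where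
  "densely_defined_on X M \<longleftrightarrow> Domain M \<subseteq> X \<and> X \<subseteq> closure (Domain M)"

definition adjoint_on :: "('s::finite, 'n::finite) l2 set \<Rightarrow> ('s, 'm::finite) l2 set
    \<Rightarrow> ('s, 'n, 'm) l2_op \<Rightarrow> ('s, 'm, 'n) l2_op" where
  "adjoint_on X Y M = {(y, x). y \<in> Y \<and> x \<in> X \<and> (\<forall>(f, g)\<in>M. cinner_l2 g y = cinner_l2 f x)}"

definition self_adjoint_on :: "('s::finite, 'n::finite) l2 set \<Rightarrow> ('s, 'n, 'n) l2_op \<Rightarrow> bool" where
  "self_adjoint_on X M \<longleftrightarrow> densely_defined_on X M \<and> adjoint_on X X M = M"

definition nonpos_op_on :: "('s::finite, 'n::finite) l2 set \<Rightarrow> ('s, 'n, 'n) l2_op \<Rightarrow> bool" where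
  "nonpos_op_on X M \<longleftrightarrow> self_adjoint_on X M \<and> (\<forall>(f, g)\<in>M. Re (cinner_l2 g f) \<le> 0)"

abbreviation "densely_defined \<equiv> densely_defined_on UNIV"
abbreviation "adjoint_op \<equiv> adjoint_on UNIV UNIV"
abbreviation "self_adjoint \<equiv> self_adjoint_on UNIV"

definition uminus_op :: "('s::finite, 'n::finite, 'm::finite) l2_op \<Rightarrow> ('s, 'n, 'm) l2_op" where
  "uminus_op M = {(f, - g) | f g. (f, g) \<in> M}"

section \<open>Fourier transform and symbols\<close>

text \<open>
  The unitary extension to all of \<open>L\<^sub>2\<close> of the Fourier integral on the intersection of \<open>L\<^sub>1\<close> and
  \<open>L\<^sub>2\<close>; existence is Plancherel's theorem, uniqueness is density of that intersection.
\<close>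

definition fourier_l2 :: "('s::finite, 'n::finite) l2 \<Rightarrow> ('s, 'n) l2" where
  "fourier_l2 = (THE F. bounded_op F \<and> surj F
    \<and> (\<forall>f g. cinner_l2 (F f) (F g) = cinner_l2 f g)
    \<and> (\<forall>f. integrable lborel (rep_l2 f) \<longrightarrow>
        (AE \<omega> in lborel. rep_l2 (F f) \<omega> =
          (2 * pi) powr (- real CARD('s) / 2) *\<^sub>R
            (LINT x|lborel. exp (- \<i> * of_real (\<omega> \<bullet> x)) *s rep_l2 f x))))"

text \<open>
  The translation invariant operator with a given symbol. The right-hand side of the defining
  equation represents an element of \<open>L\<^sub>2\<close> for exactly those \<open>f\<close> that belong to the domain, so this
  is the operator with maximal domain.
\<close>

definition symbol_op :: "(real^'s \<Rightarrow> complex^'n^'m) \<Rightarrow> ('s::finite, 'n::finite, 'm::finite) l2_op" where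
  "symbol_op M = {(f, g). AE \<omega> in lborel. rep_l2 (fourier_l2 g) \<omega> = M \<omega> *v rep_l2 (fourier_l2 f) \<omega>}"

definition has_symbol ::
    "('s::finite, 'n::finite, 'm::finite) l2_op \<Rightarrow> (real^'s \<Rightarrow> complex^'n^'m) \<Rightarrow> bool" where
  "has_symbol M Mh \<longleftrightarrow>
    (\<forall>(f, g)\<in>M. AE \<omega> in lborel. rep_l2 (fourier_l2 g) \<omega> = Mh \<omega> *v rep_l2 (fourier_l2 f) \<omega>)"

definition locally_bounded_symbol :: "(real^'s \<Rightarrow> complex^'n^'m) \<Rightarrow> bool" where
  "locally_bounded_symbol M \<longleftrightarrow> M \<in> borel_measurable borel \<and> (\<forall>K. compact K \<longrightarrow> bounded (M ` K))"

section \<open>Complex matrices and finite-dimensional systems\<close>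

definition conj_transpose :: "complex^'n^'m \<Rightarrow> complex^'m^'n" where
  "conj_transpose M = (\<chi> i j. cnj (M $ j $ i))"

definition pos_semidef :: "complex^'n^'n \<Rightarrow> bool" where
  "pos_semidef M \<longleftrightarrow> conj_transpose M = M \<and> (\<forall>v. 0 \<le> Re (cvec_inner (M *v v) v))"

definition pos_def :: "complex^'n^'n \<Rightarrow> bool" where
  "pos_def M \<longleftrightarrow> conj_transpose M = M \<and> (\<forall>v. v \<noteq> 0 \<longrightarrow> 0 < Re (cvec_inner (M *v v) v))"

text \<open>The library exponential does not apply: multiplication on \<^typ>\<open>complex^'n^'n\<close> is not \<open>**\<close>.\<close>

definition mat_exp :: "complex^'n^'n \<Rightarrow> complex^'n^'n" where
  "mat_exp M = (\<Sum>k. ((**) M ^^ k) (mat 1) /\<^sub>R fact k)"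

definition controllable :: "complex^'n^'n \<Rightarrow> complex^'m^'n \<Rightarrow> bool" where
  "controllable A B \<longleftrightarrow> (\<forall>z0 z1. \<exists>T>0. \<exists>u z. continuous_on {0..T} u
    \<and> (\<forall>t\<in>{0..T}. (z has_vector_derivative A *v z t + B *v u t) (at t within {0..T}))
    \<and> z 0 = z0 \<and> z T = z1)"

definition observable :: "complex^'n^'n \<Rightarrow> complex^'n^'p \<Rightarrow> bool" where
  "observable A C \<longleftrightarrow> (\<forall>z z'.
    (\<forall>t\<ge>0. (z has_vector_derivative A *v z t) (at t within {0..})
      \<and> (z' has_vector_derivative A *v z' t) (at t within {0..}) \<and> C *v z t = C *v z' t)
    \<longrightarrow> z 0 = z' (0::real))"

definition minimal_lti :: "complex^'n^'n \<Rightarrow> complex^'m^'n \<Rightarrow> complex^'n^'p \<Rightarrow> bool" where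
  "minimal_lti A B C \<longleftrightarrow> controllable A B \<and> observable A C"

definition passive_lti :: "complex^'n^'n \<Rightarrow> complex^'m^'n \<Rightarrow> complex^'n^'m \<Rightarrow> bool" where
  "passive_lti A B C \<longleftrightarrow> (\<exists>Q. pos_semidef Q
    \<and> pos_semidef (- (conj_transpose A ** Q + Q ** A)) \<and> conj_transpose C = Q ** B)"

section \<open>Linear translation and time invariant systems\<close>

definition ltsi_system :: "('s::finite, 'n::finite, 'n) l2_op
    \<Rightarrow> (('s, 'm::finite) l2 \<Rightarrow> ('s, 'n) l2) \<Rightarrow> (('s, 'n) l2 \<Rightarrow> ('s, 'p::finite) l2) \<Rightarrow> bool" where
  "ltsi_system A B C \<longleftrightarrow>
    linear_op A \<and> densely_defined A \<and> translation_invariant A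
    \<and> bounded_op B \<and> translation_invariant (graph B)
    \<and> bounded_op C \<and> translation_invariant (graph C)"

text \<open>For each time \<open>t\<close>, the operator with symbol \<open>\<omega> \<mapsto> C\<^sub>\<omega> exp (A\<^sub>\<omega> t) B\<^sub>\<omega>\<close>.\<close>

definition impulse_response :: "(real^'s \<Rightarrow> complex^'n^'n) \<Rightarrow> (real^'s \<Rightarrow> complex^'m^'n)
    \<Rightarrow> (real^'s \<Rightarrow> complex^'n^'p) \<Rightarrow> real \<Rightarrow> ('s::finite, 'm::finite, 'p::finite) l2_op" where
  "impulse_response Ah Bh Ch t = symbol_op (\<lambda>\<omega>. Ch \<omega> ** mat_exp (t *\<^sub>R Ah \<omega>) ** Bh \<omega>)"

definition reciprocal :: "(real \<Rightarrow> ('s::finite, 'm::finite, 'm) l2_op) \<Rightarrow> bool" where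
  "reciprocal G \<longleftrightarrow> (\<forall>t\<ge>0. self_adjoint (G t))"

definition weakly_impedance_passive :: "(real^'s \<Rightarrow> complex^'n^'n)
    \<Rightarrow> (real^'s \<Rightarrow> complex^'m^'n) \<Rightarrow> (real^'s \<Rightarrow> complex^'n^'m) \<Rightarrow> bool" where
  "weakly_impedance_passive Ah Bh Ch \<longleftrightarrow> (\<forall>\<omega>. passive_lti (Ah \<omega>) (Bh \<omega>) (Ch \<omega>))"

text \<open>Semigroups are functions on all of \<^typ>\<open>real\<close>; values at negative times are irrelevant.\<close>

definition c0_semigroup :: "(real \<Rightarrow> ('s::finite, 'n::finite) l2 \<Rightarrow> ('s, 'n) l2) \<Rightarrow> bool" where
  "c0_semigroup T \<longleftrightarrow> (\<forall>t\<ge>0. bounded_op (T t)) \<and> T 0 = id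
    \<and> (\<forall>t\<ge>0. \<forall>r\<ge>0. T (t + r) = T t \<circ> T r)
    \<and> (\<forall>z. ((\<lambda>t. T t z) \<longlongrightarrow> z) (at_right 0))"

definition generator ::
    "(real \<Rightarrow> ('s::finite, 'n::finite) l2 \<Rightarrow> ('s, 'n) l2) \<Rightarrow> ('s, 'n, 'n) l2_op" where
  "generator T = {(z, w). ((\<lambda>h. (T h z - z) /\<^sub>R h) \<longlongrightarrow> w) (at_right 0)}"

definition generates :: "('s::finite, 'n::finite, 'n) l2_op
    \<Rightarrow> (real \<Rightarrow> ('s, 'n) l2 \<Rightarrow> ('s, 'n) l2) \<Rightarrow> bool" where
  "generates A T \<longleftrightarrow> c0_semigroup T \<and> generator T = A"

text \<open>
  A semigroup is determined at nonnegative times by its generator, so the choice of \<open>T\<close> in the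
  definitions below does not matter.
\<close>

definition well_posed :: "('s::finite, 'n::finite, 'n) l2_op \<Rightarrow> bool" where
  "well_posed A \<longleftrightarrow> (\<exists>T. generates A T)"

definition has_impulse_response :: "('s::finite, 'n::finite, 'n) l2_op
    \<Rightarrow> (('s, 'm::finite) l2 \<Rightarrow> ('s, 'n) l2) \<Rightarrow> (('s, 'n) l2 \<Rightarrow> ('s, 'p::finite) l2)
    \<Rightarrow> (real \<Rightarrow> ('s, 'm, 'p) l2_op) \<Rightarrow> bool" where
  "has_impulse_response A B C G \<longleftrightarrow>
    (\<exists>T. generates A T \<and> (\<forall>t\<ge>0. graph (C \<circ> T t \<circ> B) = G t))"

definition l2_input :: "real \<Rightarrow> (real \<Rightarrow> ('s::finite, 'm::finite) l2) \<Rightarrow> bool" where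
  "l2_input t u \<longleftrightarrow> set_borel_measurable lborel {0..t} u
    \<and> set_integrable lborel {0..t} (\<lambda>\<tau>. (norm (u \<tau>))\<^sup>2)"

definition mild_state :: "(real \<Rightarrow> ('s::finite, 'n::finite) l2 \<Rightarrow> ('s, 'n) l2)
    \<Rightarrow> (('s, 'm::finite) l2 \<Rightarrow> ('s, 'n) l2) \<Rightarrow> ('s, 'n) l2 \<Rightarrow> (real \<Rightarrow> ('s, 'm) l2)
    \<Rightarrow> real \<Rightarrow> ('s, 'n) l2" where
  "mild_state T B z0 u t = T t z0 + (LINT \<tau>:{0..t}|lborel. T (t - \<tau>) (B (u \<tau>)))"

definition passive_with_storage :: "(('s::finite, 'n::finite) l2 \<Rightarrow> real) \<Rightarrow> ('s, 'n, 'n) l2_op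
    \<Rightarrow> (('s, 'm::finite) l2 \<Rightarrow> ('s, 'n) l2) \<Rightarrow> (('s, 'n) l2 \<Rightarrow> ('s, 'm) l2) \<Rightarrow> bool" where
  "passive_with_storage V A B C \<longleftrightarrow> (\<exists>T. generates A T \<and>
    (\<forall>z0. \<forall>t\<ge>0. \<forall>u. l2_input t u \<longrightarrow>
      (let z = mild_state T B z0 u; y = (\<lambda>\<tau>. C (z \<tau>))
       in V (z t) \<le> V (z 0) +
         (LINT \<tau>:{0..t}|lborel. Re (cinner_l2 (u \<tau>) (y \<tau>) + cinner_l2 (y \<tau>) (u \<tau>))))))"

definition internally_impedance_passive :: "('s::finite, 'n::finite, 'n) l2_op
    \<Rightarrow> (('s, 'm::finite) l2 \<Rightarrow> ('s, 'n) l2) \<Rightarrow> (('s, 'n) l2 \<Rightarrow> ('s, 'm) l2) \<Rightarrow> bool" where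
  "internally_impedance_passive A B C \<longleftrightarrow> passive_with_storage (\<lambda>z. (norm z)\<^sup>2) A B C"

definition self_dual :: "('s::finite, 'n::finite, 'n) l2_op
    \<Rightarrow> (('s, 'm::finite) l2 \<Rightarrow> ('s, 'n) l2) \<Rightarrow> (('s, 'n) l2 \<Rightarrow> ('s, 'm) l2) \<Rightarrow> bool" where
  "self_dual A B C \<longleftrightarrow> (\<exists>T. bounded_op T \<and> bij T \<and> bounded_op (inv T)
    \<and> T ` Domain A = Domain (adjoint_op A)
    \<and> (\<forall>(f, g)\<in>A. (T f, T g) \<in> adjoint_op A)
    \<and> adjoint_op (graph C) = graph (T \<circ> B)
    \<and> graph C = graph T O adjoint_op (graph B))"

section \<open>Partitioned state spaces\<close>

text \<open>
  A partition of the state vector is given by a set \<open>J\<close> of coordinates and its complement. The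
  space of square-integrable functions with values in \<open>\<complex>\<^sup>J\<close> is identified with the subspace of
  functions whose coordinates outside \<open>J\<close> vanish, and an \<open>I \<times> J\<close> block of a matrix with the matrix
  that is zero outside that block.
\<close>

definition l2_on :: "'n set \<Rightarrow> ('s::finite, 'n::finite) l2 set" where
  "l2_on J = {f. AE x in lborel. \<forall>i. i \<notin> J \<longrightarrow> rep_l2 f x $ i = 0}"

definition mat_block :: "'m set \<Rightarrow> 'n set \<Rightarrow> complex^'n^'m \<Rightarrow> complex^'n^'m" where
  "mat_block I J M = (\<chi> i j. if i \<in> I \<and> j \<in> J then M $ i $ j else 0)"

definition block_op :: "'m set \<Rightarrow> 'n set \<Rightarrow> (real^'s \<Rightarrow> complex^'n^'m)
    \<Rightarrow> ('s::finite, 'n::finite, 'm::finite) l2_op" where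
  "block_op I J M = symbol_op (\<lambda>\<omega>. mat_block I J (M \<omega>)) \<inter> (l2_on J \<times> l2_on I)"

end

theory Submission
  imports Defs "HOL-Probability.Characteristic_Functions"
begin

text \<open>
  Since \<open>Q = S Q\<^sup>-\<^sup>1 S\<close>, the matrix \<open>Q\<^sup>-\<^sup>1 S\<close> is an involution that is self-adjoint for the inner
  product given by \<open>Q\<close>. A \<open>Q\<close>-orthonormal basis of eigenvectors yields, pointwise in \<open>\<omega>\<close>, a matrix
  \<open>R\<close> with \<open>R\<^sup>* Q R = 1\<close> and \<open>R\<^sup>* S R = E\<close>, where \<open>E\<close> is diagonal with entries \<open>1\<close> and \<open>-1\<close>. The
  trace of \<open>Q\<^sup>-\<^sup>1 S\<close> is continuous and integer valued, so \<open>E\<close> can be taken constant; as only a Borel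
  measurable \<open>R\<close> is needed, no trivialization of the eigenbundles enters.

  The transformed symbols \<open>A' = R\<^sup>-\<^sup>1 A R\<close> and \<open>B' = R\<^sup>-\<^sup>1 B\<close> satisfy \<open>A' + A'\<^sup>* \<le> 0\<close>,
  \<open>A'\<^sup>* E = E A'\<close> and \<open>E B' = B'\<close>, the transformed \<open>C\<close> is \<open>B'\<^sup>*\<close>, and \<open>B'\<^sup>* B' = B\<^sup>* Q B = C S\<^sup>-\<^sup>1 Q B\<close>
  is bounded by hypothesis; comparing blocks gives the partition. Multiplication by \<open>exp (A' t)\<close>
  is a contraction semigroup whose generator is the maximal multiplication operator, by dominated
  convergence in one direction and Fatou's lemma in the other.

  As the Fourier transform is a definite description, all of this rests on Plancherel's theorem
  on \<open>\<real>\<^sup>s\<close>, which is obtained by Gaussian regularization.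
\<close>

section \<open>Plancherel's theorem\<close>

text \<open>Neither \<open>R\<close> nor its inverse need be bounded over all frequencies, so the
  pointwise similarity need not define a bounded operator with bounded inverse on L2. What it does
  preserve is the impulse response, whose symbol is a pointwise expression in the three matrices.
  Boundedness therefore has to be regained: for the input and output operators it comes from the
  supremum hypothesis, and well-posedness comes from the dissipation inequality for
  \<open>Q\<close>. The two equations for \<open>C\<close> give \<open>S B = Q B\<close>, so the
  input acts only through the eigenspace of \<open>Q^-1 S\<close> for the eigenvalue 1; this is why
  the second block of the new input operator vanishes. Self-adjointness, self-duality and the
  formula for the off-diagonal block all include equality of domains. Operators with unbounded
  symbols are therefore taken with maximal domain, and their adjoints and generators have to be
  determined exactly, for which truncated functions on the Fourier side serve as test
  vectors.\<close>

lemma le_one_plus_square: "a \<le> 1 + (a :: real)\<^sup>2"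
proof -
  have "2 * a \<le> a\<^sup>2 + 1" using sum_squares_bound[of a 1] by simp
  then show ?thesis using zero_le_power2[of a] by arith
qed

section \<open>Changes of variables and Gaussian integrals\<close>

lemma lborel_integral_affine:
  fixes f :: "'a::euclidean_space \<Rightarrow> 'b::{banach, second_countable_topology}" and c :: real
  assumes c: "c \<noteq> 0" and f[measurable]: "f \<in> borel_measurable borel"
  shows "(LINT x|lborel. f x) = \<bar>c\<bar> ^ DIM('a) *\<^sub>R (LINT x|lborel. f (t + c *\<^sub>R x))"
  by (subst lborel_affine[OF c, of t])
     (simp add: integral_density integral_distr)

lemma lborel_integrable_affine:
  fixes f :: "'a::euclidean_space \<Rightarrow> 'b::{banach, second_countable_topology}" and c :: real
  assumes c: "c \<noteq> 0" and f: "integrable lborel f"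
  shows "integrable lborel (\<lambda>x. f (t + c *\<^sub>R x))"
proof -
  have [measurable]: "f \<in> borel_measurable borel" using f by auto
  have "integrable (density (distr lborel borel (\<lambda>x. t + c *\<^sub>R x)) (\<lambda>_. \<bar>c\<bar>^DIM('a))) f"
    using f lborel_affine[OF c, of t] by simp
  then have "integrable (distr lborel borel (\<lambda>x. t + c *\<^sub>R x)) (\<lambda>x. \<bar>c\<bar>^DIM('a) *\<^sub>R f x)"
    by (subst (asm) integrable_density) auto
  then have "integrable lborel (\<lambda>x. \<bar>c\<bar>^DIM('a) *\<^sub>R f (t + c *\<^sub>R x))"
    by (subst (asm) integrable_distr_eq) auto
  then have "integrable lborel (\<lambda>x. inverse (\<bar>c\<bar>^DIM('a)) *\<^sub>R \<bar>c\<bar>^DIM('a) *\<^sub>R f (t + c *\<^sub>R x))"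
    by (rule integrable_scaleR_right)
  then show ?thesis using c by simp
qed

lemma lborel_integrable_translate:
  fixes f :: "'a::euclidean_space \<Rightarrow> 'b::{banach, second_countable_topology}"
  assumes "integrable lborel f" shows "integrable lborel (\<lambda>x. f (x + t))"
  using lborel_integrable_affine[of 1 f t] assms by (simp add: add.commute)

lemma lborel_integral_translate:
  fixes f :: "'a::euclidean_space \<Rightarrow> 'b::{banach, second_countable_topology}"
  assumes "f \<in> borel_measurable borel"
  shows "(LINT x|lborel. f (x + t)) = (LINT x|lborel. f x)"
  using lborel_integral_affine[of 1 f t] assms by (simp add: add.commute)

text \<open>By \<open>lborel_eq\<close> Lebesgue measure is the image of a product measure over
  \<open>Basis\<close>. This is the form of Fubini that reduces Gaussians to dimension one.\<close>

lemma lborel_prod_coordinates: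
  fixes g :: "'a::euclidean_space \<Rightarrow> real \<Rightarrow> 'b::{real_normed_field,banach,second_countable_topology}"
  assumes g: "\<And>b. b \<in> Basis \<Longrightarrow> integrable lborel (g b)"
  shows "integrable lborel (\<lambda>x::'a. \<Prod>b\<in>Basis. g b (x \<bullet> b))"
    and "(LINT x|lborel. (\<Prod>b\<in>Basis. g b (x \<bullet> b))) = (\<Prod>b\<in>Basis. LINT t|lborel. g b t)"
proof -
  interpret product_sigma_finite "\<lambda>_::'a. lborel :: real measure" by standard
  have [measurable]: "g b \<in> borel_measurable borel" if "b \<in> Basis" for b using g[OF that] by auto
  have eq: "(\<Prod>b\<in>Basis. g b ((\<Sum>b\<in>Basis. f b *\<^sub>R b) \<bullet> b)) = (\<Prod>b\<in>Basis. g b (f b))" for f :: "'a \<Rightarrow> real"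
    by (intro prod.cong) (auto simp: inner_sum_left_Basis)
  show "integrable lborel (\<lambda>x::'a. \<Prod>b\<in>Basis. g b (x \<bullet> b))"
    by (subst lborel_eq, subst integrable_distr_eq)
       (auto simp: eq intro!: product_integrable_prod g)
  show "(LINT x|lborel. (\<Prod>b\<in>Basis. g b (x \<bullet> b))) = (\<Prod>b\<in>Basis. LINT t|lborel. g b t)"
    by (subst lborel_eq, subst integral_distr)
       (auto simp: eq intro!: product_integral_prod g)
qed

text \<open>This is the characteristic function of the standard normal law, with the factor
  \<open>1 / sqrt (2 * pi)\<close> of the density cleared.\<close>

lemma gaussian_transform_real:
  "integrable lborel (\<lambda>t. exp (\<i> * of_real (t * x)) * of_real (exp (- t\<^sup>2 / 2)))"
  "(LINT t|lborel. exp (\<i> * of_real (t * x)) * of_real (exp (- t\<^sup>2 / 2)))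
    = of_real (sqrt (2 * pi) * exp (- x\<^sup>2 / 2))"
proof -
  have int: "integrable lborel (\<lambda>t::real. exp (- t\<^sup>2 / 2))"
  proof -
    have "integrable lborel (\<lambda>t. sqrt (2 * pi) * std_normal_density t)"
      by (intro integrable_mult_right integrable_normal_density) auto
    then show ?thesis by (simp add: std_normal_density_def)
  qed
  have eq: "exp (\<i> * of_real (t * x)) * of_real (exp (- t\<^sup>2 / 2))
      = of_real (sqrt (2 * pi)) * (std_normal_density t *\<^sub>R iexp (x * t))" for t
    by (simp add: std_normal_density_def scaleR_conv_of_real mult.commute)
  show "integrable lborel (\<lambda>t. exp (\<i> * of_real (t * x)) * of_real (exp (- t\<^sup>2 / 2)))"
    by (rule Bochner_Integration.integrable_bound[OF int]) (auto simp: norm_mult)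
  have "(LINT t|lborel. exp (\<i> * of_real (t * x)) * of_real (exp (- t\<^sup>2 / 2)))
     = of_real (sqrt (2 * pi)) * (LINT t|lborel. std_normal_density t *\<^sub>R iexp (x * t))"
    unfolding eq by (rule integral_mult_right_zero)
  also have "(LINT t|lborel. std_normal_density t *\<^sub>R iexp (x * t)) = char std_normal_distribution x"
    unfolding char_def by (subst integral_density) auto
  finally show "(LINT t|lborel. exp (\<i> * of_real (t * x)) * of_real (exp (- t\<^sup>2 / 2)))
    = of_real (sqrt (2 * pi) * exp (- x\<^sup>2 / 2))"
    by (simp add: char_std_normal_distribution)
qed

text \<open>Phase and Gaussian both factor over the coordinates. The value at \<open>z = 0\<close>
  also supplies the total mass of the Gaussian.\<close>

lemma gaussian_transform:
  fixes z :: "'a::euclidean_space"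
  shows "integrable lborel (\<lambda>w::'a. exp (\<i> * of_real (w \<bullet> z)) * of_real (exp (- (norm w)\<^sup>2 / 2)))"
    and "(LINT w|lborel. exp (\<i> * of_real (w \<bullet> z)) * of_real (exp (- (norm w)\<^sup>2 / 2)))
      = of_real (sqrt (2 * pi) ^ DIM('a) * exp (- (norm z)\<^sup>2 / 2))"
proof -
  have n: "(norm w)\<^sup>2 = (\<Sum>b\<in>Basis. (w \<bullet> b)\<^sup>2)" for w :: 'a
    unfolding power2_norm_eq_inner by (subst euclidean_inner) (simp add: power2_eq_square)
  have e: "exp (- (norm w)\<^sup>2 / 2) = (\<Prod>b\<in>Basis. exp (- (w \<bullet> b)\<^sup>2 / 2))" for w :: 'a
    by (simp add: n sum_negf[symmetric] sum_divide_distrib exp_sum[symmetric])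
  have i: "exp (\<i> * of_real (w \<bullet> z)) = (\<Prod>b\<in>Basis. exp (\<i> * of_real ((w \<bullet> b) * (z \<bullet> b))))" for w :: 'a
    by (subst euclidean_inner) (simp add: sum_distrib_left exp_sum[symmetric])
  have eq: "exp (\<i> * of_real (w \<bullet> z)) * of_real (exp (- (norm w)\<^sup>2 / 2))
     = (\<Prod>b\<in>Basis. exp (\<i> * of_real ((w \<bullet> b) * (z \<bullet> b))) * of_real (exp (- (w \<bullet> b)\<^sup>2 / 2)))" for w
    by (simp only: e i prod.distrib of_real_prod)
  show "integrable lborel (\<lambda>w::'a. exp (\<i> * of_real (w \<bullet> z)) * of_real (exp (- (norm w)\<^sup>2 / 2)))"
    unfolding eq by (rule lborel_prod_coordinates(1)) (rule gaussian_transform_real)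
  have "(LINT w|lborel. exp (\<i> * of_real (w \<bullet> z)) * of_real (exp (- (norm w)\<^sup>2 / 2)))
    = (\<Prod>b\<in>Basis. of_real (sqrt (2 * pi) * exp (- (z \<bullet> b)\<^sup>2 / 2)))"
    unfolding eq by (subst lborel_prod_coordinates(2)) (simp_all only: gaussian_transform_real)
  also have "\<dots> = of_real (sqrt (2 * pi) ^ DIM('a) * exp (- (norm z)\<^sup>2 / 2))"
    by (simp only: e prod.distrib of_real_prod of_real_mult prod_constant of_real_power)
  finally show "(LINT w|lborel. exp (\<i> * of_real (w \<bullet> z)) * of_real (exp (- (norm w)\<^sup>2 / 2)))
      = of_real (sqrt (2 * pi) ^ DIM('a) * exp (- (norm z)\<^sup>2 / 2))" .
qed

lemma integrable_gaussian: "integrable lborel (\<lambda>w::'a::euclidean_space. exp (- (norm w)\<^sup>2 / 2))"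
  using integrable_norm[OF gaussian_transform(1)[of 0]] by (simp add: norm_mult)

section \<open>Continuity of translation in L1\<close>

lemma translation_continuous_indicator:
  fixes A :: "'a::euclidean_space set"
  assumes A: "A \<in> sets borel" "emeasure lborel A < \<infinity>" and z: "z \<longlonglongrightarrow> 0"
  shows "(\<lambda>n. LINT x|lborel. \<bar>indicator A (x + z n) - indicator A x\<bar>) \<longlonglongrightarrow> (0::real)"
proof (rule LIMSEQ_I)
  fix e :: real assume e: "e > 0"
  \<comment> \<open>Outer regularity replaces \<open>A\<close> by an open set, whose overlap with a
    small translate can be handled pointwise. The budget is four times \<open>e / 4\<close>: the
    error \<open>U - A\<close> enters twice, once translated, and the deficit of the overlap enters
    twice.\<close>
  obtain U where U: "open U" "A \<subseteq> U" "emeasure lborel (U - A) < ennreal (e / 4)"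
    using outer_regular_lborel[OF A(1), of "e / 4"] e by auto
  have [measurable]: "A \<in> sets borel" "U \<in> sets borel" using A U by auto
  have "emeasure lborel U \<le> emeasure lborel A + emeasure lborel (U - A)"
    using emeasure_subadditive[of A lborel "U - A"] U by (auto simp: Un_absorb1)
  also have "\<dots> < \<infinity>" using A(2) U(3) by (auto simp: less_top[symmetric])
  finally have U_fin: "emeasure lborel U < \<infinity>" .
  have iU: "integrable lborel (indicator U :: 'a \<Rightarrow> real)"
    and iA: "integrable lborel (indicator A :: 'a \<Rightarrow> real)"
    using U_fin A by auto
  note iU' = lborel_integrable_translate[OF iU] and iA' = lborel_integrable_translate[OF iA]
  have UA: "(LINT x|lborel. indicator U x - indicator A x) < e / 4"
  proof -
    have "(LINT x|lborel. indicator U x - indicator A x) = (LINT x|lborel. indicator (U - A) x :: real)"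
      using U(2) by (intro Bochner_Integration.integral_cong) (auto simp: indicator_def)
    also have "\<dots> = measure lborel (U - A)" by simp
    also have "\<dots> < e / 4" using U(3) e unfolding measure_def
      by (subst enn2real_less_iff) (auto intro: less_trans[OF _ ennreal_less_top])
    finally show ?thesis .
  qed
  \<comment> \<open>The minimum is the indicator of the intersection of \<open>U\<close> with its
    translate. At a point of \<open>U\<close> openness makes it eventually 1.\<close>
  have min_lim: "(\<lambda>n. LINT x|lborel. min (indicator U (x + z n)) (indicator U x)) \<longlonglongrightarrow> (LINT x|lborel. indicator U x :: real)"
  proof (rule integral_dominated_convergence[where w = "indicator U"])
    show "AE x in lborel. (\<lambda>n. min (indicator U (x + z n)) (indicator U x)) \<longlonglongrightarrow> (indicator U x :: real)"
    proof (intro AE_I2)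
      fix x :: 'a
      show "(\<lambda>n. min (indicator U (x + z n)) (indicator U x)) \<longlonglongrightarrow> (indicator U x :: real)"
      proof (cases "x \<in> U")
        case True
        have "(\<lambda>n. x + z n) \<longlonglongrightarrow> x + 0" by (intro tendsto_intros z)
        then have "eventually (\<lambda>n. x + z n \<in> U) sequentially"
          using U(1) True by (auto simp: tendsto_def)
        then have "eventually (\<lambda>n. min (indicator U (x + z n)) (indicator U x) = (indicator U x :: real)) sequentially"
          by eventually_elim (simp add: True)
        then show ?thesis by (rule tendsto_eventually)
      next
        case False
        then have "(\<lambda>n. min (indicator U (x + z n)) (indicator U x)) = (\<lambda>n. (indicator U x :: real))"
          by (auto simp: indicator_def)
        then show ?thesis by simp
      qed
    qed
  qed (use iU in \<open>auto simp: indicator_def\<close>)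
  have "eventually (\<lambda>n. dist (LINT x|lborel. min (indicator U (x + z n)) (indicator U x)) (LINT x|lborel. indicator U x :: real) < e / 4) sequentially"
    using min_lim e by (intro tendstoD) auto
  then have "eventually (\<lambda>n. (LINT x|lborel. \<bar>indicator A (x + z n) - indicator A x\<bar>) < (e::real)) sequentially"
  proof eventually_elim
    case (elim n)
    have iM: "integrable lborel (\<lambda>x. min (indicator U (x + z n)) (indicator U x) :: real)"
      by (intro integrable_min iU iU')
    \<comment> \<open>The last summand of the majorant, a sum of two indicators minus twice their
      minimum, is the indicator of the symmetric difference of \<open>U\<close> and its
      translate.\<close>
    have "(LINT x|lborel. \<bar>indicator A (x + z n) - indicator A x\<bar>)
      \<le> (LINT x|lborel. ((indicator U (x + z n) - indicator A (x + z n)) + (indicator U x - indicator A x))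
          + ((indicator U (x + z n) + indicator U x) - 2 * min (indicator U (x + z n)) (indicator U x)) :: real)"
      using U(2) by (intro integral_mono integrable_abs Bochner_Integration.integrable_diff Bochner_Integration.integrable_add
        integrable_mult_right iA iU iA' iU' iM) (auto simp: indicator_def)
    also have "\<dots> = ((LINT x|lborel. indicator U (x + z n) - indicator A (x + z n)) + (LINT x|lborel. indicator U x - indicator A x))
          + (((LINT x|lborel. indicator U (x + z n)) + (LINT x|lborel. indicator U x)) - 2 * (LINT x|lborel. min (indicator U (x + z n)) (indicator U x)))"
      by (simp add: iA iU iA' iU' iM)
    also have "(LINT x|lborel. indicator U (x + z n) - indicator A (x + z n)) = (LINT x|lborel. indicator U x - indicator A x :: real)"
      by (rule lborel_integral_translate[of "\<lambda>x. indicator U x - indicator A x"]) measurable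
    also have "(LINT x|lborel. indicator U (x + z n)) = (LINT x|lborel. indicator U x :: real)"
      by (rule lborel_integral_translate) measurable
    finally have *: "(LINT x|lborel. \<bar>indicator A (x + z n) - indicator A x\<bar> :: real)
      \<le> (LINT x|lborel. indicator U x - indicator A x) + (LINT x|lborel. indicator U x - indicator A x)
        + ((LINT x|lborel. indicator U x) + (LINT x|lborel. indicator U x)
          - 2 * (LINT x|lborel. min (indicator U (x + z n)) (indicator U x)))" .
    have "\<bar>(LINT x|lborel. min (indicator U (x + z n)) (indicator U x)) - (LINT x|lborel. indicator U x :: real)\<bar> < e / 4"
      using elim unfolding dist_real_def .
    with * UA show ?case by arith
  qed
  then obtain N where N: "\<And>n. n \<ge> N \<Longrightarrow> (LINT x|lborel. \<bar>indicator A (x + z n) - indicator A x\<bar>) < e"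
    unfolding eventually_sequentially by blast
  have "0 \<le> (LINT x|lborel. \<bar>indicator A (x + z n) - indicator A x\<bar> :: real)" for n by simp
  with N show "\<exists>N. \<forall>n\<ge>N. norm ((LINT x|lborel. \<bar>indicator A (x + z n) - indicator A x\<bar>) - (0::real)) < e"
    by (intro exI[of _ N]) auto
qed

text \<open>Approximation by simple functions. In the limit case, an \<open>e / 3\<close> argument,
  translation invariance of the measure makes the translated approximation error equal to the
  untranslated one.\<close>

lemma translation_continuous_integrable:
  fixes f :: "'a::euclidean_space \<Rightarrow> 'b::{banach, second_countable_topology}"
  assumes f: "integrable lborel f" and z: "z \<longlonglongrightarrow> 0"
  shows "(\<lambda>n. LINT x|lborel. norm (f (x + z n) - f x)) \<longlonglongrightarrow> 0"
  using f
proof (induction rule: integrable_induct)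
  case (base A c)
  have "norm (indicator A (x + y) *\<^sub>R c - indicator A x *\<^sub>R c) = \<bar>indicator A (x + y) - indicator A x\<bar> * norm c" for x y :: 'a
    by (metis norm_scaleR real_norm_def scaleR_diff_left)
  then show ?case
    using tendsto_mult_left_zero[OF translation_continuous_indicator[OF _ _ z, of A], of "norm c"] base by simp
next
  case (add f g)
  have fg: "integrable lborel f" "integrable lborel g" by fact+
  note I = Bochner_Integration.integrable_diff[OF lborel_integrable_translate[OF fg(1)] fg(1)]
    Bochner_Integration.integrable_diff[OF lborel_integrable_translate[OF fg(2)] fg(2)]
  show ?case
  proof (rule tendsto_sandwich[OF _ _ tendsto_const])
    show "(\<lambda>n. (LINT x|lborel. norm (f (x + z n) - f x)) + (LINT x|lborel. norm (g (x + z n) - g x))) \<longlonglongrightarrow> 0"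
      using tendsto_add[OF add.IH] by simp
    show "\<forall>\<^sub>F n in sequentially. (LINT x|lborel. norm (f (x + z n) + g (x + z n) - (f x + g x)))
       \<le> (LINT x|lborel. norm (f (x + z n) - f x)) + (LINT x|lborel. norm (g (x + z n) - g x))"
    proof (intro always_eventually allI)
      fix n
      have "(LINT x|lborel. norm (f (x + z n) + g (x + z n) - (f x + g x)))
         \<le> (LINT x|lborel. norm (f (x + z n) - f x) + norm (g (x + z n) - g x))"
      proof (rule integral_mono)
        show "integrable lborel (\<lambda>x. norm (f (x + z n) + g (x + z n) - (f x + g x)))"
          using Bochner_Integration.integrable_add[OF I(1)[of "z n"] I(2)[of "z n"]]
          by (intro integrable_norm) (simp add: algebra_simps)
        show "norm (f (x + z n) + g (x + z n) - (f x + g x)) \<le> norm (f (x + z n) - f x) + norm (g (x + z n) - g x)" for x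
          by (metis add_diff_add norm_triangle_ineq)
      qed (intro Bochner_Integration.integrable_add integrable_norm I)
      then show "(LINT x|lborel. norm (f (x + z n) + g (x + z n) - (f x + g x)))
       \<le> (LINT x|lborel. norm (f (x + z n) - f x)) + (LINT x|lborel. norm (g (x + z n) - g x))"
        by (simp add: I)
    qed
  qed simp
next
  case (lim f s)
  have [measurable]: "f \<in> borel_measurable borel" "s i \<in> borel_measurable borel" for i
    using lim by (auto dest: borel_measurable_integrable)
  \<comment> \<open>The approximants of \<open>integrable_induct\<close> obey
    \<open>norm (s i x) \<le> 2 * norm (f x)\<close>, whence the factor 3.\<close>
  have L1: "(\<lambda>i. LINT x|lborel. norm (s i x - f x)) \<longlonglongrightarrow> (LINT x::'a|lborel. 0::real)"
  proof (rule integral_dominated_convergence[where w = "\<lambda>x. 3 * norm (f x)"])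
    show "AE x in lborel. (\<lambda>i. norm (s i x - f x)) \<longlonglongrightarrow> 0"
    proof (intro AE_I2)
      fix x
      have "(\<lambda>i. norm (s i x - f x)) \<longlonglongrightarrow> norm (f x - f x)" by (intro tendsto_intros lim) auto
      then show "(\<lambda>i. norm (s i x - f x)) \<longlonglongrightarrow> 0" by simp
    qed
    show "AE x in lborel. norm (norm (s i x - f x)) \<le> 3 * norm (f x)" for i
    proof (intro AE_I2)
      fix x
      have "norm (s i x) \<le> 2 * norm (f x)" using lim by auto
      then show "norm (norm (s i x - f x)) \<le> 3 * norm (f x)"
        using norm_triangle_ineq4[of "s i x" "f x"] by simp
    qed
  qed (use lim in auto)
  show ?case
  proof (rule LIMSEQ_I)
    fix e :: real assume e: "e > 0"
    obtain i where i: "(LINT x|lborel. norm (s i x - f x)) < e / 3"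
      using LIMSEQ_D[OF L1, of "e / 3"] e by force
    obtain N where N: "\<And>n. n \<ge> N \<Longrightarrow> (LINT x|lborel. norm (s i (x + z n) - s i x)) < e / 3"
      using LIMSEQ_D[OF lim.IH[of i], of "e / 3"] e by force
    have I1: "integrable lborel (\<lambda>x. norm (s i x - f x))" using lim by auto
    have I2: "integrable lborel (\<lambda>x. norm (s i (x + z n) - f (x + z n)))" for n
      using lborel_integrable_translate[OF I1] .
    have I3: "integrable lborel (\<lambda>x. norm (s i (x + z n) - s i x))" for n
      by (intro integrable_norm Bochner_Integration.integrable_diff lborel_integrable_translate lim)
    have "(LINT x|lborel. norm (f (x + z n) - f x)) < e" if "n \<ge> N" for n
    proof -
      have "(LINT x|lborel. norm (f (x + z n) - f x))
        \<le> (LINT x|lborel. norm (s i (x + z n) - f (x + z n)) + norm (s i (x + z n) - s i x) + norm (s i x - f x))"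
      proof (rule integral_mono)
        show "integrable lborel (\<lambda>x. norm (f (x + z n) - f x))"
          by (intro integrable_norm Bochner_Integration.integrable_diff lborel_integrable_translate lim)
        show "norm (f (x + z n) - f x) \<le> norm (s i (x + z n) - f (x + z n)) + norm (s i (x + z n) - s i x) + norm (s i x - f x)" for x
        proof -
          have "f (x + z n) - f x = - (s i (x + z n) - f (x + z n)) + (s i (x + z n) - s i x) + (s i x - f x)" by simp
          then show ?thesis
            using norm_triangle_ineq[of "- (s i (x + z n) - f (x + z n)) + (s i (x + z n) - s i x)" "s i x - f x"]
              norm_triangle_ineq[of "- (s i (x + z n) - f (x + z n))" "s i (x + z n) - s i x"]
            by (simp only: norm_minus_cancel)
        qed
      qed (intro Bochner_Integration.integrable_add I1 I2 I3)
      also have "\<dots> = (LINT x|lborel. norm (s i (x + z n) - f (x + z n))) + (LINT x|lborel. norm (s i (x + z n) - s i x)) + (LINT x|lborel. norm (s i x - f x))"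
        by (simp add: I1 I2 I3)
      also have "(LINT x|lborel. norm (s i (x + z n) - f (x + z n))) = (LINT x|lborel. norm (s i x - f x))"
        by (rule lborel_integral_translate[of "\<lambda>x. norm (s i x - f x)"]) measurable
      finally show ?thesis using i N[OF that] by simp
    qed
    then show "\<exists>N. \<forall>n\<ge>N. norm ((LINT x|lborel. norm (f (x + z n) - f x)) - 0) < e"
      by (intro exI[of _ N]) (simp add: integral_nonneg_AE)
  qed
qed

section \<open>Plancherel's identity for scalar functions\<close>

lemma (in pair_sigma_finite) integrable_mult_prod:
  fixes f :: "'a \<Rightarrow> 'c::{real_normed_field, banach, second_countable_topology}"
  assumes f: "integrable M1 f" and g: "integrable M2 g"
  shows "integrable (M1 \<Otimes>\<^sub>M M2) (\<lambda>(x, y). f x * g y)"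
proof (rule Fubini_integrable)
  have [measurable]: "f \<in> borel_measurable M1" "g \<in> borel_measurable M2" using f g by auto
  show "(\<lambda>(x, y). f x * g y) \<in> borel_measurable (M1 \<Otimes>\<^sub>M M2)" by measurable
  show "integrable M1 (\<lambda>x. LINT y|M2. norm (case (x, y) of (x, y) \<Rightarrow> f x * g y))"
    using f by (simp add: norm_mult)
  show "AE x in M1. integrable M2 (\<lambda>y. case (x, y) of (x, y) \<Rightarrow> f x * g y)"
    using g by simp
qed

lemma borel_measurable_cnj[measurable (raw)]:
  "f \<in> borel_measurable M \<Longrightarrow> (\<lambda>x. cnj (f x)) \<in> borel_measurable M"
  by (rule borel_measurable_continuous_on[where f = cnj]) (auto intro: continuous_intros)

lemma integrable_mult_sq:
  fixes f g :: "'a \<Rightarrow> 'b::{real_normed_field, banach, second_countable_topology}"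
  assumes [measurable]: "f \<in> borel_measurable M" "g \<in> borel_measurable M"
    and "integrable M (\<lambda>x. (norm (f x))\<^sup>2)" "integrable M (\<lambda>x. (norm (g x))\<^sup>2)"
  shows "integrable M (\<lambda>x. f x * g x)"
proof (rule Bochner_Integration.integrable_bound)
  show "integrable M (\<lambda>x. ((norm (f x))\<^sup>2 + (norm (g x))\<^sup>2) / 2)" using assms by simp
  show "AE x in M. norm (f x * g x) \<le> norm (((norm (f x))\<^sup>2 + (norm (g x))\<^sup>2) / 2)"
  proof (intro AE_I2)
    fix x
    show "norm (f x * g x) \<le> norm (((norm (f x))\<^sup>2 + (norm (g x))\<^sup>2) / 2)"
      using sum_squares_bound[of "norm (f x)" "norm (g x)"] by (simp add: norm_mult)
  qed
qed measurable

text \<open>The first assumption makes the Fourier integral converge, the second makes the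
  autocorrelation finite. Scalar values suffice, since \<open>fourier_int_isometry\<close> works
  coordinatewise.\<close>

locale square_integrable =
  fixes f :: "'a::euclidean_space \<Rightarrow> complex"
  assumes f1: "integrable lborel f" and f2: "integrable lborel (\<lambda>x. (cmod (f x))\<^sup>2)"
begin

lemma f_meas[measurable]: "f \<in> borel_measurable borel"
  using f1 by auto

text \<open>Its Fourier transform is the squared modulus of that of \<open>f\<close>, and its value
  at 0 is the squared norm \<open>N\<close>. Plancherel's identity thus amounts to Fourier inversion
  at the single point 0.\<close>

definition autocorrelation where
  "autocorrelation z = (LINT y|lborel. f (y + z) * cnj (f y))"

abbreviation "N \<equiv> LINT y|lborel. (cmod (f y))\<^sup>2"

lemma autocorrelation_integrable: "integrable lborel (\<lambda>y. f (y + z) * cnj (f y))"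
  using lborel_integrable_translate[OF f2] f2 by (intro integrable_mult_sq) auto

text \<open>The arithmetic mean of the two squares replaces Cauchy--Schwarz at no loss, as both
  squares have the integral \<open>N\<close>. The bound is uniform in \<open>z\<close> and later
  serves as a dominating constant.\<close>

lemma autocorrelation_abs: "(LINT y|lborel. cmod (f (y + z)) * cmod (f y)) \<le> N"
proof -
  have "(LINT y|lborel. cmod (f (y + z)) * cmod (f y))
    \<le> (LINT y|lborel. ((cmod (f (y + z)))\<^sup>2 + (cmod (f y))\<^sup>2) / 2)"
  proof (rule integral_mono)
    show "integrable lborel (\<lambda>y. cmod (f (y + z)) * cmod (f y))"
      using integrable_norm[OF autocorrelation_integrable[of z]] by (simp add: norm_mult)
    show "integrable lborel (\<lambda>y. ((cmod (f (y + z)))\<^sup>2 + (cmod (f y))\<^sup>2) / 2)"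
      using lborel_integrable_translate[OF f2] f2 by simp
    show "cmod (f (y + z)) * cmod (f y) \<le> ((cmod (f (y + z)))\<^sup>2 + (cmod (f y))\<^sup>2) / 2" for y
      using sum_squares_bound[of "cmod (f (y + z))" "cmod (f y)"] by simp
  qed
  also have "\<dots> = ((LINT y|lborel. (cmod (f (y + z)))\<^sup>2) + N) / 2"
    using lborel_integrable_translate[OF f2] f2 by simp
  also have "(LINT y|lborel. (cmod (f (y + z)))\<^sup>2) = N"
    by (rule lborel_integral_translate) measurable
  finally show ?thesis by simp
qed

lemma autocorrelation_bound: "cmod (autocorrelation z) \<le> N"
proof -
  have "cmod (autocorrelation z) \<le> (LINT y|lborel. cmod (f (y + z) * cnj (f y)))"
    unfolding autocorrelation_def by (rule integral_norm_bound)
  also have "\<dots> \<le> N" using autocorrelation_abs[of z] by (simp add: norm_mult)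
  finally show ?thesis .
qed

lemma autocorrelation_0: "autocorrelation 0 = of_real N"
  unfolding autocorrelation_def
  by (simp add: complex_norm_square[symmetric] flip: integral_complex_of_real)

lemma integrable_diff_sq: "integrable lborel (\<lambda>y. (cmod (f (y + z) - f y))\<^sup>2)"
  and integral_diff_sq: "(LINT y|lborel. (cmod (f (y + z) - f y))\<^sup>2) \<le> 4 * N"
proof -
  have le: "(cmod (f (y + z) - f y))\<^sup>2 \<le> 2 * (cmod (f (y + z)))\<^sup>2 + 2 * (cmod (f y))\<^sup>2" for y
    using norm_add_sq_le[of "f (y + z)" "- f y"] by simp
  have int: "integrable lborel (\<lambda>y. 2 * (cmod (f (y + z)))\<^sup>2 + 2 * (cmod (f y))\<^sup>2)"
    using lborel_integrable_translate[OF f2] f2 by simp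
  show *: "integrable lborel (\<lambda>y. (cmod (f (y + z) - f y))\<^sup>2)"
    by (rule Bochner_Integration.integrable_bound[OF int]) (use le in \<open>auto simp: abs_of_nonneg\<close>)
  have "(LINT y|lborel. (cmod (f (y + z) - f y))\<^sup>2) \<le> (LINT y|lborel. 2 * (cmod (f (y + z)))\<^sup>2 + 2 * (cmod (f y))\<^sup>2)"
    by (intro integral_mono * int le)
  also have "\<dots> = 2 * (LINT y|lborel. (cmod (f (y + z)))\<^sup>2) + 2 * N"
    using lborel_integrable_translate[OF f2] f2 by simp
  also have "(LINT y|lborel. (cmod (f (y + z)))\<^sup>2) = N"
    by (rule lborel_integral_translate) measurable
  finally show "(LINT y|lborel. (cmod (f (y + z) - f y))\<^sup>2) \<le> 4 * N" by simp
qed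

text \<open>Splitting one factor into its part bounded by \<open>k\<close> and a remainder small in \<open>L\<^sub>2\<close> reduces
  continuity of the autocorrelation to continuity of translation in \<open>L\<^sub>1\<close>.\<close>

lemma autocorrelation_continuous:
  assumes z: "z \<longlonglongrightarrow> 0"
  shows "(\<lambda>n. autocorrelation (z n)) \<longlonglongrightarrow> of_real N"
proof -
  define g where "g k y = (if cmod (f y) \<le> real k then f y else 0)" for k y
  have [measurable]: "g k \<in> borel_measurable borel" for k unfolding g_def by measurable
  have lim: "(\<lambda>k. LINT y|lborel. (cmod (f y - g k y))\<^sup>2) \<longlonglongrightarrow> (LINT y::'a|lborel. 0::real)"
  proof (rule integral_dominated_convergence[where w = "\<lambda>y. (cmod (f y))\<^sup>2"])
    show "AE y in lborel. (\<lambda>k. (cmod (f y - g k y))\<^sup>2) \<longlonglongrightarrow> 0"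
    proof (intro AE_I2 tendsto_eventually)
      fix y
      show "\<forall>\<^sub>F k in sequentially. (cmod (f y - g k y))\<^sup>2 = 0"
        using real_arch_simple[of "cmod (f y)"]
        by (auto simp: g_def eventually_sequentially) (meson le_trans of_nat_mono order.trans)
    qed
  qed (use f2 in \<open>auto simp: g_def\<close>)
  \<comment> \<open>The three terms are made small in turn: the last by a small \<open>c\<close>,
    the middle one by a large \<open>k\<close> depending on \<open>c\<close>, the first by
    continuity of translation for that \<open>k\<close>.\<close>
  have bound: "cmod (autocorrelation x - of_real N)
    \<le> real k * (LINT y|lborel. cmod (f (y + x) - f y))
      + 1 / c * (LINT y|lborel. (cmod (f y - g k y))\<^sup>2) + c * (4 * N)" if c: "c > 0" for c x k
  proof -
    have i1: "integrable lborel (\<lambda>y. cmod (f (y + x) - f y))"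
      by (intro integrable_norm Bochner_Integration.integrable_diff lborel_integrable_translate f1)
    have i2: "integrable lborel (\<lambda>y. (cmod (f y - g k y))\<^sup>2)"
      by (rule Bochner_Integration.integrable_bound[OF f2]) (auto simp: g_def)
    have "autocorrelation x - of_real N = (LINT y|lborel. (f (y + x) - f y) * cnj (f y))"
      using autocorrelation_integrable[of x] autocorrelation_integrable[of 0]
      by (simp add: autocorrelation_0[symmetric] autocorrelation_def left_diff_distrib)
    also have "cmod \<dots> \<le> (LINT y|lborel. cmod ((f (y + x) - f y) * cnj (f y)))"
      by (rule integral_norm_bound)
    also have "\<dots> \<le> (LINT y|lborel. real k * cmod (f (y + x) - f y)
       + 1 / c * (cmod (f y - g k y))\<^sup>2 + c * (cmod (f (y + x) - f y))\<^sup>2)"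
    proof (rule integral_mono)
      show "integrable lborel (\<lambda>y. cmod ((f (y + x) - f y) * cnj (f y)))"
        using autocorrelation_integrable[of x] autocorrelation_integrable[of 0]
        by (intro integrable_norm) (simp add: left_diff_distrib)
      show "integrable lborel (\<lambda>y. real k * cmod (f (y + x) - f y)
       + 1 / c * (cmod (f y - g k y))\<^sup>2 + c * (cmod (f (y + x) - f y))\<^sup>2)"
        by (intro Bochner_Integration.integrable_add integrable_mult_right i1 i2 integrable_diff_sq)
      fix y
      have "cmod ((f (y + x) - f y) * cnj (f y)) \<le> cmod (f (y + x) - f y) * (cmod (g k y) + cmod (f y - g k y))"
        unfolding norm_mult by (intro mult_left_mono) (auto simp: g_def)
      also have "\<dots> \<le> real k * cmod (f (y + x) - f y) + cmod (f (y + x) - f y) * cmod (f y - g k y)"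
        by (simp add: distrib_left mult.commute[of "real k"] mult_left_mono g_def)
      also have "cmod (f (y + x) - f y) * cmod (f y - g k y)
          \<le> 1 / c * (cmod (f y - g k y))\<^sup>2 + c * (cmod (f (y + x) - f y))\<^sup>2"
      proof -
        \<comment> \<open>Young's inequality with weight \<open>c\<close>, read off from the square
          of \<open>c * a - b\<close>.\<close>
        define a b where "a = cmod (f (y + x) - f y)" and "b = cmod (f y - g k y)"
        have ab: "0 \<le> a" "0 \<le> b" by (auto simp: a_def b_def)
        have "0 \<le> (c * a - b)\<^sup>2" by simp
        then have "2 * (c * a * b) \<le> c\<^sup>2 * a\<^sup>2 + b\<^sup>2" by (simp add: power2_diff power_mult_distrib algebra_simps)
        moreover have "0 \<le> c * a * b" using ab c by simp
        ultimately have "c * (a * b) \<le> c * (1 / c * b\<^sup>2 + c * a\<^sup>2)"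
          using c by (simp add: algebra_simps power2_eq_square)
        then show ?thesis using c unfolding a_def b_def by simp
      qed
      finally show "cmod ((f (y + x) - f y) * cnj (f y)) \<le> real k * cmod (f (y + x) - f y)
       + 1 / c * (cmod (f y - g k y))\<^sup>2 + c * (cmod (f (y + x) - f y))\<^sup>2" by simp
    qed
    also have "\<dots> = real k * (LINT y|lborel. cmod (f (y + x) - f y))
      + 1 / c * (LINT y|lborel. (cmod (f y - g k y))\<^sup>2) + c * (LINT y|lborel. (cmod (f (y + x) - f y))\<^sup>2)"
      by (simp add: i1 i2 integrable_diff_sq)
    also have "\<dots> \<le> real k * (LINT y|lborel. cmod (f (y + x) - f y))
      + 1 / c * (LINT y|lborel. (cmod (f y - g k y))\<^sup>2) + c * (4 * N)"
      by (intro add_left_mono mult_left_mono integral_diff_sq) (use c in auto)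
    finally show ?thesis .
  qed
  have N0: "0 \<le> N" by simp
  show ?thesis
  proof (rule LIMSEQ_I)
    fix e :: real assume e: "e > 0"
    \<comment> \<open>The \<open>+ 1\<close> keeps the denominator positive when
      \<open>N = 0\<close>.\<close>
    define c where "c = e / (3 * (4 * N + 1))"
    have c: "c > 0" using e N0 by (simp add: c_def add_nonneg_pos)
    have cN: "c * (4 * N) \<le> e / 3"
    proof -
      have "c * (4 * N) = e / 3 * (4 * N / (4 * N + 1))" by (simp add: c_def)
      also have "\<dots> \<le> e / 3 * 1" using e N0 by (intro mult_left_mono) (auto simp: divide_le_eq_1 intro: add_nonneg_pos)
      finally show ?thesis by simp
    qed
    obtain k where k: "(LINT y|lborel. (cmod (f y - g k y))\<^sup>2) < c * e / 3"
      using LIMSEQ_D[OF lim, of "c * e / 3"] c e by force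
    have "(\<lambda>n. real k * (LINT y|lborel. cmod (f (y + z n) - f y))) \<longlonglongrightarrow> real k * 0"
      by (intro tendsto_mult_left translation_continuous_integrable f1 z)
    from LIMSEQ_D[OF this, of "e / 3"] e obtain n0 where
      n0: "\<And>n. n \<ge> n0 \<Longrightarrow> real k * (LINT y|lborel. cmod (f (y + z n) - f y)) < e / 3"
      by (force simp: abs_mult)
    have "1 / c * (LINT y|lborel. (cmod (f y - g k y))\<^sup>2) < 1 / c * (c * e / 3)"
      using k c by (intro mult_strict_left_mono) auto
    then have ce: "1 / c * (LINT y|lborel. (cmod (f y - g k y))\<^sup>2) < e / 3" using c by simp
    show "\<exists>no. \<forall>n\<ge>no. cmod (autocorrelation (z n) - of_real N) < e"
    proof (intro exI[of _ n0] allI impI)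
      fix n assume "n \<ge> n0"
      from bound[OF c, of "z n" k] n0[OF this] cN ce
      show "cmod (autocorrelation (z n) - of_real N) < e" by linarith
    qed
  qed
qed

text \<open>Unnormalized; only \<open>\<sigma> = 1\<close> and \<open>\<sigma> = -1\<close> matter.
  Carrying the sign as a parameter treats the transform and its inverse at once.\<close>

definition transform :: "real \<Rightarrow> 'a \<Rightarrow> complex" where
  "transform \<sigma> w = (LINT x|lborel. exp (\<i> * of_real (\<sigma> * (w \<bullet> x))) * f x)"

lemma transform_meas[measurable]: "transform \<sigma> \<in> borel_measurable borel"
  unfolding transform_def by measurable

text \<open>Integrability of the squared transform is not known yet. The Gaussian factor makes the
  triple integral over the frequency and two positions \<open>x\<close>, \<open>y\<close> absolutely
  convergent, so Fubini applies. Integrating over the frequency first leaves a Gaussian in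
  \<open>(x - y) / \<delta>\<close>, and the substitution \<open>x = y + \<delta> v\<close> turns
  the rest into an average of the autocorrelation.\<close>

lemma gaussian_regularization:
  assumes \<delta>: "\<delta> > 0" and \<sigma>: "\<bar>\<sigma>\<bar> = 1"
  shows "integrable lborel (\<lambda>w. (cmod (transform \<sigma> w))\<^sup>2 * exp (- (norm (\<delta> *\<^sub>R w))\<^sup>2 / 2))"
    and "of_real (LINT w|lborel. (cmod (transform \<sigma> w))\<^sup>2 * exp (- (norm (\<delta> *\<^sub>R w))\<^sup>2 / 2))
      = (LINT v|lborel. of_real (sqrt (2 * pi) ^ DIM('a) * exp (- (norm (v :: 'a))\<^sup>2 / 2)) * autocorrelation (\<delta> *\<^sub>R v))"
proof -
  define \<Phi> where "\<Phi> w = complex_of_real (exp (- (norm (w :: 'a))\<^sup>2 / 2))" for w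
  define K where "K z = complex_of_real (sqrt (2 * pi) ^ DIM('a) * exp (- (norm (z :: 'a))\<^sup>2 / 2))" for z
  define E where "E z = exp (\<i> * of_real (\<sigma> * z))" for z :: real
  have [measurable]: "\<Phi> \<in> borel_measurable borel" "K \<in> borel_measurable borel" "E \<in> borel_measurable borel"
    unfolding \<Phi>_def K_def E_def by measurable
  have E_norm: "cmod (E z) = 1" for z by (simp add: E_def)
  have E_cnj: "cnj (E z) = E (- z)" for z by (simp add: E_def exp_cnj)
  have E_add: "E (a + b) = E a * E b" for a b by (simp add: E_def exp_add[symmetric] algebra_simps)
  have i\<Phi>: "integrable lborel (\<lambda>w. \<Phi> (\<delta> *\<^sub>R w))"
  proof -
    have "integrable lborel \<Phi>" unfolding \<Phi>_def using integrable_gaussian[where 'a = 'a] by (rule integrable_of_real)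
    from lborel_integrable_affine[OF _ this, of \<delta> 0] show ?thesis using \<delta> by simp
  qed
  \<comment> \<open>The pair \<open>p = (y, x)\<close> holds the integration variables of
    \<open>cnj (transform \<sigma> w)\<close> and of \<open>transform \<sigma> w\<close>.\<close>
  define H where "H w p = E (w \<bullet> snd p - w \<bullet> fst p) * f (snd p) * cnj (f (fst p)) * \<Phi> (\<delta> *\<^sub>R w)" for w p
  have H_meas[measurable]: "case_prod H \<in> borel_measurable (borel \<Otimes>\<^sub>M (borel \<Otimes>\<^sub>M borel))"
    unfolding H_def by measurable
  have iff: "integrable lborel (\<lambda>p::'a\<times>'a. f (snd p) * cnj (f (fst p)))"
    using lborel_pair.integrable_mult_prod[of "\<lambda>x. cnj (f x)" f] f1
    by (simp add: lborel_prod split_beta' mult.commute)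
  have iH: "integrable (lborel \<Otimes>\<^sub>M lborel) (case_prod H)"
  proof (rule Bochner_Integration.integrable_bound)
    show "integrable (lborel \<Otimes>\<^sub>M lborel) (\<lambda>(w, p). \<Phi> (\<delta> *\<^sub>R w) * (f (snd p) * cnj (f (fst p))))"
      by (intro lborel_pair.integrable_mult_prod i\<Phi> iff)
    show "case_prod H \<in> borel_measurable (lborel \<Otimes>\<^sub>M lborel)"
      using H_meas by (simp add: borel_prod lborel_prod)
  qed (auto simp: H_def norm_mult E_norm)
  have sq: "complex_of_real ((cmod (transform \<sigma> w))\<^sup>2 * exp (- (norm (\<delta> *\<^sub>R w))\<^sup>2 / 2)) = (LINT p|lborel. H w p)" for w
  proof -
    have i1: "integrable lborel (\<lambda>x. E (w \<bullet> x) * f x)"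
      by (rule Bochner_Integration.integrable_bound[OF f1]) (auto simp: norm_mult E_norm)
    then have i2: "integrable lborel (\<lambda>x. cnj (E (w \<bullet> x) * f x))"
      by (rule integrable_bounded_linear[OF bounded_linear_cnj])
    have "(LINT p|lborel. H w p) = (LINT p|(lborel \<Otimes>\<^sub>M lborel). \<Phi> (\<delta> *\<^sub>R w) * (case p of (y, x) \<Rightarrow> cnj (E (w \<bullet> y) * f y) * (E (w \<bullet> x) * f x)))"
      unfolding lborel_prod H_def
      by (intro Bochner_Integration.integral_cong) (auto simp: E_cnj diff_conv_add_uminus E_add simp del: add_uminus_conv_diff)
    also have "\<dots> = \<Phi> (\<delta> *\<^sub>R w) * (LINT p|(lborel \<Otimes>\<^sub>M lborel). (case p of (y, x) \<Rightarrow> cnj (E (w \<bullet> y) * f y) * (E (w \<bullet> x) * f x)))"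
      by simp
    also have "(LINT p|(lborel \<Otimes>\<^sub>M lborel). (case p of (y, x) \<Rightarrow> cnj (E (w \<bullet> y) * f y) * (E (w \<bullet> x) * f x)))
      = (LINT y|lborel. LINT x|lborel. cnj (E (w \<bullet> y) * f y) * (E (w \<bullet> x) * f x))"
      by (subst lborel_pair.integral_fst'[symmetric]) (use lborel_pair.integrable_mult_prod[OF i2 i1] in simp_all)
    also have "\<dots> = cnj (transform \<sigma> w) * transform \<sigma> w"
    proof -
      have "(LINT y|lborel. cnj (E (w \<bullet> y) * f y)) = cnj (transform \<sigma> w)"
        using integral_bounded_linear[OF bounded_linear_cnj i1] by (simp add: transform_def E_def)
      moreover have "(LINT x|lborel. E (w \<bullet> x) * f x) = transform \<sigma> w"
        unfolding transform_def E_def ..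
      ultimately show ?thesis by (simp only: integral_mult_right_zero integral_mult_left_zero)
    qed
    finally show ?thesis by (simp add: \<Phi>_def mult.commute[of "cnj _"] flip: complex_norm_square)
  qed
  have "integrable lborel (\<lambda>w. LINT p|lborel. H w p)"
    using lborel_pair.integrable_fst[OF iH] .
  then have "integrable lborel (\<lambda>w. Re (complex_of_real ((cmod (transform \<sigma> w))\<^sup>2 * exp (- (norm (\<delta> *\<^sub>R w))\<^sup>2 / 2))))"
    unfolding sq by (rule integrable_Re)
  then show "integrable lborel (\<lambda>w. (cmod (transform \<sigma> w))\<^sup>2 * exp (- (norm (\<delta> *\<^sub>R w))\<^sup>2 / 2))" by simp
  \<comment> \<open>The factor \<open>\<delta> ^ DIM('a)\<close> is the Jacobian of
    \<open>x = y + \<delta> v\<close>. Rescaling the frequency absorbs it, so that \<open>K\<close>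
    does not depend on \<open>\<delta>\<close>.\<close>
  have inner: "\<delta> ^ DIM('a) *\<^sub>R (LINT w|lborel. H w (y, y + \<delta> *\<^sub>R v)) = K v * (f (y + \<delta> *\<^sub>R v) * cnj (f y))" for y v
  proof -
    have "(LINT w|lborel. E (w \<bullet> v) * \<Phi> w) = \<delta> ^ DIM('a) *\<^sub>R (LINT w|lborel. E ((0 + \<delta> *\<^sub>R w) \<bullet> v) * \<Phi> (0 + \<delta> *\<^sub>R w))"
      using lborel_integral_affine[of \<delta> "\<lambda>w. E (w \<bullet> v) * \<Phi> w" 0] \<delta> by simp
    moreover have "(LINT w|lborel. E (w \<bullet> v) * \<Phi> w) = K v"
      using gaussian_transform(2)[of "\<sigma> *\<^sub>R v"] \<sigma> by (simp add: E_def \<Phi>_def K_def)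
    moreover have "(LINT w|lborel. H w (y, y + \<delta> *\<^sub>R v)) = (LINT w|lborel. E ((0 + \<delta> *\<^sub>R w) \<bullet> v) * \<Phi> (0 + \<delta> *\<^sub>R w)) * (f (y + \<delta> *\<^sub>R v) * cnj (f y))"
      unfolding H_def by (subst integral_mult_left_zero[symmetric]) (simp add: inner_add_right mult_ac)
    ultimately show ?thesis by simp
  qed
  have iG: "integrable (lborel \<Otimes>\<^sub>M lborel) (\<lambda>(v, y). K v * (f (y + \<delta> *\<^sub>R v) * cnj (f y)))"
  proof (rule lborel_pair.Fubini_integrable)
    show "(\<lambda>(v, y). K v * (f (y + \<delta> *\<^sub>R v) * cnj (f y))) \<in> borel_measurable (lborel \<Otimes>\<^sub>M lborel)" by measurable
    show "AE v in lborel. integrable lborel (\<lambda>y. case (v, y) of (v, y) \<Rightarrow> K v * (f (y + \<delta> *\<^sub>R v) * cnj (f y)))"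
      using autocorrelation_integrable by simp
    have iK: "integrable lborel K" unfolding K_def using integrable_gaussian[where 'a = 'a] by simp
    show "integrable lborel (\<lambda>v. LINT y|lborel. norm (case (v, y) of (v, y) \<Rightarrow> K v * (f (y + \<delta> *\<^sub>R v) * cnj (f y))))"
    proof (rule Bochner_Integration.integrable_bound)
      show "integrable lborel (\<lambda>v. K v * of_real N)" using iK by simp
      show "(\<lambda>v. LINT y|lborel. norm (case (v, y) of (v, y) \<Rightarrow> K v * (f (y + \<delta> *\<^sub>R v) * cnj (f y)))) \<in> borel_measurable lborel"
        by measurable
      show "AE v in lborel. norm (LINT y|lborel. norm (case (v, y) of (v, y) \<Rightarrow> K v * (f (y + \<delta> *\<^sub>R v) * cnj (f y)))) \<le> norm (K v * complex_of_real N)"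
      proof (intro AE_I2)
        fix v
        have "(LINT y|lborel. norm (case (v, y) of (v, y) \<Rightarrow> K v * (f (y + \<delta> *\<^sub>R v) * cnj (f y))))
          = cmod (K v) * (LINT y|lborel. cmod (f (y + \<delta> *\<^sub>R v)) * cmod (f y))" by (simp add: norm_mult)
        moreover have "0 \<le> (LINT y|lborel. cmod (f (y + \<delta> *\<^sub>R v)) * cmod (f y))" by simp
        ultimately show "norm (LINT y|lborel. norm (case (v, y) of (v, y) \<Rightarrow> K v * (f (y + \<delta> *\<^sub>R v) * cnj (f y)))) \<le> norm (K v * complex_of_real N)"
          using autocorrelation_abs[of "\<delta> *\<^sub>R v"] by (simp add: norm_mult mult_left_mono)
      qed
    qed
  qed
  have iG': "integrable (lborel \<Otimes>\<^sub>M lborel) (\<lambda>p. LINT w|lborel. H w p)"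
    using lborel_pair.integrable_snd[OF iH] by (simp add: lborel_prod)
  have "of_real (LINT w|lborel. (cmod (transform \<sigma> w))\<^sup>2 * exp (- (norm (\<delta> *\<^sub>R w))\<^sup>2 / 2)) = (LINT w|lborel. LINT p|lborel. H w p)"
    unfolding sq[symmetric] by (rule integral_complex_of_real[symmetric])
  also have "\<dots> = (LINT p|lborel. LINT w|lborel. H w p)"
    using lborel_pair.Fubini_integral[OF iH] by simp
  also have "\<dots> = (LINT y|lborel. LINT x|lborel. LINT w|lborel. H w (y, x))"
    using lborel_pair.integral_fst'[OF iG'] by (simp add: lborel_prod)
  also have "\<dots> = (LINT y|lborel. LINT v|lborel. K v * (f (y + \<delta> *\<^sub>R v) * cnj (f y)))"
  proof (rule Bochner_Integration.integral_cong[OF refl])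
    fix y
    have "(LINT x|lborel. LINT w|lborel. H w (y, x)) = \<bar>\<delta>\<bar> ^ DIM('a) *\<^sub>R (LINT v|lborel. LINT w|lborel. H w (y, y + \<delta> *\<^sub>R v))"
      by (rule lborel_integral_affine) (use \<delta> in \<open>auto simp: H_def\<close>)
    also have "\<dots> = (LINT v|lborel. \<delta> ^ DIM('a) *\<^sub>R (LINT w|lborel. H w (y, y + \<delta> *\<^sub>R v)))" using \<delta> by simp
    finally show "(LINT x|lborel. LINT w|lborel. H w (y, x)) = (LINT v|lborel. K v * (f (y + \<delta> *\<^sub>R v) * cnj (f y)))"
      by (simp only: inner)
  qed
  also have "\<dots> = (LINT v|lborel. LINT y|lborel. K v * (f (y + \<delta> *\<^sub>R v) * cnj (f y)))"
    using lborel_pair.Fubini_integral[of "\<lambda>v y. K v * (f (y + \<delta> *\<^sub>R v) * cnj (f y))"] iG by simp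
  also have "\<dots> = (LINT v|lborel. K v * autocorrelation (\<delta> *\<^sub>R v))"
    by (simp add: autocorrelation_def)
  finally show "of_real (LINT w|lborel. (cmod (transform \<sigma> w))\<^sup>2 * exp (- (norm (\<delta> *\<^sub>R w))\<^sup>2 / 2))
      = (LINT v|lborel. of_real (sqrt (2 * pi) ^ DIM('a) * exp (- (norm (v :: 'a))\<^sup>2 / 2)) * autocorrelation (\<delta> *\<^sub>R v))"
    by (simp only: K_def)
qed

text \<open>Let the regularization tend to 0. On the frequency side the Gaussians increase to 1, and
  monotone convergence yields integrability together with the value. On the other side the
  autocorrelation is dominated by \<open>N\<close> and continuous at 0.\<close>

lemma plancherel:
  assumes \<sigma>: "\<bar>\<sigma>\<bar> = 1"
  shows "integrable lborel (\<lambda>w. (cmod (transform \<sigma> w))\<^sup>2)"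
    and "(LINT w|lborel. (cmod (transform \<sigma> w))\<^sup>2) = (2 * pi) ^ DIM('a) * N"
proof -
  define K where "K z = sqrt (2 * pi) ^ DIM('a) * exp (- (norm (z :: 'a))\<^sup>2 / 2)" for z
  have iK: "integrable lborel K" unfolding K_def using integrable_gaussian[where 'a = 'a] by simp
  \<comment> \<open>\<open>K\<close> already contains one factor
    \<open>sqrt (2 * pi) ^ DIM('a)\<close>; the mass of the Gaussian is the second.\<close>
  have K_int: "(LINT v|lborel. K v) = (2 * pi) ^ DIM('a)"
  proof -
    have "complex_of_real (LINT v|lborel. K v) = complex_of_real (sqrt (2 * pi) ^ DIM('a)) * (LINT v::'a|lborel. of_real (exp (- (norm v)\<^sup>2 / 2)))"
      by (simp add: K_def flip: integral_complex_of_real)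
    also have "(LINT v::'a|lborel. complex_of_real (exp (- (norm v)\<^sup>2 / 2))) = of_real (sqrt (2 * pi) ^ DIM('a))"
      using gaussian_transform(2)[of "0 :: 'a"] by simp
    finally have "complex_of_real (LINT v|lborel. K v) = of_real ((sqrt (2 * pi) * sqrt (2 * pi)) ^ DIM('a))"
      by (simp only: of_real_mult of_real_power power_mult_distrib)
    then have "(LINT v|lborel. K v) = (sqrt (2 * pi) * sqrt (2 * pi)) ^ DIM('a)" by (rule of_real_eq_iff[THEN iffD1])
    then show ?thesis by simp
  qed
  define I where "I n w = (cmod (transform \<sigma> w))\<^sup>2 * exp (- (norm ((1 / real (Suc n)) *\<^sub>R w))\<^sup>2 / 2)" for n w
  have lim0: "(\<lambda>n. 1 / real (Suc n)) \<longlonglongrightarrow> 0" using lim_1_over_n LIMSEQ_Suc by blast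
  have *: "(\<lambda>n. LINT v|lborel. of_real (K v) * autocorrelation ((1 / real (Suc n)) *\<^sub>R v)) \<longlonglongrightarrow> (LINT v|lborel. of_real (K v) * of_real N)"
  proof (rule integral_dominated_convergence[where w = "\<lambda>v. K v * N"])
    show "AE v in lborel. (\<lambda>n. of_real (K v) * autocorrelation ((1 / real (Suc n)) *\<^sub>R v)) \<longlonglongrightarrow> of_real (K v) * of_real N"
    proof (intro AE_I2 tendsto_mult_left autocorrelation_continuous)
      fix v :: 'a
      have "(\<lambda>n. (1 / real (Suc n)) *\<^sub>R v) \<longlonglongrightarrow> 0 *\<^sub>R v" by (intro tendsto_scaleR lim0 tendsto_const)
      then show "(\<lambda>n. (1 / real (Suc n)) *\<^sub>R v) \<longlonglongrightarrow> 0" by simp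
    qed
    show "AE v in lborel. cmod (of_real (K v) * autocorrelation ((1 / real (Suc n)) *\<^sub>R v)) \<le> K v * N" for n
      using autocorrelation_bound by (intro AE_I2) (auto simp: norm_mult norm_power K_def intro!: mult_mono)
    show "integrable lborel (\<lambda>v. K v * N)" using iK by simp
    show "(\<lambda>v. complex_of_real (K v) * autocorrelation ((1 / real (Suc n)) *\<^sub>R v)) \<in> borel_measurable lborel" for n
      unfolding K_def autocorrelation_def by measurable
  qed (use iK in auto)
  have "(\<lambda>n. LINT w|lborel. I n w) \<longlonglongrightarrow> (2 * pi) ^ DIM('a) * N"
  proof -
    have "(LINT v|lborel. of_real (K v) * of_real N) = complex_of_real ((2 * pi) ^ DIM('a) * N)"
      by (simp only: integral_mult_left_zero integral_complex_of_real K_int of_real_mult)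
    moreover have "(LINT v|lborel. of_real (K v) * autocorrelation ((1 / real (Suc n)) *\<^sub>R v)) = complex_of_real (LINT w|lborel. I n w)" for n
      unfolding I_def by (subst gaussian_regularization(2)[OF _ \<sigma>]) (auto simp: K_def)
    ultimately show ?thesis using * by (simp only: tendsto_of_real_iff)
  qed
  moreover have "AE w in lborel. mono (\<lambda>n. I n w)"
  proof (intro AE_I2 monoI)
    fix w :: 'a and m n :: nat assume "m \<le> n"
    then have "1 / real (Suc n) \<le> 1 / real (Suc m)" by (intro divide_left_mono) auto
    then have "(1 / real (Suc n) * norm w)\<^sup>2 \<le> (1 / real (Suc m) * norm w)\<^sup>2"
      by (intro power_mono mult_right_mono) auto
    then show "I m w \<le> I n w" unfolding I_def by (intro mult_left_mono) auto
  qed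
  moreover have "AE w in lborel. (\<lambda>n. I n w) \<longlonglongrightarrow> (cmod (transform \<sigma> w))\<^sup>2"
  proof (intro AE_I2)
    fix w :: 'a
    have "(\<lambda>n. I n w) \<longlonglongrightarrow> (cmod (transform \<sigma> w))\<^sup>2 * exp (- (norm (0 *\<^sub>R w))\<^sup>2 / 2)"
      unfolding I_def by (intro tendsto_intros lim0) auto
    then show "(\<lambda>n. I n w) \<longlonglongrightarrow> (cmod (transform \<sigma> w))\<^sup>2" by simp
  qed
  moreover have "integrable lborel (I n)" for n
    unfolding I_def by (rule gaussian_regularization(1)) (use \<sigma> in auto)
  moreover have "AE w in lborel. 0 \<le> I n w" for n by (simp add: I_def)
  ultimately have "has_bochner_integral lborel (\<lambda>w. (cmod (transform \<sigma> w))\<^sup>2) ((2 * pi) ^ DIM('a) * N)"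
    using integral_monotone_convergence_nonneg[of lborel I "\<lambda>w. (cmod (transform \<sigma> w))\<^sup>2"]
    by (auto simp: has_bochner_integral_iff)
  then show "integrable lborel (\<lambda>w. (cmod (transform \<sigma> w))\<^sup>2)"
    and "(LINT w|lborel. (cmod (transform \<sigma> w))\<^sup>2) = (2 * pi) ^ DIM('a) * N"
    by (auto simp: has_bochner_integral_iff)
qed

end

section \<open>Pointwise representatives and the complex inner product\<close>

lemma rep_l2_meas[measurable]: "rep_l2 f \<in> borel_measurable borel"
  using sq_int_rep[of f] by (simp add: sq_int_def)

lemma rep_l2_add: "AE x in lborel. rep_l2 (f + g) x = rep_l2 f x + rep_l2 g x"
  using rep_abs_l2[OF sq_int_add[OF sq_int_rep sq_int_rep], of f g] by (simp add: plus_l2_def)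

lemma rep_l2_diff: "AE x in lborel. rep_l2 (f - g) x = rep_l2 f x - rep_l2 g x"
  using rep_abs_l2[OF sq_int_diff[OF sq_int_rep sq_int_rep], of f g] by (simp add: minus_l2_def)

lemma rep_l2_uminus: "AE x in lborel. rep_l2 (- f) x = - rep_l2 f x"
  using rep_abs_l2[OF sq_int_uminus[OF sq_int_rep], of f] by (simp add: uminus_l2_def)

lemma rep_l2_scaleR: "AE x in lborel. rep_l2 (c *\<^sub>R f) x = c *\<^sub>R rep_l2 f x"
  using rep_abs_l2[OF sq_int_scaleR[OF sq_int_rep], of c f] by (simp add: scaleR_l2_def)

lemma rep_l2_scaleC: "AE x in lborel. rep_l2 (scaleC_l2 c f) x = c *s rep_l2 f x"
  using rep_abs_l2[OF sq_int_scaleC[OF sq_int_rep], of c f] by (simp add: scaleC_l2_def)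

lemma rep_l2_zero: "AE x in lborel. rep_l2 0 x = 0"
  using rep_abs_l2[OF sq_int_zero] by (simp add: zero_l2_def)

lemma sq_int_translate:
  fixes f :: "real^'s \<Rightarrow> complex^'n"
  assumes "sq_int f" shows "sq_int (\<lambda>x. f (x + a))"
proof -
  have [measurable]: "f \<in> borel_measurable borel" using assms by (simp add: sq_int_def)
  show ?thesis
    using assms lborel_integrable_translate[of "\<lambda>x. (norm (f x))\<^sup>2" a] by (simp add: sq_int_def)
qed

lemma rep_l2_translate: "AE x in lborel. rep_l2 (translate_l2 a f) x = rep_l2 f (x + a)"
  using rep_abs_l2[OF sq_int_translate[OF sq_int_rep], of f a] by (simp add: translate_l2_def)

lemma cinner_l2_eq: "cinner_l2 f g = (LINT x|lborel. cvec_inner (rep_l2 f x) (rep_l2 g x))"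
  by (simp add: cinner_l2_def)

lemma inner_l2_eq: "f \<bullet> g = (LINT x|lborel. rep_l2 f x \<bullet> rep_l2 g x)"
  by (simp add: inner_l2_def)

lemma cvec_inner_add_left: "cvec_inner (u + v) w = cvec_inner u w + cvec_inner v w"
  by (simp add: cvec_inner_def algebra_simps sum.distrib)

lemma cvec_inner_scale_right: "cvec_inner v (c *s w) = cnj c * cvec_inner v w"
  by (simp add: cvec_inner_def algebra_simps sum_distrib_left)

lemma cvec_inner_scale_left: "cvec_inner (c *s v) w = c * cvec_inner v w"
  by (simp add: cvec_inner_def algebra_simps sum_distrib_left)

lemma Re_cvec_inner: "Re (cvec_inner v w) = v \<bullet> w"
  by (simp add: cvec_inner_def inner_vec_def inner_complex_def)

lemma cvec_inner_self: "cvec_inner v v = of_real ((norm v)\<^sup>2)"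
proof (rule complex_eqI)
  show "Re (cvec_inner v v) = Re (of_real ((norm v)\<^sup>2))" by (simp add: Re_cvec_inner power2_norm_eq_inner)
  show "Im (cvec_inner v v) = Im (of_real ((norm v)\<^sup>2))" by (simp add: cvec_inner_def)
qed

lemma norm_vec_sq: "(norm (v :: complex^'n))\<^sup>2 = (\<Sum>i\<in>UNIV. (cmod (v $ i))\<^sup>2)"
  by (simp add: norm_vec_def L2_set_def sum_nonneg)

lemma cvec_inner_meas[measurable (raw)]:
  fixes f g :: "'a \<Rightarrow> complex^'n"
  assumes [measurable]: "f \<in> borel_measurable M" "g \<in> borel_measurable M"
  shows "(\<lambda>x. cvec_inner (f x) (g x)) \<in> borel_measurable M"
  unfolding cvec_inner_def
  by (intro borel_measurable_sum borel_measurable_times borel_measurable_cnj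
      borel_measurable_continuous_on[where f = "\<lambda>v. v $ _"] continuous_intros assms)

lemma cmod_cvec_inner: "cmod (cvec_inner v w) \<le> norm v * norm w"
proof -
  have "cmod (cvec_inner v w) \<le> (\<Sum>i\<in>UNIV. cmod (v $ i) * cmod (w $ i))"
    unfolding cvec_inner_def by (rule sum_norm_le) (simp add: norm_mult)
  also have "\<dots> \<le> norm v * norm w"
    using L2_set_mult_ineq[of "\<lambda>i. cmod (v $ i)" "\<lambda>i. cmod (w $ i)" UNIV]
    by (simp add: norm_vec_def)
  finally show ?thesis .
qed

lemma integrable_cvec_inner:
  assumes "sq_int f" "sq_int g" shows "integrable lborel (\<lambda>x. cvec_inner (f x) (g x))"
proof (rule Bochner_Integration.integrable_bound)
  show "integrable lborel (\<lambda>x. (norm (f x))\<^sup>2 + (norm (g x))\<^sup>2)"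
    using assms by (auto simp: sq_int_def)
  have "cmod (cvec_inner v w) \<le> (norm v)\<^sup>2 + (norm w)\<^sup>2" for v w :: "complex^'b"
  proof -
    have "norm v * norm w \<le> (norm v)\<^sup>2 + (norm w)\<^sup>2"
      using sum_squares_bound[of "norm v" "norm w"] mult_nonneg_nonneg[OF norm_ge_zero norm_ge_zero, of v w]
      by linarith
    then show ?thesis using cmod_cvec_inner order_trans by blast
  qed
  then show "AE x in lborel. norm (cvec_inner (f x) (g x)) \<le> norm ((norm (f x))\<^sup>2 + (norm (g x))\<^sup>2)"
    by (auto simp: abs_of_nonneg)
qed (use assms in \<open>auto simp: sq_int_def\<close>)

lemma Re_cinner_l2: "Re (cinner_l2 f g) = f \<bullet> g"
proof -
  have "Re (cinner_l2 f g) = (LINT x|lborel. Re (cvec_inner (rep_l2 f x) (rep_l2 g x)))"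
    unfolding cinner_l2_eq
    using integral_bounded_linear[OF bounded_linear_Re integrable_cvec_inner[OF sq_int_rep sq_int_rep], of f g]
    by simp
  then show ?thesis by (simp add: Re_cvec_inner inner_l2_eq)
qed

lemma cinner_l2_scaleC_right: "cinner_l2 f (scaleC_l2 c g) = cnj c * cinner_l2 f g"
proof -
  have "cinner_l2 f (scaleC_l2 c g) = (LINT x|lborel. cnj c * cvec_inner (rep_l2 f x) (rep_l2 g x))"
    unfolding cinner_l2_eq using rep_l2_scaleC[of c g]
    by (intro integral_cong_AE) (auto simp: cvec_inner_scale_right)
  then show ?thesis by (simp add: cinner_l2_eq)
qed

lemma Im_cinner_l2: "Im (cinner_l2 f g) = f \<bullet> scaleC_l2 \<i> g"
  using Re_cinner_l2[of f "scaleC_l2 \<i> g"] by (simp add: cinner_l2_scaleC_right)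

text \<open>The imaginary part of \<open>cinner_l2 f g\<close> is the real inner product of
  \<open>f\<close> with \<open>scaleC_l2 \<i> g\<close>. Identities for the complex inner product
  thus reduce to the real one, where norms polarize.\<close>

lemma cinner_l2_eqI:
  assumes "f \<bullet> g = f' \<bullet> g'" "f \<bullet> scaleC_l2 \<i> g = f' \<bullet> scaleC_l2 \<i> g'"
  shows "cinner_l2 f g = cinner_l2 f' g'"
  by (rule complex_eqI) (use assms in \<open>simp_all add: Re_cinner_l2 Im_cinner_l2\<close>)

lemma norm_scaleC_l2: "norm (scaleC_l2 c f) = cmod c * norm f"
proof -
  have "(norm (scaleC_l2 c f))\<^sup>2 = (LINT x|lborel. (cmod c)\<^sup>2 * (norm (rep_l2 f x))\<^sup>2)"
    unfolding norm_l2_sq using rep_l2_scaleC[of c f]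
    by (intro integral_cong_AE) (auto simp: norm_vector_scalar_mult power_mult_distrib)
  also have "\<dots> = (cmod c * norm f)\<^sup>2" by (simp add: power_mult_distrib norm_l2_sq)
  finally show ?thesis by (rule power2_eq_imp_eq) auto
qed

lemma scaleC_l2_add: "scaleC_l2 c (f + g) = scaleC_l2 c f + scaleC_l2 c g"
  by (rule l2_eqI) (use rep_l2_scaleC[of c "f + g"] rep_l2_add[of f g] rep_l2_add[of "scaleC_l2 c f" "scaleC_l2 c g"]
    rep_l2_scaleC[of c f] rep_l2_scaleC[of c g] in \<open>eventually_elim, simp add: vector_add_ldistrib\<close>)

lemma scaleC_l2_scaleR: "scaleC_l2 c (r *\<^sub>R f) = r *\<^sub>R scaleC_l2 c f"
  by (rule l2_eqI) (use rep_l2_scaleC[of c "r *\<^sub>R f"] rep_l2_scaleR[of r f] rep_l2_scaleR[of r "scaleC_l2 c f"]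
    rep_l2_scaleC[of c f] in \<open>eventually_elim, simp add: vec_eq_iff\<close>)

lemma bounded_linear_scaleC_l2: "bounded_linear (scaleC_l2 c)"
  by (rule bounded_linear_intro[where K = "cmod c"])
     (auto simp: scaleC_l2_add scaleC_l2_scaleR norm_scaleC_l2)

lemma scaleC_l2_of_real: "scaleC_l2 (of_real r) f = r *\<^sub>R f"
  by (rule l2_eqI) (use rep_l2_scaleC[of "of_real r" f] rep_l2_scaleR[of r f] in \<open>eventually_elim, simp add: vec_eq_iff, simp add: scaleR_conv_of_real\<close>)

lemma mat_vec: "mat c *v v = c *s (v :: complex^'n)"
  by (simp add: vec_eq_iff matrix_vector_mult_def mat_def if_distrib[of "\<lambda>x. x * _"] cong: if_cong)

section \<open>The Fourier transform on \<open>L\<^sub>2\<close>\<close>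

definition fourier_int :: "real \<Rightarrow> (real^'s::finite \<Rightarrow> complex^'n) \<Rightarrow> real^'s \<Rightarrow> complex^'n" where
  "fourier_int \<sigma> f w = (2 * pi) powr (- real CARD('s) / 2) *\<^sub>R
    (LINT x|lborel. exp (\<i> * of_real (\<sigma> * (w \<bullet> x))) *s f x)"

lemma measurable_vec_nth[measurable (raw)]:
  fixes f :: "'a \<Rightarrow> 'b::euclidean_space^'n"
  assumes "f \<in> borel_measurable M" shows "(\<lambda>x. f x $ i) \<in> borel_measurable M"
  by (rule borel_measurable_continuous_on[where f = "\<lambda>v. v $ i"]) (auto intro!: continuous_intros assms)

lemma measurable_vec_lambda[measurable (raw)]:
  fixes f :: "'a \<Rightarrow> 'n::finite \<Rightarrow> 'b::euclidean_space"
  assumes "\<And>i. (\<lambda>x. f x i) \<in> borel_measurable M" shows "(\<lambda>x. \<chi> i. f x i) \<in> borel_measurable M"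
proof (subst borel_measurable_euclidean_space, intro ballI)
  fix b :: "'b^'n" assume "b \<in> Basis"
  then obtain i c where b: "b = axis i c" "c \<in> Basis" by (auto simp: Basis_vec_def)
  have [measurable]: "(\<lambda>x. f x i) \<in> borel_measurable M" by fact
  show "(\<lambda>x. (\<chi> i. f x i) \<bullet> b) \<in> borel_measurable M"
    unfolding b(1) by (simp add: inner_axis)
qed

lemma measurable_scalar_mult[measurable (raw)]:
  fixes f :: "'a \<Rightarrow> complex^'n"
  assumes [measurable]: "c \<in> borel_measurable M" "f \<in> borel_measurable M"
  shows "(\<lambda>x. c x *s f x) \<in> borel_measurable M"
  unfolding vector_scalar_mult_def by measurable

lemma integrable_exp_mult:
  fixes f :: "real^'s::finite \<Rightarrow> complex^'n"
  assumes f: "integrable lborel f"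
  shows "integrable lborel (\<lambda>x. exp (\<i> * of_real (\<sigma> * (w \<bullet> x))) *s f x)"
proof (rule Bochner_Integration.integrable_bound[OF f])
  have [measurable]: "f \<in> borel_measurable borel" using f by auto
  show "(\<lambda>x. exp (\<i> * of_real (\<sigma> * (w \<bullet> x))) *s f x) \<in> borel_measurable lborel" by measurable
qed (auto simp: norm_vector_scalar_mult)

lemma integrable_vec_nth:
  fixes f :: "'a \<Rightarrow> complex^'n"
  assumes "integrable M f" shows "integrable M (\<lambda>x. f x $ i)"
  using integrable_bounded_linear[OF bounded_linear_vec_nth assms] .

lemma integral_vec_nth:
  fixes f :: "'a \<Rightarrow> complex^'n"
  assumes "integrable M f" shows "integral\<^sup>L M f $ i = (LINT x|M. f x $ i)"
  using integral_bounded_linear[OF bounded_linear_vec_nth assms] by simp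

lemma fourier_int_nth:
  fixes f :: "real^'s::finite \<Rightarrow> complex^'n"
  assumes f: "integrable lborel f"
  shows "fourier_int \<sigma> f w $ i = (2 * pi) powr (- real CARD('s) / 2) *\<^sub>R
    (LINT x|lborel. exp (\<i> * of_real (\<sigma> * (w \<bullet> x))) * f x $ i)"
  by (simp only: fourier_int_def integral_vec_nth[OF integrable_exp_mult[OF f]]
      vector_scaleR_component vector_smult_component)

lemma fourier_int_add:
  assumes "integrable lborel f" "integrable lborel g"
  shows "fourier_int \<sigma> (\<lambda>x. f x + g x) w = fourier_int \<sigma> f w + fourier_int \<sigma> g w"
  by (simp only: fourier_int_def vector_add_ldistrib integrable_exp_mult[OF assms(1)]
      integrable_exp_mult[OF assms(2)] Bochner_Integration.integral_add scaleR_add_right)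

lemma fourier_int_mult_vec:
  assumes f: "integrable lborel f"
  shows "fourier_int \<sigma> (\<lambda>x. M *v f x) w = M *v fourier_int \<sigma> f w"
proof -
  have bl: "bounded_linear (\<lambda>v. M *v v)" by simp
  have "exp z *s (M *v v) = M *v (exp z *s v)" for z v by (simp add: vector_scalar_commute)
  then show ?thesis
    unfolding fourier_int_def
    using integral_bounded_linear[OF bl integrable_exp_mult[OF f], of \<sigma> w]
    by (simp add: linear_cmul[OF bounded_linear.linear[OF bl]])
qed

lemma fourier_int_cong_AE:
  fixes f g :: "real^'s::finite \<Rightarrow> complex^'n"
  assumes [measurable]: "f \<in> borel_measurable borel" "g \<in> borel_measurable borel"
    and ae: "AE x in lborel. f x = g x"
  shows "fourier_int \<sigma> f = fourier_int \<sigma> g"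
proof
  fix w
  have "(LINT x|lborel. exp (\<i> * of_real (\<sigma> * (w \<bullet> x))) *s f x) = (LINT x|lborel. exp (\<i> * of_real (\<sigma> * (w \<bullet> x))) *s g x)"
    by (rule integral_cong_AE) (use ae in auto)
  then show "fourier_int \<sigma> f w = fourier_int \<sigma> g w" by (simp add: fourier_int_def)
qed

lemma fourier_int_translate:
  fixes f :: "real^'s::finite \<Rightarrow> complex^'n"
  assumes [measurable]: "f \<in> borel_measurable borel"
  shows "fourier_int \<sigma> (\<lambda>x. f (x + a)) w = exp (- \<i> * of_real (\<sigma> * (w \<bullet> a))) *s fourier_int \<sigma> f w"
proof -
  have "(LINT x|lborel. exp (\<i> * of_real (\<sigma> * (w \<bullet> x))) *s f (x + a))
    = (LINT x|lborel. exp (- \<i> * of_real (\<sigma> * (w \<bullet> a))) *s (exp (\<i> * of_real (\<sigma> * (w \<bullet> (x + a)))) *s f (x + a)))"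
    by (simp add: vector_smult_assoc exp_add[symmetric] inner_add_right algebra_simps)
  also have "\<dots> = (LINT x|lborel. exp (- \<i> * of_real (\<sigma> * (w \<bullet> a))) *s (exp (\<i> * of_real (\<sigma> * (w \<bullet> x))) *s f x))"
    by (rule lborel_integral_translate[of "\<lambda>x. exp (- \<i> * of_real (\<sigma> * (w \<bullet> a))) *s (exp (\<i> * of_real (\<sigma> * (w \<bullet> x))) *s f x)"]) measurable
  \<comment> \<open>Multiplication by the phase is invertible, so it passes through the integral
    even where \<open>f\<close> is not integrable.\<close>
  also have "\<dots> = exp (- \<i> * of_real (\<sigma> * (w \<bullet> a))) *s (LINT x|lborel. exp (\<i> * of_real (\<sigma> * (w \<bullet> x))) *s f x)"
    by (rule integral_bounded_linear'[OF bounded_linear_vector_scalar_mult bounded_linear_vector_scalar_mult[of "exp (\<i> * of_real (\<sigma> * (w \<bullet> a)))"]])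
       (auto simp: vector_smult_assoc exp_add[symmetric])
  finally show ?thesis by (simp add: fourier_int_def vec_eq_iff)
qed

text \<open>The scalar identity is summed over the coordinates; the normalization of
  \<open>fourier_int\<close> is the one that cancels \<open>(2 * pi) ^ DIM(real^'s)\<close>.\<close>

lemma fourier_int_isometry:
  fixes f :: "real^'s::finite \<Rightarrow> complex^'n"
  assumes f1: "integrable lborel f" and f2: "sq_int f" and \<sigma>: "\<bar>\<sigma>\<bar> = 1"
  shows "sq_int (fourier_int \<sigma> f)"
    and "norm (abs_l2 (fourier_int \<sigma> f)) = norm (abs_l2 f)"
proof -
  have [measurable]: "f \<in> borel_measurable borel" using f1 by auto
  let ?c = "(2 * pi) powr (- real CARD('s) / 2)"
  have c: "?c\<^sup>2 * (2 * pi) ^ DIM(real^'s) = 1"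
  proof -
    have "?c\<^sup>2 = (2 * pi) powr (- real CARD('s))"
      unfolding power2_eq_square powr_add[symmetric] by simp
    moreover have "(2 * pi) ^ DIM(real^'s) = (2 * pi) powr real CARD('s)"
      by (subst powr_realpow) auto
    ultimately show ?thesis by (simp add: powr_add[symmetric])
  qed
  have S: "square_integrable (\<lambda>x. f x $ i)" for i
  proof
    show "complex_integrable lborel (\<lambda>x. f x $ i)" by (rule integrable_vec_nth[OF f1])
    show "integrable lborel (\<lambda>x. (cmod (f x $ i))\<^sup>2)"
    proof (rule Bochner_Integration.integrable_bound)
      show "integrable lborel (\<lambda>x. (norm (f x))\<^sup>2)" using f2 by (simp add: sq_int_def)
      have "(cmod (f x $ i))\<^sup>2 \<le> (norm (f x))\<^sup>2" for x
        unfolding norm_vec_sq by (rule member_le_sum) auto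
      then show "AE x in lborel. norm ((cmod (f x $ i))\<^sup>2) \<le> norm ((norm (f x))\<^sup>2)" by simp
    qed measurable
  qed
  have nth: "fourier_int \<sigma> f w $ i = ?c *\<^sub>R square_integrable.transform (\<lambda>x. f x $ i) \<sigma> w" for w i
    unfolding fourier_int_nth[OF f1] square_integrable.transform_def[OF S] ..
  have sq: "(norm (fourier_int \<sigma> f w))\<^sup>2 = (\<Sum>i\<in>UNIV. ?c\<^sup>2 * (cmod (square_integrable.transform (\<lambda>x. f x $ i) \<sigma> w))\<^sup>2)" for w
    by (simp add: norm_vec_sq nth power_mult_distrib)
  have int: "integrable lborel (\<lambda>w. ?c\<^sup>2 * (cmod (square_integrable.transform (\<lambda>x. f x $ i) \<sigma> w))\<^sup>2)" for i
    by (intro integrable_mult_right square_integrable.plancherel[OF S \<sigma>])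
  have meas: "fourier_int \<sigma> f \<in> borel_measurable borel"
    unfolding fourier_int_def[abs_def] by measurable
  show sqF: "sq_int (fourier_int \<sigma> f)"
    unfolding sq_int_def using meas int by (auto simp: sq)
  have "(norm (abs_l2 (fourier_int \<sigma> f)))\<^sup>2 = (\<Sum>i\<in>UNIV. LINT w|lborel. ?c\<^sup>2 * (cmod (square_integrable.transform (\<lambda>x. f x $ i) \<sigma> w))\<^sup>2)"
    unfolding norm_abs_l2_sq[OF sqF] sq by (rule Bochner_Integration.integral_sum) (rule int)
  also have "\<dots> = (\<Sum>i\<in>UNIV. ?c\<^sup>2 * (2 * pi) ^ DIM(real^'s) * (LINT x|lborel. (cmod (f x $ i))\<^sup>2))"
    using square_integrable.plancherel(2)[OF S \<sigma>] by (simp add: mult.assoc)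
  also have "\<dots> = (\<Sum>i\<in>UNIV. (LINT x|lborel. (cmod (f x $ i))\<^sup>2))"
    unfolding c by simp
  also have "\<dots> = (LINT x|lborel. (\<Sum>i\<in>UNIV. (cmod (f x $ i))\<^sup>2))"
    by (rule Bochner_Integration.integral_sum[symmetric]) (rule square_integrable.f2[OF S])
  also have "\<dots> = (norm (abs_l2 f))\<^sup>2" by (simp add: norm_abs_l2_sq[OF f2] norm_vec_sq)
  finally show "norm (abs_l2 (fourier_int \<sigma> f)) = norm (abs_l2 f)"
    by (rule power2_eq_imp_eq) auto
qed

section \<open>Extension of the Fourier integral to all of L2\<close>

definition l1_l2 :: "('s::finite, 'n::finite) l2 set" where
  "l1_l2 = {f. integrable lborel (rep_l2 f)}"

lemma l1_l2_abs:
  assumes "sq_int f" "integrable lborel f" shows "abs_l2 f \<in> l1_l2"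
proof -
  have "integrable lborel (rep_l2 (abs_l2 f)) \<longleftrightarrow> integrable lborel f"
    using rep_abs_l2[OF assms(1)] assms(2) by (intro integrable_cong_AE) auto
  then show ?thesis using assms by (simp add: l1_l2_def)
qed

lemma l1_l2_cong:
  assumes "integrable lborel g" "AE x in lborel. rep_l2 f x = g x" shows "f \<in> l1_l2"
proof -
  have "integrable lborel (rep_l2 f) \<longleftrightarrow> integrable lborel g"
    using assms by (intro integrable_cong_AE) auto
  then show ?thesis using assms by (simp add: l1_l2_def)
qed

lemma l1_l2_diff: "f \<in> l1_l2 \<Longrightarrow> g \<in> l1_l2 \<Longrightarrow> f - g \<in> l1_l2"
  by (rule l1_l2_cong[OF _ rep_l2_diff]) (auto simp: l1_l2_def)

text \<open>Restriction to a ball puts every \<open>f\<close> into \<open>l1_l2\<close>, by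
  \<open>le_one_plus_square\<close>. It commutes with sums and scalars, so algebraic laws of the
  extension hold term by term before the limit.\<close>

definition cutoff :: "nat \<Rightarrow> ('s::finite, 'n::finite) l2 \<Rightarrow> ('s, 'n) l2" where
  "cutoff k f = abs_l2 (\<lambda>x. indicator (ball 0 (real k)) x *\<^sub>R rep_l2 f x)"

lemma sq_int_cutoff: "sq_int f \<Longrightarrow> sq_int (\<lambda>x. indicator (ball 0 (real k)) x *\<^sub>R f x)"
  by (rule sq_int_bound[where h = "\<lambda>x. (norm (f x))\<^sup>2"]) (auto simp: sq_int_def indicator_def)

lemma rep_cutoff: "AE x in lborel. rep_l2 (cutoff k f) x = indicator (ball 0 (real k)) x *\<^sub>R rep_l2 f x"
  unfolding cutoff_def by (rule rep_abs_l2[OF sq_int_cutoff[OF sq_int_rep]])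

lemma cutoff_l1_l2: "cutoff k (f :: ('s::finite, 'n::finite) l2) \<in> l1_l2"
  unfolding cutoff_def
proof (rule l1_l2_abs[OF sq_int_cutoff[OF sq_int_rep]], rule Bochner_Integration.integrable_bound)
  show "integrable lborel (\<lambda>x. indicator (ball 0 (real k)) x + (norm (rep_l2 f x))\<^sup>2)"
    using sq_int_rep[of f] emeasure_lborel_ball_finite[of 0 "real k"]
    by (intro Bochner_Integration.integrable_add) (auto simp: sq_int_def)
  show "AE x in lborel. norm (indicator (ball 0 (real k)) x *\<^sub>R rep_l2 f x)
      \<le> norm (indicator (ball 0 (real k)) x + (norm (rep_l2 f x))\<^sup>2)"
    by (intro AE_I2) (auto simp: indicator_def le_one_plus_square)
  show "(\<lambda>x. indicator (ball 0 (real k)) x *\<^sub>R rep_l2 f x) \<in> borel_measurable lborel"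
    by (intro borel_measurable_scaleR borel_measurable_indicator) simp_all
qed

lemma cutoff_tendsto: "(\<lambda>k. cutoff k f) \<longlonglongrightarrow> f"
proof -
  have "(\<lambda>k. abs_l2 (\<lambda>x. indicator (ball 0 (real k)) x *\<^sub>R rep_l2 f x)) \<longlonglongrightarrow> abs_l2 (rep_l2 f)"
  proof (rule l2_dominated_convergence[where h = "\<lambda>x. (norm (rep_l2 f x))\<^sup>2"])
    show "(\<lambda>k. indicator (ball 0 (real k)) x *\<^sub>R rep_l2 f x) \<longlonglongrightarrow> rep_l2 f x" for x
    proof (rule tendsto_eventually)
      show "\<forall>\<^sub>F k in sequentially. indicator (ball 0 (real k)) x *\<^sub>R rep_l2 f x = rep_l2 f x"
        using eventually_gt_at_top[of "nat \<lceil>norm x\<rceil>"]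
        by eventually_elim (auto simp: indicator_def, linarith)
    qed
  qed (use sq_int_rep[of f] sq_int_cutoff[OF sq_int_rep] in \<open>auto simp: sq_int_def indicator_def\<close>)
  then show ?thesis by (simp add: cutoff_def abs_l2_rep)
qed

lemma cutoff_add: "cutoff k (f + g) = cutoff k f + cutoff k g"
  by (rule l2_eqI) (use rep_cutoff[of k "f + g"] rep_l2_add[of f g] rep_l2_add[of "cutoff k f" "cutoff k g"]
    rep_cutoff[of k f] rep_cutoff[of k g] in \<open>eventually_elim, simp add: scaleR_add_right\<close>)

lemma cutoff_scaleC: "cutoff k (scaleC_l2 c f) = scaleC_l2 c (cutoff k f)"
  by (rule l2_eqI) (use rep_cutoff[of k "scaleC_l2 c f"] rep_l2_scaleC[of c f] rep_l2_scaleC[of c "cutoff k f"]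
    rep_cutoff[of k f] in \<open>eventually_elim, simp add: vec_eq_iff\<close>)

text \<open>Density of \<open>l1_l2\<close>. Besides the uniqueness of \<open>fourier_l2\<close> it
  yields the rules for constant matrices and translations, which then need checking on Fourier
  integrals only.\<close>

lemma bounded_linear_eq_l1_l2:
  assumes "bounded_linear F" "bounded_linear G" "\<And>f. f \<in> l1_l2 \<Longrightarrow> F f = G f"
  shows "F = G"
proof
  fix f
  have "(\<lambda>k. F (cutoff k f)) \<longlonglongrightarrow> F f" "(\<lambda>k. G (cutoff k f)) \<longlonglongrightarrow> G f"
    by (intro bounded_linear.tendsto[OF assms(1)] bounded_linear.tendsto[OF assms(2)] cutoff_tendsto)+
  then show "F f = G f" using assms(3)[OF cutoff_l1_l2] LIMSEQ_unique by auto
qed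

definition fourier_l1 :: "real \<Rightarrow> ('s::finite, 'n::finite) l2 \<Rightarrow> ('s, 'n) l2" where
  "fourier_l1 \<sigma> f = abs_l2 (fourier_int \<sigma> (rep_l2 f))"

text \<open>The limit over cutoffs extends the isometry \<^const>\<open>fourier_l1\<close> from \<open>L\<^sub>1 \<inter> L\<^sub>2\<close>
  to \<open>L\<^sub>2\<close>; the sign \<open>\<sigma> = -1\<close> gives the transform and \<open>\<sigma> = 1\<close> its inverse.\<close>

definition fourier_sgn :: "real \<Rightarrow> ('s::finite, 'n::finite) l2 \<Rightarrow> ('s, 'n) l2" where
  "fourier_sgn \<sigma> f = lim (\<lambda>k. fourier_l1 \<sigma> (cutoff k f))"

context
  fixes \<sigma> :: real
  assumes \<sigma>: "\<bar>\<sigma>\<bar> = 1"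
begin

lemma rep_fourier_l1:
  "f \<in> l1_l2 \<Longrightarrow> AE w in lborel. rep_l2 (fourier_l1 \<sigma> f) w = fourier_int \<sigma> (rep_l2 f) w"
  unfolding fourier_l1_def
  by (rule rep_abs_l2[OF fourier_int_isometry(1)[OF _ sq_int_rep \<sigma>]]) (simp add: l1_l2_def)

lemma norm_fourier_l1: "f \<in> l1_l2 \<Longrightarrow> norm (fourier_l1 \<sigma> f) = norm f"
  unfolding fourier_l1_def using fourier_int_isometry(2)[OF _ sq_int_rep \<sigma>, of f]
  by (simp add: l1_l2_def abs_l2_rep)

lemma fourier_l1_add:
  assumes "f \<in> l1_l2" "g \<in> l1_l2"
  shows "fourier_l1 \<sigma> (f + g) = fourier_l1 \<sigma> f + fourier_l1 \<sigma> g"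
proof -
  have "fourier_int \<sigma> (rep_l2 (f + g)) = fourier_int \<sigma> (\<lambda>x. rep_l2 f x + rep_l2 g x)"
    by (rule fourier_int_cong_AE) (use rep_l2_add in auto)
  also have "\<dots> = (\<lambda>w. fourier_int \<sigma> (rep_l2 f) w + fourier_int \<sigma> (rep_l2 g) w)"
    by (rule ext, rule fourier_int_add) (use assms in \<open>auto simp: l1_l2_def\<close>)
  finally show ?thesis
    unfolding fourier_l1_def using assms
    by (auto simp: l1_l2_def intro!: abs_l2_add fourier_int_isometry(1) sq_int_rep \<sigma>)
qed

lemma fourier_l1_diff:
  assumes "f \<in> l1_l2" "g \<in> l1_l2"
  shows "fourier_l1 \<sigma> (f - g) = fourier_l1 \<sigma> f - fourier_l1 \<sigma> g"
  using fourier_l1_add[OF l1_l2_diff[OF assms] assms(2)] by (simp add: eq_diff_eq)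

lemma fourier_l1_scaleC:
  assumes "f \<in> l1_l2"
  shows "fourier_l1 \<sigma> (scaleC_l2 c f) = scaleC_l2 c (fourier_l1 \<sigma> f)"
proof -
  have "fourier_int \<sigma> (rep_l2 (scaleC_l2 c f)) = fourier_int \<sigma> (\<lambda>x. mat c *v rep_l2 f x)"
    by (rule fourier_int_cong_AE) (use rep_l2_scaleC[of c f] in \<open>auto simp: mat_vec\<close>)
  also have "\<dots> = (\<lambda>w. c *s fourier_int \<sigma> (rep_l2 f) w)"
    by (rule ext, subst fourier_int_mult_vec) (use assms in \<open>auto simp: l1_l2_def mat_vec\<close>)
  finally have "fourier_l1 \<sigma> (scaleC_l2 c f) = abs_l2 (\<lambda>w. c *s fourier_int \<sigma> (rep_l2 f) w)"
    by (simp add: fourier_l1_def)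
  also have "\<dots> = scaleC_l2 c (fourier_l1 \<sigma> f)"
    using assms rep_l2_scaleC[of c "fourier_l1 \<sigma> f"] rep_fourier_l1[OF assms]
    by (intro abs_l2_eq sq_int_scaleC fourier_int_isometry(1) sq_int_rep \<sigma>) (auto simp: l1_l2_def)
  finally show ?thesis .
qed

text \<open>The isometry \<open>fourier_l1 \<sigma>\<close> maps the Cauchy sequence of cutoffs to a
  Cauchy sequence, and L2 is complete. Only now does \<open>lim\<close> in the definition denote a
  limit.\<close>

lemma fourier_sgn_lim: "(\<lambda>k. fourier_l1 \<sigma> (cutoff k f)) \<longlonglongrightarrow> fourier_sgn \<sigma> f"
proof -
  have "Cauchy (\<lambda>k. cutoff k f)" using cutoff_tendsto by (rule LIMSEQ_imp_Cauchy)
  moreover have "dist (fourier_l1 \<sigma> (cutoff j f)) (fourier_l1 \<sigma> (cutoff k f)) = dist (cutoff j f) (cutoff k f)" for j k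
    by (simp add: dist_norm norm_fourier_l1 l1_l2_diff cutoff_l1_l2 flip: fourier_l1_diff)
  ultimately have "Cauchy (\<lambda>k. fourier_l1 \<sigma> (cutoff k f))" unfolding Cauchy_def by simp
  then show ?thesis
    unfolding fourier_sgn_def using Cauchy_convergent convergent_LIMSEQ_iff by blast
qed

lemma fourier_sgn_l1:
  assumes "f \<in> l1_l2" shows "fourier_sgn \<sigma> f = fourier_l1 \<sigma> f"
proof -
  have "(\<lambda>k. norm (cutoff k f - f)) \<longlonglongrightarrow> 0"
    using cutoff_tendsto[of f] by (simp add: LIM_zero_iff tendsto_norm_zero_iff)
  then have "(\<lambda>k. norm (fourier_l1 \<sigma> (cutoff k f) - fourier_l1 \<sigma> f)) \<longlonglongrightarrow> 0"
    using assms by (simp add: norm_fourier_l1 l1_l2_diff cutoff_l1_l2 flip: fourier_l1_diff)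
  then have "(\<lambda>k. fourier_l1 \<sigma> (cutoff k f)) \<longlonglongrightarrow> fourier_l1 \<sigma> f"
    by (simp add: LIM_zero_iff tendsto_norm_zero_iff)
  with fourier_sgn_lim show ?thesis using LIMSEQ_unique by blast
qed

lemma norm_fourier_sgn: "norm (fourier_sgn \<sigma> f) = norm f"
proof (rule LIMSEQ_unique)
  show "(\<lambda>k. norm (fourier_l1 \<sigma> (cutoff k f))) \<longlonglongrightarrow> norm (fourier_sgn \<sigma> f)"
    by (intro tendsto_norm fourier_sgn_lim)
  show "(\<lambda>k. norm (fourier_l1 \<sigma> (cutoff k f))) \<longlonglongrightarrow> norm f"
    by (simp add: norm_fourier_l1 cutoff_l1_l2 tendsto_norm cutoff_tendsto)
qed

lemma fourier_sgn_add: "fourier_sgn \<sigma> (f + g) = fourier_sgn \<sigma> f + fourier_sgn \<sigma> g"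
proof (rule LIMSEQ_unique[OF fourier_sgn_lim])
  show "(\<lambda>k. fourier_l1 \<sigma> (cutoff k (f + g))) \<longlonglongrightarrow> fourier_sgn \<sigma> f + fourier_sgn \<sigma> g"
    by (simp add: cutoff_add fourier_l1_add cutoff_l1_l2 tendsto_add fourier_sgn_lim)
qed

lemma fourier_sgn_scaleC: "fourier_sgn \<sigma> (scaleC_l2 c f) = scaleC_l2 c (fourier_sgn \<sigma> f)"
proof (rule LIMSEQ_unique[OF fourier_sgn_lim])
  show "(\<lambda>k. fourier_l1 \<sigma> (cutoff k (scaleC_l2 c f))) \<longlonglongrightarrow> scaleC_l2 c (fourier_sgn \<sigma> f)"
    by (simp add: cutoff_scaleC fourier_l1_scaleC cutoff_l1_l2
        bounded_linear.tendsto[OF bounded_linear_scaleC_l2] fourier_sgn_lim)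
qed

lemma bounded_linear_fourier_sgn: "bounded_linear (fourier_sgn \<sigma>)"
proof (rule bounded_linear_intro[where K = 1])
  show "fourier_sgn \<sigma> (r *\<^sub>R f) = r *\<^sub>R fourier_sgn \<sigma> f" for r f
    using fourier_sgn_scaleC[of "of_real r" f] by (simp add: scaleC_l2_of_real)
qed (simp_all add: fourier_sgn_add norm_fourier_sgn)

lemma bounded_op_fourier_sgn: "bounded_op (fourier_sgn \<sigma>)"
  by (simp add: bounded_op_def bounded_linear_fourier_sgn fourier_sgn_scaleC)

end

lemma inner_norm_polar: "(f :: 'a::real_inner) \<bullet> g = ((norm (f + g))\<^sup>2 - (norm f)\<^sup>2 - (norm g)\<^sup>2) / 2"
  by (simp add: power2_norm_eq_inner inner_add_left inner_add_right inner_commute)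

lemma inner_fourier_sgn:
  assumes \<sigma>: "\<bar>\<sigma>\<bar> = 1" shows "fourier_sgn \<sigma> f \<bullet> fourier_sgn \<sigma> g = f \<bullet> g"
  unfolding inner_norm_polar
  by (simp only: fourier_sgn_add[OF \<sigma>, symmetric] norm_fourier_sgn[OF \<sigma>])

lemma cinner_fourier_sgn:
  assumes \<sigma>: "\<bar>\<sigma>\<bar> = 1" shows "cinner_l2 (fourier_sgn \<sigma> f) (fourier_sgn \<sigma> g) = cinner_l2 f g"
  by (rule cinner_l2_eqI) (simp_all only: fourier_sgn_scaleC[OF \<sigma>, symmetric] inner_fourier_sgn[OF \<sigma>])

text \<open>Fubini: the kernel \<open>exp (\<i> * of_real (\<sigma> * (w \<bullet> x)))\<close> is
  symmetric in \<open>w\<close> and \<open>x\<close>, and conjugation changes the sign of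
  \<open>\<sigma>\<close>.\<close>

lemma fourier_int_adjoint:
  fixes f g :: "real^'s::finite \<Rightarrow> complex^'n"
  assumes f: "integrable lborel f" and g: "integrable lborel g"
  shows "(LINT w|lborel. cvec_inner (fourier_int \<sigma> f w) (g w)) = (LINT x|lborel. cvec_inner (f x) (fourier_int (- \<sigma>) g x))"
proof -
  have [measurable]: "f \<in> borel_measurable borel" "g \<in> borel_measurable borel" using f g by auto
  let ?c = "(2 * pi) powr (- real CARD('s) / 2)"
  define E where "E w x = exp (\<i> * of_real (\<sigma> * (w \<bullet> x)))" for w x :: "real^'s"
  have E_meas[measurable]: "case_prod E \<in> borel_measurable (borel \<Otimes>\<^sub>M borel)" unfolding E_def by measurable
  have E_cnj: "exp (\<i> * of_real (- \<sigma> * (x \<bullet> w))) = cnj (E w x)" for w x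
    by (simp add: E_def exp_cnj inner_commute)
  have int: "integrable (lborel \<Otimes>\<^sub>M lborel) (\<lambda>(w, x). E w x * f x $ i * cnj (g w $ i))" for i
  proof (rule Bochner_Integration.integrable_bound)
    show "integrable (lborel \<Otimes>\<^sub>M lborel) (\<lambda>(w, x). cnj (g w $ i) * f x $ i)"
      by (intro lborel_pair.integrable_mult_prod integrable_bounded_linear[OF bounded_linear_cnj]
          integrable_vec_nth f g)
  qed (auto simp: E_def norm_mult)
  have if_: "integrable lborel (\<lambda>w. (LINT x|lborel. E w x * f x $ i * cnj (g w $ i)))" for i
    using lborel_pair.integrable_fst[OF int[of i]] by simp
  have ig: "integrable lborel (\<lambda>x. (LINT w|lborel. E w x * f x $ i * cnj (g w $ i)))" for i
    using lborel_pair.integrable_snd[OF int[of i]] by simp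
  have L: "cvec_inner (fourier_int \<sigma> f w) (g w) = (\<Sum>i\<in>UNIV. of_real ?c * (LINT x|lborel. E w x * f x $ i * cnj (g w $ i)))" for w
    unfolding cvec_inner_def fourier_int_nth[OF f] E_def[symmetric]
    by (simp only: integral_mult_left_zero scaleR_conv_of_real) (simp only: mult.assoc)
  have R: "cvec_inner (f x) (fourier_int (- \<sigma>) g x) = (\<Sum>i\<in>UNIV. of_real ?c * (LINT w|lborel. E w x * f x $ i * cnj (g w $ i)))" for x
  proof -
    have "cnj (LINT w|lborel. cnj (E w x) * g w $ i) = (LINT w|lborel. E w x * cnj (g w $ i))" for i
    proof -
      have "integrable lborel (\<lambda>w. cnj (E w x) * g w $ i)"
        by (rule Bochner_Integration.integrable_bound[OF integrable_vec_nth[OF g, of i]]) (auto simp: E_def norm_mult)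
      from integral_bounded_linear[OF bounded_linear_cnj this] show ?thesis by simp
    qed
    moreover have "f x $ i * (LINT w|lborel. E w x * cnj (g w $ i)) = (LINT w|lborel. E w x * f x $ i * cnj (g w $ i))" for i
      by (simp add: mult_ac flip: integral_mult_right_zero)
    ultimately show ?thesis
      unfolding cvec_inner_def fourier_int_nth[OF g] E_cnj
      by (simp only: scaleR_conv_of_real complex_cnj_mult complex_cnj_complex_of_real mult.left_commute[of "f x $ _"])
  qed
  have "(LINT w|lborel. cvec_inner (fourier_int \<sigma> f w) (g w)) = (\<Sum>i\<in>UNIV. of_real ?c * (LINT w|lborel. LINT x|lborel. E w x * f x $ i * cnj (g w $ i)))"
    unfolding L Bochner_Integration.integral_sum[OF integrable_mult_right[OF if_]] integral_mult_right_zero ..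
  also have "\<dots> = (\<Sum>i\<in>UNIV. of_real ?c * (LINT x|lborel. LINT w|lborel. E w x * f x $ i * cnj (g w $ i)))"
    using lborel_pair.Fubini_integral[OF int] by simp
  also have "\<dots> = (LINT x|lborel. cvec_inner (f x) (fourier_int (- \<sigma>) g x))"
    unfolding R Bochner_Integration.integral_sum[OF integrable_mult_right[OF ig]] integral_mult_right_zero ..
  finally show ?thesis .
qed

lemma fourier_sgn_adjoint:
  assumes \<sigma>: "\<bar>\<sigma>\<bar> = 1" shows "fourier_sgn \<sigma> f \<bullet> g = f \<bullet> fourier_sgn (- \<sigma>) g"
proof -
  have \<sigma>': "\<bar>- \<sigma>\<bar> = 1" using \<sigma> by simp
  have *: "fourier_l1 \<sigma> f \<bullet> g = f \<bullet> fourier_l1 (- \<sigma>) g" if fg: "f \<in> l1_l2" "g \<in> l1_l2" for f g :: "('a, 'b) l2"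
  proof -
    have "cinner_l2 (fourier_l1 \<sigma> f) g = (LINT w|lborel. cvec_inner (fourier_int \<sigma> (rep_l2 f) w) (rep_l2 g w))"
      unfolding cinner_l2_eq
    proof (rule integral_cong_AE)
      show "AE w in lborel. cvec_inner (rep_l2 (fourier_l1 \<sigma> f) w) (rep_l2 g w) = cvec_inner (fourier_int \<sigma> (rep_l2 f) w) (rep_l2 g w)"
        using rep_fourier_l1[OF \<sigma> fg(1)] by eventually_elim simp
    qed (unfold fourier_int_def, measurable)
    also have "\<dots> = (LINT x|lborel. cvec_inner (rep_l2 f x) (fourier_int (- \<sigma>) (rep_l2 g) x))"
      by (rule fourier_int_adjoint) (use fg in \<open>auto simp: l1_l2_def\<close>)
    also have "\<dots> = cinner_l2 f (fourier_l1 (- \<sigma>) g)"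
      unfolding cinner_l2_eq
    proof (rule integral_cong_AE)
      show "AE w in lborel. cvec_inner (rep_l2 f w) (fourier_int (- \<sigma>) (rep_l2 g) w) = cvec_inner (rep_l2 f w) (rep_l2 (fourier_l1 (- \<sigma>) g) w)"
        using rep_fourier_l1[OF \<sigma>' fg(2)] by eventually_elim simp
    qed (unfold fourier_int_def, measurable)
    finally show ?thesis unfolding Re_cinner_l2[symmetric] by simp
  qed
  show ?thesis
  proof (rule LIMSEQ_unique)
    show "(\<lambda>k. fourier_l1 \<sigma> (cutoff k f) \<bullet> cutoff k g) \<longlonglongrightarrow> fourier_sgn \<sigma> f \<bullet> g"
      by (intro tendsto_inner fourier_sgn_lim \<sigma> cutoff_tendsto)
    show "(\<lambda>k. fourier_l1 \<sigma> (cutoff k f) \<bullet> cutoff k g) \<longlonglongrightarrow> f \<bullet> fourier_sgn (- \<sigma>) g"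
      unfolding *[OF cutoff_l1_l2 cutoff_l1_l2] by (intro tendsto_inner fourier_sgn_lim[OF \<sigma>'] cutoff_tendsto)
  qed
qed

text \<open>An isometry whose adjoint is also isometric is unitary; this is where inversion comes from.\<close>

lemma fourier_sgn_inverse:
  assumes \<sigma>: "\<bar>\<sigma>\<bar> = 1" shows "fourier_sgn \<sigma> (fourier_sgn (- \<sigma>) g) = g"
proof -
  have \<sigma>': "\<bar>- \<sigma>\<bar> = 1" using \<sigma> by simp
  let ?h = "fourier_sgn \<sigma> (fourier_sgn (- \<sigma>) g)"
  have "?h \<bullet> g = g \<bullet> g" by (simp add: fourier_sgn_adjoint[OF \<sigma>] inner_fourier_sgn[OF \<sigma>'])
  moreover have "?h \<bullet> ?h = g \<bullet> g" by (simp add: inner_fourier_sgn[OF \<sigma>] inner_fourier_sgn[OF \<sigma>'])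
  ultimately have "(?h - g) \<bullet> (?h - g) = 0"
    by (simp add: inner_diff_left inner_diff_right inner_commute[of g ?h])
  then show ?thesis by simp
qed

text \<open>Discharges the definite description. Surjectivity comes from the inversion formula; any
  competitor agrees with the Fourier integral on \<open>l1_l2\<close> and is then determined by
  continuity.\<close>

lemma fourier_l2_eq: "fourier_l2 = (fourier_sgn (-1) :: ('s::finite, 'n::finite) l2 \<Rightarrow> _)"
  unfolding fourier_l2_def
proof (rule the_equality)
  let ?F = "fourier_sgn (-1) :: ('s, 'n) l2 \<Rightarrow> ('s, 'n) l2"
  have \<sigma>: "\<bar>- 1 :: real\<bar> = 1" by simp
  have "surj ?F"
    using fourier_sgn_inverse[OF \<sigma>] by (intro surjI[where f = "fourier_sgn 1"]) simp
  moreover have "AE \<omega> in lborel. rep_l2 (?F f) \<omega> = (2 * pi) powr (- real CARD('s) / 2) *\<^sub>R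
            (LINT x|lborel. exp (- \<i> * of_real (\<omega> \<bullet> x)) *s rep_l2 f x)" if "integrable lborel (rep_l2 f)" for f
    using that rep_fourier_l1[OF \<sigma>, of f] fourier_sgn_l1[OF \<sigma>, of f]
    by (simp add: l1_l2_def fourier_int_def)
  ultimately show "bounded_op ?F \<and> surj ?F
    \<and> (\<forall>f g. cinner_l2 (?F f) (?F g) = cinner_l2 f g)
    \<and> (\<forall>f. integrable lborel (rep_l2 f) \<longrightarrow>
        (AE \<omega> in lborel. rep_l2 (?F f) \<omega> =
          (2 * pi) powr (- real CARD('s) / 2) *\<^sub>R
            (LINT x|lborel. exp (- \<i> * of_real (\<omega> \<bullet> x)) *s rep_l2 f x)))"
    using bounded_op_fourier_sgn[OF \<sigma>] cinner_fourier_sgn[OF \<sigma>] by blast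
next
  fix F :: "('s, 'n) l2 \<Rightarrow> ('s, 'n) l2"
  have \<sigma>: "\<bar>- 1 :: real\<bar> = 1" by simp
  assume F: "bounded_op F \<and> surj F
    \<and> (\<forall>f g. cinner_l2 (F f) (F g) = cinner_l2 f g)
    \<and> (\<forall>f. integrable lborel (rep_l2 f) \<longrightarrow>
        (AE \<omega> in lborel. rep_l2 (F f) \<omega> =
          (2 * pi) powr (- real CARD('s) / 2) *\<^sub>R
            (LINT x|lborel. exp (- \<i> * of_real (\<omega> \<bullet> x)) *s rep_l2 f x)))"
  show "F = fourier_sgn (-1)"
  proof (rule bounded_linear_eq_l1_l2)
    show "bounded_linear F" using F by (simp add: bounded_op_def)
    show "bounded_linear (fourier_sgn (-1))" by (rule bounded_linear_fourier_sgn[OF \<sigma>])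
    fix f :: "('s, 'n) l2" assume f: "f \<in> l1_l2"
    then have "AE \<omega> in lborel. rep_l2 (F f) \<omega> = fourier_int (-1) (rep_l2 f) \<omega>"
      using F by (simp add: l1_l2_def fourier_int_def)
    with rep_fourier_l1[OF \<sigma> f] show "F f = fourier_sgn (-1) f"
      unfolding fourier_sgn_l1[OF \<sigma> f] by (intro l2_eqI) (auto elim: eventually_elim2)
  qed
qed

section \<open>Matrices\<close>

lemma measurable_matrix_vector_mult[measurable (raw)]:
  fixes M :: "'a \<Rightarrow> complex^'n^'m"
  assumes [measurable]: "M \<in> borel_measurable N" "f \<in> borel_measurable N"
  shows "(\<lambda>x. M x *v f x) \<in> borel_measurable N"
  unfolding matrix_vector_mult_def by measurable

lemma measurable_matrix_matrix_mult[measurable (raw)]: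
  fixes A :: "'a \<Rightarrow> complex^'n^'m" and B :: "'a \<Rightarrow> complex^'k^'n"
  assumes [measurable]: "A \<in> borel_measurable N" "B \<in> borel_measurable N"
  shows "(\<lambda>x. A x ** B x) \<in> borel_measurable N"
  unfolding matrix_matrix_mult_def by measurable

lemma measurable_conj_transpose[measurable (raw)]:
  fixes A :: "'a \<Rightarrow> complex^'n^'m"
  assumes [measurable]: "A \<in> borel_measurable N"
  shows "(\<lambda>x. conj_transpose (A x)) \<in> borel_measurable N"
  unfolding conj_transpose_def by measurable

lemma measurable_mat_block[measurable (raw)]:
  fixes A :: "'a \<Rightarrow> complex^'n^'m"
  assumes [measurable]: "A \<in> borel_measurable N"
  shows "(\<lambda>x. mat_block I J (A x)) \<in> borel_measurable N"
  unfolding mat_block_def by measurable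

text \<open>\<open>norm M\<close> is the Frobenius norm, so Cauchy--Schwarz applies row by
  row.\<close>

lemma norm_matrix_vector_mult: "norm (M *v v) \<le> norm M * norm (v :: complex^'n)"
proof (rule power2_le_imp_le)
  have "(norm (M *v v))\<^sup>2 = (\<Sum>i\<in>UNIV. (cmod ((M *v v) $ i))\<^sup>2)" by (rule norm_vec_sq)
  also have "\<dots> \<le> (\<Sum>i\<in>UNIV. (norm (M $ i) * norm v)\<^sup>2)"
  proof (intro sum_mono power_mono)
    fix i
    have "cmod ((M *v v) $ i) \<le> (\<Sum>j\<in>UNIV. cmod (M $ i $ j) * cmod (v $ j))"
      unfolding matrix_vector_mult_def by (simp, rule sum_norm_le) (simp add: norm_mult)
    also have "\<dots> \<le> norm (M $ i) * norm v"
      using L2_set_mult_ineq[of "\<lambda>j. cmod (M $ i $ j)" "\<lambda>j. cmod (v $ j)" UNIV]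
      by (simp add: norm_vec_def)
    finally show "cmod ((M *v v) $ i) \<le> norm (M $ i) * norm v" .
  qed simp
  also have "\<dots> = (norm M * norm v)\<^sup>2"
    by (simp add: power_mult_distrib sum_distrib_right[symmetric] norm_vec_def[of M] L2_set_def sum_nonneg)
  finally show "(norm (M *v v))\<^sup>2 \<le> (norm M * norm v)\<^sup>2" .
qed simp

lemma conj_transpose_conj_transpose[simp]: "conj_transpose (conj_transpose M) = M"
  by (simp add: conj_transpose_def vec_eq_iff)

lemma conj_transpose_mult: "conj_transpose (A ** B) = conj_transpose B ** conj_transpose A"
  by (simp add: conj_transpose_def matrix_matrix_mult_def vec_eq_iff mult.commute)

lemma conj_transpose_mat_1[simp]: "conj_transpose (mat 1) = mat 1"
  by (simp add: conj_transpose_def vec_eq_iff mat_def)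

lemma conj_transpose_mat_block: "conj_transpose (mat_block I J M) = mat_block J I (conj_transpose M)"
  by (simp add: conj_transpose_def mat_block_def vec_eq_iff)

lemma mat_block_UNIV[simp]: "mat_block UNIV UNIV M = M"
  by (simp add: mat_block_def vec_eq_iff)

lemma cvec_inner_mult_left: "cvec_inner (M *v u) v = cvec_inner u (conj_transpose M *v v)"
proof -
  have "cvec_inner (M *v u) v = (\<Sum>i\<in>UNIV. \<Sum>j\<in>UNIV. M $ i $ j * u $ j * cnj (v $ i))"
    by (simp add: cvec_inner_def matrix_vector_mult_def sum_distrib_right)
  also have "\<dots> = (\<Sum>j\<in>UNIV. \<Sum>i\<in>UNIV. M $ i $ j * u $ j * cnj (v $ i))" by (rule sum.swap)
  also have "\<dots> = cvec_inner u (conj_transpose M *v v)"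
    by (simp add: cvec_inner_def matrix_vector_mult_def conj_transpose_def sum_distrib_left mult_ac)
  finally show ?thesis .
qed

lemma mat_block_vec_outside: "i \<notin> I \<Longrightarrow> (mat_block I J M *v v) $ i = 0"
  by (simp add: mat_block_def matrix_vector_mult_def)

lemma cvec_inner_diff_right: "cvec_inner u (v - w) = cvec_inner u v - cvec_inner u w"
  by (simp add: cvec_inner_def algebra_simps sum_subtractf)

lemma bounded_linear_matrix_vector[simp]: "bounded_linear ((*v) (M :: complex^'n^'m))"
  by (rule matrix_vector_mul_bounded_linear)

lemma matrix_scaleR_vec: "(r *\<^sub>R M) *v v = r *\<^sub>R (M *v (v :: complex^'n))"
  by (simp add: vec_eq_iff matrix_vector_mult_def scaleR_sum_right)

lemma matrix_scaleR_left: "(r *\<^sub>R M) ** N = r *\<^sub>R (M ** (N :: complex^'n^'m))"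
  by (simp add: vec_eq_iff matrix_matrix_mult_def scaleR_sum_right)

lemma matrix_scaleR_right: "M ** (r *\<^sub>R N) = r *\<^sub>R (M ** (N :: complex^'n^'m))"
  by (simp add: vec_eq_iff matrix_matrix_mult_def scaleR_sum_right)

lemma matrix_axis_nth: "(M *v axis j 1) $ i = (M :: complex^'n^'m) $ i $ j"
  by (simp add: matrix_vector_mult_def axis_def if_distrib[of "\<lambda>x. _ * x"] cong: if_cong)

lemma norm_le_sum_norm: "norm (v :: complex^'n) \<le> (\<Sum>i\<in>UNIV. cmod (v $ i))"
  unfolding norm_vec_def by (rule L2_set_le_sum) simp

text \<open>Entries are recovered by testing with coordinate vectors. The constant is crude, but
  only boundedness is ever drawn from it.\<close>

lemma norm_matrix_le:
  assumes le: "\<And>v. norm (M *v v) \<le> k * norm (v :: complex^'n)"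
  shows "norm (M :: complex^'n^'m) \<le> real CARD('m) * (real CARD('n) * k)"
proof -
  have entry: "cmod (M $ i $ j) \<le> k" for i j
  proof -
    have "cmod (M $ i $ j) \<le> norm (M *v axis j 1)"
      unfolding matrix_axis_nth[symmetric] by (rule Finite_Cartesian_Product.norm_nth_le)
    also have "\<dots> \<le> k" using le[of "axis j 1"] by simp
    finally show ?thesis .
  qed
  have "norm M \<le> (\<Sum>i\<in>UNIV. norm (M $ i))" unfolding norm_vec_def by (rule L2_set_le_sum) simp
  also have "\<dots> \<le> (\<Sum>i\<in>UNIV. \<Sum>j\<in>UNIV. cmod (M $ i $ j))" by (intro sum_mono norm_le_sum_norm)
  also have "\<dots> \<le> (\<Sum>i\<in>(UNIV::'m set). \<Sum>j\<in>(UNIV::'n set). k)" by (intro sum_mono entry)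
  finally show ?thesis by simp
qed

section \<open>The matrix exponential\<close>

text \<open>Square matrices with the operator norm form a Banach algebra with \<open>norm 1 = 1\<close>, which makes
  the library exponential available.\<close>

typedef 'n sqmat = "UNIV :: (complex^'n^'n) set" by simp

setup_lifting type_definition_sqmat

instantiation sqmat :: (finite) real_vector
begin
lift_definition zero_sqmat :: "'a sqmat" is 0 .
lift_definition plus_sqmat :: "'a sqmat \<Rightarrow> 'a sqmat \<Rightarrow> 'a sqmat" is "(+)" .
lift_definition minus_sqmat :: "'a sqmat \<Rightarrow> 'a sqmat \<Rightarrow> 'a sqmat" is "(-)" .
lift_definition uminus_sqmat :: "'a sqmat \<Rightarrow> 'a sqmat" is uminus .
lift_definition scaleR_sqmat :: "real \<Rightarrow> 'a sqmat \<Rightarrow> 'a sqmat" is "(*\<^sub>R)" .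
instance by standard (transfer; simp add: algebra_simps)+
end

lemma norm_nth_le_onorm: "cmod (M $ i $ j) \<le> onorm ((*v) (M :: complex^'n^'m))"
proof -
  have "cmod (M $ i $ j) \<le> norm (M *v axis j 1)"
    unfolding matrix_axis_nth[symmetric] by (rule Finite_Cartesian_Product.norm_nth_le)
  also have "\<dots> \<le> onorm ((*v) M) * norm (axis j (1::complex) :: complex^'n)"
    by (rule onorm) simp
  finally show ?thesis by simp
qed

instantiation sqmat :: (finite) real_normed_vector
begin
lift_definition norm_sqmat :: "'a sqmat \<Rightarrow> real" is "\<lambda>M. onorm ((*v) M)" .
definition sgn_sqmat :: "'a sqmat \<Rightarrow> 'a sqmat" where "sgn_sqmat M = M /\<^sub>R norm M"
definition dist_sqmat :: "'a sqmat \<Rightarrow> 'a sqmat \<Rightarrow> real" where "dist_sqmat M N = norm (M - N)"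
definition uniformity_sqmat :: "('a sqmat \<times> 'a sqmat) filter" where
  "uniformity_sqmat = (INF e\<in>{0<..}. principal {(M, N). dist M N < e})"
definition open_sqmat :: "'a sqmat set \<Rightarrow> bool" where
  "open_sqmat U \<longleftrightarrow> (\<forall>M\<in>U. eventually (\<lambda>(M', N). M' = M \<longrightarrow> N \<in> U) uniformity)"
instance
proof
  fix M N :: "'a sqmat" and r :: real and U :: "'a sqmat set"
  show "dist M N = norm (M - N)" by (rule dist_sqmat_def)
  show "sgn M = M /\<^sub>R norm M" by (rule sgn_sqmat_def)
  show "uniformity = (INF e\<in>{0<..}. principal {(M, N :: 'a sqmat). dist M N < e})"
    by (rule uniformity_sqmat_def)
  show "open U \<longleftrightarrow> (\<forall>M\<in>U. eventually (\<lambda>(M', N). M' = M \<longrightarrow> N \<in> U) uniformity)"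
    by (rule open_sqmat_def)
  show "norm M = 0 \<longleftrightarrow> M = 0"
  proof transfer
    fix M :: "complex^'a^'a"
    show "onorm ((*v) M) = 0 \<longleftrightarrow> M = 0"
    proof
      assume "onorm ((*v) M) = 0"
      then have "cmod (M $ i $ j) \<le> 0" for i j using norm_nth_le_onorm[of M i j] by simp
      then show "M = 0" by (simp add: vec_eq_iff)
    next
      assume "M = 0"
      moreover have "(*v) (0 :: complex^'a^'a) = (\<lambda>v. 0)" by auto
      ultimately show "onorm ((*v) M) = 0" by (simp add: onorm_zero)
    qed
  qed
  show "norm (M + N) \<le> norm M + norm N"
  proof transfer
    fix M N :: "complex^'a^'a"
    have "(*v) (M + N) = (\<lambda>v. M *v v + N *v v)" by (auto simp: matrix_vector_mult_add_rdistrib)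
    then show "onorm ((*v) (M + N)) \<le> onorm ((*v) M) + onorm ((*v) N)"
      using onorm_triangle[of "(*v) M" "(*v) N"] by simp
  qed
  show "norm (r *\<^sub>R M) = \<bar>r\<bar> * norm M"
  proof transfer
    fix M :: "complex^'a^'a" and r :: real
    have "(*v) (r *\<^sub>R M) = (\<lambda>v. r *\<^sub>R (M *v v))" by (auto simp: matrix_scaleR_vec)
    then show "onorm ((*v) (r *\<^sub>R M)) = \<bar>r\<bar> * onorm ((*v) M)"
      using onorm_scaleR[of "(*v) M" r] by simp
  qed
qed
end

instantiation sqmat :: (finite) real_normed_algebra_1
begin
lift_definition one_sqmat :: "'a sqmat" is "mat 1" .
lift_definition times_sqmat :: "'a sqmat \<Rightarrow> 'a sqmat \<Rightarrow> 'a sqmat" is "(**)" .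
instance
proof
  fix M N L :: "'a sqmat" and r :: real
  show "M * N * L = M * (N * L)" by transfer (simp add: matrix_mul_assoc)
  show "(M + N) * L = M * L + N * L" "L * (M + N) = L * M + L * N"
    by (transfer, simp add: vec_eq_iff matrix_matrix_mult_def algebra_simps sum.distrib)+
  show "(r *\<^sub>R M) * N = r *\<^sub>R (M * N)" by transfer (rule matrix_scaleR_left)
  show "M * (r *\<^sub>R N) = r *\<^sub>R (M * N)" by transfer (rule matrix_scaleR_right)
  show "1 * M = M" "M * 1 = M" by (transfer, simp)+
  show "(0 :: 'a sqmat) \<noteq> 1" by transfer (auto simp: vec_eq_iff mat_def)
  show "norm (M * N) \<le> norm M * norm N"
  proof transfer
    fix M N :: "complex^'a^'a"
    have "(*v) (M ** N) = (*v) M \<circ> (*v) N" by (auto simp: matrix_vector_mul_assoc)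
    then show "onorm ((*v) (M ** N)) \<le> onorm ((*v) M) * onorm ((*v) N)"
      using onorm_compose[of "(*v) M" "(*v) N"] by simp
  qed
  show "norm (1 :: 'a sqmat) = 1"
  proof transfer
    have "(*v) (mat 1 :: complex^'a^'a) = (\<lambda>v. v)" by auto
    then show "onorm ((*v) (mat 1 :: complex^'a^'a)) = 1" by (simp add: onorm_id)
  qed
qed
end

lemma bounded_linear_Rep_sqmat_vec: "bounded_linear (\<lambda>M. Rep_sqmat M *v v)"
proof (rule bounded_linear_intro[where K = "norm v"])
  show "Rep_sqmat (M + N) *v v = Rep_sqmat M *v v + Rep_sqmat N *v v" for M N
    by transfer (simp add: matrix_vector_mult_add_rdistrib)
  show "Rep_sqmat (r *\<^sub>R M) *v v = r *\<^sub>R (Rep_sqmat M *v v)" for r M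
    by transfer (simp add: matrix_scaleR_vec)
  show "norm (Rep_sqmat M *v v) \<le> norm M * norm v" for M
    by transfer (rule onorm, simp)
qed

lemma onorm_le_entries: "onorm ((*v) (M :: complex^'n^'m)) \<le> (\<Sum>i\<in>UNIV. \<Sum>j\<in>UNIV. cmod (M $ i $ j))"
proof (rule onorm_bound)
  fix v :: "complex^'n"
  have "norm (M *v v) \<le> (\<Sum>i\<in>UNIV. cmod ((M *v v) $ i))" by (rule norm_le_sum_norm)
  also have "\<dots> \<le> (\<Sum>i\<in>UNIV. (\<Sum>j\<in>UNIV. cmod (M $ i $ j)) * norm v)"
  proof (rule sum_mono)
    fix i
    have "cmod ((M *v v) $ i) \<le> (\<Sum>j\<in>UNIV. cmod (M $ i $ j * v $ j))"
      unfolding matrix_vector_mult_def vec_lambda_beta by (rule norm_sum)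
    also have "\<dots> \<le> (\<Sum>j\<in>UNIV. cmod (M $ i $ j) * norm v)"
      by (intro sum_mono) (simp add: norm_mult mult_left_mono Finite_Cartesian_Product.norm_nth_le)
    finally show "cmod ((M *v v) $ i) \<le> (\<Sum>j\<in>UNIV. cmod (M $ i $ j)) * norm v" by (simp add: sum_distrib_right)
  qed
  finally show "norm (M *v v) \<le> (\<Sum>i\<in>UNIV. \<Sum>j\<in>UNIV. cmod (M $ i $ j)) * norm v" by (simp add: sum_distrib_right)
qed (simp add: sum_nonneg)

text \<open>Entries and operator norm control each other through \<open>norm_nth_le_onorm\<close>
  and \<open>onorm_le_entries\<close>, so the limit can be taken entrywise.\<close>

instance sqmat :: (finite) banach
proof
  fix X :: "nat \<Rightarrow> 'a sqmat" assume X: "Cauchy X"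
  have "convergent (\<lambda>n. Rep_sqmat (X n) $ i $ j)" for i j
  proof (rule Cauchy_convergent, rule metric_CauchyI)
    fix e :: real assume "e > 0"
    then obtain N where N: "\<And>m n. m \<ge> N \<Longrightarrow> n \<ge> N \<Longrightarrow> dist (X m) (X n) < e" using metric_CauchyD[OF X] by blast
    have "dist (Rep_sqmat (X m) $ i $ j) (Rep_sqmat (X n) $ i $ j) \<le> dist (X m) (X n)" for m n
    proof -
      have "cmod (Rep_sqmat (X m - X n) $ i $ j) \<le> norm (X m - X n)"
        by transfer (rule norm_nth_le_onorm)
      then show ?thesis by (simp add: dist_norm minus_sqmat.rep_eq)
    qed
    with N show "\<exists>M. \<forall>m\<ge>M. \<forall>n\<ge>M. dist (Rep_sqmat (X m) $ i $ j) (Rep_sqmat (X n) $ i $ j) < e"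
      using order_le_less_trans by blast
  qed
  then obtain L where L: "\<And>i j. (\<lambda>n. Rep_sqmat (X n) $ i $ j) \<longlonglongrightarrow> L i j"
    unfolding convergent_def by metis
  define M where "M = Abs_sqmat (\<chi> i j. L i j)"
  have M: "Rep_sqmat M $ i $ j = L i j" for i j by (simp add: M_def Abs_sqmat_inverse)
  have "(\<lambda>n. norm (X n - M)) \<longlonglongrightarrow> 0"
  proof (rule tendsto_sandwich[OF _ _ tendsto_const])
    have "(\<lambda>n. \<Sum>i\<in>UNIV. \<Sum>j\<in>UNIV. cmod (Rep_sqmat (X n) $ i $ j - L i j)) \<longlonglongrightarrow> (\<Sum>i\<in>(UNIV::'a set). \<Sum>j\<in>(UNIV::'a set). cmod (L i j - L i j))"
      by (intro tendsto_intros L)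
    then show "(\<lambda>n. \<Sum>i\<in>UNIV. \<Sum>j\<in>UNIV. cmod (Rep_sqmat (X n) $ i $ j - L i j)) \<longlonglongrightarrow> 0" by simp
    have "norm (X n - M) \<le> (\<Sum>i\<in>UNIV. \<Sum>j\<in>UNIV. cmod (Rep_sqmat (X n) $ i $ j - L i j))" for n
      using onorm_le_entries[of "Rep_sqmat (X n - M)"]
      by (simp add: norm_sqmat.rep_eq minus_sqmat.rep_eq M)
    then show "\<forall>\<^sub>F n in sequentially. norm (X n - M) \<le> (\<Sum>i\<in>UNIV. \<Sum>j\<in>UNIV. cmod (Rep_sqmat (X n) $ i $ j - L i j))" by simp
  qed simp
  then have "X \<longlonglongrightarrow> M" by (simp add: LIM_zero_iff tendsto_norm_zero_iff)
  then show "convergent X" by (rule convergentI)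
qed

lemma bounded_linear_Rep_sqmat: "bounded_linear (Rep_sqmat :: 'n::finite sqmat \<Rightarrow> _)"
proof (rule bounded_linear_intro[where K = "real CARD('n) * real CARD('n)"])
  show "Rep_sqmat (M + N) = Rep_sqmat M + Rep_sqmat N" for M N :: "'n sqmat" by transfer simp
  show "Rep_sqmat (r *\<^sub>R M) = r *\<^sub>R Rep_sqmat M" for r and M :: "'n sqmat" by transfer simp
  show "norm (Rep_sqmat M) \<le> norm M * (real CARD('n) * real CARD('n))" for M :: "'n sqmat"
  proof transfer
    fix M :: "complex^'n^'n"
    have "norm M \<le> real CARD('n) * (real CARD('n) * onorm ((*v) M))"
      by (intro norm_matrix_le onorm) simp
    then show "norm M \<le> onorm ((*v) M) * (real CARD('n) * real CARD('n))" by (simp add: mult_ac)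
  qed
qed

text \<open>The bounded linear map \<open>Rep_sqmat\<close> carries the exponential series of the
  Banach algebra to the series that defines \<open>mat_exp\<close>.\<close>

lemma mat_exp_sums: "(\<lambda>k. ((**) M ^^ k) (mat 1) /\<^sub>R fact k) sums Rep_sqmat (exp (Abs_sqmat M))"
proof -
  have p: "Rep_sqmat (Abs_sqmat M ^ k) = ((**) M ^^ k) (mat 1)" for k
    by (induction k) (simp_all add: one_sqmat.rep_eq times_sqmat.rep_eq Abs_sqmat_inverse)
  show ?thesis
    using bounded_linear.sums[OF bounded_linear_Rep_sqmat exp_converges[of "Abs_sqmat M"]]
    by (simp add: linear_cmul[OF bounded_linear.linear[OF bounded_linear_Rep_sqmat]] p)
qed

lemma mat_exp_eq: "mat_exp M = Rep_sqmat (exp (Abs_sqmat M))"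
  unfolding mat_exp_def using mat_exp_sums[of M] by (rule sums_unique[symmetric])

lemma Abs_sqmat_scaleR: "Abs_sqmat (r *\<^sub>R M) = r *\<^sub>R Abs_sqmat M"
  by (metis Abs_sqmat_inverse Rep_sqmat_inverse UNIV_I scaleR_sqmat.rep_eq)

lemma mat_exp_0: "mat_exp (0 *\<^sub>R M) = mat 1"
  unfolding mat_exp_eq Abs_sqmat_scaleR by (simp add: one_sqmat.rep_eq)

lemma mat_exp_add: "mat_exp ((s + t) *\<^sub>R M) = mat_exp (s *\<^sub>R M) ** mat_exp (t *\<^sub>R M)"
proof -
  have "exp ((s + t) *\<^sub>R Abs_sqmat M) = exp (s *\<^sub>R Abs_sqmat M) * exp (t *\<^sub>R Abs_sqmat M)"
    by (simp add: scaleR_add_left exp_add_commuting)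
  then show ?thesis by (simp add: mat_exp_eq Abs_sqmat_scaleR times_sqmat.rep_eq)
qed

lemma mat_exp_vec_derivative:
  "((\<lambda>t. mat_exp (t *\<^sub>R M) *v v) has_vector_derivative mat_exp (t *\<^sub>R M) *v (M *v v)) (at t within S)"
  "((\<lambda>t. mat_exp (t *\<^sub>R M) *v v) has_vector_derivative M *v (mat_exp (t *\<^sub>R M) *v v)) (at t within S)"
proof -
  note d = bounded_linear.has_vector_derivative[OF bounded_linear_Rep_sqmat_vec[of v]]
  show "((\<lambda>t. mat_exp (t *\<^sub>R M) *v v) has_vector_derivative mat_exp (t *\<^sub>R M) *v (M *v v)) (at t within S)"
    using d[OF exp_scaleR_has_vector_derivative_right[where A = "Abs_sqmat M"], of t S]
    by (simp add: mat_exp_eq Abs_sqmat_scaleR times_sqmat.rep_eq Abs_sqmat_inverse matrix_vector_mul_assoc)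
  show "((\<lambda>t. mat_exp (t *\<^sub>R M) *v v) has_vector_derivative M *v (mat_exp (t *\<^sub>R M) *v v)) (at t within S)"
    using d[OF has_vector_derivative_at_within[OF exp_scaleR_has_vector_derivative_left[where A = "Abs_sqmat M"]], of t S]
    by (simp add: mat_exp_eq Abs_sqmat_scaleR times_sqmat.rep_eq Abs_sqmat_inverse matrix_vector_mul_assoc)
qed

lemma measurable_mat_exp[measurable (raw)]:
  fixes M :: "'a \<Rightarrow> complex^'n^'n"
  assumes [measurable]: "M \<in> borel_measurable N"
  shows "(\<lambda>x. mat_exp (M x)) \<in> borel_measurable N"
proof -
  have mult: "(\<lambda>x. A x ** B x) \<in> borel_measurable N" if [measurable]: "A \<in> borel_measurable N" "B \<in> borel_measurable N"
    for A B :: "'a \<Rightarrow> complex^'n^'n"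
    unfolding matrix_matrix_mult_def by measurable
  have [measurable]: "(\<lambda>x. ((**) (M x) ^^ k) (mat 1)) \<in> borel_measurable N" for k
    by (induction k) (simp_all add: mult)
  show ?thesis unfolding mat_exp_def by measurable
qed

text \<open>\<open>P\<close> intertwines \<open>A\<close> with \<open>P ** A ** R\<close>, and an
  intertwining relation passes to powers and to power series.\<close>

lemma mat_exp_similar:
  fixes P R A :: "complex^'n^'n"
  assumes "R ** P = mat 1"
  shows "mat_exp (t *\<^sub>R (P ** A ** R)) ** P = P ** mat_exp (t *\<^sub>R A)"
proof -
  define X where "X = Abs_sqmat (t *\<^sub>R A)"
  define Y where "Y = Abs_sqmat (t *\<^sub>R (P ** A ** R))"
  define p where "p = Abs_sqmat P"
  have "(P ** A ** R) ** P = P ** A" by (simp add: matrix_mul_assoc[symmetric] assms)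
  then have "Y * p = p * X"
    by (simp add: X_def Y_def p_def times_sqmat.abs_eq matrix_scaleR_left matrix_scaleR_right)
  then have pow: "Y ^ k * p = p * X ^ k" for k
    by (induction k) (simp_all add: mult.assoc power_commutes, metis mult.assoc power_commutes)
  have "(\<lambda>k. (Y ^ k /\<^sub>R fact k) * p) sums (exp Y * p)" by (intro sums_mult2 exp_converges)
  moreover have "(\<lambda>k. p * (X ^ k /\<^sub>R fact k)) sums (p * exp X)" by (intro sums_mult exp_converges)
  moreover have "(Y ^ k /\<^sub>R fact k) * p = p * (X ^ k /\<^sub>R fact k)" for k by (simp add: pow)
  ultimately have "exp Y * p = p * exp X" using sums_unique2 by simp
  then have "Rep_sqmat (exp Y * p) = Rep_sqmat (p * exp X)" by simp
  then show ?thesis by (simp add: times_sqmat.rep_eq X_def Y_def p_def mat_exp_eq Abs_sqmat_inverse)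
qed

text \<open>Along an orbit \<open>x\<close> the squared norm has derivative
  \<open>2 * ((M *v x) \<bullet> x)\<close>, which dissipativity makes nonpositive.\<close>

lemma mat_exp_contraction:
  assumes diss: "\<And>v. (M *v v) \<bullet> v \<le> 0" and t: "0 \<le> t"
  shows "norm (mat_exp (t *\<^sub>R M) *v v) \<le> norm v"
proof -
  let ?x = "\<lambda>t. mat_exp (t *\<^sub>R M) *v v"
  have "?x t \<bullet> ?x t \<le> ?x 0 \<bullet> ?x 0"
  proof (rule DERIV_nonpos_imp_nonincreasing[OF t])
    fix s
    have x: "(?x has_derivative (\<lambda>h. h *\<^sub>R (M *v ?x s))) (at s)"
      using mat_exp_vec_derivative(2)[of M v s UNIV] by (simp add: has_vector_derivative_def)
    have "((\<lambda>t. ?x t \<bullet> ?x t) has_derivative (\<lambda>h. ?x s \<bullet> (h *\<^sub>R (M *v ?x s)) + (h *\<^sub>R (M *v ?x s)) \<bullet> ?x s)) (at s)"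
      by (rule has_derivative_inner[OF x x])
    then have "((\<lambda>t. ?x t \<bullet> ?x t) has_real_derivative 2 * ((M *v ?x s) \<bullet> ?x s)) (at s)"
      unfolding has_field_derivative_def
      by (rule has_derivative_eq_rhs) (auto simp: inner_commute fun_eq_iff)
    moreover have "2 * ((M *v ?x s) \<bullet> ?x s) \<le> 0" using diss[of "?x s"] by simp
    ultimately show "\<exists>y. ((\<lambda>t. ?x t \<bullet> ?x t) has_real_derivative y) (at s) \<and> y \<le> 0" by blast
  qed
  then show ?thesis using mat_exp_0[of M] by (simp add: norm_le)
qed

text \<open>Mean value inequality. The derivative is taken in the form with \<open>M\<close> applied
  first, since the contraction bound then leaves \<open>norm (M *v v)\<close>. This estimate
  dominates the difference quotients when the generator is determined.\<close>

lemma mat_exp_difference: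
  assumes diss: "\<And>v. (M *v v) \<bullet> v \<le> 0" and t: "0 \<le> t"
  shows "norm (mat_exp (t *\<^sub>R M) *v v - v) \<le> t * norm (M *v v)"
proof -
  let ?x = "\<lambda>t. mat_exp (t *\<^sub>R M) *v v"
  have "norm (?x t - ?x 0) \<le> norm (M *v v) * norm (t - 0)"
  proof (rule differentiable_bound[of "{0..t}"])
    fix s assume s: "s \<in> {0..t}"
    show "(?x has_derivative (\<lambda>h. h *\<^sub>R (mat_exp (s *\<^sub>R M) *v (M *v v)))) (at s within {0..t})"
      using mat_exp_vec_derivative(1)[of M v s "{0..t}"] by (simp add: has_vector_derivative_def)
    show "onorm (\<lambda>h. h *\<^sub>R (mat_exp (s *\<^sub>R M) *v (M *v v))) \<le> norm (M *v v)"
    proof (rule onorm_le)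
      fix h :: real
      have "\<bar>h\<bar> * norm (mat_exp (s *\<^sub>R M) *v (M *v v)) \<le> \<bar>h\<bar> * norm (M *v v)"
        using s by (intro mult_left_mono mat_exp_contraction diss) auto
      then show "norm (h *\<^sub>R (mat_exp (s *\<^sub>R M) *v (M *v v))) \<le> norm (M *v v) * norm h"
        by (simp add: mult.commute)
    qed
  qed (use t in auto)
  then show ?thesis using t mat_exp_0[of M] by (simp add: mult.commute)
qed

section \<open>Multiplication operators and symbols\<close>

text \<open>Meaningful only where the product is square-integrable; \<^const>\<open>abs_l2\<close> is unspecified elsewhere.\<close>

definition mult_l2 :: "(real^'s::finite \<Rightarrow> complex^'n^'m) \<Rightarrow> ('s, 'n::finite) l2 \<Rightarrow> ('s, 'm::finite) l2" where
  "mult_l2 M f = abs_l2 (\<lambda>x. M x *v rep_l2 f x)"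

definition bounded_symbol :: "(real^'s::finite \<Rightarrow> complex^'n^'m) \<Rightarrow> bool" where
  "bounded_symbol M \<longleftrightarrow> M \<in> borel_measurable borel \<and> (\<exists>K. \<forall>x v. norm (M x *v v) \<le> K * norm v)"

lemma bounded_symbol_meas: "bounded_symbol M \<Longrightarrow> M \<in> borel_measurable borel"
  by (simp add: bounded_symbol_def)

lemma bounded_symbolE:
  assumes "bounded_symbol M"
  obtains K where "K \<ge> 0" "\<And>x v. norm (M x *v v) \<le> K * norm v"
proof -
  from assms obtain K where K: "\<And>x v. norm (M x *v v) \<le> K * norm v" by (auto simp: bounded_symbol_def)
  have "norm (M x *v v) \<le> max K 0 * norm v" for x v
    using K[of x v] mult_right_mono[of K "max K 0" "norm v"] by simp
  then show ?thesis using that[of "max K 0"] by simp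
qed

lemma bounded_symbol_const: "bounded_symbol (\<lambda>_. M)"
  using norm_matrix_vector_mult[of M] by (auto simp: bounded_symbol_def)

lemma bounded_symbol_mult:
  assumes "bounded_symbol M" "bounded_symbol N" shows "bounded_symbol (\<lambda>x. M x ** N x)"
proof -
  obtain K where K: "K \<ge> 0" "\<And>x v. norm (M x *v v) \<le> K * norm v" using bounded_symbolE[OF assms(1)] by blast
  obtain L where L: "L \<ge> 0" "\<And>x v. norm (N x *v v) \<le> L * norm v" using bounded_symbolE[OF assms(2)] by blast
  have "norm ((M x ** N x) *v v) \<le> (K * L) * norm v" for x v
  proof -
    have "norm ((M x ** N x) *v v) = norm (M x *v (N x *v v))" by (simp add: matrix_vector_mul_assoc)
    also have "\<dots> \<le> K * norm (N x *v v)" by (rule K)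
    also have "\<dots> \<le> K * (L * norm v)" by (intro mult_left_mono L K)
    finally show ?thesis by (simp add: mult.assoc)
  qed
  then show ?thesis using assms by (auto simp: bounded_symbol_def)
qed

lemma bounded_symbol_conj_transpose:
  assumes "bounded_symbol M" shows "bounded_symbol (\<lambda>x. conj_transpose (M x))"
proof -
  obtain K where K: "K \<ge> 0" "\<And>x v. norm (M x *v v) \<le> K * norm v" using bounded_symbolE[OF assms] by blast
  have "norm (conj_transpose (M x) *v v) \<le> K * norm v" for x v
  proof -
    let ?w = "conj_transpose (M x) *v v"
    have "(norm ?w)\<^sup>2 = cmod (cvec_inner ?w ?w)" by (simp add: cvec_inner_self del: of_real_power)
    also have "\<dots> = cmod (cvec_inner (M x *v ?w) v)" by (simp add: cvec_inner_mult_left)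
    also have "\<dots> \<le> norm (M x *v ?w) * norm v" by (rule cmod_cvec_inner)
    also have "\<dots> \<le> K * norm ?w * norm v" by (intro mult_right_mono K) simp
    finally have "norm ?w * norm ?w \<le> norm ?w * (K * norm v)" by (simp add: power2_eq_square mult_ac)
    then show ?thesis using K by (cases "norm ?w = 0") (auto simp: mult_le_cancel_left)
  qed
  then show ?thesis using assms by (auto simp: bounded_symbol_def)
qed

lemma sq_int_mult_bounded:
  assumes "bounded_symbol M" "sq_int f" shows "sq_int (\<lambda>x. M x *v f x)"
proof -
  obtain K where K: "K \<ge> 0" "\<And>x v. norm (M x *v v) \<le> K * norm v" using bounded_symbolE[OF assms(1)] by blast
  have [measurable]: "M \<in> borel_measurable borel" "f \<in> borel_measurable borel"
    using assms by (auto simp: bounded_symbol_def sq_int_def)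
  show ?thesis
  proof (rule sq_int_bound[where h = "\<lambda>x. K\<^sup>2 * (norm (f x))\<^sup>2"])
    show "AE x in lborel. (norm (M x *v f x))\<^sup>2 \<le> K\<^sup>2 * (norm (f x))\<^sup>2"
      using power_mono[OF K(2) norm_ge_zero, of _ _ 2] by (simp add: power_mult_distrib)
  qed (use assms in \<open>auto simp: sq_int_def\<close>)
qed

lemma rep_mult_l2:
  assumes "bounded_symbol M"
  shows "AE x in lborel. rep_l2 (mult_l2 M f) x = M x *v rep_l2 f x"
  unfolding mult_l2_def by (rule rep_abs_l2[OF sq_int_mult_bounded[OF assms sq_int_rep]])

lemma bounded_op_mult_l2:
  assumes M: "bounded_symbol M" shows "bounded_op (mult_l2 M)"
proof -
  obtain K where K: "K \<ge> 0" "\<And>x v. norm (M x *v v) \<le> K * norm v" using bounded_symbolE[OF M] by blast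
  note rep = rep_mult_l2[OF M]
  have add: "mult_l2 M (f + g) = mult_l2 M f + mult_l2 M g" for f g
    by (rule l2_eqI) (use rep[of "f + g"] rep[of f] rep[of g] rep_l2_add[of f g] rep_l2_add[of "mult_l2 M f" "mult_l2 M g"]
      in \<open>eventually_elim, simp add: matrix_vector_right_distrib\<close>)
  have scale: "mult_l2 M (scaleC_l2 c f) = scaleC_l2 c (mult_l2 M f)" for c f
    by (rule l2_eqI) (use rep[of "scaleC_l2 c f"] rep[of f] rep_l2_scaleC[of c f] rep_l2_scaleC[of c "mult_l2 M f"]
      in \<open>eventually_elim, simp add: vector_scalar_commute\<close>)
  have norm: "norm (mult_l2 M f) \<le> norm f * K" for f
  proof (rule power2_le_imp_le)
    have "(norm (mult_l2 M f))\<^sup>2 \<le> (LINT x|lborel. K\<^sup>2 * (norm (rep_l2 f x))\<^sup>2)"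
      unfolding norm_l2_sq
    proof (rule integral_mono_AE)
      show "AE x in lborel. (norm (rep_l2 (mult_l2 M f) x))\<^sup>2 \<le> K\<^sup>2 * (norm (rep_l2 f x))\<^sup>2"
        using rep[of f] by eventually_elim (use power_mono[OF K(2) norm_ge_zero, of _ _ 2] in \<open>simp add: power_mult_distrib\<close>)
    qed (use sq_int_rep in \<open>auto simp: sq_int_def\<close>)
    then show "(norm (mult_l2 M f))\<^sup>2 \<le> (norm f * K)\<^sup>2"
      by (simp add: power_mult_distrib norm_l2_sq mult.commute)
  qed (use K in simp)
  have "bounded_linear (mult_l2 M)"
  proof (rule bounded_linear_intro[OF add _ norm])
    show "mult_l2 M (r *\<^sub>R f) = r *\<^sub>R mult_l2 M f" for r f
      using scale[of "of_real r" f] by (simp add: scaleC_l2_of_real)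
  qed
  then show ?thesis using scale by (simp add: bounded_op_def)
qed

lemma bounded_opD: "bounded_op F \<Longrightarrow> bounded_linear F" "bounded_op F \<Longrightarrow> F (scaleC_l2 c f) = scaleC_l2 c (F f)"
  by (auto simp: bounded_op_def)

lemma bounded_op_compose: "bounded_op F \<Longrightarrow> bounded_op G \<Longrightarrow> bounded_op (\<lambda>f. F (G f))"
  by (auto simp: bounded_op_def intro: bounded_linear_compose)

definition inv_fourier :: "('s::finite, 'n::finite) l2 \<Rightarrow> ('s, 'n) l2" where
  "inv_fourier = fourier_sgn 1"

lemma fourier_inv_fourier[simp]: "fourier_l2 (inv_fourier f) = f"
  using fourier_sgn_inverse[of "-1" f] by (simp add: fourier_l2_eq inv_fourier_def)

lemma inv_fourier_fourier[simp]: "inv_fourier (fourier_l2 f) = f"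
  using fourier_sgn_inverse[of 1 f] by (simp add: fourier_l2_eq inv_fourier_def)

lemma bounded_op_fourier: "bounded_op fourier_l2"
  by (simp add: fourier_l2_eq bounded_op_fourier_sgn)

lemma bounded_op_inv_fourier: "bounded_op inv_fourier"
  by (simp add: inv_fourier_def bounded_op_fourier_sgn)

lemma cinner_fourier: "cinner_l2 (fourier_l2 f) (fourier_l2 g) = cinner_l2 f g"
  by (simp add: fourier_l2_eq cinner_fourier_sgn)

lemma norm_fourier: "norm (fourier_l2 f) = norm f"
  by (simp add: fourier_l2_eq norm_fourier_sgn)

lemma fourier_add: "fourier_l2 (f + g) = fourier_l2 f + fourier_l2 g"
  and fourier_diff: "fourier_l2 (f - g) = fourier_l2 f - fourier_l2 g"
  and fourier_minus: "fourier_l2 (- f) = - fourier_l2 f"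
  and fourier_scaleR: "fourier_l2 (r *\<^sub>R f) = r *\<^sub>R fourier_l2 f"
  and fourier_zero: "fourier_l2 0 = 0"
  by (rule linear_simps[OF bounded_opD(1)[OF bounded_op_fourier]])+

lemma fourier_scaleC: "fourier_l2 (scaleC_l2 c f) = scaleC_l2 c (fourier_l2 f)"
  using bounded_opD(2)[OF bounded_op_fourier] .

lemma rep_fourier_l1_l2: "f \<in> l1_l2 \<Longrightarrow> AE w in lborel. rep_l2 (fourier_l2 f) w = fourier_int (-1) (rep_l2 f) w"
  using rep_fourier_l1[of "-1" f] fourier_sgn_l1[of "-1" f] by (simp add: fourier_l2_eq)

text \<open>Applied to coordinate projections in \<open>l2_on_fourier\<close>; this is why the
  Fourier transform respects the partition of the state vector.\<close>

lemma fourier_const_matrix: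
  fixes f :: "('s::finite, 'n::finite) l2" and M :: "complex^'n^'m::finite"
  shows "fourier_l2 (mult_l2 (\<lambda>_. M) f) = mult_l2 (\<lambda>_. M) (fourier_l2 f)"
proof -
  note M = bounded_symbol_const[of M]
  have key: "fourier_l2 (mult_l2 (\<lambda>_. M) f) = mult_l2 (\<lambda>_. M) (fourier_l2 f)"
    if f: "f \<in> l1_l2" for f :: "('s, 'n) l2"
  proof -
    have f1: "integrable lborel (rep_l2 f)" using f by (simp add: l1_l2_def)
    have Mf: "mult_l2 (\<lambda>_. M) f \<in> l1_l2"
      by (rule l1_l2_cong[OF _ rep_mult_l2[OF M]]) (rule integrable_bounded_linear[OF _ f1], simp)
    have "fourier_int (-1) (rep_l2 (mult_l2 (\<lambda>_. M) f)) = fourier_int (-1) (\<lambda>x. M *v rep_l2 f x)"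
      by (rule fourier_int_cong_AE) (use rep_mult_l2[OF M] in auto)
    also have "\<dots> = (\<lambda>w. M *v fourier_int (-1) (rep_l2 f) w)"
      by (rule ext) (rule fourier_int_mult_vec[OF f1])
    finally have *: "fourier_int (-1) (rep_l2 (mult_l2 (\<lambda>_. M) f)) = (\<lambda>w. M *v fourier_int (-1) (rep_l2 f) w)" .
    show ?thesis
      by (rule l2_eqI) (use rep_fourier_l1_l2[OF Mf] rep_fourier_l1_l2[OF f] rep_mult_l2[OF M, of "fourier_l2 f"]
        in \<open>eventually_elim, simp add: *\<close>)
  qed
  show ?thesis
    by (rule fun_cong[OF bounded_linear_eq_l1_l2[OF
          bounded_opD(1)[OF bounded_op_compose[OF bounded_op_fourier bounded_op_mult_l2[OF M]]]
          bounded_opD(1)[OF bounded_op_compose[OF bounded_op_mult_l2[OF M] bounded_op_fourier]] key]])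
qed

section \<open>Translations and symbols on the Fourier side\<close>

definition phase :: "real^'s::finite \<Rightarrow> real^'s \<Rightarrow> complex^'n^'n" where
  "phase a w = mat (exp (\<i> * of_real (w \<bullet> a)))"

lemma bounded_symbol_phase: "bounded_symbol (phase a)"
proof -
  have "phase a \<in> borel_measurable borel" unfolding phase_def[abs_def] mat_def by measurable
  moreover have "norm (phase a w *v v) \<le> 1 * norm v" for w v
    by (simp add: phase_def mat_vec norm_vector_scalar_mult)
  ultimately show ?thesis unfolding bounded_symbol_def by blast
qed

lemma translate_l2_isometry: "norm (translate_l2 a f) = norm f"
proof -
  have "(norm (translate_l2 a f))\<^sup>2 = (LINT x|lborel. (norm (rep_l2 f (x + a)))\<^sup>2)"
    unfolding norm_l2_sq by (rule integral_cong_AE) (use rep_l2_translate[of a f] in auto)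
  also have "\<dots> = (norm f)\<^sup>2" unfolding norm_l2_sq by (rule lborel_integral_translate) measurable
  finally show ?thesis by (rule power2_eq_imp_eq) auto
qed

lemma AE_translate:
  fixes P :: "real^'s::finite \<Rightarrow> bool"
  assumes "AE x in lborel. P x" and [measurable]: "Measurable.pred borel P"
  shows "AE x in lborel. P (x + a)"
proof -
  have "AE x in distr lborel borel ((+) a). P x" unfolding lborel_distr_plus by (rule assms(1))
  then show ?thesis by (subst (asm) AE_distr_iff) (auto simp: add.commute)
qed

lemma bounded_linear_translate: "bounded_linear (translate_l2 a)"
proof (rule bounded_linear_intro[where K = 1])
  fix f g :: "('a, 'b) l2" and r
  have "AE x in lborel. rep_l2 (f + g) (x + a) = rep_l2 f (x + a) + rep_l2 g (x + a)"
    by (rule AE_translate[OF rep_l2_add]) measurable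
  with rep_l2_translate[of a "f + g"] rep_l2_translate[of a f] rep_l2_translate[of a g]
    rep_l2_add[of "translate_l2 a f" "translate_l2 a g"]
  have "AE x in lborel. rep_l2 (translate_l2 a (f + g)) x = rep_l2 (translate_l2 a f + translate_l2 a g) x"
    by eventually_elim simp
  then show "translate_l2 a (f + g) = translate_l2 a f + translate_l2 a g" by (rule l2_eqI)
  have "AE x in lborel. rep_l2 (r *\<^sub>R f) (x + a) = r *\<^sub>R rep_l2 f (x + a)"
    by (rule AE_translate[OF rep_l2_scaleR]) measurable
  with rep_l2_translate[of a "r *\<^sub>R f"] rep_l2_translate[of a f] rep_l2_scaleR[of r "translate_l2 a f"]
  have "AE x in lborel. rep_l2 (translate_l2 a (r *\<^sub>R f)) x = rep_l2 (r *\<^sub>R translate_l2 a f) x"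
    by eventually_elim simp
  then show "translate_l2 a (r *\<^sub>R f) = r *\<^sub>R translate_l2 a f" by (rule l2_eqI)
qed (simp add: translate_l2_isometry)

lemma fourier_translate:
  fixes f :: "('s::finite, 'n::finite) l2"
  shows "fourier_l2 (translate_l2 a f) = mult_l2 (phase a) (fourier_l2 f)"
proof -
  note M = bounded_symbol_phase[of a]
  have key: "fourier_l2 (translate_l2 a f) = mult_l2 (phase a) (fourier_l2 f)"
    if f: "f \<in> l1_l2" for f :: "('s, 'n) l2"
  proof -
    have f1: "integrable lborel (rep_l2 f)" using f by (simp add: l1_l2_def)
    have tf: "translate_l2 a f \<in> l1_l2"
      by (rule l1_l2_cong[OF lborel_integrable_translate[OF f1] rep_l2_translate])
    have "fourier_int (-1) (rep_l2 (translate_l2 a f)) = fourier_int (-1) (\<lambda>x. rep_l2 f (x + a))"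
      by (rule fourier_int_cong_AE) (use rep_l2_translate[of a f] in auto)
    also have "\<dots> = (\<lambda>w. exp (\<i> * of_real (w \<bullet> a)) *s fourier_int (-1) (rep_l2 f) w)"
      by (rule ext) (subst fourier_int_translate, simp_all)
    finally have *: "fourier_int (-1) (rep_l2 (translate_l2 a f)) = (\<lambda>w. exp (\<i> * of_real (w \<bullet> a)) *s fourier_int (-1) (rep_l2 f) w)" .
    show ?thesis
      by (rule l2_eqI) (use rep_fourier_l1_l2[OF tf] rep_fourier_l1_l2[OF f] rep_mult_l2[OF M, of "fourier_l2 f"]
        in \<open>eventually_elim, simp add: * phase_def mat_vec\<close>)
  qed
  show ?thesis
    by (rule fun_cong[OF bounded_linear_eq_l1_l2[OF
          bounded_linear_compose[OF bounded_opD(1)[OF bounded_op_fourier] bounded_linear_translate]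
          bounded_opD(1)[OF bounded_op_compose[OF bounded_op_mult_l2[OF M] bounded_op_fourier]] key]])
qed

lemma symbol_op_iff:
  "(f, g) \<in> symbol_op M \<longleftrightarrow> (AE w in lborel. rep_l2 (fourier_l2 g) w = M w *v rep_l2 (fourier_l2 f) w)"
  by (simp add: symbol_op_def)

lemma linear_op_symbol:
  fixes M :: "real^'s::finite \<Rightarrow> complex^'n::finite^'m::finite"
  shows "linear_op (symbol_op M)"
  unfolding linear_op_def
proof (intro conjI allI ballI)
  show "single_valued (symbol_op M)"
  proof (rule single_valuedI)
    fix f g h assume "(f, g) \<in> symbol_op M" "(f, h) \<in> symbol_op M"
    then have "AE w in lborel. rep_l2 (fourier_l2 g) w = rep_l2 (fourier_l2 h) w"
      unfolding symbol_op_iff by eventually_elim simp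
    then have "fourier_l2 g = fourier_l2 h" by (rule l2_eqI)
    then show "g = h" by (metis inv_fourier_fourier)
  qed
  show "(0, 0) \<in> symbol_op M"
  proof -
    have "AE w in lborel. rep_l2 (0 :: ('s, 'n) l2) w = 0" "AE w in lborel. rep_l2 (0 :: ('s, 'm) l2) w = 0"
      by (rule rep_l2_zero)+
    then show ?thesis unfolding symbol_op_iff fourier_zero by eventually_elim simp
  qed
  fix p assume p: "p \<in> symbol_op M"
  obtain f g where fg: "p = (f, g)" by (cases p)
  show "case p of (f, g) \<Rightarrow> \<forall>(f', g')\<in>symbol_op M. (f + f', g + g') \<in> symbol_op M"
  proof (unfold fg, clarify)
    fix f' g' assume "(f', g') \<in> symbol_op M"
    with p fg have "AE w in lborel. rep_l2 (fourier_l2 g) w = M w *v rep_l2 (fourier_l2 f) w"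
      "AE w in lborel. rep_l2 (fourier_l2 g') w = M w *v rep_l2 (fourier_l2 f') w" by (auto simp: symbol_op_iff)
    then show "(f + f', g + g') \<in> symbol_op M"
      using rep_l2_add[of "fourier_l2 f" "fourier_l2 f'"] rep_l2_add[of "fourier_l2 g" "fourier_l2 g'"]
      unfolding symbol_op_iff fourier_add by eventually_elim (simp add: matrix_vector_right_distrib)
  qed
  fix c
  show "case p of (f, g) \<Rightarrow> (scaleC_l2 c f, scaleC_l2 c g) \<in> symbol_op M"
  proof (unfold fg, clarify)
    have "AE w in lborel. rep_l2 (fourier_l2 g) w = M w *v rep_l2 (fourier_l2 f) w"
      using p fg by (auto simp: symbol_op_iff)
    then show "(scaleC_l2 c f, scaleC_l2 c g) \<in> symbol_op M"
      using rep_l2_scaleC[of c "fourier_l2 f"] rep_l2_scaleC[of c "fourier_l2 g"]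
      unfolding symbol_op_iff fourier_scaleC by eventually_elim (simp add: vector_scalar_commute)
  qed
qed

text \<open>On the Fourier side a translation is multiplication by a scalar of modulus 1, which
  commutes with every matrix symbol.\<close>

lemma translation_invariant_symbol: "translation_invariant (symbol_op M)"
  unfolding translation_invariant_def
proof (intro allI ballI, clarify)
  fix a f g assume "(f, g) \<in> symbol_op M"
  then show "(translate_l2 a f, translate_l2 a g) \<in> symbol_op M"
    using rep_mult_l2[OF bounded_symbol_phase[of a], of "fourier_l2 f"] rep_mult_l2[OF bounded_symbol_phase[of a], of "fourier_l2 g"]
    unfolding symbol_op_iff fourier_translate
    by eventually_elim (simp add: phase_def mat_vec vector_scalar_commute)
qed

definition mult_op :: "(real^'s::finite \<Rightarrow> complex^'n^'m) \<Rightarrow> ('s, 'n::finite) l2 \<Rightarrow> ('s, 'm::finite) l2" where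
  "mult_op M f = inv_fourier (mult_l2 M (fourier_l2 f))"

lemma fourier_mult_op[simp]: "fourier_l2 (mult_op M f) = mult_l2 M (fourier_l2 f)"
  by (simp add: mult_op_def)

lemma bounded_op_mult_op: "bounded_symbol M \<Longrightarrow> bounded_op (mult_op M)"
  unfolding mult_op_def[abs_def]
  by (rule bounded_op_compose[OF bounded_op_inv_fourier bounded_op_compose[OF bounded_op_mult_l2 bounded_op_fourier]])

lemma fourier_eqI: "fourier_l2 f = fourier_l2 g \<Longrightarrow> f = g"
  by (metis inv_fourier_fourier)

text \<open>For a bounded symbol the maximal domain is the whole space. Bounded operators thereby
  fall under the same adjoint formula as unbounded ones.\<close>

lemma graph_mult_op:
  assumes M: "bounded_symbol M" shows "graph (mult_op M) = symbol_op M"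
proof (rule set_eqI, clarify)
  fix f g
  have "(f, g) \<in> symbol_op M \<longleftrightarrow> fourier_l2 g = mult_l2 M (fourier_l2 f)"
  proof
    assume "(f, g) \<in> symbol_op M"
    then have "AE w in lborel. rep_l2 (fourier_l2 g) w = rep_l2 (mult_l2 M (fourier_l2 f)) w"
      using rep_mult_l2[OF M, of "fourier_l2 f"] unfolding symbol_op_iff by eventually_elim simp
    then show "fourier_l2 g = mult_l2 M (fourier_l2 f)" by (rule l2_eqI)
  next
    assume "fourier_l2 g = mult_l2 M (fourier_l2 f)"
    then show "(f, g) \<in> symbol_op M" using rep_mult_l2[OF M] by (simp add: symbol_op_iff)
  qed
  also have "\<dots> \<longleftrightarrow> g = mult_op M f" by (auto simp: mult_op_def dest: arg_cong[where f = inv_fourier])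
  finally show "(f, g) \<in> graph (mult_op M) \<longleftrightarrow> (f, g) \<in> symbol_op M" by (auto simp: graph_def)
qed

lemma mult_l2_mult:
  assumes "bounded_symbol M" "bounded_symbol N"
  shows "mult_l2 M (mult_l2 N f) = mult_l2 (\<lambda>x. M x ** N x) f"
  by (rule l2_eqI) (use rep_mult_l2[OF assms(1), of "mult_l2 N f"] rep_mult_l2[OF assms(2), of f]
    rep_mult_l2[OF bounded_symbol_mult[OF assms], of f] in \<open>eventually_elim, simp add: matrix_vector_mul_assoc\<close>)

lemma mult_op_mult:
  assumes "bounded_symbol M" "bounded_symbol N"
  shows "mult_op M (mult_op N f) = mult_op (\<lambda>x. M x ** N x) f"
  by (rule fourier_eqI) (simp add: mult_l2_mult[OF assms])

lemma mult_op_1: "mult_op (\<lambda>_. mat 1) f = f"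
  by (rule fourier_eqI) (simp add: mult_l2_def abs_l2_rep)

section \<open>Block operators: dense domains and adjoints\<close>

definition coord_proj :: "'n set \<Rightarrow> complex^'n^'n" where
  "coord_proj J = (\<chi> i j. if i = j \<and> i \<in> J then 1 else 0)"

lemma coord_proj_nth: "(coord_proj J *v v) $ i = (if i \<in> J then v $ i else 0)"
proof -
  have "(coord_proj J *v v) $ i = (\<Sum>j\<in>UNIV. if j = i then (if i \<in> J then v $ i else 0) else 0)"
    unfolding coord_proj_def matrix_vector_mult_def vec_lambda_beta by (rule sum.cong) auto
  then show ?thesis by simp
qed

lemma coord_proj_eq_iff: "coord_proj J *v v = v \<longleftrightarrow> (\<forall>i. i \<notin> J \<longrightarrow> v $ i = 0)"
  by (auto simp: vec_eq_iff coord_proj_nth)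

text \<open>\<open>l2_on J\<close> is the fixed space of a constant coordinate projection, and
  constant matrices commute with the transform.\<close>

lemma l2_on_fourier: "fourier_l2 f \<in> l2_on J \<longleftrightarrow> f \<in> l2_on J"
proof -
  have *: "g \<in> l2_on J \<longleftrightarrow> mult_l2 (\<lambda>_. coord_proj J) g = g" for g :: "('a, 'b) l2"
  proof
    assume "g \<in> l2_on J"
    then have "AE x in lborel. coord_proj J *v rep_l2 g x = rep_l2 g x" by (simp add: l2_on_def coord_proj_eq_iff)
    with rep_mult_l2[OF bounded_symbol_const[of "coord_proj J"], of g]
    have "AE x in lborel. rep_l2 (mult_l2 (\<lambda>_. coord_proj J) g) x = rep_l2 g x" by eventually_elim simp
    then show "mult_l2 (\<lambda>_. coord_proj J) g = g" by (rule l2_eqI)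
  next
    assume "mult_l2 (\<lambda>_. coord_proj J) g = g"
    then have "AE x in lborel. rep_l2 g x = coord_proj J *v rep_l2 g x"
      using rep_mult_l2[OF bounded_symbol_const[of "coord_proj J"], of g] by simp
    then have "AE x in lborel. \<forall>i. i \<notin> J \<longrightarrow> rep_l2 g x $ i = 0"
      by eventually_elim (metis coord_proj_eq_iff)
    then show "g \<in> l2_on J" by (simp add: l2_on_def)
  qed
  show ?thesis unfolding * fourier_const_matrix[symmetric] by (auto dest: fourier_eqI)
qed

lemma l2_on_UNIV[simp]: "l2_on UNIV = UNIV"
  by (simp add: l2_on_def)

lemma block_op_UNIV: "block_op UNIV UNIV M = symbol_op M"
  by (simp add: block_op_def)

lemma block_op_iff:
  "(f, g) \<in> block_op I J M \<longleftrightarrow> f \<in> l2_on J \<and> g \<in> l2_on I \<and>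
    (AE w in lborel. rep_l2 (fourier_l2 g) w = mat_block I J (M w) *v rep_l2 (fourier_l2 f) w)"
  by (auto simp: block_op_def symbol_op_iff)

text \<open>The source of test vectors: a function on the Fourier side that vanishes wherever the
  block exceeds a bound lies in the domain of the maximal operator. Density of domains and the
  adjoint formula both rest on this.\<close>

lemma block_op_truncate:
  fixes M :: "real^'s::finite \<Rightarrow> complex^'n^'m"
  assumes M: "M \<in> borel_measurable borel" and h: "sq_int h"
    and bound: "\<And>w. h w \<noteq> 0 \<Longrightarrow> norm (mat_block I J (M w)) \<le> K"
    and J: "\<And>w i. i \<notin> J \<Longrightarrow> h w $ i = 0"
  shows "sq_int (\<lambda>w. mat_block I J (M w) *v h w)"
    and "(inv_fourier (abs_l2 h), inv_fourier (abs_l2 (\<lambda>w. mat_block I J (M w) *v h w))) \<in> block_op I J M"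
proof -
  let ?M = "\<lambda>w. mat_block I J (M w)"
  have [measurable]: "M \<in> borel_measurable borel" "h \<in> borel_measurable borel" using M h by (auto simp: sq_int_def)
  show sq: "sq_int (\<lambda>w. ?M w *v h w)"
  proof (rule sq_int_bound[where h = "\<lambda>w. K\<^sup>2 * (norm (h w))\<^sup>2"])
    show "AE w in lborel. (norm (?M w *v h w))\<^sup>2 \<le> K\<^sup>2 * (norm (h w))\<^sup>2"
    proof (intro AE_I2)
      fix w
      show "(norm (?M w *v h w))\<^sup>2 \<le> K\<^sup>2 * (norm (h w))\<^sup>2"
      proof (cases "h w = 0")
        case False
        have "norm (?M w *v h w) \<le> norm (?M w) * norm (h w)" by (rule norm_matrix_vector_mult)
        also have "\<dots> \<le> K * norm (h w)" by (intro mult_right_mono bound False) simp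
        finally show ?thesis using power_mono[of "norm (?M w *v h w)" "K * norm (h w)" 2] by (simp add: power_mult_distrib)
      qed simp
    qed
  qed (use h in \<open>auto simp: sq_int_def\<close>)
  have r1: "AE w in lborel. rep_l2 (abs_l2 h) w = h w" by (rule rep_abs_l2[OF h])
  have r2: "AE w in lborel. rep_l2 (abs_l2 (\<lambda>w. ?M w *v h w)) w = ?M w *v h w" by (rule rep_abs_l2[OF sq])
  have "fourier_l2 (inv_fourier (abs_l2 h)) \<in> l2_on J"
    unfolding fourier_inv_fourier l2_on_def mem_Collect_eq using r1 by eventually_elim (simp add: J)
  then have "inv_fourier (abs_l2 h) \<in> l2_on J" unfolding l2_on_fourier .
  moreover have "fourier_l2 (inv_fourier (abs_l2 (\<lambda>w. ?M w *v h w))) \<in> l2_on I"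
    unfolding fourier_inv_fourier l2_on_def mem_Collect_eq using r2 by eventually_elim (simp add: mat_block_vec_outside)
  then have "inv_fourier (abs_l2 (\<lambda>w. ?M w *v h w)) \<in> l2_on I" unfolding l2_on_fourier .
  ultimately show "(inv_fourier (abs_l2 h), inv_fourier (abs_l2 (\<lambda>w. ?M w *v h w))) \<in> block_op I J M"
    unfolding block_op_iff fourier_inv_fourier
  proof (intro conjI)
    show "AE w in lborel. rep_l2 (abs_l2 (\<lambda>w. ?M w *v h w)) w = ?M w *v rep_l2 (abs_l2 h) w"
      using r2 r1 by eventually_elim simp
  qed
qed

lemma densely_defined_block:
  fixes M :: "real^'s::finite \<Rightarrow> complex^'n^'m"
  assumes M[measurable]: "M \<in> borel_measurable borel"
  shows "densely_defined_on (l2_on J) (block_op I J M)"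
  unfolding densely_defined_on_def
proof
  show "Domain (block_op I J M) \<subseteq> l2_on J" by (auto simp: block_op_iff)
  show "l2_on J \<subseteq> closure (Domain (block_op I J M))"
  proof
    fix f :: "('s, 'n) l2" assume f: "f \<in> l2_on J"
    let ?M = "\<lambda>w. mat_block I J (M w)"
    \<comment> \<open>The projection changes the representative on a null set only, and makes the
      coordinates outside \<open>J\<close> vanish at every point, as
      \<open>block_op_truncate\<close> requires.\<close>
    define g where "g w = coord_proj J *v rep_l2 (fourier_l2 f) w" for w
    have [measurable]: "g \<in> borel_measurable borel" unfolding g_def by measurable
    have "fourier_l2 f \<in> l2_on J" using f by (simp add: l2_on_fourier)
    then have g_eq: "AE w in lborel. rep_l2 (fourier_l2 f) w = g w"
      unfolding l2_on_def mem_Collect_eq by eventually_elim (simp add: g_def coord_proj_eq_iff[THEN iffD2])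
    have "AE w in lborel. (norm (g w))\<^sup>2 \<le> (norm (rep_l2 (fourier_l2 f) w))\<^sup>2"
      using g_eq by eventually_elim simp
    then have g_sq: "sq_int g"
      by (rule sq_int_bound[rotated 2]) (use sq_int_rep[of "fourier_l2 f"] in \<open>auto simp: sq_int_def\<close>)
    define h where "h k w = (if norm (?M w) \<le> real k then g w else 0)" for k w
    have [measurable]: "h k \<in> borel_measurable borel" for k unfolding h_def by measurable
    have h_sq: "sq_int (h k)" for k
      by (rule sq_int_bound[where h = "\<lambda>w. (norm (g w))\<^sup>2"]) (use g_sq in \<open>auto simp: sq_int_def h_def\<close>)
    have mem: "inv_fourier (abs_l2 (h k)) \<in> Domain (block_op I J M)" for k
      by (rule DomainI, rule block_op_truncate(2)[OF M h_sq, where K = "real k"]) (auto simp: h_def g_def coord_proj_nth split: if_splits)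
    have "(\<lambda>k. abs_l2 (h k)) \<longlonglongrightarrow> abs_l2 g"
    proof (rule l2_dominated_convergence[OF g_sq h_sq])
      show "integrable lborel (\<lambda>w. (norm (g w))\<^sup>2)" using g_sq by (simp add: sq_int_def)
      show "(norm (h k w - g w))\<^sup>2 \<le> (norm (g w))\<^sup>2" for k w by (simp add: h_def)
      show "(\<lambda>k. h k w) \<longlonglongrightarrow> g w" for w
      proof (rule tendsto_eventually)
        show "\<forall>\<^sub>F k in sequentially. h k w = g w"
          using eventually_ge_at_top[of "nat \<lceil>norm (?M w)\<rceil>"]
        proof eventually_elim
          case (elim k)
          then have "norm (?M w) \<le> real k" by linarith
          then show ?case by (simp add: h_def)
        qed
      qed
    qed
    then have "(\<lambda>k. inv_fourier (abs_l2 (h k))) \<longlonglongrightarrow> inv_fourier (abs_l2 g)"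
      by (rule bounded_linear.tendsto[OF bounded_opD(1)[OF bounded_op_inv_fourier]])
    also have "abs_l2 g = fourier_l2 f" by (rule abs_l2_eq[OF g_sq g_eq])
    finally show "f \<in> closure (Domain (block_op I J M))"
      unfolding closure_sequential using mem by (intro exI[of _ "\<lambda>k. inv_fourier (abs_l2 (h k))"]) simp
  qed
qed

text \<open>One inclusion is a pointwise identity. For the other, the defect between
  \<open>x\<close> and the conjugate transposed symbol applied to \<open>y\<close> is truncated and
  used as its own test vector, so that its norm vanishes.\<close>

lemma adjoint_block:
  fixes M :: "real^'s::finite \<Rightarrow> complex^'n^'m"
  assumes M[measurable]: "M \<in> borel_measurable borel"
  shows "adjoint_on (l2_on J) (l2_on I) (block_op I J M) = block_op J I (\<lambda>w. conj_transpose (M w))"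
proof (rule set_eqI, clarify)
  fix y x
  let ?M = "\<lambda>w. mat_block I J (M w)" and ?N = "\<lambda>w. mat_block J I (conj_transpose (M w))"
  have inner: "cvec_inner (?M w *v u) v = cvec_inner u (?N w *v v)" for w u v
    by (simp add: cvec_inner_mult_left conj_transpose_mat_block)
  show "(y, x) \<in> adjoint_on (l2_on J) (l2_on I) (block_op I J M) \<longleftrightarrow> (y, x) \<in> block_op J I (\<lambda>w. conj_transpose (M w))"
  proof
    assume yx: "(y, x) \<in> block_op J I (\<lambda>w. conj_transpose (M w))"
    have "cinner_l2 g y = cinner_l2 f x" if fg: "(f, g) \<in> block_op I J M" for f g
    proof -
      have "cinner_l2 (fourier_l2 g) (fourier_l2 y) = cinner_l2 (fourier_l2 f) (fourier_l2 x)"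
        unfolding cinner_l2_eq
      proof (rule integral_cong_AE)
        show "AE w in lborel. cvec_inner (rep_l2 (fourier_l2 g) w) (rep_l2 (fourier_l2 y) w)
          = cvec_inner (rep_l2 (fourier_l2 f) w) (rep_l2 (fourier_l2 x) w)"
        proof -
          have "AE w in lborel. rep_l2 (fourier_l2 g) w = ?M w *v rep_l2 (fourier_l2 f) w"
            "AE w in lborel. rep_l2 (fourier_l2 x) w = ?N w *v rep_l2 (fourier_l2 y) w"
            using fg yx unfolding block_op_iff by auto
          then show ?thesis by eventually_elim (simp add: inner)
        qed
      qed measurable
      then show ?thesis by (simp add: cinner_fourier)
    qed
    with yx show "(y, x) \<in> adjoint_on (l2_on J) (l2_on I) (block_op I J M)"
      by (auto simp: adjoint_on_def block_op_iff)
  next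
    assume yx: "(y, x) \<in> adjoint_on (l2_on J) (l2_on I) (block_op I J M)"
    then have on: "y \<in> l2_on I" "x \<in> l2_on J"
      and adj: "\<And>f g. (f, g) \<in> block_op I J M \<Longrightarrow> cinner_l2 g y = cinner_l2 f x"
      by (auto simp: adjoint_on_def)
    let ?y = "rep_l2 (fourier_l2 y)" and ?x = "rep_l2 (fourier_l2 x)"
    \<comment> \<open>Test vectors see only the coordinates in \<open>J\<close>; the remaining ones
      vanish on both sides and are restored at the end.\<close>
    define d where "d w = coord_proj J *v (?N w *v ?y w - ?x w)" for w
    have d_meas[measurable]: "d \<in> borel_measurable borel" unfolding d_def by measurable
    \<comment> \<open>The bounds make \<open>h k\<close> bounded with bounded support, hence
      square-integrable, and keep the block below \<open>k\<close> on that support. Every point is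
      good for large \<open>k\<close>.\<close>
    define good where "good k w \<longleftrightarrow> norm w < real k \<and> norm (?M w) \<le> real k \<and> norm (d w) \<le> real k" for k w
    have good_meas[measurable]: "Measurable.pred borel (good k)" for k unfolding good_def by measurable
    define h where "h k w = (if good k w then d w else 0)" for k w
    have [measurable]: "h k \<in> borel_measurable borel" for k unfolding h_def by measurable
    have h_sq: "sq_int (h k)" for k
    proof (rule sq_int_bound[where h = "\<lambda>w. (real k)\<^sup>2 * indicator (ball 0 (real k)) w"])
      show "integrable lborel (\<lambda>w. (real k)\<^sup>2 * indicator (ball (0 :: real^'s) (real k)) w)"
        using emeasure_lborel_ball_finite[of "0 :: real^'s" "real k"] by (intro integrable_mult_right) auto
      show "AE w in lborel. (norm (h k w))\<^sup>2 \<le> (real k)\<^sup>2 * indicator (ball 0 (real k)) w"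
        by (intro AE_I2) (auto simp: h_def good_def indicator_def intro: power_mono)
    qed measurable
    have zero: "AE w in lborel. h k w = 0" for k
    proof -
      let ?f = "inv_fourier (abs_l2 (h k))" and ?g = "inv_fourier (abs_l2 (\<lambda>w. ?M w *v h k w))"
      have bnd: "norm (?M w) \<le> real k" if "h k w \<noteq> 0" for w using that by (auto simp: h_def good_def split: if_splits)
      have J: "h k w $ i = 0" if "i \<notin> J" for w i using that by (auto simp: h_def d_def coord_proj_nth)
      have fg: "(?f, ?g) \<in> block_op I J M" and Mh_sq: "sq_int (\<lambda>w. ?M w *v h k w)"
        using block_op_truncate[OF M h_sq[of k] bnd J] by auto
      have "cinner_l2 (fourier_l2 ?g) (fourier_l2 y) = cinner_l2 (fourier_l2 ?f) (fourier_l2 x)"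
        using adj[OF fg] by (simp only: cinner_fourier)
      moreover have "cinner_l2 (fourier_l2 ?g) (fourier_l2 y) = (LINT w|lborel. cvec_inner (h k w) (?N w *v ?y w))"
        unfolding cinner_l2_eq fourier_inv_fourier
      proof (rule integral_cong_AE)
        show "AE w in lborel. cvec_inner (rep_l2 (abs_l2 (\<lambda>w. ?M w *v h k w)) w) (?y w) = cvec_inner (h k w) (?N w *v ?y w)"
          using rep_abs_l2[OF Mh_sq] by eventually_elim (simp add: inner)
      qed measurable
      moreover have "cinner_l2 (fourier_l2 ?f) (fourier_l2 x) = (LINT w|lborel. cvec_inner (h k w) (?x w))"
        unfolding cinner_l2_eq fourier_inv_fourier
      proof (rule integral_cong_AE)
        show "AE w in lborel. cvec_inner (rep_l2 (abs_l2 (h k)) w) (?x w) = cvec_inner (h k w) (?x w)"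
          using rep_abs_l2[OF h_sq[of k]] by eventually_elim simp
      qed measurable
      moreover have "integrable lborel (\<lambda>w. cvec_inner (h k w) (?N w *v ?y w))"
        using integrable_cvec_inner[OF Mh_sq sq_int_rep[of "fourier_l2 y"]] by (simp add: inner)
      moreover have "integrable lborel (\<lambda>w. cvec_inner (h k w) (?x w))"
        by (rule integrable_cvec_inner[OF h_sq sq_int_rep])
      ultimately have "(LINT w|lborel. cvec_inner (h k w) (?N w *v ?y w - ?x w)) = 0"
        by (simp add: cvec_inner_diff_right)
      moreover have "cvec_inner (h k w) (?N w *v ?y w - ?x w) = cvec_inner (h k w) (d w)" for w
        using J by (auto simp: cvec_inner_def d_def coord_proj_nth intro!: sum.cong)
      ultimately have "(LINT w|lborel. cvec_inner (h k w) (d w)) = 0" by simp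
      moreover have "cvec_inner (h k w) (d w) = of_real ((norm (h k w))\<^sup>2)" for w
        by (simp add: h_def cvec_inner_self del: of_real_power) (simp add: cvec_inner_def)
      ultimately have "(LINT w|lborel. (norm (h k w))\<^sup>2) = 0" by (simp del: of_real_power)
      moreover have "integrable lborel (\<lambda>w. (norm (h k w))\<^sup>2)" using h_sq[of k] by (simp add: sq_int_def)
      ultimately have "AE w in lborel. (norm (h k w))\<^sup>2 = 0"
        by (subst (asm) integral_nonneg_eq_0_iff_AE) auto
      then show ?thesis by simp
    qed
    have "AE w in lborel. \<forall>k. h k w = 0" using zero by (simp add: AE_all_countable)
    moreover have "AE w in lborel. \<forall>i. i \<notin> J \<longrightarrow> ?x w $ i = 0"
      using on(2)[folded l2_on_fourier[of x]] by (simp add: l2_on_def)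
    ultimately have "AE w in lborel. ?x w = ?N w *v ?y w"
    proof eventually_elim
      case (elim w)
      obtain k where k: "max (norm w) (max (norm (?M w)) (norm (d w))) < real k" using reals_Archimedean2 by blast
      have "good k w" using k by (auto simp: good_def)
      moreover have "h k w = 0" using elim(1) by blast
      ultimately have "d w = 0" by (simp add: h_def)
      moreover have "d w = ?N w *v ?y w - ?x w"
        unfolding d_def coord_proj_eq_iff using elim(2) by (simp add: mat_block_vec_outside)
      ultimately show ?case by simp
    qed
    then show "(y, x) \<in> block_op J I (\<lambda>w. conj_transpose (M w))" by (simp add: block_op_iff on)
  qed
qed

lemma adjoint_symbol:
  assumes "M \<in> borel_measurable borel"
  shows "adjoint_op (symbol_op M) = symbol_op (\<lambda>w. conj_transpose (M w))"
  using adjoint_block[OF assms, of UNIV UNIV] by (simp add: block_op_UNIV)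

lemma densely_defined_symbol:
  assumes "M \<in> borel_measurable borel" shows "densely_defined (symbol_op M)"
  using densely_defined_block[OF assms, of UNIV UNIV] by (simp add: block_op_UNIV)

section \<open>Mild solutions for contraction semigroups\<close>

text \<open>The energy balance belongs to contraction semigroups on a Hilbert space in general;
  completeness and separability are what the Bochner integral in a mild solution asks for.\<close>

locale contraction_semigroup =
  fixes T :: "real \<Rightarrow> 'a::{real_inner, banach, second_countable_topology} \<Rightarrow> 'a"
  assumes linear: "\<And>t. t \<ge> 0 \<Longrightarrow> bounded_linear (T t)"
    and T_0: "\<And>x. T 0 x = x"
    and T_add: "\<And>s t x. s \<ge> 0 \<Longrightarrow> t \<ge> 0 \<Longrightarrow> T (s + t) x = T s (T t x)"
    and contraction: "\<And>t x. t \<ge> 0 \<Longrightarrow> norm (T t x) \<le> norm x"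
    and strong: "\<And>x. ((\<lambda>t. T t x) \<longlongrightarrow> x) (at_right 0)"
begin

text \<open>Clamping makes \<open>(t, x) \<mapsto> S t x\<close> continuous on the whole line, hence Borel measurable.\<close>

definition S where "S t = T (max 0 t)"

lemma S_linear: "bounded_linear (S t)" unfolding S_def by (rule linear) simp
lemma S_contraction: "norm (S t x) \<le> norm x" unfolding S_def by (rule contraction) simp
lemma S_diff: "S t (x - y) = S t x - S t y" by (rule linear_diff[OF bounded_linear.linear[OF S_linear]])
lemma S_eq: "t \<ge> 0 \<Longrightarrow> S t = T t" by (simp add: S_def max_def)
lemma S_0: "S 0 x = x" by (simp add: S_eq T_0)
lemma S_add: "s \<ge> 0 \<Longrightarrow> t \<ge> 0 \<Longrightarrow> S (s + t) x = S s (S t x)" by (simp add: S_eq T_add)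

text \<open>The semigroup law splits off the operator for the smaller time, and contractivity
  discards it. So continuity at 0 controls the whole orbit; the maxima are due to clamping.\<close>

lemma S_modulus: "norm (S t x - S s x) \<le> norm (S \<bar>max 0 t - max 0 s\<bar> x - x)"
proof -
  have *: "norm (S b x - S a x) \<le> norm (S (b - a) x - x)" if "0 \<le> a" "a \<le> b" for a b
  proof -
    have "S b x - S a x = S a (S (b - a) x - x)" using S_add[of a "b - a" x] that by (simp add: S_diff)
    then show ?thesis by (simp add: S_contraction)
  qed
  have c: "S t = S (max 0 t)" for t by (simp add: S_def)
  have "norm (S v x - S u x) \<le> norm (S \<bar>v - u\<bar> x - x)" if "0 \<le> u" "0 \<le> v" for u v
  proof (cases "u \<le> v")
    case False
    then show ?thesis using *[of v u] that by (simp add: norm_minus_commute[of "S v x"])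
  qed (use *[of u v] that in simp)
  from this[of "max 0 s" "max 0 t"] show ?thesis
    unfolding c[of t] c[of s] by simp
qed

lemma S_tendsto_0: "((\<lambda>t. S t x) \<longlongrightarrow> x) (at 0)"
proof -
  have "((\<lambda>t. S t x) \<longlongrightarrow> x) (at_right 0)"
    by (rule Lim_transform_eventually[OF strong]) (auto simp: eventually_at_filter S_eq)
  moreover have "((\<lambda>t. S t x) \<longlongrightarrow> x) (at_left 0)"
    by (rule tendsto_eventually) (auto simp: eventually_at_filter S_def T_0)
  ultimately show ?thesis by (simp add: filterlim_split_at)
qed

text \<open>Contractivity bounds the cost of replacing \<open>x n\<close> by \<open>y\<close>
  uniformly in time; the rest is \<open>S_modulus\<close>.\<close>

lemma S_continuous:
  assumes a: "a \<longlonglongrightarrow> s" and x: "x \<longlonglongrightarrow> y"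
  shows "(\<lambda>n. S (a n) (x n)) \<longlonglongrightarrow> S s y"
proof -
  have "(\<lambda>n. \<bar>max 0 (a n) - max 0 s\<bar>) \<longlonglongrightarrow> \<bar>max 0 s - max 0 s\<bar>"
    by (intro tendsto_intros a)
  then have lim0: "(\<lambda>n. \<bar>max 0 (a n) - max 0 s\<bar>) \<longlonglongrightarrow> 0" by simp
  have "isCont (\<lambda>t. S t y) 0" using S_tendsto_0[of y] by (simp add: isCont_def S_0)
  from isCont_tendsto_compose[OF this lim0]
  have "(\<lambda>n. S \<bar>max 0 (a n) - max 0 s\<bar> y) \<longlonglongrightarrow> y" by (simp add: S_0)
  then have "(\<lambda>n. norm (x n - y) + norm (S \<bar>max 0 (a n) - max 0 s\<bar> y - y)) \<longlonglongrightarrow> norm (y - y) + norm (y - y)"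
    by (intro tendsto_intros x)
  then have lim: "(\<lambda>n. norm (x n - y) + norm (S \<bar>max 0 (a n) - max 0 s\<bar> y - y)) \<longlonglongrightarrow> 0" by simp
  have "norm (S (a n) (x n) - S s y) \<le> norm (x n - y) + norm (S \<bar>max 0 (a n) - max 0 s\<bar> y - y)" for n
  proof -
    have "S (a n) (x n) - S s y = S (a n) (x n - y) + (S (a n) y - S s y)" by (simp add: S_diff)
    then have "norm (S (a n) (x n) - S s y) \<le> norm (S (a n) (x n - y)) + norm (S (a n) y - S s y)"
      by (metis norm_triangle_ineq)
    also have "\<dots> \<le> norm (x n - y) + norm (S \<bar>max 0 (a n) - max 0 s\<bar> y - y)"
      by (intro add_mono S_contraction S_modulus)
    finally show ?thesis .
  qed
  then have "(\<lambda>n. norm (S (a n) (x n) - S s y)) \<longlonglongrightarrow> 0"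
    by (intro tendsto_sandwich[OF _ _ tendsto_const lim]) auto
  then show ?thesis by (simp add: LIM_zero_iff tendsto_norm_zero_iff)
qed

lemma S_measurable[measurable (raw)]:
  assumes [measurable]: "a \<in> borel_measurable M" "x \<in> borel_measurable M"
  shows "(\<lambda>w. S (a w) (x w)) \<in> borel_measurable M"
proof -
  have "continuous_on UNIV (\<lambda>p. S (fst p) (snd p))"
    unfolding continuous_on_sequentially
  proof (intro allI ballI impI)
    fix p q assume "(\<forall>n. p n \<in> (UNIV :: (real \<times> 'a) set)) \<and> p \<longlonglongrightarrow> q"
    then show "((\<lambda>p. S (fst p) (snd p)) \<circ> p) \<longlonglongrightarrow> S (fst q) (snd q)"
      unfolding o_def by (intro S_continuous tendsto_fst tendsto_snd) auto
  qed
  then have "(\<lambda>p. S (fst p) (snd p)) \<in> borel_measurable borel" by (rule borel_measurable_continuous_onI)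
  moreover have "(\<lambda>w. (a w, x w)) \<in> M \<rightarrow>\<^sub>M borel" by (rule borel_measurable_Pair) measurable
  ultimately have "(\<lambda>w. (\<lambda>p. S (fst p) (snd p)) (a w, x w)) \<in> borel_measurable M"
    by (rule measurable_compose[rotated])
  then show ?thesis by simp
qed

section \<open>Forced mild solutions and their energy\<close>

context
  fixes f :: "real \<Rightarrow> 'a" and z0 :: 'a
  assumes f: "integrable lborel f"
begin

definition z where "z s = S s z0 + (LINT \<tau>|lborel. indicator {0..s} \<tau> *\<^sub>R S (s - \<tau>) (f \<tau>))"

lemma f_measurable[measurable]: "f \<in> borel_measurable borel" using f by auto

lemma integrable_convolution:
  assumes [measurable]: "A \<in> sets borel"
  shows "integrable lborel (\<lambda>\<tau>. indicator A \<tau> *\<^sub>R S (s - \<tau>) (f \<tau>))"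
proof (rule Bochner_Integration.integrable_bound[OF f])
  show "AE \<tau> in lborel. norm (indicator A \<tau> *\<^sub>R S (s - \<tau>) (f \<tau>)) \<le> norm (f \<tau>)"
    by (intro AE_I2) (auto simp: indicator_def S_contraction)
qed measurable

lemma z_continuous: "isCont z s"
  unfolding continuous_at_sequentially
proof (intro allI impI)
  fix a assume a: "a \<longlonglongrightarrow> s"
  have "(\<lambda>n. LINT \<tau>|lborel. indicator {0..a n} \<tau> *\<^sub>R S (a n - \<tau>) (f \<tau>))
    \<longlonglongrightarrow> (LINT \<tau>|lborel. indicator {0..s} \<tau> *\<^sub>R S (s - \<tau>) (f \<tau>))"
  proof (rule integral_dominated_convergence[where w = "\<lambda>\<tau>. norm (f \<tau>)"])
    show "AE \<tau> in lborel. (\<lambda>n. indicator {0..a n} \<tau> *\<^sub>R S (a n - \<tau>) (f \<tau>)) \<longlonglongrightarrow> indicator {0..s} \<tau> *\<^sub>R S (s - \<tau>) (f \<tau>)"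
      \<comment> \<open>At \<open>\<tau> = s\<close> the indicators may oscillate with the sign of
        \<open>a n - s\<close>; elsewhere they are eventually constant.\<close>
      using AE_lborel_singleton[of s]
    proof eventually_elim
      case (elim \<tau>)
      have "\<forall>\<^sub>F n in sequentially. indicator {0..a n} \<tau> = (indicator {0..s} \<tau> :: real)"
      proof (cases "\<tau> < s")
        case True
        then have "\<forall>\<^sub>F n in sequentially. \<tau> < a n" using a by (simp add: order_tendsto_iff)
        then show ?thesis by eventually_elim (use True in \<open>auto simp: indicator_def\<close>)
      next
        case False
        with elim have "s < \<tau>" by simp
        then have "\<forall>\<^sub>F n in sequentially. a n < \<tau>" using a by (simp add: order_tendsto_iff)
        then show ?thesis by eventually_elim (use \<open>s < \<tau>\<close> in \<open>auto simp: indicator_def\<close>)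
      qed
      then have "(\<lambda>n. indicator {0..a n} \<tau>) \<longlonglongrightarrow> (indicator {0..s} \<tau> :: real)" by (rule tendsto_eventually)
      then show ?case by (intro tendsto_scaleR S_continuous tendsto_intros a)
    qed
    show "AE \<tau> in lborel. norm (indicator {0..a n} \<tau> *\<^sub>R S (a n - \<tau>) (f \<tau>)) \<le> norm (f \<tau>)" for n
      by (intro AE_I2) (auto simp: indicator_def S_contraction)
  qed (use f in auto)
  then show "(z \<circ> a) \<longlonglongrightarrow> z s"
    unfolding z_def o_def by (intro tendsto_add S_continuous a tendsto_const)
qed

lemma z_measurable[measurable]: "z \<in> borel_measurable borel"
  by (intro borel_measurable_continuous_onI continuous_at_imp_continuous_on ballI z_continuous)

lemma z_0: "z 0 = z0"
proof -
  have "(LINT \<tau>|lborel. indicator {0..0} \<tau> *\<^sub>R S (0 - \<tau>) (f \<tau>)) = (LINT \<tau>::real|lborel. 0)"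
  proof (rule integral_cong_AE)
    show "AE \<tau> in lborel. indicator {0..0} \<tau> *\<^sub>R S (0 - \<tau>) (f \<tau>) = 0"
      using AE_lborel_singleton[of "0 :: real"] by eventually_elim (simp add: indicator_def)
  qed measurable
  then show ?thesis by (simp add: z_def S_0)
qed

lemma z_bound: "norm (z s) \<le> norm z0 + (LINT \<tau>|lborel. norm (f \<tau>))"
proof -
  have "norm (LINT \<tau>|lborel. indicator {0..s} \<tau> *\<^sub>R S (s - \<tau>) (f \<tau>)) \<le> (LINT \<tau>|lborel. norm (f \<tau>))"
  proof (rule Bochner_Integration.integral_norm_bound_integral)
    show "integrable lborel (\<lambda>\<tau>. indicator {0..s} \<tau> *\<^sub>R S (s - \<tau>) (f \<tau>))"
      by (rule integrable_convolution) simp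
    show "norm (indicator {0..s} \<tau> *\<^sub>R S (s - \<tau>) (f \<tau>)) \<le> norm (f \<tau>)" for \<tau>
      by (auto simp: indicator_def S_contraction)
  qed (use f in simp)
  then show ?thesis
    unfolding z_def using norm_triangle_ineq S_contraction[of s z0] by (meson add_mono norm_triangle_le)
qed

text \<open>Restart of the variation of constants formula at time \<open>a\<close>. The half-open
  interval makes the two pieces of \<open>{0..b}\<close> disjoint.\<close>

lemma z_step:
  assumes ab: "0 \<le> a" "a \<le> b"
  shows "z b = S (b - a) (z a) + (LINT \<tau>|lborel. indicator {a<..b} \<tau> *\<^sub>R S (b - \<tau>) (f \<tau>))"
proof -
  have "S (b - a) (LINT \<tau>|lborel. indicator {0..a} \<tau> *\<^sub>R S (a - \<tau>) (f \<tau>))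
     = (LINT \<tau>|lborel. S (b - a) (indicator {0..a} \<tau> *\<^sub>R S (a - \<tau>) (f \<tau>)))"
    by (rule integral_bounded_linear[OF S_linear integrable_convolution, symmetric]) simp
  also have "\<dots> = (LINT \<tau>|lborel. indicator {0..a} \<tau> *\<^sub>R S (b - \<tau>) (f \<tau>))"
  proof (rule Bochner_Integration.integral_cong[OF refl])
    fix \<tau> :: real
    show "S (b - a) (indicator {0..a} \<tau> *\<^sub>R S (a - \<tau>) (f \<tau>)) = indicator {0..a} \<tau> *\<^sub>R S (b - \<tau>) (f \<tau>)"
      using S_add[of "b - a" "a - \<tau>" "f \<tau>"] ab linear_0[OF bounded_linear.linear[OF S_linear]]
      by (auto simp: indicator_def)
  qed
  finally have 1: "S (b - a) (z a) = S b z0 + (LINT \<tau>|lborel. indicator {0..a} \<tau> *\<^sub>R S (b - \<tau>) (f \<tau>))"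
    using S_add[of "b - a" a z0] ab by (simp add: z_def linear_add[OF bounded_linear.linear[OF S_linear]])
  have "(LINT \<tau>|lborel. indicator {0..b} \<tau> *\<^sub>R S (b - \<tau>) (f \<tau>))
    = (LINT \<tau>|lborel. indicator {0..a} \<tau> *\<^sub>R S (b - \<tau>) (f \<tau>) + indicator {a<..b} \<tau> *\<^sub>R S (b - \<tau>) (f \<tau>))"
    using ab by (intro Bochner_Integration.integral_cong) (auto simp: indicator_def)
  also have "\<dots> = (LINT \<tau>|lborel. indicator {0..a} \<tau> *\<^sub>R S (b - \<tau>) (f \<tau>)) + (LINT \<tau>|lborel. indicator {a<..b} \<tau> *\<^sub>R S (b - \<tau>) (f \<tau>))"
    by (intro Bochner_Integration.integral_add integrable_convolution) auto
  finally show ?thesis unfolding 1 z_def[of b] by simp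
qed

text \<open>With \<open>z b = w + g\<close> and \<open>norm w \<le> norm (z a)\<close>, expanding \<open>w = z b - g\<close> leaves the error
  term \<open>- norm g ^ 2\<close>, which has the right sign.\<close>

lemma energy_step:
  assumes ab: "0 \<le> a" "a \<le> b"
  shows "(norm (z b))\<^sup>2 \<le> (norm (z a))\<^sup>2 + (LINT \<tau>|lborel. indicator {a<..b} \<tau> * (2 * (z b \<bullet> S (b - \<tau>) (f \<tau>))))"
proof -
  define g where "g = (LINT \<tau>|lborel. indicator {a<..b} \<tau> *\<^sub>R S (b - \<tau>) (f \<tau>))"
  have w: "S (b - a) (z a) = z b - g" using z_step[OF ab] by (simp add: g_def)
  have "(norm (z b - g))\<^sup>2 \<le> (norm (z a))\<^sup>2"
    unfolding w[symmetric] by (intro power_mono S_contraction) simp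
  then have "(norm (z b))\<^sup>2 \<le> (norm (z a))\<^sup>2 + 2 * (z b \<bullet> g)"
    by (simp add: power2_norm_eq_inner inner_diff_left inner_diff_right inner_commute)
       (use inner_ge_zero[of g] in linarith)
  also have "2 * (z b \<bullet> g) = (LINT \<tau>|lborel. 2 * (z b \<bullet> (indicator {a<..b} \<tau> *\<^sub>R S (b - \<tau>) (f \<tau>))))"
    unfolding g_def by (subst integral_mult_right_zero, subst integral_inner_right) (auto intro!: integrable_convolution)
  also have "\<dots> = (LINT \<tau>|lborel. indicator {a<..b} \<tau> * (2 * (z b \<bullet> S (b - \<tau>) (f \<tau>))))"
    by (intro Bochner_Integration.integral_cong) auto
  finally show ?thesis .
qed

text \<open>A mild solution need not be differentiable, so \<open>energy_step\<close> is summed over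
  a uniform grid and the mesh is sent to 0. The summed integrand evaluates \<open>z\<close> at the
  right end of each cell; continuity of \<open>z\<close> and of the semigroup gives its
  limit.\<close>

lemma energy_inequality:
  assumes t: "t \<ge> 0"
  shows "(norm (z t))\<^sup>2 \<le> (norm z0)\<^sup>2 + (LINT \<tau>|lborel. indicator {0<..t} \<tau> * (2 * (z \<tau> \<bullet> f \<tau>)))"
proof (cases "t = 0")
  case True
  then show ?thesis by (simp add: z_0)
next
  case False
  with t have t: "t > 0" by simp
  \<comment> \<open>\<open>q N \<tau>\<close> rounds \<open>\<tau>\<close> up to the grid of mesh
    \<open>t / real (Suc N)\<close>, so that \<open>\<Phi> N\<close> below is the integrand of
    \<open>energy_step\<close> on all cells at once.\<close>
  define q where "q N \<tau> = real_of_int \<lceil>\<tau> / (t / real (Suc N))\<rceil> * (t / real (Suc N))" for N \<tau>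
  define \<Phi> where "\<Phi> N \<tau> = 2 * (z (q N \<tau>) \<bullet> S (q N \<tau> - \<tau>) (f \<tau>))" for N \<tau>
  \<comment> \<open>A bound for \<open>norm (z s)\<close> at all times, which makes
    \<open>2 * Mz * norm (f \<tau>)\<close> a dominating function.\<close>
  define Mz where "Mz = norm z0 + (LINT \<tau>|lborel. norm (f \<tau>))"
  have [measurable]: "q N \<in> borel_measurable borel" for N unfolding q_def by measurable
  have \<Phi>_meas[measurable]: "\<Phi> N \<in> borel_measurable borel" for N unfolding \<Phi>_def by measurable
  have \<Phi>_bound: "norm (\<Phi> N \<tau>) \<le> 2 * Mz * norm (f \<tau>)" for N \<tau>
  proof -
    have "\<bar>z (q N \<tau>) \<bullet> S (q N \<tau> - \<tau>) (f \<tau>)\<bar> \<le> norm (z (q N \<tau>)) * norm (S (q N \<tau> - \<tau>) (f \<tau>))"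
      by (rule Cauchy_Schwarz_ineq2)
    also have "\<dots> \<le> Mz * norm (f \<tau>)"
      by (intro mult_mono z_bound[folded Mz_def] S_contraction) (auto simp: Mz_def)
    finally show ?thesis by (simp add: \<Phi>_def abs_mult)
  qed
  have \<Phi>_int: "integrable lborel (\<lambda>\<tau>. indicator A \<tau> * \<Phi> N \<tau>)" if [measurable]: "A \<in> sets borel" for A N
  proof (rule Bochner_Integration.integrable_bound)
    show "integrable lborel (\<lambda>\<tau>. 2 * Mz * norm (f \<tau>))" using f by simp
    have "0 \<le> 2 * Mz * norm (f \<tau>)" for \<tau> using \<Phi>_bound[of 0 \<tau>] norm_ge_zero order_trans by blast
    then show "AE \<tau> in lborel. norm (indicator A \<tau> * \<Phi> N \<tau>) \<le> norm (2 * Mz * norm (f \<tau>))"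
      using \<Phi>_bound by (intro AE_I2) (auto simp: indicator_def abs_of_nonneg)
  qed measurable
  have sum: "(norm (z (real k * (t / real (Suc N)))))\<^sup>2
     \<le> (norm z0)\<^sup>2 + (LINT \<tau>|lborel. indicator {0<..real k * (t / real (Suc N))} \<tau> * \<Phi> N \<tau>)" for N k
  proof (induction k)
    case 0
    then show ?case by (simp add: z_0)
  next
    case (Suc k)
    define h where "h = t / real (Suc N)"
    have h: "h > 0" using t by (simp add: h_def)
    have q: "q N \<tau> = real (Suc k) * h" if "\<tau> \<in> {real k * h<..real (Suc k) * h}" for \<tau>
    proof -
      have "real k < \<tau> / h" "\<tau> / h \<le> real (Suc k)" using that h by (auto simp: field_simps)
      then have "\<lceil>\<tau> / h\<rceil> = int (Suc k)" by (intro ceiling_unique) auto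
      then show ?thesis by (simp add: q_def h_def)
    qed
    have le: "0 \<le> real k * h" "real k * h \<le> real (Suc k) * h" using h by auto
    have "(norm (z (real (Suc k) * h)))\<^sup>2 \<le> (norm (z (real k * h)))\<^sup>2 +
      (LINT \<tau>|lborel. indicator {real k * h<..real (Suc k) * h} \<tau> * (2 * (z (real (Suc k) * h) \<bullet> S (real (Suc k) * h - \<tau>) (f \<tau>))))"
      by (rule energy_step[OF le])
    also have "(LINT \<tau>|lborel. indicator {real k * h<..real (Suc k) * h} \<tau> * (2 * (z (real (Suc k) * h) \<bullet> S (real (Suc k) * h - \<tau>) (f \<tau>))))
      = (LINT \<tau>|lborel. indicator {real k * h<..real (Suc k) * h} \<tau> * \<Phi> N \<tau>)"
    proof (rule Bochner_Integration.integral_cong[OF refl])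
      fix \<tau> :: real
      show "indicator {real k * h<..real (Suc k) * h} \<tau> * (2 * (z (real (Suc k) * h) \<bullet> S (real (Suc k) * h - \<tau>) (f \<tau>)))
        = indicator {real k * h<..real (Suc k) * h} \<tau> * \<Phi> N \<tau>"
        using q[of \<tau>] by (cases "\<tau> \<in> {real k * h<..real (Suc k) * h}") (simp_all add: \<Phi>_def)
    qed
    also have "(norm (z (real k * h)))\<^sup>2 \<le> (norm z0)\<^sup>2 + (LINT \<tau>|lborel. indicator {0<..real k * h} \<tau> * \<Phi> N \<tau>)"
      using Suc.IH by (simp add: h_def)
    finally have "(norm (z (real (Suc k) * h)))\<^sup>2 \<le> (norm z0)\<^sup>2 + ((LINT \<tau>|lborel. indicator {0<..real k * h} \<tau> * \<Phi> N \<tau>)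
       + (LINT \<tau>|lborel. indicator {real k * h<..real (Suc k) * h} \<tau> * \<Phi> N \<tau>))" by simp
    also have "(LINT \<tau>|lborel. indicator {0<..real k * h} \<tau> * \<Phi> N \<tau>)
       + (LINT \<tau>|lborel. indicator {real k * h<..real (Suc k) * h} \<tau> * \<Phi> N \<tau>)
       = (LINT \<tau>|lborel. indicator {0<..real k * h} \<tau> * \<Phi> N \<tau> + indicator {real k * h<..real (Suc k) * h} \<tau> * \<Phi> N \<tau>)"
      by (intro Bochner_Integration.integral_add[symmetric] \<Phi>_int) auto
    also have "\<dots> = (LINT \<tau>|lborel. indicator {0<..real (Suc k) * h} \<tau> * \<Phi> N \<tau>)"
      using le by (intro Bochner_Integration.integral_cong) (auto simp: indicator_def)
    finally show ?case by (simp add: h_def)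
  qed
  \<comment> \<open>After \<open>Suc N\<close> cells the grid ends exactly at
    \<open>t\<close>.\<close>
  have bound: "(norm (z t))\<^sup>2 \<le> (norm z0)\<^sup>2 + (LINT \<tau>|lborel. indicator {0<..t} \<tau> * \<Phi> N \<tau>)" for N
    using sum[of "Suc N" N] by simp
  have q_lim: "(\<lambda>N. q N \<tau>) \<longlonglongrightarrow> \<tau>" for \<tau>
  proof (rule tendsto_sandwich[of "\<lambda>_. \<tau>" _ _ "\<lambda>N. \<tau> + t / real (Suc N)"])
    have h: "t / real (Suc N) > 0" for N using t by simp
    show "\<forall>\<^sub>F N in sequentially. \<tau> \<le> q N \<tau>"
    proof (intro always_eventually allI)
      fix N
      have "\<tau> / (t / real (Suc N)) \<le> real_of_int \<lceil>\<tau> / (t / real (Suc N))\<rceil>" by linarith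
      then show "\<tau> \<le> q N \<tau>" unfolding q_def using h[of N] by (simp only: pos_divide_le_eq)
    qed
    show "\<forall>\<^sub>F N in sequentially. q N \<tau> \<le> \<tau> + t / real (Suc N)"
    proof (intro always_eventually allI)
      fix N
      have "real_of_int \<lceil>\<tau> / (t / real (Suc N))\<rceil> \<le> \<tau> / (t / real (Suc N)) + 1" by linarith
      then have "q N \<tau> \<le> (\<tau> / (t / real (Suc N)) + 1) * (t / real (Suc N))"
        unfolding q_def using h[of N] by (intro mult_right_mono) auto
      also have "\<dots> = \<tau> + t / real (Suc N)"
      proof -
        have "(x / h + 1) * h = x + h" if "h \<noteq> 0" for x h :: real using that by (simp add: distrib_right)
        from this[of "t / real (Suc N)" \<tau>] h[of N] show ?thesis by linarith
      qed
      finally show "q N \<tau> \<le> \<tau> + t / real (Suc N)" .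
    qed
    have "(\<lambda>N. 1 / real (Suc N)) \<longlonglongrightarrow> 0" using lim_1_over_n LIMSEQ_Suc by blast
    then have "(\<lambda>N. \<tau> + t * (1 / real (Suc N))) \<longlonglongrightarrow> \<tau> + t * 0" by (intro tendsto_intros)
    then show "(\<lambda>N. \<tau> + t / real (Suc N)) \<longlonglongrightarrow> \<tau>" by simp
  qed simp
  have "(\<lambda>N. LINT \<tau>|lborel. indicator {0<..t} \<tau> * \<Phi> N \<tau>) \<longlonglongrightarrow> (LINT \<tau>|lborel. indicator {0<..t} \<tau> * (2 * (z \<tau> \<bullet> f \<tau>)))"
  proof (rule integral_dominated_convergence[where w = "\<lambda>\<tau>. 2 * Mz * norm (f \<tau>)"])
    show "AE \<tau> in lborel. (\<lambda>N. indicator {0<..t} \<tau> * \<Phi> N \<tau>) \<longlonglongrightarrow> indicator {0<..t} \<tau> * (2 * (z \<tau> \<bullet> f \<tau>))"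
    proof (intro AE_I2 tendsto_mult_left)
      fix \<tau>
      have "(\<lambda>N. q N \<tau> - \<tau>) \<longlonglongrightarrow> \<tau> - \<tau>" by (intro tendsto_intros q_lim)
      then have "(\<lambda>N. S (q N \<tau> - \<tau>) (f \<tau>)) \<longlonglongrightarrow> S (\<tau> - \<tau>) (f \<tau>)" by (rule S_continuous) simp
      then have "(\<lambda>N. S (q N \<tau> - \<tau>) (f \<tau>)) \<longlonglongrightarrow> f \<tau>" by (simp add: S_0)
      moreover have "(\<lambda>N. z (q N \<tau>)) \<longlonglongrightarrow> z \<tau>" using z_continuous q_lim by (rule isCont_tendsto_compose)
      ultimately show "(\<lambda>N. \<Phi> N \<tau>) \<longlonglongrightarrow> 2 * (z \<tau> \<bullet> f \<tau>)"
        unfolding \<Phi>_def by (intro tendsto_mult_left tendsto_inner)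
    qed
    have "0 \<le> 2 * Mz * norm (f \<tau>)" for \<tau> using \<Phi>_bound[of 0 \<tau>] norm_ge_zero order_trans by blast
    then show "AE \<tau> in lborel. norm (indicator {0<..t} \<tau> * \<Phi> N \<tau>) \<le> 2 * Mz * norm (f \<tau>)" for N
      using \<Phi>_bound by (intro AE_I2) (auto simp: indicator_def)
  qed (use f in auto)
  then have "(\<lambda>N. (norm z0)\<^sup>2 + (LINT \<tau>|lborel. indicator {0<..t} \<tau> * \<Phi> N \<tau>)) \<longlonglongrightarrow> (norm z0)\<^sup>2 + (LINT \<tau>|lborel. indicator {0<..t} \<tau> * (2 * (z \<tau> \<bullet> f \<tau>)))"
    by (intro tendsto_intros)
  then show ?thesis by (rule LIMSEQ_le_const) (use bound in auto)
qed

end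

end

section \<open>Simultaneous normal form of a pair of Hermitian matrix functions\<close>

definition qform :: "complex^'n^'n \<Rightarrow> complex^'n \<Rightarrow> complex^'n \<Rightarrow> complex" where
  "qform Q x y = cvec_inner (Q *v x) y"

lemma cnj_cvec_inner: "cnj (cvec_inner x y) = cvec_inner y x"
  by (simp add: cvec_inner_def mult.commute)

lemma qform_add_left: "qform Q (x + y) v = qform Q x v + qform Q y v"
  by (simp add: qform_def matrix_vector_right_distrib cvec_inner_add_left)

lemma qform_diff_left: "qform Q (x - y) v = qform Q x v - qform Q y v"
  by (simp add: qform_def cvec_inner_def matrix_vector_mult_diff_distrib algebra_simps sum_subtractf)

lemma qform_diff_right: "qform Q v (x - y) = qform Q v x - qform Q v y"
  by (simp add: qform_def cvec_inner_diff_right)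

lemma qform_scale_left: "qform Q (c *s x) y = c * qform Q x y"
  by (simp add: qform_def vector_scalar_commute cvec_inner_scale_left)

lemma qform_scale_right: "qform Q x (c *s y) = cnj c * qform Q x y"
  by (simp add: qform_def cvec_inner_scale_right)

lemma qform_0[simp]: "qform Q 0 y = 0" "qform Q x 0 = 0"
  by (simp_all add: qform_def cvec_inner_def)

lemma qform_cnj:
  assumes "pos_def Q" shows "cnj (qform Q x y) = qform Q y x"
proof -
  have "conj_transpose Q = Q" using assms by (simp add: pos_def_def)
  then show ?thesis using cvec_inner_mult_left[of Q y x] by (simp add: qform_def cnj_cvec_inner)
qed

lemma qform_self:
  assumes "pos_def Q"
  shows "qform Q x x = of_real (Re (qform Q x x))" and "x \<noteq> 0 \<Longrightarrow> 0 < Re (qform Q x x)"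
proof -
  have "Im (qform Q x x) = 0"
    using arg_cong[OF qform_cnj[OF assms, of x x], of Im] by simp
  then show "qform Q x x = of_real (Re (qform Q x x))" by (simp add: complex_eq_iff)
  show "x \<noteq> 0 \<Longrightarrow> 0 < Re (qform Q x x)" using assms by (simp add: pos_def_def qform_def)
qed

definition qnormalize :: "complex^'n^'n \<Rightarrow> complex^'n \<Rightarrow> complex^'n" where
  "qnormalize Q x = complex_of_real (1 / sqrt (Re (qform Q x x))) *s x"

definition outer :: "complex^'n^'n \<Rightarrow> complex^'n \<Rightarrow> complex^'n^'n" where
  "outer Q w = (\<chi> i j. w $ i * cnj ((Q *v w) $ j))"

lemma outer_vec:
  assumes "pos_def Q" shows "outer Q w *v x = qform Q x w *s w"
proof -
  have "qform Q x w = cvec_inner x (Q *v w)"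
    unfolding qform_cnj[OF assms, of w x, symmetric] by (simp add: qform_def cnj_cvec_inner)
  then show ?thesis
    by (simp add: vec_eq_iff outer_def matrix_vector_mult_def cvec_inner_def sum_distrib_left sum_distrib_right mult_ac)
qed

text \<open>Gram--Schmidt for the columns of the projection \<open>E\<close>: each step splits off the rank-one
  projection onto the normalized column \<open>E e\<^sub>i\<close>. A vanishing column yields the zero vector
  (via \<open>1 / 0 = 0\<close>), so that the frame depends measurably on the parameter without case
  distinctions.\<close>

fun frame :: "('a \<Rightarrow> complex^'n^'n) \<Rightarrow> ('a \<Rightarrow> complex^'n^'n) \<Rightarrow> 'n list \<Rightarrow> ('a \<Rightarrow> complex^'n) list" where
  "frame Q E [] = []"
| "frame Q E (i # ks) = (\<lambda>\<omega>. qnormalize (Q \<omega>) (E \<omega> *v axis i 1)) #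
     frame Q (\<lambda>\<omega>. E \<omega> - outer (Q \<omega>) (qnormalize (Q \<omega>) (E \<omega> *v axis i 1))) ks"

lemma matrix_eq_axisI: "(\<And>j. M *v axis j 1 = 0) \<Longrightarrow> M = (0 :: complex^'n^'m)"
  by (simp add: vec_eq_iff matrix_axis_nth)

text \<open>Induction along the list: removing the rank-one part leaves a projection that is again
  orthogonal for \<open>Q\<close> and has one more vanishing column, until nothing remains.
  \<open>N\<close> stays the original projection while \<open>E\<close> shrinks, so that all frame
  vectors are seen to lie in the range of \<open>N\<close>.\<close>

lemma frame_decomposition:
  assumes pd: "pos_def (Q \<omega>)"
    and idem: "\<And>x. E \<omega> *v (E \<omega> *v x) = E \<omega> *v x"
    and sa: "\<And>x y. qform (Q \<omega>) (E \<omega> *v x) y = qform (Q \<omega>) x (E \<omega> *v y)"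
    and N: "\<And>x. N *v (E \<omega> *v x) = E \<omega> *v x"
    and zero: "\<And>j. j \<notin> set ks \<Longrightarrow> E \<omega> *v axis j 1 = 0"
  shows "(\<forall>w\<in>set (frame Q E ks). N *v w \<omega> = w \<omega> \<and> (w \<omega> = 0 \<or> qform (Q \<omega>) (w \<omega>) (w \<omega>) = 1))
    \<and> (\<forall>x. (\<Sum>w\<leftarrow>frame Q E ks. qform (Q \<omega>) x (w \<omega>) *s w \<omega>) = E \<omega> *v x)"
  using idem sa N zero
proof (induction ks arbitrary: E)
  case Nil
  then have "E \<omega> = 0" by (intro matrix_eq_axisI) simp
  then show ?case by simp
next
  case (Cons i ks)
  note idem = Cons.prems(1) and sa = Cons.prems(2) and N = Cons.prems(3) and zero = Cons.prems(4)
  define w0 where "w0 = E \<omega> *v axis i 1"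
  define w where "w = qnormalize (Q \<omega>) w0"
  define E' where "E' = (\<lambda>\<omega>. E \<omega> - outer (Q \<omega>) (qnormalize (Q \<omega>) (E \<omega> *v axis i 1)))"
  let ?q = "qform (Q \<omega>)"
  have E': "E' \<omega> *v x = E \<omega> *v x - ?q x w *s w" for x
    by (simp add: E'_def w_def w0_def matrix_vector_mult_diff_rdistrib outer_vec[OF pd])
  have Ew: "E \<omega> *v w = w"
    by (simp add: w_def qnormalize_def vector_scalar_commute w0_def idem)
  have Nw: "N *v w = w"
    by (simp add: w_def qnormalize_def vector_scalar_commute w0_def N)
  have qE: "?q (E \<omega> *v x) w = ?q x w" for x by (simp add: sa Ew)
  define r where "r = Re (?q w0 w0)"
  have w_r: "w = of_real (1 / sqrt r) *s w0" by (simp add: w_def qnormalize_def r_def)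
  have q0: "?q w0 w0 = of_real r" unfolding r_def by (rule qform_self(1)[OF pd])
  have r_pos: "w0 \<noteq> 0 \<Longrightarrow> 0 < r" unfolding r_def by (rule qform_self(2)[OF pd])
  have norm: "w = 0 \<or> ?q w w = 1"
  proof (cases "w0 = 0")
    case False
    then have "?q w w = of_real ((1 / sqrt r) * (1 / sqrt r) * r)"
      by (simp only: w_r qform_scale_left qform_scale_right q0 complex_cnj_complex_of_real of_real_mult mult.assoc)
    also have "(1 / sqrt r) * (1 / sqrt r) * r = 1" using r_pos[OF False] by (simp add: field_simps)
    finally show ?thesis by simp
  qed (simp add: w_r)
  \<comment> \<open>The rank-one part reproduces column \<open>i\<close> of \<open>E\<close>, so
    this column of the remainder vanishes.\<close>
  have ei: "?q (axis i 1) w *s w = w0"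
  proof (cases "w0 = 0")
    case False
    have "?q (axis i 1) w = ?q w0 w" using qE[of "axis i 1"] by (simp add: w0_def)
    also have "\<dots> = of_real (1 / sqrt r * r)" by (simp add: w_r qform_scale_right q0)
    finally have "?q (axis i 1) w *s w = of_real (1 / sqrt r * r * (1 / sqrt r)) *s w0"
      by (simp only: w_r vector_smult_assoc of_real_mult[symmetric])
    also have "1 / sqrt r * r * (1 / sqrt r) = 1" using r_pos[OF False] by (simp add: field_simps)
    finally show ?thesis by simp
  qed (simp add: w_r)
  have IH: "(\<forall>w\<in>set (frame Q E' ks). N *v w \<omega> = w \<omega> \<and> (w \<omega> = 0 \<or> ?q (w \<omega>) (w \<omega>) = 1))
    \<and> (\<forall>x. (\<Sum>w\<leftarrow>frame Q E' ks. ?q x (w \<omega>) *s w \<omega>) = E' \<omega> *v x)"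
  proof (rule Cons.IH)
    fix x y
    have "?q (E' \<omega> *v x) w *s w = 0"
      using norm by (auto simp: E' qform_diff_left qform_scale_left qE)
    then show "E' \<omega> *v (E' \<omega> *v x) = E' \<omega> *v x"
      unfolding E'[of "E' \<omega> *v x"]
      by (simp add: E' matrix_vector_mult_diff_distrib idem Ew vector_scalar_commute)
    show "?q (E' \<omega> *v x) y = ?q x (E' \<omega> *v y)"
      by (simp add: E' qform_diff_left qform_diff_right qform_scale_left qform_scale_right sa qform_cnj[OF pd] mult.commute)
    show "N *v (E' \<omega> *v x) = E' \<omega> *v x"
      by (simp add: E' matrix_vector_mult_diff_distrib N Nw vector_scalar_commute)
    fix j assume j: "j \<notin> set ks"
    show "E' \<omega> *v axis j 1 = 0"
    proof (cases "j = i")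
      case True
      then show ?thesis by (simp add: E' ei w0_def[symmetric])
    next
      case False
      then have "E \<omega> *v axis j 1 = 0" using zero j by auto
      then show ?thesis using qE[of "axis j 1"] by (simp add: E')
    qed
  qed
  have *: "frame Q E (i # ks) = (\<lambda>\<omega>. qnormalize (Q \<omega>) (E \<omega> *v axis i 1)) # frame Q E' ks"
    by (simp add: E'_def)
  have **: "qnormalize (Q \<omega>) (E \<omega> *v axis i 1) = w" by (simp add: w_def w0_def)
  show ?case
    unfolding * using IH norm Nw by (simp add: ** E')
qed

section \<open>Measurable dependence on the frequency\<close>

lemma measurable_qform[measurable (raw)]:
  fixes Q :: "'a \<Rightarrow> complex^'n^'n"
  assumes [measurable]: "Q \<in> borel_measurable M" "x \<in> borel_measurable M" "y \<in> borel_measurable M"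
  shows "(\<lambda>\<omega>. qform (Q \<omega>) (x \<omega>) (y \<omega>)) \<in> borel_measurable M"
  unfolding qform_def by measurable

lemma measurable_qnormalize[measurable (raw)]:
  fixes Q :: "'a \<Rightarrow> complex^'n^'n"
  assumes [measurable]: "Q \<in> borel_measurable M" "x \<in> borel_measurable M"
  shows "(\<lambda>\<omega>. qnormalize (Q \<omega>) (x \<omega>)) \<in> borel_measurable M"
  unfolding qnormalize_def by measurable

lemma measurable_outer[measurable (raw)]:
  fixes Q :: "'a \<Rightarrow> complex^'n^'n"
  assumes [measurable]: "Q \<in> borel_measurable M" "x \<in> borel_measurable M"
  shows "(\<lambda>\<omega>. outer (Q \<omega>) (x \<omega>)) \<in> borel_measurable M"
  unfolding outer_def by measurable

lemma measurable_frame: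
  assumes Q[measurable]: "Q \<in> borel_measurable M" and "E \<in> borel_measurable M"
  shows "w \<in> set (frame Q E ks) \<Longrightarrow> w \<in> borel_measurable M"
  using assms(2)
proof (induction ks arbitrary: E)
  case (Cons i ks)
  have [measurable]: "E \<in> borel_measurable M" by fact
  have "(\<lambda>\<omega>. qnormalize (Q \<omega>) (E \<omega> *v axis i 1)) \<in> borel_measurable M" by measurable
  moreover have "(\<lambda>\<omega>. E \<omega> - outer (Q \<omega>) (qnormalize (Q \<omega>) (E \<omega> *v axis i 1))) \<in> borel_measurable M" by measurable
  ultimately show ?case using Cons by auto
qed simp

text \<open>The position of the \<open>m\<close>-th nonzero vector varies with
  \<open>\<omega>\<close>, which a case distinction on the head of the list resolves. An index
  beyond the end is harmless, since \<open>[] ! m\<close> is a constant.\<close>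

lemma measurable_filter_nth:
  fixes fs :: "('a \<Rightarrow> 'b::euclidean_space) list"
  assumes "\<And>f. f \<in> set fs \<Longrightarrow> f \<in> borel_measurable M"
  shows "(\<lambda>\<omega>. filter (\<lambda>w. w \<noteq> 0) (map (\<lambda>f. f \<omega>) fs) ! m) \<in> borel_measurable M"
  using assms
proof (induction fs arbitrary: m)
  case (Cons f fs)
  have [measurable]: "f \<in> borel_measurable M" using Cons.prems by simp
  have IH[measurable]: "(\<lambda>\<omega>. filter (\<lambda>w. w \<noteq> 0) (map (\<lambda>f. f \<omega>) fs) ! m) \<in> borel_measurable M" for m
    using Cons by simp
  have "(\<lambda>\<omega>. filter (\<lambda>w. w \<noteq> 0) (map (\<lambda>f. f \<omega>) (f # fs)) ! m) =
    (\<lambda>\<omega>. if f \<omega> \<noteq> 0 then (case m of 0 \<Rightarrow> f \<omega> | Suc k \<Rightarrow> filter (\<lambda>w. w \<noteq> 0) (map (\<lambda>f. f \<omega>) fs) ! k)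
      else filter (\<lambda>w. w \<noteq> 0) (map (\<lambda>f. f \<omega>) fs) ! m)"
    by (auto simp: fun_eq_iff split: nat.split)
  also have "\<dots> \<in> borel_measurable M" by (cases m) simp_all
  finally show ?case .
qed simp

section \<open>Coercivity, continuity of the inverse, and ranks as traces\<close>

lemma continuous_mult_vec:
  fixes M :: "'a::topological_space \<Rightarrow> complex^'n^'m"
  assumes "continuous_on S M" "continuous_on S v"
  shows "continuous_on S (\<lambda>x. M x *v v x)"
  unfolding matrix_vector_mult_def
  by (intro continuous_on_vec_lambda continuous_intros assms continuous_on_component)

text \<open>The form attains a positive minimum on the compact product of \<open>K\<close> with the
  unit sphere, and homogeneity does the rest. It serves twice: for the continuity of
  \<open>Q^-1 S\<close> and for bounding \<open>R\<close> on compact sets.\<close>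

lemma pos_def_lower_bound:
  fixes Q :: "'a::topological_space \<Rightarrow> complex^'n^'n"
  assumes K: "compact K" and cont: "continuous_on K Q" and pd: "\<And>\<omega>. \<omega> \<in> K \<Longrightarrow> pos_def (Q \<omega>)"
  obtains c where "c > 0" "\<And>\<omega> v. \<omega> \<in> K \<Longrightarrow> c * (norm v)\<^sup>2 \<le> Re (qform (Q \<omega>) v v)"
proof (cases "K = {}")
  case True
  then show ?thesis using that[of 1] by simp
next
  case False
  let ?f = "\<lambda>p. Re (qform (Q (fst p)) (snd p) (snd p))"
  let ?S = "K \<times> sphere (0 :: complex^'n) 1"
  have "compact ?S" using K by (intro compact_Times) auto
  moreover have "?S \<noteq> {}"
  proof -
    have "axis undefined 1 \<in> sphere (0 :: complex^'n) 1" by simp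
    then show ?thesis using False by blast
  qed
  moreover have "continuous_on ?S ?f"
  proof -
    have c1: "continuous_on ?S (\<lambda>p. Q (fst p))"
      by (rule continuous_on_compose2[OF cont]) (auto intro!: continuous_intros)
    have c2: "continuous_on ?S (\<lambda>p. Q (fst p) *v snd p)"
      by (intro continuous_mult_vec c1 continuous_intros)
    show ?thesis unfolding qform_def cvec_inner_def
      by (intro continuous_intros continuous_on_component c2)
  qed
  ultimately obtain p where p: "p \<in> ?S" "\<And>p'. p' \<in> ?S \<Longrightarrow> ?f p \<le> ?f p'"
    using continuous_attains_inf[of ?S ?f] by blast
  obtain \<omega>0 v0 where p_eq: "p = (\<omega>0, v0)" by (cases p)
  have c: "?f p > 0" using p(1) qform_self(2)[OF pd, of \<omega>0 v0] by (cases "v0 = 0") (auto simp: p_eq)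
  show ?thesis
  proof (rule that[OF c])
    fix \<omega> and v :: "complex^'n" assume \<omega>: "\<omega> \<in> K"
    show "?f p * (norm v)\<^sup>2 \<le> Re (qform (Q \<omega>) v v)"
    proof (cases "v = 0")
      case False
      define u where "u = complex_of_real (1 / norm v) *s v"
      have "norm u = 1" unfolding u_def norm_vector_scalar_mult norm_of_real using False by simp
      then have "?f p \<le> Re (qform (Q \<omega>) u u)" using p(2)[of "(\<omega>, u)"] \<omega> by simp
      also have "Re (qform (Q \<omega>) u u) = Re (qform (Q \<omega>) v v) / (norm v)\<^sup>2"
        by (simp add: u_def qform_scale_left qform_scale_right power2_eq_square)
      finally show ?thesis using False by (simp add: pos_le_divide_eq)
    qed simp
  qed
qed

lemma matrix_inv_cancel:
  assumes "invertible (M :: complex^'n^'n)"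
  shows "M ** matrix_inv M = mat 1" "matrix_inv M ** M = mat 1"
  using someI_ex[OF assms[unfolded invertible_def]] unfolding matrix_inv_def by blast+

lemma pos_def_invertible:
  assumes "pos_def Q" shows "invertible Q"
proof -
  have "x = 0" if "Q *v x = 0" for x
    using qform_self(2)[OF assms, of x] that by (auto simp: qform_def cvec_inner_def)
  then show ?thesis
    using invertible_left_inverse[of Q] matrix_left_invertible_ker[of Q] by blast
qed

text \<open>The difference \<open>d\<close> of two solutions satisfies
  \<open>Q (x n) *v d = y n\<close> with a residual \<open>y n\<close> that tends to 0. Coercivity,
  uniform near \<open>a\<close>, turns this into \<open>norm d \<le> norm (y n) / c\<close> without
  any formula for the inverse.\<close>

lemma continuous_inverse_mult:
  fixes Q S :: "'a::euclidean_space \<Rightarrow> complex^'n^'n"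
  assumes Q: "continuous_on UNIV Q" and S: "continuous_on UNIV S" and pd: "\<And>\<omega>. pos_def (Q \<omega>)"
  shows "continuous_on UNIV (\<lambda>\<omega>. (matrix_inv (Q \<omega>) ** S \<omega>) *v v)"
  unfolding continuous_on_sequentially
proof (intro allI ballI impI, elim conjE)
  fix x :: "nat \<Rightarrow> 'a" and a assume x: "x \<longlonglongrightarrow> a"
  let ?K = "\<lambda>\<omega>. matrix_inv (Q \<omega>) ** S \<omega>"
  have QK: "Q \<omega> *v (?K \<omega> *v v) = S \<omega> *v v" for \<omega> v
    using matrix_inv_cancel(1)[OF pos_def_invertible[OF pd[of \<omega>]]]
    by (simp add: matrix_vector_mul_assoc matrix_mul_assoc)
  obtain c where c: "c > 0" "\<And>\<omega> v. \<omega> \<in> cball a 1 \<Longrightarrow> c * (norm v)\<^sup>2 \<le> Re (qform (Q \<omega>) v v)"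
    using pos_def_lower_bound[OF compact_cball continuous_on_subset[OF Q] pd] by (metis subset_UNIV)
  define y where "y n = S (x n) *v v - Q (x n) *v (?K a *v v)" for n
  have comp: "(\<lambda>n. M (x n) *v u) \<longlonglongrightarrow> M a *v u" if "continuous_on UNIV M" for M :: "'a \<Rightarrow> complex^'n^'n" and u
  proof -
    have "continuous_on UNIV (\<lambda>\<omega>. M \<omega> *v u)" by (intro continuous_mult_vec that continuous_intros)
    then show ?thesis using x unfolding continuous_on_sequentially o_def by simp
  qed
  have "y \<longlonglongrightarrow> S a *v v - Q a *v (?K a *v v)"
    unfolding y_def by (intro tendsto_diff comp Q S)
  then have "(\<lambda>n. 1 / c * norm (y n)) \<longlonglongrightarrow> 1 / c * norm (0 :: complex^'n)"
    unfolding QK by (intro tendsto_intros) simp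
  then have lim: "(\<lambda>n. 1 / c * norm (y n)) \<longlonglongrightarrow> 0" by simp
  have "(\<lambda>n. norm (?K (x n) *v v - ?K a *v v)) \<longlonglongrightarrow> 0"
  proof (rule tendsto_sandwich[OF _ _ tendsto_const lim])
    have "\<forall>\<^sub>F n in sequentially. dist (x n) a < 1" using x by (rule tendstoD) simp
    then show "\<forall>\<^sub>F n in sequentially. norm (?K (x n) *v v - ?K a *v v) \<le> 1 / c * norm (y n)"
    proof eventually_elim
      case (elim n)
      define d where "d = ?K (x n) *v v - ?K a *v v"
      have Qd: "Q (x n) *v d = y n" by (simp add: d_def y_def matrix_vector_mult_diff_distrib QK)
      have "c * (norm d)\<^sup>2 \<le> Re (qform (Q (x n)) d d)" using elim by (intro c) (simp add: dist_commute)
      also have "\<dots> \<le> norm (y n) * norm d"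
        unfolding qform_def Qd using complex_Re_le_cmod cmod_cvec_inner order_trans by blast
      finally have "norm d * (c * norm d) \<le> norm d * norm (y n)" by (simp add: power2_eq_square mult_ac)
      then have "c * norm d \<le> norm (y n)" by (cases "d = 0") auto
      then show ?case unfolding d_def[symmetric] using c(1) by (simp add: field_simps)
    qed
  qed simp
  then show "((\<lambda>\<omega>. ?K \<omega> *v v) \<circ> x) \<longlonglongrightarrow> ?K a *v v"
    unfolding o_def by (simp add: LIM_zero_iff tendsto_norm_zero_iff)
qed

definition signature :: "'n set \<Rightarrow> complex^'n^'n" where
  "signature J = (\<chi> i j. if i = j then (if i \<in> J then 1 else - 1) else 0)"

lemma signature_vec: "(signature J *v v) $ i = (if i \<in> J then v $ i else - v $ i)"
proof -
  have "(signature J *v v) $ i = (\<Sum>j\<in>UNIV. if j = i then (if i \<in> J then v $ i else - v $ i) else 0)"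
    unfolding signature_def matrix_vector_mult_def vec_lambda_beta by (rule sum.cong) auto
  then show ?thesis by simp
qed

text \<open>The map \<open>\<lambda>x. qform (Q \<omega>) x w *s w\<close> has trace
  \<open>qform (Q \<omega>) w w\<close>, which is 1 or, for \<open>w = 0\<close>, 0. The number of
  nonzero frame vectors is thus a trace and inherits its continuity.\<close>

lemma trace_eq_length_frame:
  fixes Q :: "'a \<Rightarrow> complex^'n^'n"
  assumes pd: "pos_def (Q \<omega>)"
    and frame: "\<forall>w\<in>set fs. w \<omega> = 0 \<or> qform (Q \<omega>) (w \<omega>) (w \<omega>) = 1"
    and sum: "\<And>x. (\<Sum>w\<leftarrow>fs. qform (Q \<omega>) x (w \<omega>) *s w \<omega>) = E *v x"
  shows "(\<Sum>i\<in>UNIV. (E *v axis i 1) $ i) = of_nat (length (filter (\<lambda>w. w \<noteq> 0) (map (\<lambda>f. f \<omega>) fs)))"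
proof -
  have q: "(\<Sum>i\<in>UNIV. qform (Q \<omega>) (axis i 1) w * w $ i) = qform (Q \<omega>) w w" for w
  proof -
    have a: "qform (Q \<omega>) (axis i 1) w = cnj ((Q \<omega> *v w) $ i)" for i
      unfolding qform_cnj[OF pd, of w "axis i 1", symmetric]
      by (simp add: qform_def cvec_inner_def axis_def if_distrib[of cnj] if_distrib[of "\<lambda>x. _ * x"] cong: if_cong)
    have "(\<Sum>i\<in>UNIV. qform (Q \<omega>) (axis i 1) w * w $ i) = cnj (qform (Q \<omega>) w w)"
      unfolding a by (simp add: qform_def cvec_inner_def mult.commute)
    then show ?thesis by (simp add: qform_cnj[OF pd])
  qed
  have nth: "(\<Sum>w\<leftarrow>fs. g w) $ i = (\<Sum>w\<leftarrow>fs. g w $ i)" for g :: "_ \<Rightarrow> complex^'n" and i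
    by (induction fs) auto
  have swap: "(\<Sum>i\<in>UNIV. (\<Sum>w\<leftarrow>fs. h w i)) = (\<Sum>w\<leftarrow>fs. \<Sum>i\<in>UNIV. h w i)" for h :: "_ \<Rightarrow> 'n \<Rightarrow> complex"
    by (induction fs) (auto simp: sum.distrib)
  have "(\<Sum>i\<in>UNIV. (E *v axis i 1) $ i) = (\<Sum>i\<in>UNIV. (\<Sum>w\<leftarrow>fs. qform (Q \<omega>) (axis i 1) (w \<omega>) * w \<omega> $ i))"
    unfolding sum[symmetric] nth by simp
  also have "\<dots> = (\<Sum>w\<leftarrow>fs. qform (Q \<omega>) (w \<omega>) (w \<omega>))" unfolding swap q ..
  also have "\<dots> = of_nat (length (filter (\<lambda>w. w \<noteq> 0) (map (\<lambda>f. f \<omega>) fs)))"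
    using frame by (induction fs) auto
  finally show ?thesis .
qed

lemma simultaneous_normal_form:
  fixes Qh Sh :: "real^'s::finite \<Rightarrow> complex^'n::finite^'n"
  assumes Q: "continuous_on UNIV Qh" and S: "continuous_on UNIV Sh"
    and pd: "\<And>\<omega>. pos_def (Qh \<omega>)" and S_herm: "\<And>\<omega>. Sh \<omega> = conj_transpose (Sh \<omega>)"
    and QS: "\<And>\<omega>. Qh \<omega> = Sh \<omega> ** matrix_inv (Qh \<omega>) ** Sh \<omega>"
  obtains R :: "real^'s \<Rightarrow> complex^'n^'n" and J where "R \<in> borel_measurable borel"
    and "\<And>\<omega>. R \<omega> ** (conj_transpose (R \<omega>) ** Qh \<omega>) = mat 1"
    and "\<And>\<omega>. Sh \<omega> ** R \<omega> = Qh \<omega> ** R \<omega> ** signature J"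
proof -
  define K where "K \<omega> = matrix_inv (Qh \<omega>) ** Sh \<omega>" for \<omega>
  note inv = matrix_inv_cancel[OF pos_def_invertible[OF pd]]
  have QK: "Qh \<omega> ** K \<omega> = Sh \<omega>" for \<omega>
    unfolding K_def matrix_mul_assoc inv by simp
  have KK: "K \<omega> ** K \<omega> = mat 1" for \<omega>
  proof -
    have "K \<omega> ** K \<omega> = matrix_inv (Qh \<omega>) ** (Sh \<omega> ** matrix_inv (Qh \<omega>) ** Sh \<omega>)"
      by (simp add: K_def matrix_mul_assoc)
    then show ?thesis by (simp only: QS[symmetric] inv)
  qed
  have K_cont: "continuous_on UNIV (\<lambda>\<omega>. K \<omega> *v v)" for v
    unfolding K_def by (rule continuous_inverse_mult[OF Q S pd])
  have [measurable]: "K \<in> borel_measurable borel"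
  proof -
    have "(\<lambda>\<omega>. \<chi> i. \<chi> j. (K \<omega> *v axis j 1) $ i) \<in> borel_measurable borel"
      by (intro measurable_vec_lambda measurable_vec_nth borel_measurable_continuous_onI K_cont)
    moreover have "(\<lambda>\<omega>. \<chi> i. \<chi> j. (K \<omega> *v axis j 1) $ i) = K" by (simp add: fun_eq_iff vec_eq_iff matrix_axis_nth)
    ultimately show ?thesis by simp
  qed
  have [measurable]: "Qh \<in> borel_measurable borel" using Q by (rule borel_measurable_continuous_onI)
  \<comment> \<open>For \<open>\<epsilon> = 1\<close> and \<open>\<epsilon> = -1\<close> these are
    the spectral projections of the involution \<open>K\<close>; by \<open>qK\<close> they are
    orthogonal for the inner product of \<open>Qh\<close>.\<close>
  define N where "N \<epsilon> \<omega> = (1/2 :: real) *\<^sub>R (mat 1 + \<epsilon> *\<^sub>R K \<omega>)" for \<epsilon> :: real and \<omega>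
  have [measurable]: "N \<epsilon> \<in> borel_measurable borel" for \<epsilon> unfolding N_def by measurable
  have N_vec: "N \<epsilon> \<omega> *v x = (1/2) *\<^sub>R (x + \<epsilon> *\<^sub>R (K \<omega> *v x))" for \<epsilon> \<omega> x
    by (simp add: N_def matrix_scaleR_vec matrix_vector_mult_add_rdistrib)
  have KKv: "K \<omega> *v (K \<omega> *v x) = x" for \<omega> x by (simp add: matrix_vector_mul_assoc KK)
  have K_scale: "K \<omega> *v (r *\<^sub>R x) = r *\<^sub>R (K \<omega> *v x)" for \<omega> r x
    by (simp add: linear_cmul[OF bounded_linear.linear[OF bounded_linear_matrix_vector]])
  have NK: "K \<omega> *v (N \<epsilon> \<omega> *v x) = \<epsilon> *\<^sub>R (N \<epsilon> \<omega> *v x)" if "\<epsilon> * \<epsilon> = 1" for \<epsilon> \<omega> x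
    using that by (simp add: N_vec K_scale matrix_vector_right_distrib KKv scaleR_add_right)
  have idem: "N \<epsilon> \<omega> *v (N \<epsilon> \<omega> *v x) = N \<epsilon> \<omega> *v x" if "\<epsilon> * \<epsilon> = 1" for \<epsilon> \<omega> x
    unfolding N_vec[of \<epsilon> \<omega> "N \<epsilon> \<omega> *v x"] NK[OF that] using that by (simp add: scaleR_2[symmetric])
  have qK: "qform (Qh \<omega>) (K \<omega> *v x) y = qform (Qh \<omega>) x (K \<omega> *v y)" for \<omega> x y
  proof -
    have "qform (Qh \<omega>) (K \<omega> *v x) y = cvec_inner (Sh \<omega> *v x) y"
      by (simp add: qform_def matrix_vector_mul_assoc QK)
    also have "\<dots> = cvec_inner x (Sh \<omega> *v y)" using cvec_inner_mult_left[of "Sh \<omega>" x y] S_herm[of \<omega>] by simp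
    also have "\<dots> = cnj (qform (Qh \<omega>) (K \<omega> *v y) x)"
      by (simp add: qform_def matrix_vector_mul_assoc QK cnj_cvec_inner)
    finally show ?thesis by (simp add: qform_cnj[OF pd])
  qed
  have R_C: "r *\<^sub>R v = complex_of_real r *s v" for r and v :: "complex^'n"
    by (simp add: vec_eq_iff) (simp add: scaleR_conv_of_real)
  have sa: "qform (Qh \<omega>) (N \<epsilon> \<omega> *v x) y = qform (Qh \<omega>) x (N \<epsilon> \<omega> *v y)" for \<epsilon> \<omega> x y
  proof -
    have "qform (Qh \<omega>) x (u + v) = qform (Qh \<omega>) x u + qform (Qh \<omega>) x v" for u v
      using qform_diff_right[of "Qh \<omega>" x "u + v" v] by simp
    then show ?thesis
      by (simp add: N_vec R_C qform_scale_left qform_scale_right qform_add_left qK)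
  qed
  obtain xs :: "'n list" where xs: "set xs = UNIV" using finite_list[of "UNIV :: 'n set"] by auto
  define fs where "fs \<epsilon> = frame Qh (N \<epsilon>) xs" for \<epsilon>
  have fs: "(\<forall>w\<in>set (fs \<epsilon>). N \<epsilon> \<omega> *v w \<omega> = w \<omega> \<and> (w \<omega> = 0 \<or> qform (Qh \<omega>) (w \<omega>) (w \<omega>) = 1))"
    "(\<Sum>w\<leftarrow>fs \<epsilon>. qform (Qh \<omega>) x (w \<omega>) *s w \<omega>) = N \<epsilon> \<omega> *v x" if "\<epsilon> * \<epsilon> = 1" for \<epsilon> \<omega> x
    using frame_decomposition[where Q = Qh and E = "N \<epsilon>" and N = "N \<epsilon> \<omega>" and \<omega> = \<omega> and ks = xs,
        OF pd idem[OF that] sa idem[OF that]] xs by (auto simp: fs_def)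
  have fs_meas: "f \<in> borel_measurable borel" if "f \<in> set (fs \<epsilon>)" for f \<epsilon>
    using that unfolding fs_def by (rule measurable_frame[rotated 2]) measurable
  \<comment> \<open>Without the zero vectors the lengths are the ranks of the two projections. They
    turn out not to depend on \<open>\<omega>\<close>, although the places of the nonzero vectors in
    \<open>fs\<close> may.\<close>
  define L where "L \<epsilon> \<omega> = filter (\<lambda>w. w \<noteq> 0) (map (\<lambda>f. f \<omega>) (fs \<epsilon>))" for \<epsilon> \<omega>
  have count: "(\<Sum>i\<in>UNIV. (N \<epsilon> \<omega> *v axis i 1) $ i) = of_nat (length (L \<epsilon> \<omega>))" if "\<epsilon> * \<epsilon> = 1" for \<epsilon> \<omega>
    unfolding L_def using fs[OF that] by (intro trace_eq_length_frame[where Q = Qh] pd) auto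
  have L_props: "K \<omega> *v w = \<epsilon> *\<^sub>R w" if "w \<in> set (L \<epsilon> \<omega>)" "\<epsilon> * \<epsilon> = 1" for w \<epsilon> \<omega>
  proof -
    have "N \<epsilon> \<omega> *v w = w" using that fs(1)[OF that(2), of \<omega>] by (auto simp: L_def)
    then show ?thesis using NK[OF that(2), of \<omega> w] by simp
  qed
  have L_sum: "(\<Sum>w\<leftarrow>L \<epsilon> \<omega>. qform (Qh \<omega>) x w *s w) = N \<epsilon> \<omega> *v x" if "\<epsilon> * \<epsilon> = 1" for \<epsilon> \<omega> x
  proof -
    have "(\<Sum>w\<leftarrow>filter (\<lambda>w. w \<noteq> 0) (map (\<lambda>f. f \<omega>) l). qform (Qh \<omega>) x w *s w) = (\<Sum>w\<leftarrow>l. qform (Qh \<omega>) x (w \<omega>) *s w \<omega>)" for l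
      by (induction l) auto
    then show ?thesis using fs(2)[OF that] by (simp add: L_def)
  qed
  have N_cont: "continuous_on UNIV (\<lambda>\<omega>. \<Sum>i\<in>UNIV. (N 1 \<omega> *v axis i 1) $ i)"
    unfolding N_vec by (intro continuous_intros continuous_on_component K_cont)
  \<comment> \<open>A continuous function with finitely many values on a connected space is
    constant; this fixes the rank for all frequencies.\<close>
  have "(\<lambda>\<omega>. \<Sum>i\<in>UNIV. (N 1 \<omega> *v axis i 1) $ i) constant_on UNIV"
  proof (rule continuous_finite_range_constant[OF connected_UNIV N_cont])
    have "length (L 1 \<omega>) \<le> length (fs 1)" for \<omega>
      unfolding L_def by (metis length_filter_le length_map)
    then have "range (\<lambda>\<omega>. \<Sum>i\<in>UNIV. (N 1 \<omega> *v axis i 1) $ i) \<subseteq> of_nat ` {..length (fs 1)}"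
      by (auto simp: count)
    then show "finite (range (\<lambda>\<omega>. \<Sum>i\<in>UNIV. (N 1 \<omega> *v axis i 1) $ i))" by (rule finite_subset) simp
  qed
  then obtain c where c: "\<And>\<omega>. (\<Sum>i\<in>UNIV. (N 1 \<omega> *v axis i 1) $ i) = c" by (auto simp: constant_on_def)
  define n1 where "n1 = length (L 1 undefined)"
  have len1: "length (L 1 \<omega>) = n1" for \<omega>
  proof -
    have "of_nat (length (L 1 \<omega>)) = (of_nat n1 :: complex)" using c[of \<omega>] c[of undefined] by (simp add: count n1_def)
    then show ?thesis by simp
  qed
  have len: "length (L 1 \<omega>) + length (L (-1) \<omega>) = CARD('n)" for \<omega>
  proof -
    have "complex_of_nat (length (L 1 \<omega>) + length (L (-1) \<omega>)) = (\<Sum>i\<in>UNIV. (N 1 \<omega> *v axis i 1) $ i + (N (-1) \<omega> *v axis i 1) $ i)"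
      by (simp add: sum.distrib count)
    also have "\<dots> = (\<Sum>i\<in>(UNIV :: 'n set). 1)"
    proof (rule sum.cong[OF refl])
      fix i :: 'n
      have "N 1 \<omega> *v axis i 1 + N (-1) \<omega> *v axis i 1 = axis i 1"
        by (simp add: N_vec scaleR_add_right scaleR_diff_right flip: scaleR_add_left)
      from arg_cong[OF this, of "\<lambda>v. v $ i"]
      show "(N 1 \<omega> *v axis i 1) $ i + (N (-1) \<omega> *v axis i 1) $ i = 1" by (simp add: axis_def)
    qed
    finally have "complex_of_nat (length (L 1 \<omega>) + length (L (-1) \<omega>)) = of_nat CARD('n)" by simp
    then show ?thesis by (simp only: of_nat_eq_iff)
  qed
  obtain e :: "'n \<Rightarrow> nat" where e: "bij_betw e UNIV {..<CARD('n)}"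
    using ex_bij_betw_finite_nat[of "UNIV :: 'n set"] by (auto simp: atLeast0LessThan)
  \<comment> \<open>\<open>e\<close> numbers the coordinates from 0, and the first \<open>n1\<close>
    places of \<open>l\<close> below hold the eigenvectors for 1. As \<open>n1\<close> is constant,
    so is \<open>J\<close>.\<close>
  define J where "J = {j. e j < n1}"
  define l where "l \<omega> = L 1 \<omega> @ L (-1) \<omega>" for \<omega>
  have l_len: "length (l \<omega>) = CARD('n)" for \<omega> using len by (simp add: l_def)
  have e_less: "e j < CARD('n)" for j using e by (auto simp: bij_betw_def)
  define R where "R \<omega> = (\<chi> i j. (l \<omega> ! e j) $ i)" for \<omega>
  have l_nth: "l \<omega> ! k = (if k < n1 then L 1 \<omega> ! k else L (-1) \<omega> ! (k - n1))" for \<omega> k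
    by (simp add: l_def nth_append len1)
  have l_meas: "(\<lambda>\<omega>. l \<omega> ! k) \<in> borel_measurable borel" for k
    unfolding l_nth L_def by (cases "k < n1") (simp_all add: measurable_filter_nth fs_meas)
  have R_meas: "R \<in> borel_measurable borel"
    unfolding R_def[abs_def] by (intro measurable_vec_lambda measurable_vec_nth l_meas)
  have R_vec: "R \<omega> *v y = (\<Sum>j\<in>UNIV. y $ j *s (l \<omega> ! e j))" for \<omega> y
    by (simp add: vec_eq_iff R_def matrix_vector_mult_def mult.commute)
  have R_axis: "R \<omega> *v axis j 1 = l \<omega> ! e j" for \<omega> j
    by (simp add: vec_eq_iff matrix_axis_nth) (simp add: R_def)
  \<comment> \<open>This is completeness of the frame: the two projections add up to the identity.
    For a square matrix it entails orthonormality, which therefore never has to be tracked.\<close>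
  have R1: "R \<omega> ** (conj_transpose (R \<omega>) ** Qh \<omega>) = mat 1" for \<omega>
  proof -
    have "(R \<omega> ** (conj_transpose (R \<omega>) ** Qh \<omega>)) *v x = mat 1 *v x" for x
    proof -
      have nth: "(conj_transpose (R \<omega>) *v (Qh \<omega> *v x)) $ j = qform (Qh \<omega>) x (l \<omega> ! e j)" for j
        unfolding matrix_vector_mult_def[of "conj_transpose (R \<omega>)"] qform_def cvec_inner_def
        by (simp add: conj_transpose_def R_def mult.commute)
      have "(R \<omega> ** (conj_transpose (R \<omega>) ** Qh \<omega>)) *v x = (\<Sum>j\<in>UNIV. qform (Qh \<omega>) x (l \<omega> ! e j) *s (l \<omega> ! e j))"
        by (simp add: matrix_vector_mul_assoc[symmetric] R_vec nth)
      also have "\<dots> = (\<Sum>k<CARD('n). qform (Qh \<omega>) x (l \<omega> ! k) *s (l \<omega> ! k))"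
        by (rule sum.reindex_bij_betw[OF e])
      also have "\<dots> = (\<Sum>w\<leftarrow>l \<omega>. qform (Qh \<omega>) x w *s w)"
        by (simp add: sum_list_sum_nth l_len atLeast0LessThan)
      also have "\<dots> = N 1 \<omega> *v x + N (-1) \<omega> *v x" by (simp add: l_def L_sum)
      also have "\<dots> = x" by (simp add: N_vec scaleR_add_right scaleR_diff_right flip: scaleR_add_left)
      finally show ?thesis by simp
    qed
    then show ?thesis by (subst matrix_eq) blast
  qed
  have R2: "Sh \<omega> ** R \<omega> = Qh \<omega> ** R \<omega> ** signature J" for \<omega>
  proof -
    have "K \<omega> *v (R \<omega> *v axis j 1) = R \<omega> *v (signature J *v axis j 1)" for j
    proof (cases "j \<in> J")
      case True
      then have "l \<omega> ! e j \<in> set (L 1 \<omega>)" unfolding l_nth J_def by (simp add: len1)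
      moreover have "signature J *v axis j 1 = axis j 1" using True by (auto simp: vec_eq_iff signature_vec axis_def)
      ultimately show ?thesis using L_props[of "l \<omega> ! e j" 1 \<omega>] by (simp add: R_axis)
    next
      case False
      have "e j - n1 < length (L (-1) \<omega>)" using False e_less[of j] len[of \<omega>] by (simp add: J_def len1)
      then have "l \<omega> ! e j \<in> set (L (-1) \<omega>)" using False unfolding l_nth J_def by simp
      moreover have "signature J *v axis j 1 = (-1) *\<^sub>R axis j 1" using False by (auto simp: vec_eq_iff signature_vec axis_def)
      ultimately show ?thesis using L_props[of "l \<omega> ! e j" "-1" \<omega>]
        by (simp add: R_axis linear_neg[OF bounded_linear.linear[OF bounded_linear_matrix_vector]])
    qed
    then have "(K \<omega> ** R \<omega> - R \<omega> ** signature J) *v axis j 1 = 0" for j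
      by (simp add: matrix_vector_mult_diff_rdistrib matrix_vector_mul_assoc)
    then have "K \<omega> ** R \<omega> - R \<omega> ** signature J = 0" by (rule matrix_eq_axisI)
    then have "K \<omega> ** R \<omega> = R \<omega> ** signature J" by simp
    then show ?thesis by (metis QK matrix_mul_assoc)
  qed
  show ?thesis by (rule that[OF R_meas R1 R2])
qed

section \<open>Semigroups of dissipative symbols\<close>

definition semigroup_op :: "(real^'s::finite \<Rightarrow> complex^'n::finite^'n) \<Rightarrow> real \<Rightarrow> ('s, 'n) l2 \<Rightarrow> ('s, 'n) l2" where
  "semigroup_op A t = mult_op (\<lambda>\<omega>. mat_exp (t *\<^sub>R A \<omega>))"

lemma l2_tendsto_norm_iff: "((\<lambda>n. X n) \<longlonglongrightarrow> (x :: ('s::finite, 'n::finite) l2)) \<longleftrightarrow> (\<lambda>n. norm (X n - x)) \<longlonglongrightarrow> 0"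
  by (simp add: LIM_zero_iff tendsto_norm_zero_iff)

lemma fourier_tendsto_iff: "(\<lambda>n. fourier_l2 (X n)) \<longlonglongrightarrow> fourier_l2 x \<longleftrightarrow> X \<longlonglongrightarrow> x"
  unfolding l2_tendsto_norm_iff by (simp add: norm_fourier flip: fourier_diff)

context
  fixes A :: "real^'s::finite \<Rightarrow> complex^'n::finite^'n"
  assumes A[measurable]: "A \<in> borel_measurable borel"
    and diss: "\<And>\<omega> v. (A \<omega> *v v) \<bullet> v \<le> 0"
begin

lemma bounded_symbol_mat_exp:
  assumes t: "t \<ge> 0" shows "bounded_symbol (\<lambda>\<omega>. mat_exp (t *\<^sub>R A \<omega>))"
  unfolding bounded_symbol_def
proof (intro conjI exI allI)
  show "(\<lambda>\<omega>. mat_exp (t *\<^sub>R A \<omega>)) \<in> borel_measurable borel" by measurable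
  show "norm (mat_exp (t *\<^sub>R A \<omega>) *v v) \<le> 1 * norm v" for \<omega> v
    using mat_exp_contraction[OF diss t] by simp
qed

lemma bounded_op_semigroup: "t \<ge> 0 \<Longrightarrow> bounded_op (semigroup_op A t)"
  unfolding semigroup_op_def by (intro bounded_op_mult_op bounded_symbol_mat_exp)

lemma semigroup_op_0: "semigroup_op A 0 = id"
  unfolding fun_eq_iff semigroup_op_def mat_exp_0 mult_op_1 by simp

lemma semigroup_op_add:
  assumes "s \<ge> 0" "t \<ge> 0"
  shows "semigroup_op A (s + t) f = semigroup_op A s (semigroup_op A t f)"
  unfolding semigroup_op_def mat_exp_add
  by (rule mult_op_mult[OF bounded_symbol_mat_exp[OF assms(1)] bounded_symbol_mat_exp[OF assms(2)], symmetric])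

lemma semigroup_op_contraction:
  assumes t: "t \<ge> 0" shows "norm (semigroup_op A t f) \<le> norm f"
proof -
  note rep = rep_mult_l2[OF bounded_symbol_mat_exp[OF t], of "fourier_l2 f"]
  have "(norm (fourier_l2 (semigroup_op A t f)))\<^sup>2 \<le> (norm (fourier_l2 f))\<^sup>2"
    unfolding norm_l2_sq semigroup_op_def fourier_mult_op
  proof (rule integral_mono_AE)
    show "AE \<omega> in lborel. (norm (rep_l2 (mult_l2 (\<lambda>\<omega>. mat_exp (t *\<^sub>R A \<omega>)) (fourier_l2 f)) \<omega>))\<^sup>2 \<le> (norm (rep_l2 (fourier_l2 f) \<omega>))\<^sup>2"
      using rep by eventually_elim (simp add: mat_exp_contraction[OF diss t] power_mono)
  qed (use sq_int_rep in \<open>auto simp: sq_int_def\<close>)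
  then show ?thesis unfolding norm_fourier by (rule power2_le_imp_le) simp
qed

lemma mat_exp_tendsto: "((\<lambda>t. mat_exp (t *\<^sub>R M) *v v) \<longlongrightarrow> v) (at (0 :: real))"
proof -
  have "isCont (\<lambda>t. mat_exp (t *\<^sub>R M) *v v) 0"
    by (rule has_vector_derivative_continuous[OF mat_exp_vec_derivative(1)])
  then show ?thesis using mat_exp_0[of M] by (simp add: isCont_def)
qed

lemma mat_exp_quotient_tendsto: "((\<lambda>t. (mat_exp (t *\<^sub>R M) *v v - v) /\<^sub>R t) \<longlongrightarrow> M *v v) (at (0 :: real))"
proof -
  let ?x = "\<lambda>t. mat_exp (t *\<^sub>R M) *v v"
  have "(?x has_derivative (\<lambda>h. h *\<^sub>R (M *v v))) (at 0)"
    using mat_exp_vec_derivative(1)[of M v 0 UNIV] mat_exp_0[of M] by (simp add: has_vector_derivative_def)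
  then have "((\<lambda>h. norm (?x h - ?x 0 - h *\<^sub>R (M *v v)) / norm h) \<longlongrightarrow> 0) (at 0)"
    by (simp add: has_derivative_at)
  moreover have "\<forall>\<^sub>F h in at 0. norm (?x h - ?x 0 - h *\<^sub>R (M *v v)) / norm h = norm ((?x h - v) /\<^sub>R h - M *v v)"
  proof (rule eventually_at_filter[THEN iffD2], rule always_eventually, intro allI impI)
    fix h :: real assume h: "h \<noteq> 0"
    then have "(?x h - v) /\<^sub>R h - M *v v = (?x h - ?x 0 - h *\<^sub>R (M *v v)) /\<^sub>R h"
      using mat_exp_0[of M] by (simp add: scaleR_diff_right)
    then show "norm (?x h - ?x 0 - h *\<^sub>R (M *v v)) / norm h = norm ((?x h - v) /\<^sub>R h - M *v v)"
      by (simp add: divide_inverse mult.commute)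
  qed
  ultimately have "((\<lambda>h. norm ((?x h - v) /\<^sub>R h - M *v v)) \<longlongrightarrow> 0) (at 0)"
    by (rule Lim_transform_eventually)
  then show ?thesis by (simp add: LIM_zero_iff tendsto_norm_zero_iff)
qed

lemma strongly_continuous: "((\<lambda>t. semigroup_op A t f) \<longlongrightarrow> f) (at_right 0)"
  unfolding tendsto_at_iff_sequentially
proof (intro allI impI)
  fix X :: "nat \<Rightarrow> real" assume X: "\<forall>i. X i \<in> {0<..} - {0}" "X \<longlonglongrightarrow> 0"
  let ?f = "rep_l2 (fourier_l2 f)"
  have "(\<lambda>i. abs_l2 (\<lambda>\<omega>. mat_exp (X i *\<^sub>R A \<omega>) *v ?f \<omega>)) \<longlonglongrightarrow> abs_l2 ?f"
  proof (rule l2_dominated_convergence[OF sq_int_rep])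
    have pos: "X i \<ge> 0" for i using X(1)[rule_format, of i] by simp
    show "sq_int (\<lambda>\<omega>. mat_exp (X i *\<^sub>R A \<omega>) *v ?f \<omega>)" for i
      by (rule sq_int_mult_bounded[OF bounded_symbol_mat_exp[OF pos] sq_int_rep])
    show "integrable lborel (\<lambda>\<omega>. 4 * (norm (?f \<omega>))\<^sup>2)" using sq_int_rep[of "fourier_l2 f"] by (simp add: sq_int_def)
    show "(norm (mat_exp (X i *\<^sub>R A \<omega>) *v ?f \<omega> - ?f \<omega>))\<^sup>2 \<le> 4 * (norm (?f \<omega>))\<^sup>2" for i \<omega>
    proof -
      have "norm (mat_exp (X i *\<^sub>R A \<omega>) *v ?f \<omega> - ?f \<omega>) \<le> 2 * norm (?f \<omega>)"
        using norm_triangle_ineq4[of "mat_exp (X i *\<^sub>R A \<omega>) *v ?f \<omega>" "?f \<omega>"]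
          mat_exp_contraction[OF diss pos, where v = "?f \<omega>"] by (smt (verit))
      from power_mono[OF this norm_ge_zero, of 2] show ?thesis by (simp add: power_mult_distrib)
    qed
    show "(\<lambda>i. mat_exp (X i *\<^sub>R A \<omega>) *v ?f \<omega>) \<longlonglongrightarrow> ?f \<omega>" for \<omega>
    proof -
      have "\<forall>i. X i \<in> UNIV - {0}" using X(1) by (metis DiffD2 DiffI UNIV_I)
      then show ?thesis
        using mat_exp_tendsto[of "A \<omega>" "?f \<omega>"] X(2) unfolding tendsto_at_iff_sequentially o_def by blast
    qed
  qed
  then have "(\<lambda>i. fourier_l2 (semigroup_op A (X i) f)) \<longlonglongrightarrow> fourier_l2 f"
    by (simp add: semigroup_op_def mult_l2_def abs_l2_rep)
  then show "((\<lambda>t. semigroup_op A t f) \<circ> X) \<longlonglongrightarrow> f" unfolding fourier_tendsto_iff o_def .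
qed

lemma c0_semigroup_op: "c0_semigroup (semigroup_op A)"
  unfolding c0_semigroup_def
  by (simp add: bounded_op_semigroup semigroup_op_0 semigroup_op_add strongly_continuous fun_eq_iff del: id_apply)

lemma difference_quotient:
  assumes "h > 0"
  shows "AE \<omega> in lborel. rep_l2 (fourier_l2 ((semigroup_op A h f - f) /\<^sub>R h)) \<omega>
    = (mat_exp (h *\<^sub>R A \<omega>) *v rep_l2 (fourier_l2 f) \<omega> - rep_l2 (fourier_l2 f) \<omega>) /\<^sub>R h"
proof -
  let ?M = "mult_l2 (\<lambda>\<omega>. mat_exp (h *\<^sub>R A \<omega>)) (fourier_l2 f)"
  have eq: "fourier_l2 ((semigroup_op A h f - f) /\<^sub>R h) = (?M - fourier_l2 f) /\<^sub>R h"
    by (simp add: fourier_scaleR fourier_diff semigroup_op_def)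
  have "AE \<omega> in lborel. rep_l2 ?M \<omega> = mat_exp (h *\<^sub>R A \<omega>) *v rep_l2 (fourier_l2 f) \<omega>"
    using assms by (intro rep_mult_l2 bounded_symbol_mat_exp) simp
  with rep_l2_scaleR[of "inverse h" "?M - fourier_l2 f"] rep_l2_diff[of ?M "fourier_l2 f"]
  show ?thesis unfolding eq by eventually_elim simp
qed

lemma generator_semigroup_op: "generator (semigroup_op A) = symbol_op A"
proof (rule set_eqI, clarify)
  fix f g :: "('s, 'n) l2"
  let ?f = "rep_l2 (fourier_l2 f)" and ?g = "rep_l2 (fourier_l2 g)"
  define D where "D h \<omega> = (mat_exp (h *\<^sub>R A \<omega>) *v ?f \<omega> - ?f \<omega>) /\<^sub>R h" for h \<omega>
  have D_meas[measurable]: "D h \<in> borel_measurable borel" for h unfolding D_def by measurable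
  have D_lim: "(\<lambda>i. D (X i) \<omega>) \<longlonglongrightarrow> A \<omega> *v ?f \<omega>" if "\<And>i. X i > 0" "X \<longlonglongrightarrow> 0" for X \<omega>
  proof -
    have "\<forall>i. X i \<in> UNIV - {0}" using that(1) by (metis DiffI UNIV_I less_irrefl singletonD)
    then show ?thesis
      using mat_exp_quotient_tendsto[of "A \<omega>" "?f \<omega>"] that(2) unfolding tendsto_at_iff_sequentially o_def D_def by blast
  qed
  show "(f, g) \<in> generator (semigroup_op A) \<longleftrightarrow> (f, g) \<in> symbol_op A"
  proof
    assume fg: "(f, g) \<in> symbol_op A"
    then have g: "AE \<omega> in lborel. ?g \<omega> = A \<omega> *v ?f \<omega>" by (simp add: symbol_op_iff)
    have Af: "sq_int (\<lambda>\<omega>. A \<omega> *v ?f \<omega>)"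
    proof (rule sq_int_bound)
      show "integrable lborel (\<lambda>\<omega>. (norm (?g \<omega>))\<^sup>2)" using sq_int_rep[of "fourier_l2 g"] by (simp add: sq_int_def)
      show "AE \<omega> in lborel. (norm (A \<omega> *v ?f \<omega>))\<^sup>2 \<le> (norm (?g \<omega>))\<^sup>2" using g by eventually_elim simp
    qed measurable
    have "((\<lambda>h. (semigroup_op A h f - f) /\<^sub>R h) \<longlongrightarrow> g) (at_right 0)"
      unfolding tendsto_at_iff_sequentially
    proof (intro allI impI)
      fix X :: "nat \<Rightarrow> real" assume X: "\<forall>i. X i \<in> {0<..} - {0}" "X \<longlonglongrightarrow> 0"
      have pos: "X i > 0" for i using X(1)[rule_format, of i] by simp
      \<comment> \<open>The quotients are bounded pointwise by their own limit, which is
        square-integrable because it represents the transform of \<open>g\<close>.\<close>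
      have D_le: "norm (D (X i) \<omega>) \<le> norm (A \<omega> *v ?f \<omega>)" for i \<omega>
      proof -
        have "norm (mat_exp (X i *\<^sub>R A \<omega>) *v ?f \<omega> - ?f \<omega>) \<le> X i * norm (A \<omega> *v ?f \<omega>)"
          by (rule mat_exp_difference[OF diss less_imp_le[OF pos]])
        moreover have "norm (D (X i) \<omega>) = norm (mat_exp (X i *\<^sub>R A \<omega>) *v ?f \<omega> - ?f \<omega>) / X i"
          using pos[of i] by (simp add: D_def divide_inverse mult.commute)
        ultimately show ?thesis using pos[of i] by (simp only: pos_divide_le_eq mult.commute)
      qed
      have D_sq: "sq_int (D (X i))" for i
      proof (rule sq_int_bound)
        show "integrable lborel (\<lambda>\<omega>. (norm (A \<omega> *v ?f \<omega>))\<^sup>2)" using Af by (simp add: sq_int_def)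
        show "AE \<omega> in lborel. (norm (D (X i) \<omega>))\<^sup>2 \<le> (norm (A \<omega> *v ?f \<omega>))\<^sup>2" using D_le by (intro AE_I2 power_mono) auto
      qed measurable
      have "(\<lambda>i. abs_l2 (D (X i))) \<longlonglongrightarrow> abs_l2 (\<lambda>\<omega>. A \<omega> *v ?f \<omega>)"
      proof (rule l2_dominated_convergence[OF Af D_sq])
        show "integrable lborel (\<lambda>\<omega>. 4 * (norm (A \<omega> *v ?f \<omega>))\<^sup>2)" using Af by (simp add: sq_int_def)
        show "(norm (D (X i) \<omega> - A \<omega> *v ?f \<omega>))\<^sup>2 \<le> 4 * (norm (A \<omega> *v ?f \<omega>))\<^sup>2" for i \<omega>
        proof -
          have "norm (D (X i) \<omega> - A \<omega> *v ?f \<omega>) \<le> 2 * norm (A \<omega> *v ?f \<omega>)"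
            using norm_triangle_ineq4[of "D (X i) \<omega>" "A \<omega> *v ?f \<omega>"] D_le[of i \<omega>] by simp
          from power_mono[OF this norm_ge_zero, of 2] show ?thesis by (simp add: power_mult_distrib)
        qed
      qed (rule D_lim[OF pos X(2)])
      moreover have "abs_l2 (D (X i)) = fourier_l2 ((semigroup_op A (X i) f - f) /\<^sub>R X i)" for i
        by (rule abs_l2_eq[OF D_sq]) (use difference_quotient[OF pos[of i], of f] in \<open>simp add: D_def\<close>)
      moreover have "abs_l2 (\<lambda>\<omega>. A \<omega> *v ?f \<omega>) = fourier_l2 g" by (rule abs_l2_eq[OF Af g])
      ultimately show "((\<lambda>h. (semigroup_op A h f - f) /\<^sub>R h) \<circ> X) \<longlonglongrightarrow> g"
        by (simp add: fourier_tendsto_iff o_def)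
    qed
    then show "(f, g) \<in> generator (semigroup_op A)" by (simp add: generator_def)
  next
    assume "(f, g) \<in> generator (semigroup_op A)"
    then have lim: "((\<lambda>h. (semigroup_op A h f - f) /\<^sub>R h) \<longlongrightarrow> g) (at_right 0)" by (simp add: generator_def)
    \<comment> \<open>A single sequence of times suffices here, and its countability allows the
      exceptional null sets of all quotients to be united before Fatou's lemma.\<close>
    define X where "X i = 1 / real (Suc i)" for i
    have X: "X i > 0" "X \<longlonglongrightarrow> 0" for i
      unfolding X_def using lim_1_over_n LIMSEQ_Suc by (auto simp del: of_nat_Suc)
    define q where "q i = (semigroup_op A (X i) f - f) /\<^sub>R X i" for i
    have "q \<longlonglongrightarrow> g"
      using lim X unfolding tendsto_at_iff_sequentially o_def q_def by simp
    then have q0: "(\<lambda>i. (norm (fourier_l2 (q i) - fourier_l2 g))\<^sup>2) \<longlonglongrightarrow> 0\<^sup>2"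
      unfolding l2_tendsto_norm_iff by (intro tendsto_power) (simp add: norm_fourier flip: fourier_diff)
    have qD: "AE \<omega> in lborel. rep_l2 (fourier_l2 (q i)) \<omega> = D (X i) \<omega>" for i
      using difference_quotient[OF X(1)[of i], of f] by (simp add: D_def q_def)
    have "AE \<omega> in lborel. \<forall>i. rep_l2 (fourier_l2 (q i)) \<omega> = D (X i) \<omega>"
      using qD by (simp add: AE_all_countable)
    then have "(\<integral>\<^sup>+\<omega>. ennreal ((norm (A \<omega> *v ?f \<omega> - ?g \<omega>))\<^sup>2) \<partial>lborel)
      = (\<integral>\<^sup>+\<omega>. liminf (\<lambda>i. ennreal ((norm (rep_l2 (fourier_l2 (q i)) \<omega> - ?g \<omega>))\<^sup>2)) \<partial>lborel)"
    proof (intro nn_integral_cong_AE, eventually_elim)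
      case (elim \<omega>)
      have "(\<lambda>i. ennreal ((norm (D (X i) \<omega> - ?g \<omega>))\<^sup>2)) \<longlonglongrightarrow> ennreal ((norm (A \<omega> *v ?f \<omega> - ?g \<omega>))\<^sup>2)"
        by (intro tendsto_ennrealI tendsto_intros D_lim X)
      from lim_imp_Liminf[OF sequentially_bot this] show ?case using elim by simp
    qed
    also have "\<dots> \<le> liminf (\<lambda>i. \<integral>\<^sup>+\<omega>. ennreal ((norm (rep_l2 (fourier_l2 (q i)) \<omega> - ?g \<omega>))\<^sup>2) \<partial>lborel)"
      by (intro nn_integral_liminf) measurable
    also have "\<dots> = liminf (\<lambda>i. ennreal ((norm (fourier_l2 (q i) - fourier_l2 g))\<^sup>2))"
    proof -
      have "(\<integral>\<^sup>+\<omega>. ennreal ((norm (rep_l2 (fourier_l2 (q i)) \<omega> - ?g \<omega>))\<^sup>2) \<partial>lborel) = ennreal ((norm (fourier_l2 (q i) - fourier_l2 g))\<^sup>2)" for i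
        by (subst ennreal_norm_abs_l2_sq[symmetric]) (simp_all add: sq_int_diff sq_int_rep abs_l2_diff abs_l2_rep)
      then show ?thesis by simp
    qed
    also have "\<dots> = 0"
      using tendsto_ennrealI[OF q0] by (simp add: lim_imp_Liminf)
    finally have "(\<integral>\<^sup>+\<omega>. ennreal ((norm (A \<omega> *v ?f \<omega> - ?g \<omega>))\<^sup>2) \<partial>lborel) = 0" by simp
    then have "AE \<omega> in lborel. ennreal ((norm (A \<omega> *v ?f \<omega> - ?g \<omega>))\<^sup>2) = 0"
      by (subst (asm) nn_integral_0_iff_AE) auto
    then show "(f, g) \<in> symbol_op A"
      unfolding symbol_op_iff by eventually_elim simp
  qed
qed

lemma generates_semigroup_op: "generates (symbol_op A) (semigroup_op A)"
  by (simp add: generates_def c0_semigroup_op generator_semigroup_op)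

lemma contraction_semigroup_op: "contraction_semigroup (semigroup_op A)"
proof (rule contraction_semigroup.intro)
  show "bounded_linear (semigroup_op A t)" if "t \<ge> 0" for t
    using bounded_op_semigroup[OF that] by (simp add: bounded_op_def)
qed (simp_all add: semigroup_op_0 semigroup_op_add semigroup_op_contraction strongly_continuous)

end

lemma bounded_op_inner_adjoint:
  assumes "bounded_symbol M"
  shows "mult_op M f \<bullet> g = f \<bullet> mult_op (\<lambda>\<omega>. conj_transpose (M \<omega>)) g"
proof -
  have "cinner_l2 (fourier_l2 (mult_op M f)) (fourier_l2 g)
    = cinner_l2 (fourier_l2 f) (fourier_l2 (mult_op (\<lambda>\<omega>. conj_transpose (M \<omega>)) g))"
    unfolding cinner_l2_eq fourier_mult_op
  proof (rule integral_cong_AE)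
    show "AE \<omega> in lborel. cvec_inner (rep_l2 (mult_l2 M (fourier_l2 f)) \<omega>) (rep_l2 (fourier_l2 g) \<omega>)
      = cvec_inner (rep_l2 (fourier_l2 f) \<omega>) (rep_l2 (mult_l2 (\<lambda>\<omega>. conj_transpose (M \<omega>)) (fourier_l2 g)) \<omega>)"
      using rep_mult_l2[OF assms, of "fourier_l2 f"] rep_mult_l2[OF bounded_symbol_conj_transpose[OF assms], of "fourier_l2 g"]
      by eventually_elim (simp add: cvec_inner_mult_left)
  qed measurable
  then show ?thesis unfolding cinner_fourier Re_cinner_l2[symmetric] by simp
qed

text \<open>This is \<open>energy_inequality\<close> with forcing \<open>B u\<close>. As the output
  operator is the adjoint of the input operator, the inner product of the state with
  \<open>B u\<close> equals that of \<open>u\<close> with the output, and twice this is the supply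
  rate.\<close>

lemma internally_passive:
  fixes A :: "real^'s::finite \<Rightarrow> complex^'n::finite^'n" and B :: "real^'s \<Rightarrow> complex^'m::finite^'n"
  assumes A: "A \<in> borel_measurable borel" and diss: "\<And>\<omega> v. (A \<omega> *v v) \<bullet> v \<le> 0"
    and B: "bounded_symbol B"
  shows "internally_impedance_passive (symbol_op A) (mult_op B) (mult_op (\<lambda>\<omega>. conj_transpose (B \<omega>)))"
  unfolding internally_impedance_passive_def passive_with_storage_def Let_def
proof (intro exI[of _ "semigroup_op A"] conjI allI impI)
  show "generates (symbol_op A) (semigroup_op A)" by (rule generates_semigroup_op[OF A diss])
  fix z0 :: "('s, 'n) l2" and t :: real and u :: "real \<Rightarrow> ('s, 'm) l2" assume t: "0 \<le> t" and u: "l2_input t u"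
  let ?T = "semigroup_op A" and ?B = "mult_op B" and ?C = "mult_op (\<lambda>\<omega>. conj_transpose (B \<omega>))"
  interpret contraction_semigroup ?T by (rule contraction_semigroup_op[OF A diss])
  have B_bl: "bounded_linear ?B" using bounded_op_mult_op[OF B] by (simp add: bounded_op_def)
  \<comment> \<open>Only the values of \<open>u\<close> on \<open>{0..t}\<close> are controlled. Cut
    off there, a square-integrable input is integrable because the interval has finite
    length.\<close>
  define f where "f \<tau> = ?B (indicator {0..t} \<tau> *\<^sub>R u \<tau>)" for \<tau>
  have f_eq: "f \<tau> = indicator {0..t} \<tau> *\<^sub>R ?B (u \<tau>)" for \<tau>
    by (simp add: f_def linear_cmul[OF bounded_linear.linear[OF B_bl]])
  have f_int: "integrable lborel f"
    unfolding f_def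
  proof (rule integrable_bounded_linear[OF B_bl], rule Bochner_Integration.integrable_bound)
    show "integrable lborel (\<lambda>\<tau>. indicator {0..t} \<tau> + indicator {0..t} \<tau> *\<^sub>R (norm (u \<tau>))\<^sup>2 :: real)"
    proof (rule Bochner_Integration.integrable_add)
      show "integrable lborel (indicator {0..t} :: real \<Rightarrow> real)" by (intro integrable_real_indicator) (simp_all add: emeasure_lborel_Icc_eq)
      show "integrable lborel (\<lambda>\<tau>. indicator {0..t} \<tau> *\<^sub>R (norm (u \<tau>))\<^sup>2)"
        using u unfolding l2_input_def set_integrable_def by blast
    qed
    show "(\<lambda>\<tau>. indicator {0..t} \<tau> *\<^sub>R u \<tau>) \<in> borel_measurable lborel"
      using u by (simp add: l2_input_def set_borel_measurable_def)
    show "AE \<tau> in lborel. norm (indicator {0..t} \<tau> *\<^sub>R u \<tau>) \<le> norm (indicator {0..t} \<tau> + indicator {0..t} \<tau> *\<^sub>R (norm (u \<tau>))\<^sup>2 :: real)"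
      by (intro AE_I2) (auto simp: indicator_def le_one_plus_square)
  qed
  define y where "y = z f z0"
  have mild: "mild_state ?T ?B z0 u s = y s" if "0 \<le> s" "s \<le> t" for s
  proof -
    have "(LINT \<tau>:{0..s}|lborel. ?T (s - \<tau>) (?B (u \<tau>))) = (LINT \<tau>|lborel. indicator {0..s} \<tau> *\<^sub>R S (s - \<tau>) (f \<tau>))"
      unfolding set_lebesgue_integral_def
      by (intro Bochner_Integration.integral_cong) (use that in \<open>auto simp: indicator_def f_eq S_eq\<close>)
    then show ?thesis unfolding mild_state_def y_def z_def[OF f_int] using that by (simp add: S_eq)
  qed
  have y0: "y 0 = z0" unfolding y_def by (rule z_0[OF f_int])
  have "(norm (mild_state ?T ?B z0 u t))\<^sup>2 \<le> (norm (mild_state ?T ?B z0 u 0))\<^sup>2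
     + (LINT \<tau>|lborel. indicator {0<..t} \<tau> * (2 * (y \<tau> \<bullet> f \<tau>)))"
    using energy_inequality[OF f_int t, of z0] t by (simp add: mild y0 y_def[symmetric])
  also have "(LINT \<tau>|lborel. indicator {0<..t} \<tau> * (2 * (y \<tau> \<bullet> f \<tau>)))
    = (LINT \<tau>:{0..t}|lborel. Re (cinner_l2 (u \<tau>) (?C (mild_state ?T ?B z0 u \<tau>)) + cinner_l2 (?C (mild_state ?T ?B z0 u \<tau>)) (u \<tau>)))"
  proof -
    have "(LINT \<tau>|lborel. indicator {0<..t} \<tau> * (2 * (y \<tau> \<bullet> f \<tau>))) = (LINT \<tau>|lborel. indicator {0..t} \<tau> * (2 * (y \<tau> \<bullet> f \<tau>)))"
    proof (rule integral_cong_AE)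
      have [measurable]: "y \<in> borel_measurable borel" "f \<in> borel_measurable borel"
        unfolding y_def using z_measurable[OF f_int] f_int by auto
      show "(\<lambda>\<tau>. indicator {0<..t} \<tau> * (2 * (y \<tau> \<bullet> f \<tau>))) \<in> borel_measurable lborel"
        "(\<lambda>\<tau>. indicator {0..t} \<tau> * (2 * (y \<tau> \<bullet> f \<tau>))) \<in> borel_measurable lborel" by measurable
      show "AE \<tau> in lborel. indicator {0<..t} \<tau> * (2 * (y \<tau> \<bullet> f \<tau>)) = indicator {0..t} \<tau> * (2 * (y \<tau> \<bullet> f \<tau>))"
        using AE_lborel_singleton[of "0 :: real"] by eventually_elim (auto simp: indicator_def)
    qed
    also have "\<dots> = (LINT \<tau>:{0..t}|lborel. Re (cinner_l2 (u \<tau>) (?C (mild_state ?T ?B z0 u \<tau>)) + cinner_l2 (?C (mild_state ?T ?B z0 u \<tau>)) (u \<tau>)))"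
      unfolding set_lebesgue_integral_def
    proof (rule Bochner_Integration.integral_cong[OF refl])
      fix \<tau> :: real
      show "indicator {0..t} \<tau> * (2 * (y \<tau> \<bullet> f \<tau>)) = indicator {0..t} \<tau> *\<^sub>R
        Re (cinner_l2 (u \<tau>) (?C (mild_state ?T ?B z0 u \<tau>)) + cinner_l2 (?C (mild_state ?T ?B z0 u \<tau>)) (u \<tau>))"
      proof (cases "\<tau> \<in> {0..t}")
        case True
        have "y \<tau> \<bullet> f \<tau> = u \<tau> \<bullet> ?C (y \<tau>)"
          using bounded_op_inner_adjoint[OF B, of "u \<tau>" "y \<tau>"] True by (simp add: f_eq inner_commute)
        then show ?thesis using True by (simp add: mild Re_cinner_l2 inner_commute)
      qed simp
    qed
    finally show ?thesis .
  qed
  finally show "(norm (mild_state ?T ?B z0 u t))\<^sup>2 \<le> (norm (mild_state ?T ?B z0 u 0))\<^sup>2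
     + (LINT \<tau>:{0..t}|lborel. Re (cinner_l2 (u \<tau>) (?C (mild_state ?T ?B z0 u \<tau>)) + cinner_l2 (?C (mild_state ?T ?B z0 u \<tau>)) (u \<tau>)))" .
qed

section \<open>Self-duality and the block structure\<close>

lemma locally_bounded_of_bounded_symbol:
  assumes "bounded_symbol M" shows "locally_bounded_symbol M"
proof -
  obtain K where "\<And>x v. norm (M x *v v) \<le> K * norm v" using bounded_symbolE[OF assms] by blast
  then have "norm (M x) \<le> real CARD('c) * (real CARD('b) * K)" for x by (rule norm_matrix_le)
  then show ?thesis
    using bounded_symbol_meas[OF assms] by (auto simp: locally_bounded_symbol_def bounded_iff)
qed

lemma cvec_inner_minus_left: "cvec_inner (- v) w = - cvec_inner v w"
  by (simp add: cvec_inner_def sum_negf)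

lemma conj_transpose_signature[simp]: "conj_transpose (signature J) = signature J"
  by (simp add: conj_transpose_def signature_def vec_eq_iff)

lemma signature_signature[simp]: "signature J ** signature J = mat 1"
  by (subst matrix_eq) (simp add: matrix_vector_mul_assoc[symmetric] vec_eq_iff signature_vec)

lemma signature_mult_nth: "(signature J ** M) $ i $ j = (if i \<in> J then M $ i $ j else - M $ i $ j)"
proof -
  have "(signature J ** M) $ i $ j = (signature J *v (\<chi> k. M $ k $ j)) $ i"
    by (simp add: matrix_matrix_mult_def matrix_vector_mult_def)
  then show ?thesis by (simp add: signature_vec)
qed

lemma mult_signature_nth: "(M ** signature J) $ i $ j = (if j \<in> J then M $ i $ j else - M $ i $ j)"
proof -
  have "M ** signature J = conj_transpose (signature J ** conj_transpose M)"
    by (simp add: conj_transpose_mult)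
  then show ?thesis by (simp add: conj_transpose_def signature_mult_nth)
qed

lemma minus_matrix_vector: "(- M) *v v = - (M *v (v :: complex^'n))"
  by (simp add: vec_eq_iff matrix_vector_mult_def sum_negf)

lemma uminus_block_op:
  fixes M :: "real^'s::finite \<Rightarrow> complex^'n::finite^'m::finite"
  shows "uminus_op (block_op I J M) = block_op I J (\<lambda>\<omega>. - M \<omega>)"
proof -
  have m: "mat_block I J (- N) *v v = - (mat_block I J N *v v)" for N :: "complex^'n^'m" and v
    by (simp add: vec_eq_iff mat_block_def matrix_vector_mult_def sum_negf[symmetric] if_distrib[of uminus] if_distrib[of "\<lambda>x. x * _"] cong: if_cong)
  have neg: "(f, - g) \<in> block_op I J M \<longleftrightarrow> (f, g) \<in> block_op I J (\<lambda>\<omega>. - M \<omega>)" for f g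
  proof -
    have on: "- g \<in> l2_on I \<longleftrightarrow> g \<in> l2_on I"
    proof -
      have "(AE x in lborel. \<forall>i. i \<notin> I \<longrightarrow> rep_l2 (- g) x $ i = 0) \<longleftrightarrow> (AE x in lborel. \<forall>i. i \<notin> I \<longrightarrow> rep_l2 g x $ i = 0)"
        (is "?L \<longleftrightarrow> ?R")
      proof
        assume ?L with rep_l2_uminus[of g] show ?R by eventually_elim simp
      next
        assume ?R with rep_l2_uminus[of g] show ?L by eventually_elim simp
      qed
      then show ?thesis by (simp add: l2_on_def)
    qed
    have "(AE \<omega> in lborel. rep_l2 (- fourier_l2 g) \<omega> = mat_block I J (M \<omega>) *v rep_l2 (fourier_l2 f) \<omega>)
      \<longleftrightarrow> (AE \<omega> in lborel. rep_l2 (fourier_l2 g) \<omega> = mat_block I J (- M \<omega>) *v rep_l2 (fourier_l2 f) \<omega>)" (is "?L \<longleftrightarrow> ?R")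
    proof
      assume ?L with rep_l2_uminus[of "fourier_l2 g"] show ?R
        by eventually_elim (metis m minus_minus)
    next
      assume ?R with rep_l2_uminus[of "fourier_l2 g"] show ?L by eventually_elim (simp add: m)
    qed
    then show ?thesis by (simp add: block_op_iff on fourier_minus)
  qed
  show ?thesis
  proof (rule set_eqI, clarify)
    fix f g
    have "(f, g) \<in> uminus_op (block_op I J M) \<longleftrightarrow> (f, - g) \<in> block_op I J M"
      by (auto simp: uminus_op_def) (metis minus_minus)
    then show "(f, g) \<in> uminus_op (block_op I J M) \<longleftrightarrow> (f, g) \<in> block_op I J (\<lambda>\<omega>. - M \<omega>)"
      by (simp add: neg)
  qed
qed

lemma block_op_cong:
  "(\<And>\<omega>. mat_block I J (M \<omega>) = mat_block I J (N \<omega>)) \<Longrightarrow> block_op I J M = block_op I J N"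
  by (simp add: block_op_def)

lemma zero_block_op:
  fixes M :: "real^'s::finite \<Rightarrow> complex^'n::finite^'m::finite"
  assumes "\<And>\<omega>. mat_block I UNIV (M \<omega>) = 0"
  shows "block_op I UNIV M = graph (\<lambda>_. 0)"
proof (rule set_eqI, clarify)
  fix f :: "('s, 'n) l2" and g :: "('s, 'm) l2"
  have "g = 0" if "AE \<omega> in lborel. rep_l2 (fourier_l2 g) \<omega> = 0"
  proof -
    have "fourier_l2 g = 0" using that rep_l2_zero by (intro l2_eqI) (auto elim: eventually_elim2)
    then show ?thesis using fourier_eqI[of g 0] by (simp add: fourier_zero)
  qed
  moreover have "(0 :: ('s, 'm) l2) \<in> l2_on I"
  proof -
    have "AE x in lborel. rep_l2 (0 :: ('s, 'm) l2) x = 0" by (rule rep_l2_zero)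
    then show ?thesis unfolding l2_on_def mem_Collect_eq by eventually_elim simp
  qed
  ultimately show "(f, g) \<in> block_op I UNIV M \<longleftrightarrow> (f, g) \<in> graph (\<lambda>_. 0)"
    by (auto simp: block_op_iff graph_def assms fourier_zero rep_l2_zero)
qed

text \<open>Self-adjointness is the exact adjoint formula combined with the Hermitian symmetry of
  the block. The sign is inherited because on vectors supported in \<open>J\<close> the block and
  the whole matrix have the same quadratic form.\<close>

lemma nonpos_block_op:
  fixes M :: "real^'s::finite \<Rightarrow> complex^'n::finite^'n"
  assumes M: "M \<in> borel_measurable borel" and diss: "\<And>\<omega> v. (M \<omega> *v v) \<bullet> v \<le> 0"
    and herm: "\<And>\<omega>. mat_block J J (conj_transpose (M \<omega>)) = mat_block J J (M \<omega>)"
  shows "nonpos_op_on (l2_on J) (block_op J J M)"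
  unfolding nonpos_op_on_def self_adjoint_on_def
proof (intro conjI ballI)
  show "densely_defined_on (l2_on J) (block_op J J M)" by (rule densely_defined_block[OF M])
  show "adjoint_on (l2_on J) (l2_on J) (block_op J J M) = block_op J J M"
    unfolding adjoint_block[OF M] by (rule block_op_cong) (rule herm)
  fix p assume p: "p \<in> block_op J J M"
  obtain f g where fg: "p = (f, g)" by (cases p)
  have "fourier_l2 f \<in> l2_on J" using p fg by (simp add: block_op_iff l2_on_fourier)
  then have on: "AE \<omega> in lborel. \<forall>i. i \<notin> J \<longrightarrow> rep_l2 (fourier_l2 f) \<omega> $ i = 0" by (simp add: l2_on_def)
  have block: "(mat_block J J N *v v) \<bullet> v = (N *v v) \<bullet> v" if "\<forall>i. i \<notin> J \<longrightarrow> v $ i = 0" for N :: "complex^'n^'n" and v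
  proof -
    have "(mat_block J J N *v v) $ i = (coord_proj J *v (N *v v)) $ i" for i
    proof (cases "i \<in> J")
      case True
      then have "(mat_block J J N *v v) $ i = (\<Sum>j\<in>UNIV. N $ i $ j * v $ j)"
        unfolding mat_block_def matrix_vector_mult_def vec_lambda_beta using that by (intro sum.cong) auto
      then show ?thesis using True by (simp add: coord_proj_nth) (simp add: matrix_vector_mult_def)
    qed (simp add: coord_proj_nth mat_block_vec_outside)
    then have "mat_block J J N *v v = coord_proj J *v (N *v v)" by (simp add: vec_eq_iff)
    then show ?thesis using that by (auto simp: inner_vec_def coord_proj_nth intro!: sum.cong)
  qed
  have "AE \<omega> in lborel. rep_l2 (fourier_l2 g) \<omega> = mat_block J J (M \<omega>) *v rep_l2 (fourier_l2 f) \<omega>"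
    using p fg by (simp add: block_op_iff)
  with on have le: "AE \<omega> in lborel. rep_l2 (fourier_l2 g) \<omega> \<bullet> rep_l2 (fourier_l2 f) \<omega> \<le> 0"
    by eventually_elim (simp add: block diss)
  have "cinner_l2 g f = cinner_l2 (fourier_l2 g) (fourier_l2 f)" by (simp add: cinner_fourier)
  then have "Re (cinner_l2 g f) = (LINT \<omega>|lborel. rep_l2 (fourier_l2 g) \<omega> \<bullet> rep_l2 (fourier_l2 f) \<omega>)"
    by (simp add: Re_cinner_l2 inner_l2_eq)
  also have "\<dots> \<le> (LINT \<omega>::real^'s|lborel. 0)"
    by (rule integral_mono_AE[OF integrable_sq_inner[OF sq_int_rep sq_int_rep] _ le]) simp
  finally show "case p of (f, g) \<Rightarrow> Re (cinner_l2 g f) \<le> 0" by (simp add: fg)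
qed

text \<open>The isomorphism is multiplication by the constant matrix \<open>signature J\<close>.
  Being an involution, it maps each of the two graphs into the other, which gives equality of the
  domains.\<close>

lemma self_dual_symbol:
  fixes A :: "real^'s::finite \<Rightarrow> complex^'n::finite^'n" and B :: "real^'s \<Rightarrow> complex^'m::finite^'n"
  assumes A: "A \<in> borel_measurable borel" and B: "bounded_symbol B"
    and dual: "\<And>\<omega>. conj_transpose (A \<omega>) ** signature J = signature J ** A \<omega>"
    and JB: "\<And>\<omega>. signature J ** B \<omega> = B \<omega>"
  shows "self_dual (symbol_op A) (mult_op B) (mult_op (\<lambda>\<omega>. conj_transpose (B \<omega>)))"
  unfolding self_dual_def
proof (intro exI conjI)
  let ?T = "mult_op (\<lambda>_. signature J) :: ('s, 'n) l2 \<Rightarrow> ('s, 'n) l2"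
  note E = bounded_symbol_const[of "signature J"] and C = bounded_symbol_conj_transpose[OF B]
  have TT: "?T (?T f) = f" for f by (simp add: mult_op_mult[OF E E] mult_op_1)
  show bo: "bounded_op ?T" by (rule bounded_op_mult_op[OF E])
  show "bij ?T" by (rule o_bij[of ?T]) (auto simp: TT fun_eq_iff)
  have "inv ?T = ?T" by (rule inv_unique_comp) (auto simp: TT fun_eq_iff)
  then show "bounded_op (inv ?T)" using bo by simp
  have adj: "adjoint_op (symbol_op A) = symbol_op (\<lambda>\<omega>. conj_transpose (A \<omega>))" by (rule adjoint_symbol[OF A])
  have dual': "signature J ** conj_transpose (A \<omega>) = A \<omega> ** signature J" for \<omega>
  proof -
    have "signature J ** conj_transpose (A \<omega>) = signature J ** (conj_transpose (A \<omega>) ** signature J) ** signature J"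
      by (simp add: matrix_mul_assoc[symmetric])
    also have "\<dots> = A \<omega> ** signature J" by (simp add: dual matrix_mul_assoc)
    finally show ?thesis .
  qed
  have trans: "(?T f, ?T g) \<in> symbol_op N" if "(f, g) \<in> symbol_op M" and eq: "\<And>\<omega>. signature J ** M \<omega> = N \<omega> ** signature J"
    for f g and M N :: "real^'s \<Rightarrow> complex^'n^'n"
  proof -
    have "AE \<omega> in lborel. rep_l2 (fourier_l2 g) \<omega> = M \<omega> *v rep_l2 (fourier_l2 f) \<omega>" using that by (simp add: symbol_op_iff)
    with rep_mult_l2[OF E, of "fourier_l2 f"] rep_mult_l2[OF E, of "fourier_l2 g"] show ?thesis
      unfolding symbol_op_iff fourier_mult_op by eventually_elim (simp add: matrix_vector_mul_assoc eq)
  qed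
  have forward: "(?T f, ?T g) \<in> adjoint_op (symbol_op A)" if "(f, g) \<in> symbol_op A" for f g
    unfolding adj by (rule trans[OF that]) (simp add: dual)
  then show "\<forall>(f, g)\<in>symbol_op A. (?T f, ?T g) \<in> adjoint_op (symbol_op A)" by auto
  have backward: "(?T f, ?T g) \<in> symbol_op A" if "(f, g) \<in> adjoint_op (symbol_op A)" for f g
    using that unfolding adj by (rule trans) (rule dual')
  show "?T ` Domain (symbol_op A) = Domain (adjoint_op (symbol_op A))"
  proof (rule set_eqI, rule iffI)
    fix f assume "f \<in> ?T ` Domain (symbol_op A)"
    then show "f \<in> Domain (adjoint_op (symbol_op A))" using forward by blast
  next
    fix f assume "f \<in> Domain (adjoint_op (symbol_op A))"
    then have "?T f \<in> Domain (symbol_op A)" using backward by blast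
    then show "f \<in> ?T ` Domain (symbol_op A)" using TT[of f] by (metis image_eqI)
  qed
  have BJ: "conj_transpose (B \<omega>) ** signature J = conj_transpose (B \<omega>)" for \<omega>
    using arg_cong[OF JB[of \<omega>], of conj_transpose] by (simp add: conj_transpose_mult)
  have "adjoint_op (graph (mult_op (\<lambda>\<omega>. conj_transpose (B \<omega>)))) = symbol_op B"
    by (simp add: graph_mult_op[OF C] adjoint_symbol bounded_symbol_meas[OF C])
  also have "\<dots> = graph (?T \<circ> mult_op B)"
    unfolding graph_mult_op[OF B, symmetric] by (simp add: comp_def mult_op_mult[OF E B] JB)
  finally show "adjoint_op (graph (mult_op (\<lambda>\<omega>. conj_transpose (B \<omega>)))) = graph (?T \<circ> mult_op B)" .
  have "adjoint_op (graph (mult_op B)) = graph (mult_op (\<lambda>\<omega>. conj_transpose (B \<omega>)))"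
    by (simp add: graph_mult_op[OF B] graph_mult_op[OF C] adjoint_symbol bounded_symbol_meas[OF B])
  moreover have "graph ?T O graph (mult_op (\<lambda>\<omega>. conj_transpose (B \<omega>))) = graph (\<lambda>f. mult_op (\<lambda>\<omega>. conj_transpose (B \<omega>)) (?T f))"
    by (auto simp: graph_def)
  moreover have "(\<lambda>f. mult_op (\<lambda>\<omega>. conj_transpose (B \<omega>)) (?T f)) = mult_op (\<lambda>\<omega>. conj_transpose (B \<omega>))"
    by (simp add: fun_eq_iff mult_op_mult[OF C E] BJ)
  ultimately show "graph (mult_op (\<lambda>\<omega>. conj_transpose (B \<omega>))) = graph ?T O adjoint_op (graph (mult_op B))"
    by simp
qed

theorem theorem3:
  fixes A :: "('s::finite, 'n::finite, 'n) l2_op"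
    and B :: "('s, 'm::finite) l2 \<Rightarrow> ('s, 'n) l2"
    and C :: "('s, 'n) l2 \<Rightarrow> ('s, 'm) l2"
    and Ah Sh Qh :: "real^'s \<Rightarrow> complex^'n^'n"
    and Bh :: "real^'s \<Rightarrow> complex^'m^'n"
    and Ch :: "real^'s \<Rightarrow> complex^'n^'m"
  assumes system: "ltsi_system A B C"
    and symbols: "has_symbol A Ah" "has_symbol (graph B) Bh" "has_symbol (graph C) Ch"
    and continuous_symbols:
      "continuous_on UNIV Ah" "continuous_on UNIV Bh" "continuous_on UNIV Ch"
    and reciprocal: "reciprocal (impulse_response Ah Bh Ch)"
    and weakly_passive: "weakly_impedance_passive Ah Bh Ch"
    and minimal: "\<And>\<omega>. minimal_lti (Ah \<omega>) (Bh \<omega>) (Ch \<omega>)"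
    and S_Q_continuous: "continuous_on UNIV Sh" "continuous_on UNIV Qh"
    and S_Q_invertible: "\<And>\<omega>. invertible (Sh \<omega>)" "\<And>\<omega>. invertible (Qh \<omega>)"
    and S: "\<And>\<omega>. Sh \<omega> = conj_transpose (Sh \<omega>)"
      "\<And>\<omega>. conj_transpose (Ah \<omega>) ** Sh \<omega> = Sh \<omega> ** Ah \<omega>"
      "\<And>\<omega>. conj_transpose (Ch \<omega>) = Sh \<omega> ** Bh \<omega>"
    and Q: "\<And>\<omega>. pos_def (Qh \<omega>)"
      "\<And>\<omega>. pos_semidef (- (conj_transpose (Ah \<omega>) ** Qh \<omega> + Qh \<omega> ** Ah \<omega>))"
      "\<And>\<omega>. conj_transpose (Ch \<omega>) = Qh \<omega> ** Bh \<omega>"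
    and Q_S: "\<And>\<omega>. Qh \<omega> = Sh \<omega> ** matrix_inv (Qh \<omega>) ** Sh \<omega>"
    and sup_finite:
      "bdd_above (range (\<lambda>\<omega>. onorm ((*v) (Ch \<omega> ** matrix_inv (Sh \<omega>) ** Qh \<omega> ** Bh \<omega>))))"
  shows "\<exists>(A' :: ('s, 'n, 'n) l2_op) (B' :: ('s, 'm) l2 \<Rightarrow> ('s, 'n) l2)
      (C' :: ('s, 'n) l2 \<Rightarrow> ('s, 'm) l2).
    ltsi_system A' B' C' \<and> well_posed A'
    \<and> has_impulse_response A' B' C' (impulse_response Ah Bh Ch)
    \<and> internally_impedance_passive A' B' C' \<and> self_dual A' B' C'
    \<and> (\<exists>(J :: 'n set) (Ah' :: real^'s \<Rightarrow> complex^'n^'n) (Bh' :: real^'s \<Rightarrow> complex^'m^'n).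
        locally_bounded_symbol Ah' \<and> locally_bounded_symbol Bh'
        \<and> A' = symbol_op Ah' \<and> graph B' = symbol_op Bh'
        \<and> (let A11 = block_op J J Ah'; A12 = block_op J (- J) Ah';
               A21 = block_op (- J) J Ah'; A22 = block_op (- J) (- J) Ah'
           in densely_defined_on (l2_on J) A11 \<and> densely_defined_on (l2_on (- J)) A12
             \<and> densely_defined_on (l2_on (- J)) A22
             \<and> A21 = uminus_op (adjoint_on (l2_on (- J)) (l2_on J) A12)
             \<and> nonpos_op_on (l2_on J) A11 \<and> nonpos_op_on (l2_on (- J)) A22)
        \<and> block_op (- J) UNIV Bh' = graph (\<lambda>_. 0)
        \<and> adjoint_op (graph C') = graph B')"
proof -
  obtain R :: "real^'s \<Rightarrow> complex^'n^'n" and J where R_meas[measurable]: "R \<in> borel_measurable borel"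
    and R1: "\<And>\<omega>. R \<omega> ** (conj_transpose (R \<omega>) ** Qh \<omega>) = mat 1"
    and R2: "\<And>\<omega>. Sh \<omega> ** R \<omega> = Qh \<omega> ** R \<omega> ** signature J"
    using simultaneous_normal_form[OF S_Q_continuous(2,1) Q(1) S(1) Q_S] by blast
  \<comment> \<open>This is the inverse of \<open>R\<close>, in a form that is visibly measurable
    and whose conjugate transpose is \<open>Qh \<omega> ** R \<omega>\<close>.\<close>
  define P where "P \<omega> = conj_transpose (R \<omega>) ** Qh \<omega>" for \<omega>
  define Ab where "Ab \<omega> = P \<omega> ** Ah \<omega> ** R \<omega>" for \<omega>
  define Bb where "Bb \<omega> = P \<omega> ** Bh \<omega>" for \<omega>
  have [measurable]: "Qh \<in> borel_measurable borel" "Ah \<in> borel_measurable borel" "Bh \<in> borel_measurable borel"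
    using S_Q_continuous continuous_symbols by (auto intro: borel_measurable_continuous_onI)
  have P_meas[measurable]: "P \<in> borel_measurable borel" unfolding P_def[abs_def] by measurable
  have Ab_meas[measurable]: "Ab \<in> borel_measurable borel" unfolding Ab_def[abs_def] by measurable
  have Bb_meas[measurable]: "Bb \<in> borel_measurable borel" unfolding Bb_def[abs_def] by measurable
  have RP: "R \<omega> ** P \<omega> = mat 1" for \<omega> unfolding P_def by (rule R1)
  then have PR: "P \<omega> ** R \<omega> = mat 1" for \<omega> using matrix_left_right_inverse by blast
  have Q_herm: "conj_transpose (Qh \<omega>) = Qh \<omega>" for \<omega> using Q(1)[of \<omega>] by (simp add: pos_def_def)
  have P_ct: "conj_transpose (P \<omega>) = Qh \<omega> ** R \<omega>" for \<omega> by (simp add: P_def conj_transpose_mult Q_herm)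
  have PP: "conj_transpose (P \<omega>) ** P \<omega> = Qh \<omega>" for \<omega>
    by (simp add: P_ct matrix_mul_assoc[symmetric] RP)
  have P_inner: "cvec_inner (P \<omega> *v x) (P \<omega> *v y) = cvec_inner x (Qh \<omega> *v y)" for \<omega> x y
    by (simp add: cvec_inner_mult_left matrix_vector_mul_assoc PP)
  have RPv: "R \<omega> *v (P \<omega> *v x) = x" "P \<omega> *v (R \<omega> *v x) = x" for \<omega> x
    by (simp_all add: matrix_vector_mul_assoc RP PR)
  \<comment> \<open>\<open>R\<close> takes the standard inner product to that of \<open>Qh\<close>,
    so the dissipation inequality for \<open>Qh\<close> at \<open>R \<omega> *v v\<close> becomes
    the one for \<open>Ab\<close> at \<open>v\<close>.\<close>
  have diss: "(Ab \<omega> *v v) \<bullet> v \<le> 0" for \<omega> v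
  proof -
    define x where "x = R \<omega> *v v"
    have v: "v = P \<omega> *v x" by (simp add: x_def RPv)
    have "cvec_inner (Ab \<omega> *v v) v = cvec_inner (Ah \<omega> *v x) (Qh \<omega> *v x)"
      unfolding P_inner[symmetric] v[symmetric] by (simp add: Ab_def x_def matrix_vector_mul_assoc matrix_mul_assoc)
    then have 1: "(Ab \<omega> *v v) \<bullet> v = Re (cvec_inner (Ah \<omega> *v x) (Qh \<omega> *v x))"
      unfolding Re_cvec_inner[symmetric] by simp
    have "0 \<le> Re (cvec_inner ((- (conj_transpose (Ah \<omega>) ** Qh \<omega> + Qh \<omega> ** Ah \<omega>)) *v x) x)"
      using Q(2)[of \<omega>] unfolding pos_semidef_def by blast
    also have "(- (conj_transpose (Ah \<omega>) ** Qh \<omega> + Qh \<omega> ** Ah \<omega>)) *v x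
       = - (conj_transpose (Ah \<omega>) *v (Qh \<omega> *v x) + Qh \<omega> *v (Ah \<omega> *v x))"
      unfolding minus_matrix_vector matrix_vector_mult_add_rdistrib matrix_vector_mul_assoc ..
    also have "cvec_inner \<dots> x = - (cvec_inner (Qh \<omega> *v x) (Ah \<omega> *v x) + cvec_inner (Ah \<omega> *v x) (Qh \<omega> *v x))"
      unfolding cvec_inner_minus_left cvec_inner_add_left
      using cvec_inner_mult_left[of "conj_transpose (Ah \<omega>)" "Qh \<omega> *v x" x] cvec_inner_mult_left[of "Qh \<omega>" "Ah \<omega> *v x" x]
      by (simp add: Q_herm)
    finally show ?thesis unfolding 1 cnj_cvec_inner[of "Ah \<omega> *v x" "Qh \<omega> *v x", symmetric] by simp
  qed
  \<comment> \<open>The first form turns the new output symbol into an adjoint in \<open>Cb\<close>;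
    the second cancels \<open>matrix_inv (Sh \<omega>)\<close> in the supremum hypothesis.\<close>
  have C_eq: "Ch \<omega> = conj_transpose (Bh \<omega>) ** Qh \<omega>" "Ch \<omega> = conj_transpose (Bh \<omega>) ** Sh \<omega>" for \<omega>
    using arg_cong[OF Q(3)[of \<omega>], of conj_transpose] arg_cong[OF S(3)[of \<omega>], of conj_transpose] S(1)[of \<omega>]
    by (simp_all add: conj_transpose_mult Q_herm)
  have Cb: "Ch \<omega> ** R \<omega> = conj_transpose (Bb \<omega>)" for \<omega>
    by (simp add: C_eq(1) Bb_def conj_transpose_mult P_ct matrix_mul_assoc)
  obtain K where K: "\<And>\<omega>. onorm ((*v) (Ch \<omega> ** matrix_inv (Sh \<omega>) ** Qh \<omega> ** Bh \<omega>)) \<le> K"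
    using sup_finite unfolding bdd_above_def by auto
  \<comment> \<open>The product of \<open>conj_transpose (Bb \<omega>)\<close> and
    \<open>Bb \<omega>\<close> is the matrix whose norm the supremum hypothesis bounds, hence
    \<open>sqrt K\<close> as the bound for \<open>Bb\<close>.\<close>
  have Bb_sq: "(norm (Bb \<omega> *v v))\<^sup>2 \<le> K * (norm v)\<^sup>2" for \<omega> v
  proof -
    let ?M = "Ch \<omega> ** matrix_inv (Sh \<omega>) ** Qh \<omega> ** Bh \<omega>"
    have "?M = conj_transpose (Bh \<omega>) ** (Sh \<omega> ** matrix_inv (Sh \<omega>)) ** Qh \<omega> ** Bh \<omega>"
      by (simp add: C_eq(2) matrix_mul_assoc)
    then have M: "?M = conj_transpose (Bh \<omega>) ** Qh \<omega> ** Bh \<omega>"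
      by (simp add: matrix_inv_cancel(1)[OF S_Q_invertible(1)])
    have "(norm (Bb \<omega> *v v))\<^sup>2 = cmod (cvec_inner (Bb \<omega> *v v) (Bb \<omega> *v v))" by (simp add: cvec_inner_self del: of_real_power)
    also have "cvec_inner (Bb \<omega> *v v) (Bb \<omega> *v v) = cvec_inner v (?M *v v)"
    proof -
      have "conj_transpose (Bb \<omega>) ** Bb \<omega> = conj_transpose (Bh \<omega>) ** (conj_transpose (P \<omega>) ** P \<omega>) ** Bh \<omega>"
        by (simp add: Bb_def conj_transpose_mult matrix_mul_assoc)
      then have "conj_transpose (Bb \<omega>) ** Bb \<omega> = ?M" unfolding PP M .
      then show ?thesis unfolding cvec_inner_mult_left matrix_vector_mul_assoc by simp
    qed
    also have "cmod \<dots> \<le> norm v * norm (?M *v v)" by (rule cmod_cvec_inner)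
    also have "\<dots> \<le> norm v * (K * norm v)"
    proof (intro mult_left_mono)
      have "norm (?M *v v) \<le> onorm ((*v) ?M) * norm v" by (rule onorm) simp
      also have "\<dots> \<le> K * norm v" by (intro mult_right_mono K) simp
      finally show "norm (?M *v v) \<le> K * norm v" .
    qed simp
    finally show ?thesis by (simp add: power2_eq_square mult_ac)
  qed
  have Bb: "bounded_symbol Bb"
    unfolding bounded_symbol_def
  proof (intro conjI exI allI)
    show "norm (Bb \<omega> *v v) \<le> sqrt K * norm v" for \<omega> v
      using real_sqrt_le_mono[OF Bb_sq[of \<omega> v]] by (simp add: real_sqrt_mult)
  qed (rule Bb_meas)
  note Cs = bounded_symbol_conj_transpose[OF Bb]
  have sig: "signature J = conj_transpose (R \<omega>) ** Sh \<omega> ** R \<omega>" for \<omega>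
  proof -
    have "conj_transpose (R \<omega>) ** Sh \<omega> ** R \<omega> = P \<omega> ** R \<omega> ** signature J"
      by (simp add: matrix_mul_assoc[symmetric] R2 P_def)
    then show ?thesis by (simp add: PR)
  qed
  have RtP: "conj_transpose (R \<omega>) ** conj_transpose (P \<omega>) = mat 1" for \<omega>
    using arg_cong[OF PR[of \<omega>], of conj_transpose] by (simp add: conj_transpose_mult)
  have PtR: "conj_transpose (P \<omega>) ** conj_transpose (R \<omega>) = mat 1" for \<omega>
    using arg_cong[OF RP[of \<omega>], of conj_transpose] by (simp add: conj_transpose_mult)
  have dual: "conj_transpose (Ab \<omega>) ** signature J = signature J ** Ab \<omega>" for \<omega>
  proof -
    have "conj_transpose (Ab \<omega>) ** signature J
      = conj_transpose (R \<omega>) ** conj_transpose (Ah \<omega>) ** (conj_transpose (P \<omega>) ** conj_transpose (R \<omega>)) ** Sh \<omega> ** R \<omega>"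
      unfolding sig[of \<omega>] by (simp add: Ab_def conj_transpose_mult matrix_mul_assoc)
    also have "\<dots> = conj_transpose (R \<omega>) ** (conj_transpose (Ah \<omega>) ** Sh \<omega>) ** R \<omega>"
      by (simp add: PtR matrix_mul_assoc)
    also have "\<dots> = conj_transpose (R \<omega>) ** Sh \<omega> ** (R \<omega> ** P \<omega>) ** Ah \<omega> ** R \<omega>"
      by (simp add: S(2) RP matrix_mul_assoc)
    also have "\<dots> = signature J ** Ab \<omega>"
      unfolding sig[of \<omega>] by (simp add: Ab_def matrix_mul_assoc)
    finally show ?thesis .
  qed
  \<comment> \<open>Here the two equations for \<open>Ch\<close> meet: \<open>Sh\<close> and
    \<open>Qh\<close> agree on the range of \<open>Bh\<close>.\<close>
  have JB: "signature J ** Bb \<omega> = Bb \<omega>" for \<omega>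
  proof -
    have "signature J ** Bb \<omega> = conj_transpose (R \<omega>) ** Sh \<omega> ** (R \<omega> ** P \<omega>) ** Bh \<omega>"
      unfolding sig[of \<omega>] by (simp add: Bb_def matrix_mul_assoc)
    also have "\<dots> = conj_transpose (R \<omega>) ** (Sh \<omega> ** Bh \<omega>)" by (simp add: RP matrix_mul_assoc)
    also have "Sh \<omega> ** Bh \<omega> = Qh \<omega> ** Bh \<omega>" using Q(3)[of \<omega>] S(3)[of \<omega>] by simp
    finally show ?thesis by (simp add: Bb_def P_def matrix_mul_assoc)
  qed
  have response: "Ch \<omega> ** mat_exp (t *\<^sub>R Ah \<omega>) ** Bh \<omega> = conj_transpose (Bb \<omega>) ** (mat_exp (t *\<^sub>R Ab \<omega>) ** Bb \<omega>)" for \<omega> t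
  proof -
    have "conj_transpose (Bb \<omega>) ** (mat_exp (t *\<^sub>R Ab \<omega>) ** Bb \<omega>) = Ch \<omega> ** R \<omega> ** (mat_exp (t *\<^sub>R Ab \<omega>) ** P \<omega>) ** Bh \<omega>"
      unfolding Cb by (simp add: Bb_def matrix_mul_assoc)
    also have "mat_exp (t *\<^sub>R Ab \<omega>) ** P \<omega> = P \<omega> ** mat_exp (t *\<^sub>R Ah \<omega>)"
      unfolding Ab_def by (rule mat_exp_similar[OF RP])
    also have "Ch \<omega> ** R \<omega> ** (P \<omega> ** mat_exp (t *\<^sub>R Ah \<omega>)) ** Bh \<omega> = Ch \<omega> ** (R \<omega> ** P \<omega>) ** mat_exp (t *\<^sub>R Ah \<omega>) ** Bh \<omega>"
      by (simp add: matrix_mul_assoc)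
    finally show ?thesis by (simp add: RP)
  qed
  \<comment> \<open>\<open>R\<close> is merely measurable, but the squared norm of
    \<open>P \<omega> *v x\<close> is the quadratic form of \<open>Qh\<close>. On compact sets
    continuity of \<open>Qh\<close> bounds this form from above, hence \<open>P\<close>, and
    coercivity bounds it from below, hence \<open>R\<close>.\<close>
  have Ab_locally_bounded: "locally_bounded_symbol Ab"
    unfolding locally_bounded_symbol_def
  proof (intro conjI allI impI Ab_meas)
    fix X :: "(real^'s) set" assume X: "compact X"
    obtain c where c: "c > 0" "\<And>\<omega> v. \<omega> \<in> X \<Longrightarrow> c * (norm v)\<^sup>2 \<le> Re (qform (Qh \<omega>) v v)"
      using pos_def_lower_bound[OF X continuous_on_subset[OF S_Q_continuous(2)] Q(1)] by (metis subset_UNIV)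
    have bd: "\<exists>k. \<forall>\<omega>\<in>X. norm (M \<omega>) \<le> k" if "continuous_on UNIV M" for M :: "real^'s \<Rightarrow> complex^'n^'n"
      using compact_imp_bounded[OF compact_continuous_image[OF continuous_on_subset[OF that subset_UNIV] X]]
      by (auto simp: bounded_iff)
    obtain a where a: "\<And>\<omega>. \<omega> \<in> X \<Longrightarrow> norm (Ah \<omega>) \<le> a" using bd[OF continuous_symbols(1)] by blast
    obtain q where q: "\<And>\<omega>. \<omega> \<in> X \<Longrightarrow> norm (Qh \<omega>) \<le> q" using bd[OF S_Q_continuous(2)] by blast
    have P_sq: "(norm (P \<omega> *v x))\<^sup>2 = Re (qform (Qh \<omega>) x x)" for \<omega> x
      using P_inner[of \<omega> x x] cvec_inner_self[of "P \<omega> *v x"] qform_cnj[OF Q(1), of \<omega> x x]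
      by (simp add: qform_def cnj_cvec_inner del: of_real_power) (metis Re_complex_of_real)
    have P_le: "norm (P \<omega> *v x) \<le> sqrt q * norm x" if "\<omega> \<in> X" for \<omega> x
    proof -
      have "(norm (P \<omega> *v x))\<^sup>2 \<le> norm (Qh \<omega> *v x) * norm x"
        unfolding P_sq qform_def using complex_Re_le_cmod cmod_cvec_inner order_trans by blast
      also have "\<dots> \<le> (norm (Qh \<omega>) * norm x) * norm x" by (intro mult_right_mono norm_matrix_vector_mult) simp
      also have "\<dots> \<le> (q * norm x) * norm x" by (intro mult_right_mono q that) auto
      finally have "(norm (P \<omega> *v x))\<^sup>2 \<le> q * (norm x)\<^sup>2" by (simp add: power2_eq_square mult.assoc)
      from real_sqrt_le_mono[OF this] show ?thesis by (simp add: real_sqrt_mult)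
    qed
    have R_le: "norm (R \<omega> *v v) \<le> sqrt (1 / c) * norm v" if "\<omega> \<in> X" for \<omega> v
    proof -
      have "c * (norm (R \<omega> *v v))\<^sup>2 \<le> (norm v)\<^sup>2"
        using c(2)[OF that, of "R \<omega> *v v"] P_sq[of \<omega> "R \<omega> *v v"] by (simp add: RPv)
      then have "(norm (R \<omega> *v v))\<^sup>2 \<le> (1 / c) * (norm v)\<^sup>2" using c(1) by (simp add: field_simps)
      from real_sqrt_le_mono[OF this] show ?thesis unfolding real_sqrt_mult by simp
    qed
    have "norm (Ab \<omega> *v v) \<le> (sqrt q * (a * sqrt (1 / c))) * norm v" if \<omega>: "\<omega> \<in> X" for \<omega> v
    proof -
      have a0: "0 \<le> a" "0 \<le> q" using a[OF \<omega>] q[OF \<omega>] norm_ge_zero order_trans by blast+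
      have "norm (Ab \<omega> *v v) = norm (P \<omega> *v (Ah \<omega> *v (R \<omega> *v v)))"
        by (simp add: Ab_def matrix_vector_mul_assoc matrix_mul_assoc)
      also have "\<dots> \<le> sqrt q * norm (Ah \<omega> *v (R \<omega> *v v))" by (rule P_le[OF \<omega>])
      also have "\<dots> \<le> sqrt q * (norm (Ah \<omega>) * norm (R \<omega> *v v))"
        by (intro mult_left_mono norm_matrix_vector_mult) (simp add: a0)
      also have "\<dots> \<le> sqrt q * (a * (sqrt (1 / c) * norm v))"
        by (intro mult_left_mono mult_mono a \<omega> R_le) (use a0 in auto)
      finally show ?thesis by (simp add: mult_ac)
    qed
    then have "norm (Ab \<omega>) \<le> real CARD('n) * (real CARD('n) * (sqrt q * (a * sqrt (1 / c))))" if "\<omega> \<in> X" for \<omega>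
      using that by (intro norm_matrix_le) auto
    then show "bounded (Ab ` X)" by (auto simp: bounded_iff)
  qed

  \<comment> \<open>The operators of the new system\<close>
  let ?A = "symbol_op Ab" and ?B = "mult_op Bb" and ?C = "mult_op (\<lambda>\<omega>. conj_transpose (Bb \<omega>))"
  note gen = generates_semigroup_op[OF Ab_meas diss]
  \<comment> \<open>\<open>dual\<close> read entry by entry: where \<open>i\<close> and
    \<open>j\<close> lie on the same side of the partition the symbol is Hermitian, where they lie
    on different sides it is skew-Hermitian. The block structure of the new generator is contained
    in this.\<close>
  have entry: "(if j \<in> J then conj_transpose (Ab \<omega>) $ i $ j else - conj_transpose (Ab \<omega>) $ i $ j)
      = (if i \<in> J then Ab \<omega> $ i $ j else - Ab \<omega> $ i $ j)" for \<omega> i j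
    using arg_cong[OF dual[of \<omega>], of "\<lambda>M. M $ i $ j"] by (simp only: signature_mult_nth mult_signature_nth)
  have "ltsi_system ?A ?B ?C"
    unfolding ltsi_system_def graph_mult_op[OF Bb] graph_mult_op[OF Cs]
    by (intro conjI linear_op_symbol densely_defined_symbol Ab_meas translation_invariant_symbol bounded_op_mult_op Bb Cs)
  moreover have "well_posed ?A" unfolding well_posed_def using gen by blast
  moreover have "has_impulse_response ?A ?B ?C (impulse_response Ah Bh Ch)"
    unfolding has_impulse_response_def
  proof (intro exI[of _ "semigroup_op Ab"] conjI gen allI impI)
    fix t :: real assume t: "0 \<le> t"
    note E = bounded_symbol_mat_exp[OF Ab_meas diss t]
    have "?C \<circ> semigroup_op Ab t \<circ> ?B = mult_op (\<lambda>\<omega>. conj_transpose (Bb \<omega>) ** (mat_exp (t *\<^sub>R Ab \<omega>) ** Bb \<omega>))"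
      by (simp add: fun_eq_iff semigroup_op_def mult_op_mult[OF E Bb] mult_op_mult[OF Cs bounded_symbol_mult[OF E Bb]])
    then show "graph (?C \<circ> semigroup_op Ab t \<circ> ?B) = impulse_response Ah Bh Ch t"
      by (simp add: graph_mult_op[OF bounded_symbol_mult[OF Cs bounded_symbol_mult[OF E Bb]]] impulse_response_def response)
  qed
  moreover have "internally_impedance_passive ?A ?B ?C"
    by (rule internally_passive[OF Ab_meas diss Bb])
  moreover have "self_dual ?A ?B ?C"
    by (rule self_dual_symbol[OF Ab_meas Bb dual JB])
  moreover have "densely_defined_on (l2_on J) (block_op J J Ab)" "densely_defined_on (l2_on (- J)) (block_op J (- J) Ab)"
    "densely_defined_on (l2_on (- J)) (block_op (- J) (- J) Ab)"
    by (rule densely_defined_block[OF Ab_meas])+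
  moreover have "block_op (- J) J Ab = uminus_op (adjoint_on (l2_on (- J)) (l2_on J) (block_op J (- J) Ab))"
    unfolding adjoint_block[OF Ab_meas] uminus_block_op
  proof (rule block_op_cong)
    fix \<omega>
    show "mat_block (- J) J (Ab \<omega>) = mat_block (- J) J (- conj_transpose (Ab \<omega>))"
      unfolding mat_block_def vec_eq_iff vec_lambda_beta
    proof (intro allI)
      fix i j
      show "(if i \<in> - J \<and> j \<in> J then Ab \<omega> $ i $ j else 0) = (if i \<in> - J \<and> j \<in> J then (- conj_transpose (Ab \<omega>)) $ i $ j else 0)"
        using entry[of j \<omega> i] by (auto split: if_splits)
    qed
  qed
  moreover have "nonpos_op_on (l2_on J) (block_op J J Ab)"
  proof (rule nonpos_block_op[OF Ab_meas diss])
    show "mat_block J J (conj_transpose (Ab \<omega>)) = mat_block J J (Ab \<omega>)" for \<omega>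
      unfolding mat_block_def vec_eq_iff vec_lambda_beta
    proof (intro allI)
      fix i j
      show "(if i \<in> J \<and> j \<in> J then conj_transpose (Ab \<omega>) $ i $ j else 0) = (if i \<in> J \<and> j \<in> J then Ab \<omega> $ i $ j else 0)"
        using entry[of j \<omega> i] by (auto split: if_splits)
    qed
  qed
  moreover have "nonpos_op_on (l2_on (- J)) (block_op (- J) (- J) Ab)"
  proof (rule nonpos_block_op[OF Ab_meas diss])
    show "mat_block (- J) (- J) (conj_transpose (Ab \<omega>)) = mat_block (- J) (- J) (Ab \<omega>)" for \<omega>
      unfolding mat_block_def vec_eq_iff vec_lambda_beta
    proof (intro allI)
      fix i j
      show "(if i \<in> - J \<and> j \<in> - J then conj_transpose (Ab \<omega>) $ i $ j else 0) = (if i \<in> - J \<and> j \<in> - J then Ab \<omega> $ i $ j else 0)"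
        using entry[of j \<omega> i] by (auto split: if_splits)
    qed
  qed
  moreover have "block_op (- J) UNIV Bb = graph (\<lambda>_. 0)"
  proof (rule zero_block_op)
    fix \<omega>
    have "Bb \<omega> $ i $ j = 0" if "i \<notin> J" for i j
      using signature_mult_nth[of J "Bb \<omega>" i j] that by (simp add: JB)
    then show "mat_block (- J) UNIV (Bb \<omega>) = 0" by (simp add: mat_block_def vec_eq_iff)
  qed
  moreover have "adjoint_op (graph ?C) = graph ?B"
    by (simp add: graph_mult_op[OF Cs] graph_mult_op[OF Bb] adjoint_symbol bounded_symbol_meas[OF Cs])
  ultimately show ?thesis
    unfolding Let_def
    using Ab_locally_bounded locally_bounded_of_bounded_symbol[OF Bb] graph_mult_op[OF Bb]
    by (intro exI[of _ ?A] exI[of _ ?B] exI[of _ ?C] conjI exI[of _ J] exI[of _ Ab] exI[of _ Bb]) (assumption | rule refl)+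
qed

end
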